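(* Let $G(V,E,\mathcal{F})$ be a regular labeled cuboid graph with iso-level $c\in(0,1)$, considered together with its system of labeled cuboid graphs. Let $\omega=[Q_1,\ldots,Q_n]$, $n\ge3$, be an iso-path of $G$, and set $l_i=\overline{Q_iQ_{i+1}}$ for $i=1,\ldots,n-1$ and $l_n=\overline{Q_nQ_1}$ (these are iso-lines of $G$ and edges of $\omega$). Then there exist iso-paths $\omega_1,\ldots,\omega_n$ in the system of labeled cuboid graphs of $G$ such that $l_i=\omega\cap\omega_i$ for $i=1,\ldots,n$ and each pair $(\omega,\omega_i)$ is disperse connected with respect to $l_i$.
   Context: **Labeled cuboid graphs.** A cuboid is $C=[a_1,b_1]\times[a_2,b_2]\times[a_3,b_3]\subset\mathbb{R}^3$. A labeled cuboid graph $G(V,E,\mathcal{F})$ consists of the 8 vertices $V$ and 12 edges $E$ of a cuboid (the cuboid of $G$) and $\mathcal{F}:V\to[0,1]$. Two nodes are incident if they are the end points of an edge. Fix an iso-level $c\in(0,1)$. A node $P$ is disperse if $\mathcal{F}(P)>c$ and continuous if $\mathcal{F}(P)\le c$; $D(G)$ is the number of disperse nodes. $G$ (or a face, or an edge) is disperse (continuous) if all its nodes are. On an edge with end points $x_0,x_1$ such that $\mathcal{F}(x_0)\le c<\mathcal{F}(x_1)$, the iso-point is the point $x_0+(x_1-x_0)\frac{c-\mathcal{F}(x_0)}{\mathcal{F}(x_1)-\mathcal{F}(x_0)}$; these are all iso-points of $G$. An iso-node is a node that is an iso-point (label $c$ and incident to a disperse node). An L-face is a face with exactly two disperse and two continuous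 nodes, the disperse ones not incident; it is trivial if both its continuous nodes are iso-nodes, otherwise non-trivial. $L(G)$ is the set of L-faces. A singular face has three disperse nodes and one iso-node. A regular face is one that is not an L-face, disperse, continuous or singular. Two faces of a cuboid are parallel if they have no common node. Two graphs are face-neighbors (edge-neighbors) if the intersection of their cuboids is a face (an edge) of both. **Singular / isolated iso-paths; regular graphs.** A $T_1$-subgraph of $G$: a node with label $c$ together with its three incident nodes, all disperse. A $T_2$-subgraph: a subgraph with seven nodes, two of which are incident and have label $c$ while the other five are disperse. $G$ is an $F_1$-graph if there is $\tilde V\subset V$, $|\tilde V|=4$, with each $P\in\tilde V$ incident to exactly two nodes of $V\setminus\tilde V$, $\mathcal{F}=c$ on $\tilde V$ and $\mathcal{F}>c$ on $V\setminus\tilde V$. $G_1$ is an $F_2$-graph if it has a face-neighbor $G_2$ such that all four common nodes have label $c$ (in both) and all other nodes of $G_1$ and of $G_2$ are disperse. $G$ is singular iso-path free if it has no $T_1$- or $T_2$-subgraph, and isolated iso-path free if it is not an $F_1$- or $F_2$-graph. $G$ is regular if it is neither disperse nor continuous, is singular iso-path free and isolated iso-path free. **System of graphs of $G$.** In a cuboid mesh, the system of cuboids of a cuboid $C$ consists of $C$ and all cuboids sharing at least an edge with $C$ (each edge of $C$ being surrounded by four cuboids; altogether 19 cuboids). The system of (labeled cuboid) graphs of $G$ consists of $G$ and labeled cuboid graphs on the other cuboids of the system of cuboids of the cuboid of $G$, with common iso-level $c$, all singular iso-path free and isolated iso-path free. The graphs arise from one labeling of the mesh vertices by the following removal step, performed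 separately in each cuboid: if the graph is not an $F_1$- or $F_2$-graph, the label-$c$ node of every $T_1$-subgraph, and then both label-$c$ nodes of a $T_2$-subgraph (if any), are relabeled $1$; if the graph is an $F_1$- or $F_2$-graph, its four label-$c$ nodes are relabeled $1$. **$S$-subgraphs.** $S_1$-subgraph: a disperse node and its three incident nodes, all continuous. $S_2$-subgraph: two incident disperse nodes and the four further nodes incident to them, all continuous. $S_3$-subgraph: a node with label $<c$ and its three incident nodes, all disperse. An $S_i$-rule at an $S_i$-subgraph $H$ records the closed polygon through the iso-points on the edges of $H$ (a triangle for $i=1,3$; for $i=2$ the quadrilateral through the four iso-points, consecutive ones on a common face), and then relabels: for $i=1,2$ the disperse nodes of $H$ get label $0$; for $i=3$ the continuous node of $H$ gets label $1$. The $S_i^n$-rule is the successive application of the $S_i$-rule at $n$ distinct $S_i$-subgraphs. Table of $S^n$-rules for regular $G$ with $L(G)\ne\emptyset$: $D=2$: $S_1$. $D=3$: $S_1$ if $|L(G)|=1$, $S_1^2$ if $|L(G)|=3$. $D=4$: if $|L(G)|=2$, $S_1$ for non-parallel and $S_2$ for parallel L-faces; $S_1^3$ if $|L(G)|=6$. $D=5$: $S_3$ if $|L(G)|=1$, $S_1$ if $|L(G)|=3$. $D=6$: $S_3$. **Iso-paths.** $C$-rules: on each regular face join the two iso-points lying on the edges of the face that have one disperse and one continuous end point. Inner iso-paths of a regular $G$: (1) if $L(G)\neq\emptyset$, apply the $S^n$-rule from the table, recording $n$ polygons; the resulting graph has a further iso-path, formed by the segments given by the $C$-rules; (2) if $L(G)=\emptyset$,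 $D(G)=2$ and $G$ has an $S_1$-subgraph (resp. $D(G)=6$ and $G$ has an $S_3$-subgraph), apply the $S_1$-rule (resp. $S_3$-rule) once and then the $C$-rules to the resulting graph; (3) otherwise the $C$-rules applied to $G$ give the iso-path. Non-regular graphs have no iso-path. Outer iso-path: a simple closed polygon lying on a non-trivial L-face of $G$, with common face $M$ of the cuboids of $G$ and its face-neighbor $G'$, which equals $\bigcup_k J_k\cap M$, where $\{J_k\}$ are the inner iso-paths of $G$ and $G'$. An iso-path is an inner or outer iso-path, written $[Q_1,\ldots,Q_n]$ (closed polygon with consecutive vertices $Q_i$, which are iso-points); iso-lines are its edges. **Corresponding disperse nodes.** The iso-line on a regular face (joining its two iso-points) corresponds to all disperse nodes of that face. On an L-face, the iso-line joining the two iso-points on the face edges at a disperse node $Q$ corresponds to $Q$, and on a non-trivial L-face the iso-line joining the two iso-points on the face edges at a continuous non-iso-node $P$ corresponds to $P$. A disperse node corresponds to an iso-line $l$ with respect to an iso-path $\omega$ if $l$ is an edge of $\omega$ and $l$ corresponds to that node (on a trivial L-face: the disperse node of the face that is disperse in the $S$-subgraph, or in the remaining graph, from which $\omega$ is obtained). **Disperse path.** A simple, non-closed path that is a union of $r\ge2$ disperse edges of graphs in the system of graphs of $G$. **Disperse connectedness.** Let $l$ be an iso-line of the regular graph $G$, $\omega_1$ an iso-path of $G$, $\omega_2\neq\omega_1$ an iso-path in the system of graphs of $G$, $l=\omega_1\cap\omega_2$. They are disperse connected with respect to $l$ if one of the following holds: (1) $\omega_1,\omega_2$ are the only iso-paths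 in the system of graphs of $G$ with $l=\omega_1\cap\omega_2$; (2) $\omega_1$ is an inner iso-path of $G$, $\omega_2$ is an inner iso-path of a graph in the system, and either (a) at least one disperse node corresponds to $l$ both with respect to $\omega_1$ and with respect to $\omega_2$, or (b) there are distinct disperse nodes $P_1$ (a node of $G$) and $P_2$ (possibly not a node of $G$) in the system, corresponding to $l$ with respect to $\omega_1$ and $\omega_2$ respectively, that are connected by a disperse path in the system of graphs of $G$.
   Formalization: "l_i = ω∩ω_i" (false as stated, also in disperse connectedness) is relaxed: l_i is a common edge; other common points are iso-nodes or lie on common iso-lines with an iso-node. In a T_2-subgraph, all nodes incident to the two label-c nodes must be among the seven. *)

theory Defs
  imports "HOL-Analysis.Analysis"
begin

section \<open>Cuboids and cuboid meshes\<close>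

type_synonym pt = "real ^ 3"

text \<open>The cuboid \<open>[a\<^sub>1,b\<^sub>1] \<times> [a\<^sub>2,b\<^sub>2] \<times> [a\<^sub>3,b\<^sub>3]\<close> is given by the pair \<open>(a, b)\<close>. Edges and faces are
  represented by the sets of their two, respectively four, nodes.\<close>

type_synonym cuboid = "pt \<times> pt"

definition is_cuboid :: "cuboid \<Rightarrow> bool" where
  "is_cuboid C \<longleftrightarrow> (\<forall>i. fst C $ i < snd C $ i)"

definition body :: "cuboid \<Rightarrow> pt set" where
  "body C = cbox (fst C) (snd C)"

definition nodes :: "cuboid \<Rightarrow> pt set" where
  "nodes C = {P. \<forall>i. P $ i \<in> {fst C $ i, snd C $ i}}"

definition incident :: "cuboid \<Rightarrow> pt \<Rightarrow> pt \<Rightarrow> bool" where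
  "incident C P Q \<longleftrightarrow> P \<in> nodes C \<and> Q \<in> nodes C \<and> (\<exists>!i. P $ i \<noteq> Q $ i)"

definition nbrs :: "cuboid \<Rightarrow> pt \<Rightarrow> pt set" where
  "nbrs C P = {Q. incident C P Q}"

definition edges :: "cuboid \<Rightarrow> pt set set" where
  "edges C = {{P, Q} | P Q. incident C P Q}"

definition faces :: "cuboid \<Rightarrow> pt set set" where
  "faces C = {{P \<in> nodes C. P $ i = v} | i v. v \<in> {fst C $ i, snd C $ i}}"

definition parallel :: "pt set \<Rightarrow> pt set \<Rightarrow> bool" where
  "parallel F F' \<longleftrightarrow> F \<inter> F' = {}"

definition face_neighbors :: "cuboid \<Rightarrow> cuboid \<Rightarrow> bool" where
  "face_neighbors C C' \<longleftrightarrow> (\<exists>F \<in> faces C \<inter> faces C'. body C \<inter> body C' = convex hull F)"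

text \<open>Face-to-face meshes: two distinct cuboids are disjoint or meet in a common node, edge or face.\<close>

definition cuboid_mesh :: "cuboid set \<Rightarrow> bool" where
  "cuboid_mesh M \<longleftrightarrow> (\<forall>C \<in> M. is_cuboid C) \<and>
     (\<forall>C \<in> M. \<forall>C' \<in> M. C \<noteq> C' \<longrightarrow> body C \<inter> body C' = {} \<or>
        (\<exists>S. S \<in> ((\<lambda>P. {P}) ` nodes C \<union> edges C \<union> faces C) \<inter>
                   ((\<lambda>P. {P}) ` nodes C' \<union> edges C' \<union> faces C') \<and>
             body C \<inter> body C' = convex hull S))"

text \<open>\<open>C\<close> lies in the interior of the mesh. In a face-to-face mesh this makes
  \<open>system_of_cuboids M C\<close> below a set of 19 cuboids.\<close>

definition surrounded :: "cuboid set \<Rightarrow> cuboid \<Rightarrow> bool" where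
  "surrounded M C \<longleftrightarrow> (\<forall>e \<in> edges C. card {C' \<in> M. e \<in> edges C'} = 4)"

definition system_of_cuboids :: "cuboid set \<Rightarrow> cuboid \<Rightarrow> cuboid set" where
  "system_of_cuboids M C = {C' \<in> M. C' = C \<or> edges C \<inter> edges C' \<noteq> {}}"

section \<open>Labeled cuboid graphs\<close>

text \<open>Only the values of \<open>lab\<close> at the nodes of the cuboid matter.\<close>

record lcgraph =
  cub :: cuboid
  lab :: "pt \<Rightarrow> real"

definition relabel :: "pt set \<Rightarrow> real \<Rightarrow> lcgraph \<Rightarrow> lcgraph" where
  "relabel X v G = G\<lparr>lab := (\<lambda>P. if P \<in> X then v else lab G P)\<rparr>"

datatype rule = S1 | S2 | S3

context
  fixes c :: real  \<comment> \<open>the iso-level\<close>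
begin

definition disp :: "lcgraph \<Rightarrow> pt set" where
  "disp G = {P \<in> nodes (cub G). lab G P > c}"

definition cont :: "lcgraph \<Rightarrow> pt set" where
  "cont G = {P \<in> nodes (cub G). lab G P \<le> c}"

definition level :: "lcgraph \<Rightarrow> pt set" where
  "level G = {P \<in> nodes (cub G). lab G P = c}"

text \<open>The edges carrying an iso-point, as pairs (continuous end point, disperse end point).\<close>

definition mixed :: "lcgraph \<Rightarrow> (pt \<times> pt) set" where
  "mixed G = {(P, Q). incident (cub G) P Q \<and> P \<in> cont G \<and> Q \<in> disp G}"

definition iso_pt :: "lcgraph \<Rightarrow> pt \<times> pt \<Rightarrow> pt" where
  "iso_pt G = (\<lambda>(P, Q). P + ((c - lab G P) / (lab G Q - lab G P)) *\<^sub>R (Q - P))"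

definition iso_points :: "lcgraph \<Rightarrow> pt set" where
  "iso_points G = iso_pt G ` mixed G"

definition iso_nodes :: "lcgraph \<Rightarrow> pt set" where
  "iso_nodes G = nodes (cub G) \<inter> iso_points G"

definition L_faces :: "lcgraph \<Rightarrow> pt set set" where
  "L_faces G = {F \<in> faces (cub G). card (F \<inter> disp G) = 2 \<and> card (F \<inter> cont G) = 2 \<and>
     (\<forall>P \<in> F \<inter> disp G. \<forall>Q \<in> F \<inter> disp G. \<not> incident (cub G) P Q)}"

definition trivial_L_face :: "lcgraph \<Rightarrow> pt set \<Rightarrow> bool" where
  "trivial_L_face G F \<longleftrightarrow> F \<in> L_faces G \<and> F \<inter> cont G \<subseteq> iso_nodes G"

definition singular_faces :: "lcgraph \<Rightarrow> pt set set" where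
  "singular_faces G = {F \<in> faces (cub G). card (F \<inter> disp G) = 3 \<and> card (F \<inter> iso_nodes G) = 1}"

definition regular_faces :: "lcgraph \<Rightarrow> pt set set" where
  "regular_faces G = {F \<in> faces (cub G). F \<notin> L_faces G \<and> \<not> F \<subseteq> disp G \<and> \<not> F \<subseteq> cont G \<and>
     F \<notin> singular_faces G}"

subsection \<open>Singular and isolated iso-paths, regular graphs\<close>

text \<open>Subgraphs are represented by their sets of nodes.\<close>

definition T1_subgraph :: "lcgraph \<Rightarrow> pt set \<Rightarrow> bool" where
  "T1_subgraph G H \<longleftrightarrow>
     (\<exists>P \<in> level G. H = insert P (nbrs (cub G) P) \<and> nbrs (cub G) P \<subseteq> disp G)"

text \<open>As in a \<open>T\<^sub>1\<close>-subgraph, the nodes incident to the level nodes belong to the subgraph; the node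
  left out is one of the two nodes incident to neither of them. Were it allowed to be incident to one
  of them, the removal step below would not always yield graphs without \<open>T\<^sub>1\<close>-subgraphs, and it would
  move iso-points.\<close>

definition T2_subgraph :: "lcgraph \<Rightarrow> pt set \<Rightarrow> bool" where
  "T2_subgraph G H \<longleftrightarrow> H \<subseteq> nodes (cub G) \<and> card H = 7 \<and>
     (\<exists>P \<in> level G. \<exists>Q \<in> level G. incident (cub G) P Q \<and>
        nbrs (cub G) P \<union> nbrs (cub G) Q \<subseteq> H \<and> H - {P, Q} \<subseteq> disp G)"

definition F1_graph :: "lcgraph \<Rightarrow> bool" where
  "F1_graph G \<longleftrightarrow> (\<exists>V \<subseteq> nodes (cub G). card V = 4 \<and>
     (\<forall>P \<in> V. card (nbrs (cub G) P - V) = 2) \<and> V \<subseteq> level G \<and> nodes (cub G) - V \<subseteq> disp G)"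

text \<open>\<open>\<G>\<close> is the family of graphs among which the face-neighbor is sought.\<close>

definition F2_graph :: "lcgraph set \<Rightarrow> lcgraph \<Rightarrow> bool" where
  "F2_graph \<G> G \<longleftrightarrow> (\<exists>G' \<in> \<G>. face_neighbors (cub G) (cub G') \<and>
     nodes (cub G) \<inter> nodes (cub G') \<subseteq> level G \<inter> level G' \<and>
     nodes (cub G) - nodes (cub G') \<subseteq> disp G \<and> nodes (cub G') - nodes (cub G) \<subseteq> disp G')"

definition singular_free :: "lcgraph \<Rightarrow> bool" where
  "singular_free G \<longleftrightarrow> (\<nexists>H. T1_subgraph G H \<or> T2_subgraph G H)"

definition isolated_free :: "lcgraph set \<Rightarrow> lcgraph \<Rightarrow> bool" where
  "isolated_free \<G> G \<longleftrightarrow> \<not> F1_graph G \<and> \<not> F2_graph \<G> G"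

definition regular_graph :: "lcgraph set \<Rightarrow> lcgraph \<Rightarrow> bool" where
  "regular_graph \<G> G \<longleftrightarrow> disp G \<noteq> {} \<and> cont G \<noteq> {} \<and> singular_free G \<and> isolated_free \<G> G"

text \<open>The removal step on the cuboid \<open>C\<close> of a mesh \<open>M\<close> whose vertices carry the labels \<open>\<phi>\<close>.\<close>

definition removed :: "cuboid set \<Rightarrow> (pt \<Rightarrow> real) \<Rightarrow> cuboid \<Rightarrow> lcgraph" where
  "removed M \<phi> C =
     (let raw = (\<lambda>C. \<lparr>cub = C, lab = \<phi>\<rparr>); G = raw C in
      if F1_graph G \<or> F2_graph (raw ` M) G then relabel (level G) 1 G
      else (let G' = relabel (level G \<inter> \<Union>{H. T1_subgraph G H}) 1 G in
            relabel (level G' \<inter> \<Union>{H. T2_subgraph G' H}) 1 G'))"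

subsection \<open>Inner iso-paths\<close>

text \<open>The segments joining, within a common face, the iso-points on two edges of the subgraph with
  node set \<open>H\<close>. For a regular face \<open>H\<close> this is the single segment of the \<open>C\<close>-rule, for an
  \<open>S\<^sub>i\<close>-subgraph \<open>H\<close> it is the set of edges of the triangle or quadrilateral of the \<open>S\<^sub>i\<close>-rule.\<close>

definition lines_in :: "lcgraph \<Rightarrow> pt set \<Rightarrow> pt set set" where
  "lines_in G H = {closed_segment (iso_pt G (P, Q)) (iso_pt G (P', Q')) | P Q P' Q' F.
     (P, Q) \<in> mixed G \<and> (P', Q') \<in> mixed G \<and> (P, Q) \<noteq> (P', Q') \<and> {P, Q, P', Q'} \<subseteq> H \<and>
     F \<in> faces (cub G) \<and> {P, Q, P', Q'} \<subseteq> F}"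

definition C_lines :: "lcgraph \<Rightarrow> pt set set" where
  "C_lines G = (\<Union>F \<in> regular_faces G. lines_in G F)"

fun S_subgraph :: "rule \<Rightarrow> lcgraph \<Rightarrow> pt set \<Rightarrow> bool" where
  "S_subgraph S1 G H \<longleftrightarrow>
     (\<exists>P \<in> disp G. H = insert P (nbrs (cub G) P) \<and> nbrs (cub G) P \<subseteq> cont G)"
| "S_subgraph S2 G H \<longleftrightarrow>
     (\<exists>P \<in> disp G. \<exists>Q \<in> disp G. incident (cub G) P Q \<and>
        H = nbrs (cub G) P \<union> nbrs (cub G) Q \<and> H - {P, Q} \<subseteq> cont G)"
| "S_subgraph S3 G H \<longleftrightarrow>
     (\<exists>P \<in> nodes (cub G). lab G P < c \<and> H = insert P (nbrs (cub G) P) \<and> nbrs (cub G) P \<subseteq> disp G)"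

fun S_relabel :: "rule \<Rightarrow> lcgraph \<Rightarrow> pt set \<Rightarrow> lcgraph" where
  "S_relabel S1 G H = relabel (H \<inter> disp G) 0 G"
| "S_relabel S2 G H = relabel (H \<inter> disp G) 0 G"
| "S_relabel S3 G H = relabel (H \<inter> cont G) 1 G"

text \<open>\<open>S_rules r n G R G'\<close>: the \<open>r\<^sup>n\<close>-rule turns \<open>G\<close> into \<open>G'\<close>, recording \<open>R\<close>. A recorded polygon is
  the set of its edges, paired with the disperse nodes of the subgraph it comes from. After the
  relabeling the subgraph no longer is an \<open>r\<close>-subgraph, so the \<open>n\<close> subgraphs are distinct.\<close>

inductive S_rules :: "rule \<Rightarrow> nat \<Rightarrow> lcgraph \<Rightarrow> (pt set set \<times> pt set) set \<Rightarrow> lcgraph \<Rightarrow> bool" where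
  "S_rules r 0 G {} G"
| "S_subgraph r G H \<Longrightarrow> S_rules r n (S_relabel r G H) R G' \<Longrightarrow>
     S_rules r (Suc n) G (insert (lines_in G H, H \<inter> disp G) R) G'"

definition S_table :: "lcgraph \<Rightarrow> rule \<Rightarrow> nat \<Rightarrow> bool" where
  "S_table G r n \<longleftrightarrow> (let d = card (disp G); l = card (L_faces G);
       par = (\<exists>F \<in> L_faces G. \<exists>F' \<in> L_faces G. parallel F F') in
     d = 2 \<and> r = S1 \<and> n = 1 \<or>
     d = 3 \<and> l = 1 \<and> r = S1 \<and> n = 1 \<or>
     d = 3 \<and> l = 3 \<and> r = S1 \<and> n = 2 \<or>
     d = 4 \<and> l = 2 \<and> \<not> par \<and> r = S1 \<and> n = 1 \<or>
     d = 4 \<and> l = 2 \<and> par \<and> r = S2 \<and> n = 1 \<or>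
     d = 4 \<and> l = 6 \<and> r = S1 \<and> n = 3 \<or>
     d = 5 \<and> l = 1 \<and> r = S3 \<and> n = 1 \<or>
     d = 5 \<and> l = 3 \<and> r = S1 \<and> n = 1 \<or>
     d = 6 \<and> r = S3 \<and> n = 1)"

text \<open>The \<open>S\<^sup>n\<close>-rules leave a choice of the subgraphs, whence a predicate: \<open>W\<close> is the set of inner
  iso-paths of \<open>G\<close> obtained by one run of the rules. The second component of an element of \<open>W\<close> is the
  set of disperse nodes of the \<open>S\<close>-subgraph, or of the remaining graph, it is obtained from.\<close>

definition inner_iso_paths :: "lcgraph set \<Rightarrow> lcgraph \<Rightarrow> (pt set set \<times> pt set) set \<Rightarrow> bool" where
  "inner_iso_paths \<G> G W \<longleftrightarrow>
     (if \<not> regular_graph \<G> G then W = {}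
      else if L_faces G \<noteq> {} then
        \<exists>r n R G'. S_table G r n \<and> S_rules r n G R G' \<and> W = insert (C_lines G', disp G') R
      else if card (disp G) = 2 \<and> (\<exists>H. S_subgraph S1 G H) then
        \<exists>R G'. S_rules S1 1 G R G' \<and> W = insert (C_lines G', disp G') R
      else if card (disp G) = 6 \<and> (\<exists>H. S_subgraph S3 G H) then
        \<exists>R G'. S_rules S3 1 G R G' \<and> W = insert (C_lines G', disp G') R
      else W = {(C_lines G, disp G)})"

end

section \<open>Iso-paths in a system of graphs\<close>

definition side :: "pt list \<Rightarrow> nat \<Rightarrow> pt set" where
  "side Qs i = closed_segment (Qs ! i) (Qs ! (Suc i mod length Qs))"

definition polygon_lines :: "pt list \<Rightarrow> pt set set" where
  "polygon_lines Qs = side Qs ` {..<length Qs}"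

definition closed_polygon :: "pt list \<Rightarrow> bool" where
  "closed_polygon Qs \<longleftrightarrow> 3 \<le> length Qs \<and> distinct Qs"

definition simple_closed_polygon :: "pt list \<Rightarrow> bool" where
  "simple_closed_polygon Qs \<longleftrightarrow> closed_polygon Qs \<and>
     (\<forall>i < length Qs. \<forall>j < length Qs. i \<noteq> j \<longrightarrow>
        side Qs i \<inter> side Qs j =
          {Qs ! i, Qs ! (Suc i mod length Qs)} \<inter> {Qs ! j, Qs ! (Suc j mod length Qs)})"

text \<open>An iso-path is given by the set of its edges. An inner iso-path moreover remembers its cuboid
  and the disperse nodes of the (sub)graph it is obtained from, so inner iso-paths of different graphs
  are different iso-paths even if the polygons coincide.\<close>

datatype iso_path =
    Inner cuboid (lines: "pt set set") "pt set"
  | Outer (lines: "pt set set")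

definition curve :: "iso_path \<Rightarrow> pt set" where
  "curve \<omega> = \<Union> (lines \<omega>)"

text \<open>\<open>meet_along N \<omega>\<^sub>1 \<omega>\<^sub>2 l\<close>: the iso-line \<open>l\<close> is the intersection of the two iso-paths up to contacts
  at the iso-nodes \<open>N\<close>. Such contacts cannot be excluded. If a face has the node labels
  \<open>> c, < c, = c, < c\<close> in cyclic order and the adjacent cuboids carry mirror-symmetric labels such that
  each has one iso-path running through the whole cuboid, then the two iso-paths have in common the
  iso-line on the face and, in addition, the opposite iso-node.\<close>

definition meet_along :: "pt set \<Rightarrow> iso_path \<Rightarrow> iso_path \<Rightarrow> pt set \<Rightarrow> bool" where
  "meet_along N \<omega>1 \<omega>2 l \<longleftrightarrow> l \<in> lines \<omega>1 \<inter> lines \<omega>2 \<and>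
     (\<forall>x \<in> (curve \<omega>1 \<inter> curve \<omega>2) - l.
        x \<in> N \<or> (\<exists>m \<in> lines \<omega>1 \<inter> lines \<omega>2. x \<in> m \<and> m \<inter> N \<noteq> {}))"

lemma meet_along_iff_Int:
  assumes "curve \<omega>1 \<inter> curve \<omega>2 \<inter> N = {}"
  shows "meet_along N \<omega>1 \<omega>2 l \<longleftrightarrow> l \<in> lines \<omega>1 \<inter> lines \<omega>2 \<and> l = curve \<omega>1 \<inter> curve \<omega>2"
  using assms unfolding meet_along_def curve_def by blast

lemma meet_along_if_Int:
  assumes "l \<in> lines \<omega>1 \<inter> lines \<omega>2" "l = curve \<omega>1 \<inter> curve \<omega>2"
  shows "meet_along N \<omega>1 \<omega>2 l"
  using assms unfolding meet_along_def by blast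

text \<open>The graph \<open>G\<close> of the cuboid \<open>C\<close> with its system of graphs; \<open>W\<close> selects, for every graph of the
  system, one outcome of the rules for the inner iso-paths.\<close>

locale graph_system =
  fixes c :: real and M :: "cuboid set" and \<phi> :: "pt \<Rightarrow> real" and C :: cuboid
    and W :: "cuboid \<Rightarrow> (pt set set \<times> pt set) set"
  assumes iso_level: "0 < c" "c < 1"
    and mesh: "cuboid_mesh M" "C \<in> M" "surrounded M C"
    and labels: "\<And>C' P. C' \<in> M \<Longrightarrow> P \<in> nodes C' \<Longrightarrow> \<phi> P \<in> {0..1}"
    and free: "\<And>C'. C' \<in> system_of_cuboids M C \<Longrightarrow>
          singular_free c (removed c M \<phi> C') \<and>
          isolated_free c (removed c M \<phi> ` M) (removed c M \<phi> C')"
    and inner: "\<And>C'. C' \<in> system_of_cuboids M C \<Longrightarrow>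
          inner_iso_paths c (removed c M \<phi> ` M) (removed c M \<phi> C') (W C')"
begin

definition graph :: "cuboid \<Rightarrow> lcgraph" where
  "graph C' = removed c M \<phi> C'"

definition regular :: "cuboid \<Rightarrow> bool" where
  "regular C' \<longleftrightarrow> regular_graph c (graph ` M) (graph C')"

definition system :: "cuboid set" where
  "system = system_of_cuboids M C"

definition outer_iso_path :: "cuboid \<Rightarrow> pt set set \<Rightarrow> bool" where
  "outer_iso_path C1 E \<longleftrightarrow> regular C1 \<and> (\<exists>C2 \<in> system. \<exists>F \<in> faces C1 \<inter> faces C2.
     face_neighbors C1 C2 \<and> F \<in> L_faces c (graph C1) \<and> \<not> trivial_L_face c (graph C1) F \<and>
     (\<exists>Qs. simple_closed_polygon Qs \<and> E = polygon_lines Qs \<and>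
        set Qs \<subseteq> iso_points c (graph C1) \<union> iso_points c (graph C2) \<and>
        \<Union>E = (\<Union>(L, S) \<in> W C1 \<union> W C2. \<Union>L) \<inter> convex hull F))"

definition iso_paths :: "cuboid \<Rightarrow> iso_path set" where
  "iso_paths C' = {Inner C' L S | L S. (L, S) \<in> W C'} \<union> {Outer E | E. outer_iso_path C' E}"

definition system_iso_paths :: "iso_path set" where
  "system_iso_paths = (\<Union>C' \<in> system. iso_paths C')"

text \<open>Two iso-paths with \<open>l = \<omega>\<^sub>1 \<inter> \<omega>\<^sub>2\<close>, see \<open>meet_along\<close>.\<close>

definition meet :: "iso_path \<Rightarrow> iso_path \<Rightarrow> pt set \<Rightarrow> bool" where
  "meet = meet_along (\<Union>C' \<in> system. iso_nodes c (graph C'))"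

subsection \<open>Disperse connectedness\<close>

text \<open>The disperse node \<open>Q\<close> corresponds to \<open>l\<close> with respect to an inner iso-path. The iso-line of a
  non-trivial L-face at a continuous node corresponds to that node, hence to no disperse node; and
  disperse connectedness involves corresponding nodes for inner iso-paths only.\<close>

fun corresponds :: "pt \<Rightarrow> pt set \<Rightarrow> iso_path \<Rightarrow> bool" where
  "corresponds Q l (Inner C' L S) \<longleftrightarrow> l \<in> L \<and> Q \<in> disp c (graph C') \<and>
     ((\<exists>F \<in> regular_faces c (graph C'). Q \<in> F \<and> l \<in> lines_in c (graph C') F) \<or>
      (\<exists>F \<in> L_faces c (graph C'). Q \<in> F \<and>
         (\<exists>P P'. P \<noteq> P' \<and> {P, P'} \<subseteq> F \<and> {(P, Q), (P', Q)} \<subseteq> mixed c (graph C') \<and>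
            l = closed_segment (iso_pt c (graph C') (P, Q)) (iso_pt c (graph C') (P', Q))) \<and>
         (trivial_L_face c (graph C') F \<longrightarrow> Q \<in> S)))"
| "corresponds Q l (Outer E) \<longleftrightarrow> False"

definition disperse_edge :: "pt \<Rightarrow> pt \<Rightarrow> bool" where
  "disperse_edge P Q \<longleftrightarrow> (\<exists>C' \<in> system. incident C' P Q \<and> {P, Q} \<subseteq> disp c (graph C'))"

definition disperse_path :: "pt list \<Rightarrow> bool" where
  "disperse_path Ps \<longleftrightarrow> 3 \<le> length Ps \<and> distinct Ps \<and> successively disperse_edge Ps"

definition disperse_connected :: "iso_path \<Rightarrow> iso_path \<Rightarrow> pt set \<Rightarrow> bool" where
  "disperse_connected \<omega>1 \<omega>2 l \<longleftrightarrow>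
     \<omega>1 \<in> iso_paths C \<and> \<omega>2 \<in> system_iso_paths \<and> \<omega>2 \<noteq> \<omega>1 \<and> meet \<omega>1 \<omega>2 l \<and>
     ((\<forall>\<alpha> \<in> system_iso_paths. \<forall>\<beta> \<in> system_iso_paths.
          \<alpha> \<noteq> \<beta> \<and> meet \<alpha> \<beta> l \<longrightarrow> {\<alpha>, \<beta>} = {\<omega>1, \<omega>2}) \<or>
      is_Inner \<omega>1 \<and> is_Inner \<omega>2 \<and>
      ((\<exists>P. corresponds P l \<omega>1 \<and> corresponds P l \<omega>2) \<or>
       (\<exists>P1 P2. P1 \<noteq> P2 \<and> corresponds P1 l \<omega>1 \<and> corresponds P2 l \<omega>2 \<and>
          (\<exists>Ps. disperse_path Ps \<and> hd Ps = P1 \<and> last Ps = P2))))"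

end

end

theory Submission
  imports Defs
begin

text \<open>
  Call an edge mixed if exactly one of its end points is disperse. The inner iso-paths of a regular
  graph correspond to a partition of its mixed edges into classes: the lines of an iso-path join, on
  each face, the iso-points of the mixed edges of its class. For the rules \<open>S\<^sub>1\<close> and \<open>S\<^sub>2\<close> a class
  consists of the mixed edges at a component of the disperse nodes, for \<open>S\<^sub>3\<close> at a component of the
  continuous ones. A relabeled node has only disperse neighbours in the relabeled graph, so all
  iso-points are determined by the original labels, and the lines which two neighbouring graphs
  draw on their common face can be compared.

  A line of an inner iso-path which is not part of an edge of a cuboid lies on exactly one face. If
  this is not an L-face, the only other iso-path through the line is one of the face-neighbour. On a
  non-trivial L-face each of the two graphs draws lines either around the disperse nodes of the face
  or around its continuous nodes. If the choices agree, both graphs draw the given line; otherwise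
  the lines of the two graphs form an outer iso-path through it. On a trivial L-face both lines of a
  graph are the diagonal, which belongs to an inner iso-path of the face-neighbour with the same
  disperse node or, if the face-neighbour has relabeled nodes of the face, only to the two inner
  iso-paths of the graph itself. A line along an edge of the cuboid joins two nodes with label \<open>c\<close>;
  here one goes around the four cuboids at the edge until the line occurs again, and the relabeled
  nodes passed on the way yield the disperse path.
\<close>

section \<open>Nodes and faces of a cuboid\<close>

text \<open>Two obstacles shape the argument. The removal step works cuboid by cuboid, so
  neighbouring graphs may disagree on whether a common node is disperse; case distinctions on a
  common face are therefore made on the labels \<open>\<phi>\<close> of the mesh. And
  \<open>meet\<close> speaks of all points of two curves. This is reduced to combinatorics by
  carriers: \<open>car D x\<close> is the node set of the smallest face of \<open>D\<close> around
  \<open>x\<close>, and it is the same for all cuboids of the mesh containing \<open>x\<close>. A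
  point of an iso-line is an iso-node, a strict iso-point (carrier its mixed edge), or has as
  carrier a whole face or an edge of label \<open>c\<close>; so two lines through \<open>x\<close>
  must be of the same kind at the same place. Interior points of a line likewise tell which cuboids
  can contain it. The rules leave a choice of subgraphs. No particular run is followed:
  \<open>class_struct\<close> collects what all runs share, and the table of rules is used only to
  see that the graph left after the \<open>S\<close>-rules has no L-face and that \<open>S3\<close>
  is applied only if there are at least five disperse nodes.\<close>

definition flip :: "cuboid \<Rightarrow> 3 \<Rightarrow> pt \<Rightarrow> pt" where
  "flip D i V = (\<chi> j. if j = i then fst D $ i + snd D $ i - V $ i else V $ j)"

definition face :: "cuboid \<Rightarrow> 3 \<Rightarrow> pt \<Rightarrow> pt set" where
  "face D i V = {P \<in> nodes D. P $ i = V $ i}"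

lemma flip_nth: "flip D i V $ j = (if j = i then fst D $ i + snd D $ i - V $ i else V $ j)"
  by (simp add: flip_def)

lemma flip_flip [simp]: "flip D i (flip D i V) = V"
  by (simp add: flip_def vec_eq_iff)

lemma flip_commute: "flip D i (flip D j V) = flip D j (flip D i V)"
  by (auto simp: flip_def vec_eq_iff)

lemma nodesD: "V \<in> nodes D \<Longrightarrow> V $ i = fst D $ i \<or> V $ i = snd D $ i"
  by (auto simp: nodes_def)

lemma flip_nodes [simp]: "flip D i V \<in> nodes D \<longleftrightarrow> V \<in> nodes D"
proof -
  have "flip D i V \<in> nodes D" if "V \<in> nodes D" for V
    unfolding nodes_def
  proof (intro CollectI allI)
    fix j show "flip D i V $ j \<in> {fst D $ j, snd D $ j}"
      using nodesD[OF that, of j] by (auto simp: flip_nth)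
  qed
  from this[of V] this[of "flip D i V"] show ?thesis by auto
qed

lemma is_cuboidD: "is_cuboid D \<Longrightarrow> fst D $ i < snd D $ i"
  by (simp add: is_cuboid_def)

lemma flip_nth_neq: "is_cuboid D \<Longrightarrow> V \<in> nodes D \<Longrightarrow> flip D i V $ i \<noteq> V $ i"
  using nodesD[of V D i] is_cuboidD[of D i] by (auto simp: flip_nth)

lemma flip_neq:
  assumes "is_cuboid D" "V \<in> nodes D"
  shows "flip D i V \<noteq> V" "V \<noteq> flip D i V"
  using flip_nth_neq[OF assms, of i] by auto

lemma flip_inj: "is_cuboid D \<Longrightarrow> V \<in> nodes D \<Longrightarrow> flip D i V = flip D j V \<longleftrightarrow> i = j"
  using flip_nth_neq[of D V i] by (auto simp: flip_nth vec_eq_iff)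

lemma node_nth_cases:
  assumes "is_cuboid D" "V \<in> nodes D" "U \<in> nodes D"
  shows "U $ i = V $ i \<or> U $ i = flip D i V $ i"
  using nodesD[OF assms(2), of i] nodesD[OF assms(3), of i] by (auto simp: flip_nth)

lemma incident_sym: "incident D P Q \<longleftrightarrow> incident D Q P"
  unfolding incident_def by metis

lemma incident_nodes: "incident D P Q \<Longrightarrow> P \<in> nodes D \<and> Q \<in> nodes D"
  by (simp add: incident_def)

text \<open>This trades the unique axis in \<open>incident\<close> for an equation, so that
  neighbourhoods can be computed by rewriting.\<close>

lemma incident_iff:
  assumes "is_cuboid D"
  shows "incident D P Q \<longleftrightarrow> P \<in> nodes D \<and> (\<exists>i. Q = flip D i P)"
proof
  assume a: "incident D P Q"
  then obtain i where i: "P $ i \<noteq> Q $ i" "\<And>j. P $ j \<noteq> Q $ j \<Longrightarrow> j = i"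
    unfolding incident_def by blast
  have n: "P \<in> nodes D" "Q \<in> nodes D" using a by (auto simp: incident_def)
  have "P $ j = Q $ j" if "j \<noteq> i" for j using i(2) that by blast
  then have "Q = flip D i P"
    using node_nth_cases[OF assms n(1) n(2), of i] i(1) by (simp add: vec_eq_iff flip_nth)
  with n show "P \<in> nodes D \<and> (\<exists>i. Q = flip D i P)" by blast
next
  assume "P \<in> nodes D \<and> (\<exists>i. Q = flip D i P)"
  then obtain i where i: "P \<in> nodes D" "Q = flip D i P" by blast
  with flip_nth_neq[OF assms i(1), of i] show "incident D P Q"
    unfolding incident_def by (auto simp: flip_nth split: if_splits)
qed

lemma incident_neq: "incident D P Q \<Longrightarrow> P \<noteq> Q"
  unfolding incident_def by auto

lemma nbrs_eq: "is_cuboid D \<Longrightarrow> P \<in> nodes D \<Longrightarrow> nbrs D P = range (\<lambda>i. flip D i P)"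
  by (auto simp: nbrs_def incident_iff)

lemma in_nbrs: "Q \<in> nbrs D P \<longleftrightarrow> incident D P Q"
  by (simp add: nbrs_def)

text \<open>Axes are named relative to the situation (along an edge, normal to a face) instead of
  being enumerated; the last conclusion then splits an equality of points into three coordinate
  equations in these names.\<close>

lemma third_axis:
  fixes i j :: 3
  assumes "i \<noteq> j"
  obtains k where "k \<noteq> i" "k \<noteq> j" "UNIV = {i, j, k}" "\<forall>P. (\<forall>l. P l) \<longleftrightarrow> P i \<and> P j \<and> P k"
proof -
  have u: "(UNIV :: 3 set) = {1, 2, 3}" by (rule UNIV_3)
  have d: "(1::3) \<noteq> 2" "(1::3) \<noteq> 3" "(2::3) \<noteq> 3" by simp_all
  have "\<exists>k. k \<noteq> i \<and> k \<noteq> j \<and> UNIV = {i, j, k}"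
    using assms exhaust_3[of i] exhaust_3[of j]
    by (intro ccontr[of "\<exists>k. k \<noteq> i \<and> k \<noteq> j \<and> UNIV = {i, j, k}"], unfold not_ex forall_3 u) (use d in auto)
  then obtain k where "k \<noteq> i" "k \<noteq> j" "UNIV = {i, j, k}" by blast
  note k = this
  have "(\<forall>l. P l) \<longleftrightarrow> P i \<and> P j \<and> P k" for P
  proof -
    have "(\<forall>l. P l) \<longleftrightarrow> (\<forall>l\<in>UNIV. P l)" by simp
    then show ?thesis unfolding k(3) by simp
  qed
  then show ?thesis using that[OF k] by blast
qed

lemma other_axes:
  fixes i :: 3
  obtains j k where "j \<noteq> i" "k \<noteq> i" "k \<noteq> j" "UNIV = {i, j, k}" "\<forall>P. (\<forall>l. P l) \<longleftrightarrow> P i \<and> P j \<and> P k"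
proof -
  have "\<exists>j. j \<noteq> i"
  proof (cases "i = 1")
    case True
    then have "(2::3) \<noteq> i" by simp
    then show ?thesis by blast
  qed auto
  then obtain j where j: "i \<noteq> j" by metis
  obtain k where k: "k \<noteq> i" "k \<noteq> j" "UNIV = {i, j, k}" "\<forall>P. (\<forall>l. P l) \<longleftrightarrow> P i \<and> P j \<and> P k"
    by (rule third_axis[OF j])
  show ?thesis by (rule that[OF j[symmetric] k])
qed

lemma face_mem [simp]: "V \<in> nodes D \<Longrightarrow> V \<in> face D i V"
  by (simp add: face_def)

lemma face_eqI: "W \<in> face D i V \<Longrightarrow> face D i W = face D i V"
  by (auto simp: face_def)

lemma face_sub: "face D i V \<subseteq> nodes D" by (auto simp: face_def)

lemma faces_sub: "F \<in> faces D \<Longrightarrow> F \<subseteq> nodes D" by (auto simp: faces_def)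

lemma face_in_faces: "V \<in> nodes D \<Longrightarrow> face D i V \<in> faces D"
  unfolding faces_def face_def using nodesD[of V D i] by blast

lemma finite_nodes: "finite (nodes D)"
proof -
  have "nodes D \<subseteq> vec_lambda ` (PiE UNIV (\<lambda>i. {fst D $ i, snd D $ i}))"
  proof
    fix P assume "P \<in> nodes D"
    then have "P = vec_lambda (\<lambda>i. P $ i)" "(\<lambda>i. P $ i) \<in> PiE UNIV (\<lambda>i. {fst D $ i, snd D $ i})"
      by (auto simp: nodes_def)
    then show "P \<in> vec_lambda ` (PiE UNIV (\<lambda>i. {fst D $ i, snd D $ i}))" by blast
  qed
  moreover have "finite (vec_lambda ` (PiE UNIV (\<lambda>i. {fst D $ i, snd D $ i})) :: pt set)"
    by (intro finite_imageI finite_PiE) auto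
  ultimately show ?thesis by (rule finite_subset)
qed

lemma facesE:
  assumes "is_cuboid D" "F \<in> faces D"
  obtains i V where "V \<in> nodes D" "F = face D i V"
proof -
  from assms(2) obtain i v where F: "v \<in> {fst D $ i, snd D $ i}" "F = {P \<in> nodes D. P $ i = v}"
    unfolding faces_def by blast
  define V where "V = (\<chi> j. if j = i then v else fst D $ j)"
  have "V \<in> nodes D" "F = face D i V" using F by (auto simp: V_def nodes_def face_def)
  with that show ?thesis by blast
qed

lemma facesE_at:
  assumes "is_cuboid D" "F \<in> faces D" "V \<in> F"
  obtains i where "F = face D i V"
  using facesE[OF assms(1,2)] assms(3) face_eqI by metis

lemma face_flip_mem [simp]: "j \<noteq> i \<Longrightarrow> flip D j U \<in> face D i V \<longleftrightarrow> U \<in> face D i V"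
  by (simp add: face_def flip_nth)

lemma face_eq4:
  assumes D: "is_cuboid D" "V \<in> nodes D" and ax: "j \<noteq> i" "k \<noteq> i" "k \<noteq> (j :: 3)"
  shows "face D i V = {V, flip D j V, flip D j (flip D k V), flip D k V}"
proof -
  obtain k' where k': "k' \<noteq> i" "k' \<noteq> j" "UNIV = {i, j, k'}" "\<forall>P. (\<forall>l. P l) \<longleftrightarrow> P i \<and> P j \<and> P k'"
    by (rule third_axis[OF ax(1)[symmetric]])
  have "k \<in> {i, j, k'}" using k'(3) by blast
  then have kk: "k' = k" using ax by blast
  have "U \<in> {V, flip D j V, flip D j (flip D k V), flip D k V}" if U: "U \<in> face D i V" for U
  proof -
    have U': "U \<in> nodes D" "U $ i = V $ i" using U by (auto simp: face_def)
    have 1: "U $ j = V $ j \<or> U $ j = flip D j V $ j" "U $ k = V $ k \<or> U $ k = flip D k V $ k"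
      using node_nth_cases[OF D U'(1)] by blast+
    show ?thesis
      using 1 U' ax unfolding vec_eq_iff insert_iff empty_iff k'(4)[unfolded kk, rule_format] by (auto simp: flip_nth)
  qed
  moreover have "{V, flip D j V, flip D j (flip D k V), flip D k V} \<subseteq> face D i V"
    using D ax by simp
  ultimately show ?thesis by blast
qed

section \<open>Faces as cyclically ordered quadruples of nodes\<close>

lemma not_incident_diag:
  assumes "is_cuboid D" "V \<in> nodes D" "j \<noteq> (k :: 3)"
  shows "\<not> incident D V (flip D j (flip D k V))"
proof
  assume "incident D V (flip D j (flip D k V))"
  then have "\<exists>!i. V $ i \<noteq> flip D j (flip D k V) $ i" by (simp add: incident_def)
  moreover have "V $ j \<noteq> flip D j (flip D k V) $ j" "V $ k \<noteq> flip D j (flip D k V) $ k"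
    using flip_nth_neq[OF assms(1,2)] assms(3) by (metis flip_nth)+
  ultimately show False using assms(3) by blast
qed

text \<open>Opposite nodes are \<open>A\<close>, \<open>B\<close> and \<open>P\<close>,
  \<open>Q\<close>. Rotations and reflections of the quadruple are again quadruples, so any node or
  edge of the face can be put first; nearly all arguments on a single face are made on such a
  quadruple.\<close>

definition quad :: "cuboid \<Rightarrow> pt set \<Rightarrow> pt \<Rightarrow> pt \<Rightarrow> pt \<Rightarrow> pt \<Rightarrow> bool" where
  "quad D F A P B Q \<longleftrightarrow> F \<in> faces D \<and> F = {A, P, B, Q} \<and> distinct [A, P, B, Q] \<and>
     incident D A P \<and> incident D P B \<and> incident D B Q \<and> incident D Q A \<and>
     \<not> incident D A B \<and> \<not> incident D P Q"

lemma quad_face: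
  assumes D: "is_cuboid D" "V \<in> nodes D" and ax: "j \<noteq> i" "k \<noteq> i" "k \<noteq> (j :: 3)"
  shows "quad D (face D i V) V (flip D j V) (flip D j (flip D k V)) (flip D k V)"
proof -
  have n: "flip D k V \<in> nodes D" "flip D j V \<in> nodes D" using D by auto
  have "\<not> incident D (flip D j V) (flip D j (flip D k (flip D j V)))"
    by (rule not_incident_diag) (use D ax in auto)
  moreover have "flip D j (flip D k (flip D j V)) = flip D k V" by (metis flip_commute flip_flip)
  moreover have "V \<noteq> flip D j (flip D k V)"
    using flip_nth_neq[OF D, of j] ax by (metis flip_nth)
  moreover have "flip D j (flip D k V) = flip D k (flip D j V)" by (rule flip_commute)
  ultimately show ?thesis
    unfolding quad_def face_eq4[OF D ax]
    using D ax face_in_faces[OF D(2), of i, unfolded face_eq4[OF D ax]] flip_neq[OF D] flip_neq[OF D(1) n(1)] flip_neq[OF D(1) n(2)]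
      not_incident_diag[OF D, of j k] flip_inj[OF D]
    by (simp add: incident_iff) (metis flip_commute flip_flip)
qed

lemma quad_exists:
  assumes "is_cuboid D" "F \<in> faces D" "A \<in> F"
  obtains P B Q where "quad D F A P B Q"
proof -
  obtain i where F: "F = face D i A" using facesE_at[OF assms] .
  obtain j k where "j \<noteq> i" "k \<noteq> i" "k \<noteq> j" using other_axes[of i] .
  with quad_face[OF assms(1), of A j i k] that F assms face_sub show ?thesis by (metis subsetD)
qed

lemma quad_rot: "quad D F A P B Q \<Longrightarrow> quad D F P B Q A"
  unfolding quad_def by (auto simp: incident_sym)

lemma quad_refl: "quad D F A P B Q \<Longrightarrow> quad D F A Q B P"
  unfolding quad_def by (auto simp: incident_sym)

lemma quad_exists_edge:
  assumes "is_cuboid D" "F \<in> faces D" "A \<in> F" "P \<in> F" "incident D A P"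
  obtains B Q where "quad D F A P B Q"
proof -
  obtain P' B Q where q: "quad D F A P' B Q" using quad_exists[OF assms(1-3)] .
  then have "P = P' \<or> P = Q" using assms incident_neq[OF assms(5)] unfolding quad_def by auto
  with q quad_refl[OF q] that show ?thesis by blast
qed

text \<open>Incidence depends only on the coordinates and on membership in the node set, so a common
  face carries the same quadruples in both cuboids.\<close>

lemma quad_mono:
  assumes "quad D F A P B Q" "F \<in> faces D'"
  shows "quad D' F A P B Q"
proof -
  have "F \<subseteq> nodes D'" by (rule faces_sub[OF assms(2)])
  then show ?thesis using assms unfolding quad_def incident_def by simp
qed

lemma quadD:
  assumes "quad D F A P B Q"
  shows "F \<in> faces D" "F = {A, P, B, Q}" "A \<noteq> P" "A \<noteq> B" "A \<noteq> Q" "P \<noteq> B" "P \<noteq> Q" "B \<noteq> Q"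
    "incident D A P" "incident D P B" "incident D B Q" "incident D Q A"
    "incident D P A" "incident D B P" "incident D Q B" "incident D A Q"
    "\<not> incident D A B" "\<not> incident D P Q" "\<not> incident D B A" "\<not> incident D Q P"
    "A \<in> nodes D" "P \<in> nodes D" "B \<in> nodes D" "Q \<in> nodes D"
  using assms unfolding quad_def by (auto simp: incident_sym dest: incident_nodes)

text \<open>Two distinct neighbours of a node are reached along different axes and hence differ from
  each other in two coordinates.\<close>

lemma no_triangle:
  assumes "is_cuboid D" "incident D P Q" "incident D P R" "incident D Q R"
  shows False
proof -
  obtain i j where ij: "P \<in> nodes D" "Q = flip D i P" "R = flip D j P"
    using assms by (auto simp: incident_iff)
  have "i \<noteq> j" using assms(4) ij by (auto dest: incident_neq)
  moreover have "incident D Q (flip D i (flip D j Q))"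
    using assms(4) ij by (metis flip_commute flip_flip)
  ultimately show False using not_incident_diag[of D Q i j] assms(1) ij by auto
qed

lemma incident_irrefl [simp]: "\<not> incident D P P"
  unfolding incident_def by auto

lemma quad_ex: "is_cuboid D \<Longrightarrow> F \<in> faces D \<Longrightarrow> A \<in> F \<Longrightarrow> \<exists>P B Q. quad D F A P B Q"
  by (rule quad_exists) (assumption+, intro exI)

lemma faces_nonempty: "is_cuboid D \<Longrightarrow> F \<in> faces D \<Longrightarrow> \<exists>V. V \<in> F"
  by (rule facesE, assumption+) (use face_mem in fast)

section \<open>Iso-points and iso-lines\<close>

text \<open>The nodes of the smallest face (of dimension at most three) of the cuboid containing \<open>x\<close>.\<close>
definition car :: "cuboid \<Rightarrow> pt \<Rightarrow> pt set" where
  "car D x = {V. \<forall>i. if x $ i \<in> {fst D $ i, snd D $ i} then V $ i = x $ i else V $ i \<in> {fst D $ i, snd D $ i}}"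

lemma car_sub: "car D x \<subseteq> nodes D"
  unfolding car_def nodes_def by (auto split: if_splits)

lemma car_node: "V \<in> nodes D \<Longrightarrow> car D V = {V}"
  unfolding car_def nodes_def by (auto simp: vec_eq_iff)

lemma car_edge:
  assumes D: "is_cuboid D" "incident D P Q" and t: "0 < t" "t < 1" and x: "x = P + t *\<^sub>R (Q - P)"
  shows "car D x = {P, Q}"
proof -
  obtain i where i: "P \<in> nodes D" "Q = flip D i P" using D by (auto simp: incident_iff)
  have xl: "x $ l = P $ l" if "l \<noteq> i" for l using that by (simp add: x i flip_nth)
  have lt: "fst D $ i < snd D $ i" using D(1) by (rule is_cuboidD)
  have "x $ i \<notin> {fst D $ i, snd D $ i}"
  proof -
    have *: "x $ i = P $ i + t * (fst D $ i + snd D $ i - 2 * P $ i)" by (simp add: x i flip_nth)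
    from nodesD[OF i(1), of i] show ?thesis
    proof
      assume "P $ i = fst D $ i"
      then have "x $ i = fst D $ i + t * (snd D $ i - fst D $ i)" using * by (simp add: algebra_simps)
      moreover have "0 < t * (snd D $ i - fst D $ i)" "t * (snd D $ i - fst D $ i) < snd D $ i - fst D $ i"
        using lt t by auto
      ultimately show ?thesis by auto
    next
      assume "P $ i = snd D $ i"
      then have "x $ i = snd D $ i - t * (snd D $ i - fst D $ i)" using * by (simp add: algebra_simps)
      moreover have "0 < t * (snd D $ i - fst D $ i)" "t * (snd D $ i - fst D $ i) < snd D $ i - fst D $ i"
        using lt t by auto
      ultimately show ?thesis by auto
    qed
  qed
  moreover have "P $ l \<in> {fst D $ l, snd D $ l}" for l using nodesD[OF i(1)] by auto
  ultimately have "V \<in> car D x \<longleftrightarrow> (\<forall>l. if l \<noteq> i then V $ l = P $ l else V $ l \<in> {fst D $ l, snd D $ l})" for V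
    unfolding car_def mem_Collect_eq by (intro all_cong1) (use xl in auto)
  moreover have "(\<forall>l. if l \<noteq> i then V $ l = P $ l else V $ l \<in> {fst D $ l, snd D $ l}) \<longleftrightarrow> V = P \<or> V = Q" for V
  proof -
    have "{fst D $ i, snd D $ i} = {P $ i, Q $ i}" using nodesD[OF i(1), of i] by (auto simp: i(2) flip_nth)
    then show ?thesis unfolding vec_eq_iff[of V] by (auto simp: i(2) flip_nth)
  qed
  ultimately show ?thesis by blast
qed

lemma open_segment_nth:
  fixes x y z :: pt
  assumes "x \<in> open_segment y z"
  obtains u where "0 < u" "u < 1" "\<forall>i. x $ i = (1 - u) * y $ i + u * z $ i"
  using assms by (auto simp: in_segment)

lemma body_nth: "x \<in> body D \<longleftrightarrow> (\<forall>i. fst D $ i \<le> x $ i \<and> x $ i \<le> snd D $ i)"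
  by (simp add: body_def mem_box_cart)

lemma nodes_body: "is_cuboid D \<Longrightarrow> V \<in> nodes D \<Longrightarrow> V \<in> body D"
  unfolding body_nth using nodesD[of V D] is_cuboidD[of D]
  by (metis less_eq_real_def order_refl)

lemma body_segment: "x \<in> body D \<Longrightarrow> y \<in> body D \<Longrightarrow> closed_segment x y \<subseteq> body D"
  unfolding body_def by (intro closed_segment_subset) (auto intro: convex_box)

text \<open>A proper convex combination of numbers on one side of a bound attains the bound only if
  all of them do. So every coordinate that is extremal at the inner point \<open>x\<close> is
  extremal, with the same value, at both ends.\<close>

lemma car_mono:
  assumes "x \<in> open_segment y z" "y \<in> body D" "z \<in> body D"
  shows "car D y \<subseteq> car D x" "car D z \<subseteq> car D x"
proof -
  have *: "car D y \<subseteq> car D x" if o: "x \<in> open_segment y z" and b: "y \<in> body D" "z \<in> body D" for y z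
  proof
    fix V assume V: "V \<in> car D y"
    obtain u where u: "0 < u" "u < 1" "\<forall>i. x $ i = (1 - u) * y $ i + u * z $ i"
      using open_segment_nth[OF o] .
    have yi: "y $ i = x $ i" if e: "x $ i = fst D $ i \<or> x $ i = snd D $ i" for i
    proof -
      have bd: "fst D $ i \<le> y $ i" "fst D $ i \<le> z $ i" "y $ i \<le> snd D $ i" "z $ i \<le> snd D $ i"
        using b by (auto simp: body_nth)
      from e show ?thesis
      proof
        assume e: "x $ i = fst D $ i"
        have "(1 - u) * (y $ i - fst D $ i) + u * (z $ i - fst D $ i) = 0"
          using u(3)[rule_format, of i] e by (simp add: algebra_simps)
        moreover have "0 \<le> (1 - u) * (y $ i - fst D $ i)" "0 \<le> u * (z $ i - fst D $ i)" using bd u(1,2) by auto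
        ultimately have "(1 - u) * (y $ i - fst D $ i) = 0" by linarith
        then show ?thesis using u(1,2) e by auto
      next
        assume e: "x $ i = snd D $ i"
        have "(1 - u) * (snd D $ i - y $ i) + u * (snd D $ i - z $ i) = 0"
          using u(3)[rule_format, of i] e by (simp add: algebra_simps)
        moreover have "0 \<le> (1 - u) * (snd D $ i - y $ i)" "0 \<le> u * (snd D $ i - z $ i)" using bd u(1,2) by auto
        ultimately have "(1 - u) * (snd D $ i - y $ i) = 0" by linarith
        then show ?thesis using u(1,2) e by auto
      qed
    qed
    have "V $ i = x $ i" if "x $ i \<in> {fst D $ i, snd D $ i}" for i
    proof -
      have "if y $ i \<in> {fst D $ i, snd D $ i} then V $ i = y $ i else V $ i \<in> {fst D $ i, snd D $ i}"
        using V unfolding car_def by blast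
      moreover have "y $ i = x $ i" using yi that by simp
      ultimately show ?thesis using that by simp
    qed
    moreover have "V $ i \<in> {fst D $ i, snd D $ i}" for i using V car_sub[of D y] by (auto simp: nodes_def)
    ultimately show "V \<in> car D x" unfolding car_def by simp
  qed
  show "car D y \<subseteq> car D x" by (rule *[OF assms])
  show "car D z \<subseteq> car D x" using *[of z y] assms by (simp add: open_segment_commute)
qed

lemma car_face: "V \<in> nodes D \<Longrightarrow> x $ i = V $ i \<Longrightarrow> car D x \<subseteq> face D i V"
  using car_sub[of D x] nodesD[of V D i] unfolding face_def car_def
  by (auto split: if_splits)

section \<open>Iso-points and the carriers of points of iso-lines\<close>

fun ends :: "pt \<times> pt \<Rightarrow> pt set" where "ends (P, Q) = {P, Q}"

lemma mixedD:
  assumes "(P, Q) \<in> mixed c G"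
  shows "incident (cub G) P Q" "P \<in> cont c G" "Q \<in> disp c G" "lab G P \<le> c" "c < lab G Q"
    "P \<in> nodes (cub G)" "Q \<in> nodes (cub G)" "P \<noteq> Q" "incident (cub G) Q P"
  using assms by (auto simp: mixed_def cont_def disp_def incident_sym dest: incident_neq)

lemma cont_disp: "P \<in> cont c G \<Longrightarrow> P \<in> disp c G \<Longrightarrow> False"
  by (auto simp: cont_def disp_def)

lemma cont_iff: "P \<in> nodes (cub G) \<Longrightarrow> P \<in> cont c G \<longleftrightarrow> P \<notin> disp c G"
  by (auto simp: cont_def disp_def)

lemma iso_level: "lab G P = c \<Longrightarrow> iso_pt c G (P, Q) = P"
  by (simp add: iso_pt_def)

lemma iso_param:
  assumes "(P, Q) \<in> mixed c G"
  obtains t where "0 \<le> t" "t < 1" "iso_pt c G (P, Q) = P + t *\<^sub>R (Q - P)" "t = 0 \<longleftrightarrow> lab G P = c"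
proof -
  define t where "t = (c - lab G P) / (lab G Q - lab G P)"
  have "0 \<le> t" "t < 1" "t = 0 \<longleftrightarrow> lab G P = c" using mixedD(4,5)[OF assms] by (auto simp: t_def)
  then show ?thesis using that by (simp add: iso_pt_def t_def)
qed

lemma car_iso_strict:
  assumes "is_cuboid (cub G)" "(P, Q) \<in> mixed c G" "lab G P < c"
  shows "car (cub G) (iso_pt c G (P, Q)) = {P, Q}"
proof -
  obtain t where t: "0 \<le> t" "t < 1" "iso_pt c G (P, Q) = P + t *\<^sub>R (Q - P)" "t = 0 \<longleftrightarrow> lab G P = c"
    using iso_param[OF assms(2)] .
  show ?thesis by (rule car_edge[OF assms(1) mixedD(1)[OF assms(2)] _ _ t(3)]) (use t assms in auto)
qed

lemma car_iso_level:
  assumes "(P, Q) \<in> mixed c G" "lab G P = c"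
  shows "car (cub G) (iso_pt c G (P, Q)) = {P}"
  using iso_level[OF assms(2)] mixedD(6)[OF assms(1)] car_node by simp

lemma fst_in_car_iso:
  "is_cuboid (cub G) \<Longrightarrow> (P, Q) \<in> mixed c G \<Longrightarrow> P \<in> car (cub G) (iso_pt c G (P, Q))"
  using car_iso_strict[of G P Q c] car_iso_level[of P Q c G] mixedD(4)[of P Q c G] by force

text \<open>The carrier of an iso-point gives back its edge when the continuous label is below
  \<open>c\<close>, and only the continuous node when that label is \<open>c\<close>. Hence
  iso-points of different edges coincide only at an iso-node.\<close>

lemma iso_eqD:
  assumes "is_cuboid (cub G)" "(P, Q) \<in> mixed c G" "(P', Q') \<in> mixed c G"
    and "iso_pt c G (P, Q) = iso_pt c G (P', Q')"
  shows "P = P' \<and> (Q = Q' \<or> lab G P = c)"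
proof -
  note m = mixedD[OF assms(2)] and m' = mixedD[OF assms(3)]
  have ne: "P \<noteq> Q'" "P' \<noteq> Q" using m(2,3) m'(2,3) cont_disp by blast+
  consider "lab G P < c" "lab G P' < c" | "lab G P = c" "lab G P' < c"
    | "lab G P < c" "lab G P' = c" | "lab G P = c" "lab G P' = c"
    using m(4) m'(4) by linarith
  then show ?thesis
  proof cases
    case 1
    then have "{P, Q} = {P', Q'}"
      using car_iso_strict[OF assms(1,2)] car_iso_strict[OF assms(1,3)] assms(4) by simp
    then show ?thesis using ne by (auto simp: doubleton_eq_iff)
  next
    case 2
    then have "{P} = {P', Q'}"
      using car_iso_level[OF assms(2)] car_iso_strict[OF assms(1,3)] assms(4) by simp
    then show ?thesis using ne by auto
  next
    case 3
    then have "{P, Q} = {P'}"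
      using car_iso_strict[OF assms(1,2)] car_iso_level[OF assms(3)] assms(4) by simp
    then show ?thesis using ne by auto
  next
    case 4
    then show ?thesis using iso_level assms(4) by metis
  qed
qed

lemma iso_body:
  assumes "is_cuboid (cub G)" "(P, Q) \<in> mixed c G"
  shows "iso_pt c G (P, Q) \<in> body (cub G)"
proof -
  obtain t where t: "0 \<le> t" "t < 1" "iso_pt c G (P, Q) = P + t *\<^sub>R (Q - P)" "t = 0 \<longleftrightarrow> lab G P = c"
    using iso_param[OF assms(2)] .
  have "iso_pt c G (P, Q) \<in> closed_segment P Q"
    unfolding in_segment by (rule exI[of _ t]) (use t in \<open>auto simp: algebra_simps\<close>)
  then show ?thesis
    using body_segment nodes_body[OF assms(1)] mixedD(6,7)[OF assms(2)] by blast
qed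

lemma iso_face:
  assumes "(P, Q) \<in> mixed c G" "P $ i = v" "Q $ i = v"
  shows "iso_pt c G (P, Q) $ i = v"
  using assms(2,3) by (simp add: iso_pt_def)

lemma segment_nth_eq:
  fixes x y z :: pt
  assumes "x \<in> closed_segment y z" "y $ i = v" "z $ i = v"
  shows "x $ i = v"
proof -
  obtain u where "x = (1 - u) *\<^sub>R y + u *\<^sub>R z" using assms(1) by (auto simp: in_segment)
  then have "x $ i = (1 - u) * y $ i + u * z $ i" by simp
  then show ?thesis using assms(2,3) by (simp add: algebra_simps)
qed

text \<open>The last case is a line along an edge of the cuboid, whose ends are iso-nodes.\<close>
lemma line_point_cases:
  assumes D: "is_cuboid (cub G)" and m: "(P, Q) \<in> mixed c G" "(P', Q') \<in> mixed c G"
    and F: "F \<in> faces (cub G)" "{P, Q, P', Q'} \<subseteq> F"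
    and ne: "iso_pt c G (P, Q) \<noteq> iso_pt c G (P', Q')"
    and x: "x \<in> closed_segment (iso_pt c G (P, Q)) (iso_pt c G (P', Q'))"
  shows "x = iso_pt c G (P, Q) \<or> x = iso_pt c G (P', Q') \<or> car (cub G) x = F \<or>
    (lab G P = c \<and> lab G P' = c \<and> incident (cub G) P P' \<and> car (cub G) x = {P, P'})"
proof (cases "x = iso_pt c G (P, Q) \<or> x = iso_pt c G (P', Q') \<or> car (cub G) x = F")
  case False
  then have xo: "x \<in> open_segment (iso_pt c G (P, Q)) (iso_pt c G (P', Q'))"
    using x by (simp add: open_segment_def)
  note mono = car_mono[OF xo iso_body[OF D m(1)] iso_body[OF D m(2)]]
  note n = mixedD[OF m(1)] mixedD[OF m(2)]
  obtain i where i: "F = face (cub G) i P" using facesE_at[OF D F(1), of P] F(2) by blast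
  have Fi: "V $ i = P $ i" if "V \<in> F" for V using that by (simp add: i face_def)
  have "x $ i = P $ i"
  proof (rule segment_nth_eq[OF x])
    have "Q $ i = P $ i" "P' $ i = P $ i" "Q' $ i = P $ i" by (rule Fi, use F(2) in simp)+
    then show "iso_pt c G (P, Q) $ i = P $ i" "iso_pt c G (P', Q') $ i = P $ i"
      using iso_face[OF m(1)] iso_face[OF m(2)] by auto
  qed
  then have cF: "car (cub G) x \<subseteq> F" unfolding i by (rule car_face[OF n(6)])
  \<comment> \<open>If the normal axis \<open>i\<close> were the only extremal one at
    \<open>x\<close>, every node of \<open>F\<close> would belong to the carrier. A second extremal
    axis confines the carrier to an edge in the remaining direction.\<close>
  obtain j where j: "j \<noteq> i" "x $ j \<in> {fst (cub G) $ j, snd (cub G) $ j}"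
  proof (rule ccontr)
    assume "\<not> thesis"
    note that' = that
    have nj: "x $ j \<notin> {fst (cub G) $ j, snd (cub G) $ j}" if "j \<noteq> i" for j using that' that \<open>\<not> thesis\<close> by blast
    have "F \<subseteq> car (cub G) x"
    proof
      fix V assume "V \<in> F"
      then have "V \<in> nodes (cub G)" "V $ i = x $ i" using Fi faces_sub[OF F(1)] \<open>x $ i = P $ i\<close> by auto
      then have "if x $ l \<in> {fst (cub G) $ l, snd (cub G) $ l} then V $ l = x $ l
          else V $ l \<in> {fst (cub G) $ l, snd (cub G) $ l}" for l
        using nj[of l] nodesD[of V "cub G" l] by (cases "l = i") auto
      then show "V \<in> car (cub G) x" unfolding car_def by blast
    qed
    with cF False show False by blast
  qed
  obtain k where k: "k \<noteq> i" "k \<noteq> j" "\<forall>P. (\<forall>l. P l) \<longleftrightarrow> P i \<and> P j \<and> P k"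
    by (rule third_axis[OF j(1)[symmetric]])
  have Pc: "P \<in> car (cub G) x" "P' \<in> car (cub G) x"
    using mono fst_in_car_iso[OF D m(1)] fst_in_car_iso[OF D m(2)] by auto
  have cj: "V $ j = x $ j" if "V \<in> car (cub G) x" for V
  proof -
    have "if x $ j \<in> {fst (cub G) $ j, snd (cub G) $ j} then V $ j = x $ j
        else V $ j \<in> {fst (cub G) $ j, snd (cub G) $ j}"
      using that unfolding car_def by blast
    with j(2) show ?thesis by simp
  qed
  have g: "V = P \<or> V = flip (cub G) k P" if V: "V \<in> car (cub G) x" for V
  proof -
    have "V \<in> nodes (cub G)" using V car_sub by blast
    then have "V $ k = P $ k \<or> V $ k = flip (cub G) k P $ k" using node_nth_cases[OF D n(6)] by blast
    moreover have "V $ i = P $ i" "V $ j = P $ j" using V cF Fi cj[OF V] cj[OF Pc(1)] by auto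
    ultimately show ?thesis unfolding vec_eq_iff k(3)[rule_format] using k by (auto simp: flip_nth)
  qed
  have "P \<noteq> P'"
  proof
    assume e: "P = P'"
    then have "lab G P < c" using ne n(4) iso_level[of G P c Q] iso_level[of G P c Q'] by force
    then have "Q \<in> car (cub G) x" "Q' \<in> car (cub G) x"
      using mono car_iso_strict[OF D m(1)] car_iso_strict[OF D m(2)] e by auto
    then have "Q = Q'" using g n e by metis
    with e ne show False by simp
  qed
  then have P': "P' = flip (cub G) k P" using g[OF Pc(2)] by simp
  \<comment> \<open>With a label below \<open>c\<close> the disperse end \<open>Q\<close> would lie
    in the carrier as well, but the carrier has room only for \<open>P\<close> and
    \<open>P'\<close>.\<close>
  have "\<not> lab G P < c"
  proof
    assume "lab G P < c"
    then have "Q \<in> car (cub G) x" using mono car_iso_strict[OF D m(1)] by auto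
    then have "Q = P'" using g n P' by metis
    then show False using n cont_disp by metis
  qed
  moreover have "\<not> lab G P' < c"
  proof
    assume "lab G P' < c"
    then have "Q' \<in> car (cub G) x" using mono car_iso_strict[OF D m(2)] by auto
    then have "Q' = P" using g n P' by metis
    then show False using n cont_disp by metis
  qed
  moreover have "incident (cub G) P P'" using D n P' by (auto simp: incident_iff)
  moreover have "car (cub G) x = {P, P'}" using g Pc P' by auto
  ultimately show ?thesis using n by force
qed blast

section \<open>L-faces as alternating faces, and the effect of removing an isolated node\<close>

definition alternating_faces :: "cuboid \<Rightarrow> pt set \<Rightarrow> pt set set" where
  "alternating_faces D d = {F \<in> faces D. \<forall>U \<in> F. \<forall>V \<in> F. incident D U V \<longrightarrow> (U \<in> d) \<noteq> (V \<in> d)}"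

text \<open>This symmetry lets one argument serve both for disperse nodes with continuous neighbours
  (\<open>S1\<close>) and for continuous nodes with disperse neighbours (\<open>S3\<close>).\<close>

lemma alternating_compl: "alternating_faces D (- d) = alternating_faces D d"
  unfolding alternating_faces_def by auto

lemma alternating_quad:
  assumes "quad D F A P B Q" "A \<in> d" "B \<in> d" "P \<notin> d" "Q \<notin> d"
  shows "F \<in> alternating_faces D d"
  using assms(2-) quadD(1)[OF assms(1)] quadD(17-20)[OF assms(1)]
  by (simp add: alternating_faces_def quadD(2)[OF assms(1)])

lemma alternating_quadE:
  assumes "is_cuboid D" "F \<in> alternating_faces D d"
  obtains A P B Q where "quad D F A P B Q" "A \<in> d" "B \<in> d" "P \<notin> d" "Q \<notin> d"
proof -
  have F: "F \<in> faces D" and alt: "\<And>U V. U \<in> F \<Longrightarrow> V \<in> F \<Longrightarrow> incident D U V \<Longrightarrow> (U \<in> d) \<noteq> (V \<in> d)"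
    using assms(2) by (auto simp: alternating_faces_def)
  obtain V where "V \<in> F" using faces_nonempty[OF assms(1) F] by blast
  then obtain A P B Q where q: "quad D F A P B Q" using quad_ex[OF assms(1) F] by blast
  note qd = quadD[OF q]
  have "(A \<in> d) \<noteq> (P \<in> d)" "(P \<in> d) \<noteq> (B \<in> d)" "(B \<in> d) \<noteq> (Q \<in> d)"
    by (rule alt; use qd in simp)+
  then have *: "A \<in> d \<and> B \<in> d \<and> P \<notin> d \<and> Q \<notin> d \<or> P \<in> d \<and> Q \<in> d \<and> B \<notin> d \<and> A \<notin> d" by blast
  show ?thesis using * that[OF q] that[OF quad_rot[OF q]] by argo
qed

lemma alternating_quadE_at:
  assumes "is_cuboid D" "F \<in> alternating_faces D d" "A \<in> F" "A \<in> d"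
  obtains P B Q where "quad D F A P B Q" "B \<in> d" "P \<notin> d" "Q \<notin> d"
proof -
  obtain A' P B Q where q: "quad D F A' P B Q" "A' \<in> d" "B \<in> d" "P \<notin> d" "Q \<notin> d"
    using alternating_quadE[OF assms(1,2)] .
  have "A = A' \<or> A = P \<or> A = B \<or> A = Q" using quadD(2)[OF q(1)] assms(3) by simp
  then have "A = A' \<or> A = B" using q assms(4) by metis
  then show ?thesis
  proof
    assume "A = A'" then show ?thesis using q by (intro that[of P B Q]) simp_all
  next
    assume "A = B" then show ?thesis using q quad_rot[OF quad_rot[OF q(1)]] by (intro that[of Q A' P]) simp_all
  qed
qed

lemma L_faces_eq:
  assumes D: "is_cuboid (cub G)"
  shows "L_faces c G = alternating_faces (cub G) (disp c G)"
proof (intro equalityI subsetI)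
  fix F assume F: "F \<in> L_faces c G"
  then have f: "F \<in> faces (cub G)" "card (F \<inter> disp c G) = 2"
    and ni: "\<And>P Q. P \<in> F \<inter> disp c G \<Longrightarrow> Q \<in> F \<inter> disp c G \<Longrightarrow> \<not> incident (cub G) P Q"
    by (auto simp: L_faces_def)
  obtain A where A: "A \<in> F" "A \<in> disp c G"
  proof -
    have "F \<inter> disp c G \<noteq> {}" using f(2) by (metis card.empty zero_neq_numeral)
    then show ?thesis using that by blast
  qed
  obtain P B Q where q: "quad (cub G) F A P B Q" using quad_exists[OF D f(1) A(1)] .
  note qd = quadD[OF q]
  have PQ: "P \<notin> disp c G" "Q \<notin> disp c G" using ni[of A P] ni[of A Q] A qd by auto
  have "B \<in> disp c G"
  proof (rule ccontr)
    assume "B \<notin> disp c G"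
    then have "F \<inter> disp c G = {A}" using qd A PQ by auto
    then show False using f(2) by simp
  qed
  with alternating_quad[OF q A(2)] PQ show "F \<in> alternating_faces (cub G) (disp c G)" by blast
next
  fix F assume F: "F \<in> alternating_faces (cub G) (disp c G)"
  obtain A P B Q where q: "quad (cub G) F A P B Q" "A \<in> disp c G" "B \<in> disp c G" "P \<notin> disp c G" "Q \<notin> disp c G"
    using alternating_quadE[OF D F] .
  note qd = quadD[OF q(1)]
  have "F \<inter> disp c G = {A, B}" unfolding qd(2) using q(2-) by blast
  moreover have "F \<inter> cont c G = {P, Q}"
    unfolding qd(2) using q(2-) cont_iff[of _ G c] qd(21-24) by blast
  ultimately show "F \<in> L_faces c G"
    unfolding L_faces_def mem_Collect_eq using qd(1,4,7,17,19) by simp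
qed

lemma card_nodes_le: "is_cuboid D \<Longrightarrow> card (nodes D) \<le> 8"
proof -
  assume D: "is_cuboid D"
  show ?thesis
  proof (cases "nodes D = {}")
    case False
    then obtain A where A: "A \<in> nodes D" by blast
    obtain i j k :: 3 where ax: "j \<noteq> i" "k \<noteq> i" "k \<noteq> j" using other_axes .
    have *: "finite (face D i B)" "card (face D i B) \<le> 4" if "B \<in> nodes D" for B
      unfolding face_eq4[OF D that ax] by (simp_all add: card_insert_if)
    have n: "flip D i A \<in> nodes D" using A by simp
    have "nodes D \<subseteq> face D i A \<union> face D i (flip D i A)"
      using node_nth_cases[OF D A] by (auto simp: face_def)
    then have "card (nodes D) \<le> card (face D i A \<union> face D i (flip D i A))"
      by (rule card_mono[rotated]) (simp add: *(1)[OF A] *(1)[OF n])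
    also have "\<dots> \<le> card (face D i A) + card (face D i (flip D i A))" by (rule card_Un_le)
    also have "\<dots> \<le> 4 + 4" by (intro add_mono *(2) A n)
    finally show ?thesis by simp
  qed simp
qed

text \<open>A face through \<open>A\<close> cannot alternate once \<open>A\<close> is removed, since
  a neighbour of \<open>A\<close> on it would have to be in \<open>d\<close>. So \<open>F\<close> is
  opposite to \<open>A\<close> in some direction \<open>i\<close>; its node next to \<open>A\<close>
  is outside \<open>d\<close>, and alternation fixes the other three nodes.\<close>

lemma isolated_alternating:
  assumes D: "is_cuboid D" "A \<in> nodes D" and A: "A \<in> d" "\<And>i. flip D i A \<notin> d"
    and F: "F \<in> alternating_faces D (d - {A})"
  obtains i j k where "j \<noteq> i" "k \<noteq> i" "k \<noteq> j" "A \<notin> F" "F = face D i (flip D i A)"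
    "flip D j (flip D i A) \<in> d" "flip D k (flip D i A) \<in> d" "flip D j (flip D k (flip D i A)) \<notin> d"
proof -
  have f: "F \<in> faces D" using F by (simp add: alternating_faces_def)
  have alt: "(U \<in> d - {A}) \<noteq> (V \<in> d - {A})" if "U \<in> F" "V \<in> F" "incident D U V" for U V
    using F that by (simp add: alternating_faces_def)
  have AF: "A \<notin> F"
  proof
    assume "A \<in> F"
    then obtain P B Q where q: "quad D F A P B Q" using quad_ex[OF D(1) f] by blast
    note qd = quadD[OF q]
    have "(P \<in> d - {A})" using alt[of A P] qd by simp
    moreover obtain i where "P = flip D i A" using qd D by (auto simp: incident_iff)
    ultimately show False using A(2) by simp
  qed
  obtain i V where V: "V \<in> nodes D" "F = face D i V" using facesE[OF D(1) f] .
  have "A $ i \<noteq> V $ i" using AF D V by (auto simp: face_def)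
  then have "V $ i = flip D i A $ i" using node_nth_cases[OF D V(1)] by metis
  then have Fi: "F = face D i (flip D i A)" by (simp add: V face_def)
  obtain j k where ax: "j \<noteq> i" "k \<noteq> i" "k \<noteq> j" using other_axes[of i] .
  let ?P = "flip D i A"
  have n: "?P \<in> nodes D" using D by simp
  note q = quad_face[OF D(1) n ax, folded Fi]
  note qd = quadD[OF q]
  have p: "?P \<notin> d - {A}" using A by blast
  have "flip D j ?P \<in> d - {A}" using alt[of ?P "flip D j ?P"] p qd by simp
  moreover have "flip D k ?P \<in> d - {A}" using alt[of ?P "flip D k ?P"] p qd by simp
  moreover have "flip D j (flip D k ?P) \<notin> d - {A}"
    using alt[of "flip D k ?P" "flip D j (flip D k ?P)"] calculation(2) qd by simp
  moreover have "flip D j (flip D k ?P) \<noteq> A" using AF qd by auto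
  ultimately show ?thesis by (intro that[OF ax AF Fi]) auto
qed

text \<open>Besides \<open>F\<close>, the two faces through \<open>A\<close> that contain the
  direction \<open>i\<close> alternate: on each of them the node opposite to \<open>A\<close> lies
  on \<open>F\<close> and belongs to \<open>d\<close>.\<close>

lemma isolated_alternating_three:
  assumes D: "is_cuboid D" "A \<in> nodes D" and A: "A \<in> d" "\<And>i. flip D i A \<notin> d"
    and F: "F \<in> alternating_faces D (d - {A})"
  shows "3 \<le> card (alternating_faces D d)"
proof -
  obtain i j k where ax: "j \<noteq> i" "k \<noteq> i" "k \<noteq> j" and AF: "A \<notin> F" "F = face D i (flip D i A)"
    and d: "flip D j (flip D i A) \<in> d" "flip D k (flip D i A) \<in> d"
    by (rule isolated_alternating[OF assms])
  have "F \<in> alternating_faces D d" using F AF(1) unfolding alternating_faces_def by auto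
  moreover have 1: "face D k A \<in> alternating_faces D d"
  proof (rule alternating_quad[OF quad_face[OF D, of i k j]])
    show "flip D i (flip D j A) \<in> d" using d(1) by (simp add: flip_commute)
  qed (use A ax in auto)
  moreover have 2: "face D j A \<in> alternating_faces D d"
  proof (rule alternating_quad[OF quad_face[OF D, of i j k]])
    show "flip D i (flip D k A) \<in> d" using d(2) by (simp add: flip_commute)
  qed (use A ax in auto)
  ultimately have "{F, face D k A, face D j A} \<subseteq> alternating_faces D d" by blast
  moreover have "card {F, face D k A, face D j A} = 3"
  proof -
    have "flip D k A \<in> face D j A" "flip D k A \<notin> face D k A"
      using ax D flip_nth_neq[OF D, of k] by (auto simp: face_def flip_nth)
    moreover have "A \<in> face D k A" "A \<in> face D j A" using D by simp_all
    ultimately have "F \<noteq> face D k A" "F \<noteq> face D j A" "face D k A \<noteq> face D j A" using AF(1) by blast+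
    then show ?thesis by simp
  qed
  moreover have "finite (alternating_faces D d)"
  proof (rule finite_subset)
    show "alternating_faces D d \<subseteq> Pow (nodes D)" using faces_sub unfolding alternating_faces_def by blast
  qed (simp add: finite_nodes)
  ultimately show ?thesis by (metis card_mono)
qed

text \<open>Outside \<open>d\<close> there are the three neighbours of \<open>A\<close> and the
  antipode of \<open>A\<close>, which is four of at most eight nodes.\<close>

lemma isolated_alternating_card:
  assumes D: "is_cuboid D" "A \<in> nodes D" and A: "A \<in> d" "\<And>i. flip D i A \<notin> d" "d \<subseteq> nodes D"
    and F: "F \<in> alternating_faces D (d - {A})"
  shows "card d \<le> 4"
proof -
  obtain i j k where ax: "j \<noteq> i" "k \<noteq> i" "k \<noteq> j"
    and d: "flip D j (flip D k (flip D i A)) \<notin> d"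
    by (rule isolated_alternating[OF D A(1,2) F])
  let ?X = "{flip D i A, flip D j A, flip D k A, flip D j (flip D k (flip D i A))}"
  have 1: "?X \<subseteq> nodes D - d" using A d D by auto
  have "flip D j (flip D k (flip D i A)) \<noteq> flip D l A" for l
  proof
    assume *: "flip D j (flip D k (flip D i A)) = flip D l A"
    obtain m where m: "m \<in> {i, j, k}" "m \<noteq> l" using ax by auto
    have "flip D j (flip D k (flip D i A)) $ m = flip D m A $ m" using m ax by (auto simp: flip_nth)
    moreover have "flip D l A $ m = A $ m" using m by (simp add: flip_nth)
    ultimately show False using * flip_nth_neq[OF D, of m] by metis
  qed
  note ne = this this[symmetric]
  have "card ?X = 4" using ax ax[symmetric] by (simp add: card_insert_if flip_inj[OF D] ne)
  then have "4 \<le> card (nodes D - d)" using card_mono[OF _ 1] finite_nodes by auto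
  moreover have "card (nodes D - d) = card (nodes D) - card d"
    by (rule card_Diff_subset[OF finite_subset[OF A(3) finite_nodes] A(3)])
  ultimately show ?thesis using card_nodes_le[OF D(1)] by linarith
qed

section \<open>Classes of edges with one disperse end point\<close>

text \<open>In contrast to \<open>lines_in\<close>, distinct iso-points are required instead of
  distinct edges; this drops the segments that degenerate to an iso-node.\<close>

definition cls :: "real \<Rightarrow> lcgraph \<Rightarrow> (pt \<times> pt) set \<Rightarrow> pt set set" where
  "cls c G K = {closed_segment (iso_pt c G a) (iso_pt c G b) | a b F. a \<in> K \<and> b \<in> K \<and>
     F \<in> faces (cub G) \<and> ends a \<subseteq> F \<and> ends b \<subseteq> F \<and> iso_pt c G a \<noteq> iso_pt c G b}"

lemma clsI:
  assumes "a \<in> K" "b \<in> K" "F \<in> faces (cub G)" "ends a \<subseteq> F" "ends b \<subseteq> F" "iso_pt c G a \<noteq> iso_pt c G b"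
  shows "closed_segment (iso_pt c G a) (iso_pt c G b) \<in> cls c G K"
  unfolding cls_def mem_Collect_eq
  by (rule exI[of _ a], rule exI[of _ b], rule exI[of _ F]) (use assms in simp)

lemma clsE:
  assumes "l \<in> cls c G K"
  obtains a b F where "l = closed_segment (iso_pt c G a) (iso_pt c G b)" "a \<in> K" "b \<in> K"
    "F \<in> faces (cub G)" "ends a \<subseteq> F" "ends b \<subseteq> F" "iso_pt c G a \<noteq> iso_pt c G b"
  using assms unfolding cls_def mem_Collect_eq by (elim exE conjE) (rule that)

lemma lines_inI:
  assumes "(P, Q) \<in> mixed c G" "(P', Q') \<in> mixed c G" "(P, Q) \<noteq> (P', Q')" "{P, Q, P', Q'} \<subseteq> H"
    "F \<in> faces (cub G)" "{P, Q, P', Q'} \<subseteq> F"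
  shows "closed_segment (iso_pt c G (P, Q)) (iso_pt c G (P', Q')) \<in> lines_in c G H"
  unfolding lines_in_def mem_Collect_eq
  by (rule exI[of _ P], rule exI[of _ Q], rule exI[of _ P'], rule exI[of _ Q'], rule exI[of _ F]) (intro conjI refl assms)

lemma lines_inE:
  assumes "l \<in> lines_in c G H"
  obtains P Q P' Q' F where "l = closed_segment (iso_pt c G (P, Q)) (iso_pt c G (P', Q'))"
    "(P, Q) \<in> mixed c G" "(P', Q') \<in> mixed c G" "(P, Q) \<noteq> (P', Q')" "{P, Q, P', Q'} \<subseteq> H"
    "F \<in> faces (cub G)" "{P, Q, P', Q'} \<subseteq> F"
  using assms unfolding lines_in_def mem_Collect_eq by (elim exE conjE) (rule that)

definition at_disp :: "real \<Rightarrow> lcgraph \<Rightarrow> pt set \<Rightarrow> (pt \<times> pt) set" where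
  "at_disp c G T = {(P, Q) \<in> mixed c G. Q \<in> T}"

definition at_cont :: "real \<Rightarrow> lcgraph \<Rightarrow> pt set \<Rightarrow> (pt \<times> pt) set" where
  "at_cont c G U = {(P, Q) \<in> mixed c G. P \<in> U}"

lemma cls_cong:
  assumes "cub G = cub G'" "\<And>a. a \<in> K \<Longrightarrow> iso_pt c G a = iso_pt c G' a"
  shows "cls c G K = cls c G' K"
proof -
  have "cls c G K \<subseteq> cls c G' K" if c: "cub G = cub G'" and i: "\<And>a. a \<in> K \<Longrightarrow> iso_pt c G a = iso_pt c G' a" for G G'
  proof
    fix l assume "l \<in> cls c G K"
    then obtain a b F where "l = closed_segment (iso_pt c G a) (iso_pt c G b)" "a \<in> K" "b \<in> K"
      "F \<in> faces (cub G)" "ends a \<subseteq> F" "ends b \<subseteq> F" "iso_pt c G a \<noteq> iso_pt c G b"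
      by (rule clsE)
    then show "l \<in> cls c G' K"
      using clsI[of a K b F G' c] by (simp add: c i)
  qed
  from this[of G G'] this[of G' G] assms show ?thesis by auto
qed

definition comp_closed :: "cuboid \<Rightarrow> pt set \<Rightarrow> pt set \<Rightarrow> bool" where
  "comp_closed D d T \<longleftrightarrow> T \<subseteq> d \<and> (\<forall>Q \<in> T. \<forall>Q' \<in> d. incident D Q Q' \<longrightarrow> Q' \<in> T)"

lemma mixed_iff:
  "(P, Q) \<in> mixed c G \<longleftrightarrow> incident (cub G) P Q \<and> P \<notin> disp c G \<and> Q \<in> disp c G"
  unfolding mixed_def by (auto simp: cont_iff dest: incident_nodes)

text \<open>The disperse nodes of a face that does not alternate are connected within the face, so
  they lie in the same component.\<close>

lemma mixed_face_same_disp: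
  assumes D: "is_cuboid (cub G)" and F: "F \<in> faces (cub G)" "F \<notin> L_faces c G"
    and T: "comp_closed (cub G) (disp c G) T"
    and m: "(P, A) \<in> mixed c G" "(P', A') \<in> mixed c G" "{P, A, P', A'} \<subseteq> F" and A: "A \<in> T"
  shows "A' \<in> T"
proof -
  note n = m(1,2)[unfolded mixed_iff]
  obtain B Q where q: "quad (cub G) F A P B Q"
    using quad_exists_edge[OF D F(1), of A P] m n by (auto simp: incident_sym)
  note qd = quadD[OF q]
  have cl: "Y \<in> T" if "X \<in> T" "Y \<in> disp c G" "incident (cub G) X Y" for X Y
    using T that by (auto simp: comp_closed_def)
  have "Q \<in> disp c G \<or> B \<notin> disp c G"
    using F(2) alternating_quad[OF q, of "disp c G"] n unfolding L_faces_eq[OF D] by blast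
  moreover have "A' = A \<or> A' = B \<or> A' = Q" using m(3) n qd(2) by auto
  ultimately show ?thesis using A n cl[of A Q] cl[of Q B] qd(11,15,16) by blast
qed

lemma mixed_face_same_cont:
  assumes D: "is_cuboid (cub G)" and F: "F \<in> faces (cub G)" "F \<notin> L_faces c G"
    and U: "comp_closed (cub G) (cont c G) U"
    and m: "(P, A) \<in> mixed c G" "(P', A') \<in> mixed c G" "{P, A, P', A'} \<subseteq> F" and P: "P \<in> U"
  shows "P' \<in> U"
proof -
  note n = m(1,2)[unfolded mixed_iff]
  obtain B Q where q: "quad (cub G) F A P B Q"
    using quad_exists_edge[OF D F(1), of A P] m n by (auto simp: incident_sym)
  note qd = quadD[OF q]
  have cl: "Y \<in> U" if "X \<in> U" "Y \<in> nodes (cub G)" "Y \<notin> disp c G" "incident (cub G) X Y" for X Y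
    using U that by (auto simp: comp_closed_def cont_iff)
  have "Q \<in> disp c G \<or> B \<notin> disp c G"
    using F(2) alternating_quad[OF q, of "disp c G"] n unfolding L_faces_eq[OF D] by blast
  moreover have "P' = P \<or> P' = B \<or> P' = Q" using m(3) n qd(2) by auto
  ultimately show ?thesis using P n cl[of P B] cl[of B Q] qd(10,11,23,24) by blast
qed

text \<open>On a singular face the only continuous node is the iso-node, so all iso-points of the
  face coincide with it.\<close>

lemma line_not_singular:
  assumes D: "is_cuboid (cub G)" and F: "F \<in> faces (cub G)" and m: "(P, Q) \<in> mixed c G" "(P', Q') \<in> mixed c G"
    "{P, Q, P', Q'} \<subseteq> F" and ne: "iso_pt c G (P, Q) \<noteq> iso_pt c G (P', Q')"
  shows "F \<notin> singular_faces c G"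
proof
  note n = mixedD[OF m(1)] mixedD[OF m(2)]
  assume "F \<in> singular_faces c G"
  then have c: "card (F \<inter> disp c G) = 3" "card (F \<inter> iso_nodes c G) = 1" by (auto simp: singular_faces_def)
  obtain A B Z where q: "quad (cub G) F P A B Z" using quad_ex[OF D F, of P] m by blast
  note qd = quadD[OF q]
  have "P \<notin> disp c G" using n(2) cont_disp by blast
  then have "F \<inter> disp c G \<subseteq> {A, B, Z}" using qd(2) by blast
  moreover have "card {A, B, Z} = 3" using qd by auto
  ultimately have d: "F \<inter> disp c G = {A, B, Z}" using c(1) by (intro card_subset_eq) auto
  have "P' \<in> F" "P' \<notin> disp c G" using m(3) n(11) cont_disp by auto
  then have "P' = P" using d qd(2) by auto
  obtain X where X: "X \<in> F" "X \<in> iso_nodes c G" using c(2) by (auto simp: card_1_singleton_iff)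
  then obtain R S where R: "X \<in> nodes (cub G)" "(R, S) \<in> mixed c G" "X = iso_pt c G (R, S)"
    by (auto simp: iso_nodes_def iso_points_def)
  have XR: "X = R" using fst_in_car_iso[OF D R(2)] car_node[OF R(1)] R(3) by auto
  then have "X \<notin> disp c G" using mixedD[OF R(2)] cont_disp by blast
  then have "X = P" using X(1) d qd(2) by auto
  have "\<not> lab G R < c"
  proof
    assume "lab G R < c"
    then have "car (cub G) X = {R, S}" unfolding R(3) by (rule car_iso_strict[OF D R(2)])
    then have "{R, S} = {X}" unfolding car_node[OF R(1)] by (rule sym)
    then have "S \<in> {X}" "R \<in> {X}" by blast+
    then show False using mixedD(8)[OF R(2)] by simp
  qed
  then have "lab G P = c" using XR \<open>X = P\<close> n by auto
  then show False using ne \<open>P' = P\<close> iso_level by metis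
qed

text \<open>The point is that no segment of a regular face degenerates. A degenerate one needs a
  node with label \<open>c\<close> whose two neighbours on the face are disperse; as there are no
  L-faces, the fourth node is disperse too, and the face is singular.\<close>

lemma C_lines_eq:
  assumes D: "is_cuboid (cub G)" and L: "L_faces c G = {}"
  shows "C_lines c G = cls c G (mixed c G)"
proof (intro equalityI subsetI)
  fix l assume "l \<in> C_lines c G"
  then obtain F where F: "F \<in> regular_faces c G" and lF: "l \<in> lines_in c G F"
    unfolding C_lines_def by blast
  from lF obtain P Q P' Q' where m: "(P, Q) \<in> mixed c G" "(P', Q') \<in> mixed c G"
    "(P, Q) \<noteq> (P', Q')" "{P, Q, P', Q'} \<subseteq> F"
    and l: "l = closed_segment (iso_pt c G (P, Q)) (iso_pt c G (P', Q'))"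
    by (rule lines_inE)
  have f: "F \<in> faces (cub G)" "F \<notin> singular_faces c G" using F by (auto simp: regular_faces_def)
  have "iso_pt c G (P, Q) \<noteq> iso_pt c G (P', Q')"
  proof
    assume "iso_pt c G (P, Q) = iso_pt c G (P', Q')"
    then have e: "P = P'" "lab G P = c" "Q \<noteq> Q'" using iso_eqD[OF D m(1,2)] m(3) by auto
    note n = mixedD[OF m(1)] mixedD[OF m(2)]
    obtain Z B where q: "quad (cub G) F P Q Z B"
      using quad_exists_edge[OF D f(1), of P Q] m n by auto
    note qd = quadD[OF q]
    have B: "B = Q'" using n(10) m(4) qd e n(17) by auto
    have "Z \<in> disp c G"
      using L alternating_quad[OF quad_rot[OF q], of "disp c G"] n B e cont_disp unfolding L_faces_eq[OF D] by blast
    then have d: "F \<inter> disp c G = {Q, Z, B}" using qd n B cont_disp by auto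
    have "F \<inter> iso_nodes c G = {P}"
    proof (intro equalityI subsetI)
      fix X assume "X \<in> F \<inter> iso_nodes c G"
      then obtain R S where R: "X \<in> F" "X \<in> nodes (cub G)" "(R, S) \<in> mixed c G" "X = iso_pt c G (R, S)"
        by (auto simp: iso_nodes_def iso_points_def)
      have "X = R" using fst_in_car_iso[OF D R(3)] car_node[OF R(2)] R(4) by auto
      then have "X \<notin> disp c G" using mixedD[OF R(3)] cont_disp by blast
      then show "X \<in> {P}" using d R(1) qd(2) by auto
    next
      fix X assume "X \<in> {P}"
      moreover have "iso_pt c G (P, Q) = P" using iso_level e(2) by simp
      ultimately show "X \<in> F \<inter> iso_nodes c G" using m(1) qd(2) n(6)
        by (force simp: iso_nodes_def iso_points_def)
    qed
    then have "F \<in> singular_faces c G" using f(1) d qd by (simp add: singular_faces_def)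
    with f(2) show False by simp
  qed
  then show "l \<in> cls c G (mixed c G)"
    unfolding l using m f(1) by (intro clsI[of _ _ _ F]) auto
next
  fix l assume "l \<in> cls c G (mixed c G)"
  then obtain P Q P' Q' F where F: "F \<in> faces (cub G)" and m: "(P, Q) \<in> mixed c G" "(P', Q') \<in> mixed c G"
    "{P, Q, P', Q'} \<subseteq> F" and ne: "iso_pt c G (P, Q) \<noteq> iso_pt c G (P', Q')"
    and l: "l = closed_segment (iso_pt c G (P, Q)) (iso_pt c G (P', Q'))"
    unfolding cls_def by auto
  note n = mixedD[OF m(1)] mixedD[OF m(2)]
  have ns: "F \<notin> singular_faces c G" by (rule line_not_singular[OF D F m ne])
  have reg: "F \<in> regular_faces c G"
  proof -
    have "P \<notin> disp c G" "Q \<notin> cont c G" using n(2,3) cont_disp by blast+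
    then show ?thesis using F L m(3) ns by (auto simp: regular_faces_def)
  qed
  show "l \<in> C_lines c G"
  proof -
    have "(P, Q) \<noteq> (P', Q')" using ne by auto
    then have "l \<in> lines_in c G F"
      unfolding l by (rule lines_inI[OF m(1,2) _ m(3) F m(3)])
    with reg show ?thesis unfolding C_lines_def by blast
  qed
qed

text \<open>Each iso-path is replaced by the class \<open>K\<close> of the mixed edges that it
  passes. The classes partition the mixed edges, and all mixed edges of a face that is no L-face are
  in one class. The final disjunction is the type of the rules: either \<open>K\<close> consists of
  the mixed edges with disperse end in \<open>S\<close> and has one disperse node on each L-face it
  meets (\<open>S1\<close>, \<open>S2\<close>, or no rule), or it is closed under changing the
  disperse end and has one continuous node on each such L-face (\<open>S3\<close>). The bound 5
  reflects that the rules use \<open>S3\<close> only for five or six disperse nodes; it later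
  excludes this type for a graph with four disperse nodes.\<close>

definition class_struct :: "real \<Rightarrow> lcgraph \<Rightarrow> (pt set set \<times> pt set) set \<Rightarrow> ((pt \<times> pt) set \<times> pt set) set \<Rightarrow> bool" where
  "class_struct c G W \<K> \<longleftrightarrow>
     W = (\<lambda>(K, S). (cls c G K, S)) ` \<K> \<and> \<Union> (fst ` \<K>) = mixed c G \<and>
     (\<forall>x \<in> \<K>. \<forall>y \<in> \<K>. x \<noteq> y \<longrightarrow> fst x \<inter> fst y = {}) \<and>
     (\<forall>(K, S) \<in> \<K>. \<forall>F \<in> faces (cub G). F \<notin> L_faces c G \<longrightarrow>
        (\<forall>P A P' A'. (P, A) \<in> K \<longrightarrow> (P', A') \<in> mixed c G \<longrightarrow> {P, A, P', A'} \<subseteq> F \<longrightarrow> (P', A') \<in> K)) \<and>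
     ((\<forall>(K, S) \<in> \<K>. (\<forall>P A. (P, A) \<in> mixed c G \<longrightarrow> A \<in> S \<longleftrightarrow> (P, A) \<in> K) \<and>
         (\<forall>F \<in> L_faces c G. \<forall>P A P' A'. (P, A) \<in> K \<longrightarrow> (P', A') \<in> K \<longrightarrow> {P, A, P', A'} \<subseteq> F \<longrightarrow> A = A')) \<or>
      5 \<le> card (disp c G) \<and>
      (\<forall>(K, S) \<in> \<K>. (\<forall>P A A'. (P, A) \<in> K \<longrightarrow> (P, A') \<in> mixed c G \<longrightarrow> (P, A') \<in> K) \<and>
         (\<forall>F \<in> L_faces c G. \<forall>P A P' A'. (P, A) \<in> K \<longrightarrow> (P', A') \<in> K \<longrightarrow> {P, A, P', A'} \<subseteq> F \<longrightarrow> P = P')))"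

section \<open>The $S$-rules\<close>

lemma cub_relabel [simp]: "cub (relabel X v G) = cub G"
  by (simp add: relabel_def)

lemma lab_relabel: "lab (relabel X v G) P = (if P \<in> X then v else lab G P)"
  by (simp add: relabel_def)

lemma relabel_empty [simp]: "relabel {} v G = G"
  by (simp add: relabel_def)

lemma relabel_relabel: "relabel X v (relabel Y v G) = relabel (X \<union> Y) v G"
  by (simp add: relabel_def fun_eq_iff)

lemma disp_relabel_cont: "v \<le> c \<Longrightarrow> disp c (relabel T v G) = disp c G - T"
  by (auto simp: disp_def lab_relabel)

lemma disp_relabel_disp: "c < v \<Longrightarrow> T \<subseteq> nodes (cub G) \<Longrightarrow> disp c (relabel T v G) = disp c G \<union> T"
  by (auto simp: disp_def lab_relabel)

lemma disp_sub: "disp c G \<subseteq> nodes (cub G)"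
  by (auto simp: disp_def)

lemma comp_closedD: "comp_closed D d T \<Longrightarrow> Q \<in> T \<Longrightarrow> Q' \<in> d \<Longrightarrow> incident D Q Q' \<Longrightarrow> Q' \<in> T"
  by (auto simp: comp_closed_def)

text \<open>Making a union of components continuous creates no mixed edge, because its neighbours
  outside were continuous already; only its own mixed edges disappear.\<close>

lemma mixed_relabel_cont:
  assumes "v \<le> c" "comp_closed (cub G) (disp c G) T"
  shows "mixed c (relabel T v G) = at_disp c G (disp c G - T)"
proof (intro set_eqI, clarify)
  fix P Q
  have "P \<notin> disp c G" if "incident (cub G) P Q" "P \<notin> disp c G - T" "Q \<in> disp c G - T"
    using that comp_closedD[OF assms(2), of P Q] assms(2) by (auto simp: comp_closed_def)
  then show "(P, Q) \<in> mixed c (relabel T v G) \<longleftrightarrow> (P, Q) \<in> at_disp c G (disp c G - T)"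
    by (auto simp: mixed_iff at_disp_def disp_relabel_cont[OF assms(1)])
qed

lemma iso_relabel: "P \<notin> T \<Longrightarrow> Q \<notin> T \<Longrightarrow> iso_pt c (relabel T v G) (P, Q) = iso_pt c G (P, Q)"
  by (simp add: iso_pt_def lab_relabel)

text \<open>Neither end of a surviving mixed edge lies in \<open>T\<close>, so its iso-point is not
  moved by the relabeling.\<close>

lemma cls_relabel_cont:
  assumes "v \<le> c" "comp_closed (cub G) (disp c G) T" "K \<subseteq> mixed c (relabel T v G)"
  shows "cls c (relabel T v G) K = cls c G K"
proof (rule cls_cong)
  fix a assume "a \<in> K"
  moreover obtain P Q where a: "a = (P, Q)" by (cases a)
  ultimately have "(P, Q) \<in> at_disp c G (disp c G - T)" using assms mixed_relabel_cont[OF assms(1,2)] by auto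
  then have "P \<notin> T" "Q \<notin> T" using assms(2) by (auto simp: at_disp_def mixed_iff comp_closed_def)
  then show "iso_pt c (relabel T v G) a = iso_pt c G a" unfolding a by (rule iso_relabel)
qed simp

text \<open>Common shape of the disperse nodes of an \<open>S1\<close>- or
  \<open>S2\<close>-subgraph: one node or one edge. Two members have no common neighbour, so no line
  degenerates, and an L-face contains at most one of them.\<close>

definition clique :: "cuboid \<Rightarrow> pt set \<Rightarrow> bool" where
  "clique D T \<longleftrightarrow> (\<forall>P \<in> T. \<forall>Q \<in> T. P = Q \<or> incident D P Q)"

text \<open>\<open>H\<close> contains all neighbours of \<open>T\<close>, so its mixed edges are
  those at \<open>T\<close>. Two of them with the same iso-point would share the continuous end and,
  by the clique property, form a triangle.\<close>

lemma lines_in_at_disp: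
  assumes D: "is_cuboid (cub G)" and H: "H \<inter> disp c G = T" "\<And>Q. Q \<in> T \<Longrightarrow> nbrs (cub G) Q \<subseteq> H" "clique (cub G) T"
  shows "lines_in c G H = cls c G (at_disp c G T)"
proof (intro equalityI subsetI)
  fix l assume "l \<in> lines_in c G H"
  then obtain P Q P' Q' F where m: "(P, Q) \<in> mixed c G" "(P', Q') \<in> mixed c G"
    "(P, Q) \<noteq> (P', Q')" "{P, Q, P', Q'} \<subseteq> H" and F: "F \<in> faces (cub G)" "{P, Q, P', Q'} \<subseteq> F"
    and l: "l = closed_segment (iso_pt c G (P, Q)) (iso_pt c G (P', Q'))"
    by (rule lines_inE)
  have T: "Q \<in> T" "Q' \<in> T" using m mixedD(3)[OF m(1)] mixedD(3)[OF m(2)] H(1) by auto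
  have "iso_pt c G (P, Q) \<noteq> iso_pt c G (P', Q')"
  proof
    assume "iso_pt c G (P, Q) = iso_pt c G (P', Q')"
    then have e: "P = P'" "Q \<noteq> Q'" using iso_eqD[OF D m(1,2)] m(3) by auto
    then have "incident (cub G) Q Q'" using H(3) T by (auto simp: clique_def)
    then show False using no_triangle[OF D, of P Q Q'] mixedD(1)[OF m(1)] mixedD(1)[OF m(2)] e by simp
  qed
  then show "l \<in> cls c G (at_disp c G T)"
    unfolding l using m F T by (intro clsI[of _ _ _ F]) (simp_all add: at_disp_def)
next
  fix l assume "l \<in> cls c G (at_disp c G T)"
  then obtain a b F where ab: "a \<in> at_disp c G T" "b \<in> at_disp c G T"
    "l = closed_segment (iso_pt c G a) (iso_pt c G b)"
    "F \<in> faces (cub G)" "ends a \<subseteq> F" "ends b \<subseteq> F" "iso_pt c G a \<noteq> iso_pt c G b"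
    by (rule clsE)
  obtain P Q P' Q' where e: "a = (P, Q)" "b = (P', Q')" by (cases a, cases b) simp
  have m: "(P, Q) \<in> mixed c G" "(P', Q') \<in> mixed c G" "Q \<in> T" "Q' \<in> T"
    using ab e by (auto simp: at_disp_def)
  have "P \<in> H" "P' \<in> H" using H(2)[OF m(3)] H(2)[OF m(4)] mixedD(9)[OF m(1)] mixedD(9)[OF m(2)]
    by (auto simp: in_nbrs)
  moreover have "Q \<in> H" "Q' \<in> H" using m H(1) by auto
  ultimately show "l \<in> lines_in c G H"
    unfolding ab(3) e using ab(4-7) m by (intro lines_inI[where F = F]) (auto simp: e)
qed

lemma S12_subgraph:
  assumes D: "is_cuboid (cub G)" and S: "S_subgraph c r G H" and r: "r \<noteq> S3"
  obtains T where "H \<inter> disp c G = T" "T \<noteq> {}" "S_relabel c r G H = relabel T 0 G"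
    "comp_closed (cub G) (disp c G) T" "clique (cub G) T" "lines_in c G H = cls c G (at_disp c G T)"
    "r = S1 \<longrightarrow> (\<exists>A \<in> nodes (cub G). T = {A} \<and> (\<forall>i. flip (cub G) i A \<notin> disp c G))"
    "r = S2 \<longrightarrow> (\<exists>A i. A \<in> nodes (cub G) \<and> T = {A, flip (cub G) i A} \<and>
       (\<forall>j. j \<noteq> i \<longrightarrow> flip (cub G) j A \<notin> disp c G \<and> flip (cub G) j (flip (cub G) i A) \<notin> disp c G))"
proof (cases r)
  case S1
  then obtain P where P: "P \<in> disp c G" "H = insert P (nbrs (cub G) P)" "nbrs (cub G) P \<subseteq> cont c G"
    using S by auto
  have nd: "Q \<notin> disp c G" if "incident (cub G) P Q" for Q
    using that P(3) cont_disp unfolding in_nbrs[symmetric] by blast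
  have T: "H \<inter> disp c G = {P}" using P nd by (auto simp: in_nbrs)
  have n: "P \<in> nodes (cub G)" using P(1) disp_sub by blast
  show ?thesis
  proof (rule that[OF T])
    show "S_relabel c r G H = relabel {P} 0 G" using T S1 by simp
    show "comp_closed (cub G) (disp c G) {P}" using P(1) nd by (auto simp: comp_closed_def)
    show "clique (cub G) {P}" by (simp add: clique_def)
    then show "lines_in c G H = cls c G (at_disp c G {P})"
      by (intro lines_in_at_disp D T) (use P in auto)
    have "\<exists>A \<in> nodes (cub G). {P} = {A} \<and> (\<forall>i. flip (cub G) i A \<notin> disp c G)"
      using n nd D by (auto simp: incident_iff)
    then show "r = S1 \<longrightarrow> (\<exists>A \<in> nodes (cub G). {P} = {A} \<and> (\<forall>i. flip (cub G) i A \<notin> disp c G))" by simp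
  qed (use S1 in auto)
next
  case S2
  then obtain P Q where P: "P \<in> disp c G" "Q \<in> disp c G" "incident (cub G) P Q"
    "H = nbrs (cub G) P \<union> nbrs (cub G) Q" "H - {P, Q} \<subseteq> cont c G"
    using S by auto
  have nd: "X \<notin> disp c G" if "incident (cub G) P X \<or> incident (cub G) Q X" "X \<noteq> P" "X \<noteq> Q" for X
    using that P(4,5) cont_disp unfolding in_nbrs[symmetric] by blast
  have "Q \<in> nbrs (cub G) P" "P \<in> nbrs (cub G) Q" using P(3) by (auto simp: in_nbrs incident_sym)
  then have T: "H \<inter> disp c G = {P, Q}" using P(1,2,4,5) cont_disp by blast
  have n: "P \<in> nodes (cub G)" "Q \<in> nodes (cub G)" using P(1,2) disp_sub by blast+
  obtain i where i: "Q = flip (cub G) i P" using P(3) D by (auto simp: incident_iff)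
  show ?thesis
  proof (rule that[OF T])
    show "S_relabel c r G H = relabel {P, Q} 0 G" using T S2 by simp
    show "comp_closed (cub G) (disp c G) {P, Q}" using P(1,2) nd by (auto simp: comp_closed_def)
    show "clique (cub G) {P, Q}" using P(3) by (auto simp: clique_def incident_sym)
    then show "lines_in c G H = cls c G (at_disp c G {P, Q})"
      by (intro lines_in_at_disp D T) (use P in auto)
    have "flip (cub G) j P \<notin> disp c G \<and> flip (cub G) j Q \<notin> disp c G" if "j \<noteq> i" for j
    proof -
      have a: "incident (cub G) P (flip (cub G) j P)" "incident (cub G) Q (flip (cub G) j Q)"
        using n D by (auto simp: incident_iff)
      have b: "flip (cub G) j P \<noteq> Q" "flip (cub G) j Q \<noteq> P"
        using that flip_inj[OF D n(1)] flip_inj[OF D n(2), of j i] unfolding i by auto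
      show ?thesis using nd a b incident_neq by metis
    qed
    then show "r = S2 \<longrightarrow> (\<exists>A i. A \<in> nodes (cub G) \<and> {P, Q} = {A, flip (cub G) i A} \<and>
       (\<forall>j. j \<noteq> i \<longrightarrow> flip (cub G) j A \<notin> disp c G \<and> flip (cub G) j (flip (cub G) i A) \<notin> disp c G))"
      using n(1) i by blast
  qed (use S2 in auto)
qed (use r in simp)

definition disp_part :: "real \<Rightarrow> lcgraph \<Rightarrow> pt set set \<Rightarrow> bool" where
  "disp_part c G \<T> \<longleftrightarrow> (\<forall>T \<in> \<T>. comp_closed (cub G) (disp c G) T) \<and>
     (\<forall>T \<in> \<T>. \<forall>T' \<in> \<T>. T \<noteq> T' \<longrightarrow> T \<inter> T' = {})"

lemma disp_part_insert:
  assumes "\<And>T'. T' \<in> \<T> \<Longrightarrow> comp_closed (cub G) (disp c G) T'"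
    and "\<And>T' T''. T' \<in> \<T> \<Longrightarrow> T'' \<in> \<T> \<Longrightarrow> T' \<noteq> T'' \<Longrightarrow> T' \<inter> T'' = {}"
    and "comp_closed (cub G) (disp c G) T" "\<And>T'. T' \<in> \<T> \<Longrightarrow> T \<inter> T' = {}"
  shows "disp_part c G (insert T \<T>)"
  unfolding disp_part_def
proof (intro conjI ballI impI)
  fix X assume "X \<in> insert T \<T>"
  then show "comp_closed (cub G) (disp c G) X" using assms(1,3) by blast
next
  fix X Y assume "X \<in> insert T \<T>" "Y \<in> insert T \<T>" "X \<noteq> Y"
  then show "X \<inter> Y = {}" using assms(2,4) by (elim insertE) (auto simp: Int_commute)
qed

lemma comp_closed_relabel:
  assumes "v \<le> c" "comp_closed (cub G) (disp c G) T" "comp_closed (cub G) (disp c (relabel T v G)) T'"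
  shows "comp_closed (cub G) (disp c G) T'"
proof -
  have d: "disp c (relabel T v G) = disp c G - T" by (rule disp_relabel_cont[OF assms(1)])
  have s: "T' \<subseteq> disp c G - T" using assms(3) d by (simp add: comp_closed_def)
  have "Q' \<in> T'" if Q: "Q \<in> T'" "Q' \<in> disp c G" "incident (cub G) Q Q'" for Q Q'
  proof (cases "Q' \<in> T")
    case True
    have "Q \<in> T" using comp_closedD[OF assms(2) True, of Q] Q s by (auto simp: incident_sym)
    with s Q show ?thesis by blast
  next
    case False
    then show ?thesis using comp_closedD[OF assms(3) Q(1), of Q'] Q d by simp
  qed
  then show ?thesis using s by (auto simp: comp_closed_def)
qed

text \<open>Induction on the run: a component of the relabeled graph is one of the original graph,
  and its iso-points have not moved. The count for \<open>S1\<close> holds because each application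
  removes a single disperse node.\<close>

lemma S12_rules:
  assumes "S_rules c r n G R G'" "r \<noteq> S3" "is_cuboid (cub G)" "0 < c"
  shows "\<exists>\<T>. R = (\<lambda>T. (cls c G (at_disp c G T), T)) ` \<T> \<and> disp_part c G \<T> \<and> (\<forall>T \<in> \<T>. clique (cub G) T) \<and>
    G' = relabel (\<Union>\<T>) 0 G \<and> (r = S1 \<longrightarrow> card (disp c G') + n = card (disp c G))"
  using assms
proof (induction rule: S_rules.induct)
  case (1 r G)
  show ?case by (rule exI[of _ "{}"]) (simp add: disp_part_def)
next
  case (2 r G H n R G')
  note D = 2(5)
  obtain T where T: "H \<inter> disp c G = T" "T \<noteq> {}" "S_relabel c r G H = relabel T 0 G"
    "comp_closed (cub G) (disp c G) T" "clique (cub G) T" "lines_in c G H = cls c G (at_disp c G T)"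
    "r = S1 \<longrightarrow> (\<exists>A \<in> nodes (cub G). T = {A} \<and> (\<forall>i. flip (cub G) i A \<notin> disp c G))"
    by (rule S12_subgraph[OF D 2(1,4)])
  let ?G1 = "relabel T 0 G"
  have v: "0 \<le> c" using 2(6) by simp
  have d1: "disp c ?G1 = disp c G - T" by (rule disp_relabel_cont[OF v])
  have Ts: "T \<subseteq> disp c G" using T(1) by blast
  obtain \<T> where IH: "R = (\<lambda>T'. (cls c ?G1 (at_disp c ?G1 T'), T')) ` \<T>" "disp_part c ?G1 \<T>"
    "\<forall>T' \<in> \<T>. clique (cub G) T'" "G' = relabel (\<Union>\<T>) 0 ?G1" "r = S1 \<longrightarrow> card (disp c G') + n = card (disp c ?G1)"
    using 2(3) 2(4,6) D unfolding T(3) by auto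
  have sub: "T' \<subseteq> disp c G - T" if "T' \<in> \<T>" for T' using IH(2) that d1 by (auto simp: disp_part_def comp_closed_def)
  have "cls c ?G1 (at_disp c ?G1 T') = cls c G (at_disp c G T')" if "T' \<in> \<T>" for T'
  proof -
    have e: "at_disp c ?G1 T' = at_disp c G T'"
      using sub[OF that] unfolding at_disp_def[of _ ?G1] mixed_relabel_cont[OF v T(4)] by (auto simp: at_disp_def)
    have "cls c ?G1 (at_disp c ?G1 T') = cls c G (at_disp c ?G1 T')"
      by (rule cls_relabel_cont[OF v T(4)]) (auto simp: at_disp_def)
    then show ?thesis by (simp add: e)
  qed
  then have "insert (lines_in c G H, H \<inter> disp c G) R = (\<lambda>T. (cls c G (at_disp c G T), T)) ` insert T \<T>"
    unfolding IH(1) T(1) T(6) by simp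
  moreover have "disp_part c G (insert T \<T>)"
  proof -
    have dj: "T \<inter> T' = {}" if "T' \<in> \<T>" for T' using sub[OF that] by blast
    show ?thesis
    proof (rule disp_part_insert[OF _ _ T(4) dj])
      fix T' assume "T' \<in> \<T>"
      then have "comp_closed (cub ?G1) (disp c ?G1) T'" using IH(2) unfolding disp_part_def by blast
      then show "comp_closed (cub G) (disp c G) T'" by (intro comp_closed_relabel[OF v T(4)]) simp
    qed (use IH(2) in \<open>auto simp: disp_part_def\<close>)
  qed
  moreover have "G' = relabel (\<Union>(insert T \<T>)) 0 G" unfolding IH(4) relabel_relabel by (simp add: Un_commute)
  moreover have "r = S1 \<longrightarrow> card (disp c G') + Suc n = card (disp c G)"
  proof
    assume r: "r = S1"
    then obtain A where A: "T = {A}" using T(7) by blast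
    have "A \<in> disp c G" using A Ts by simp
    then have "card (disp c G) = Suc (card (disp c ?G1))"
      using card_Suc_Diff1[OF finite_subset[OF disp_sub finite_nodes], of A c G] d1 A by simp
    then show "card (disp c G') + Suc n = card (disp c G)" using IH(5) r by simp
  qed
  moreover have "\<forall>T' \<in> insert T \<T>. clique (cub G) T'" using IH(3) T(5) by simp
  ultimately show ?case by (intro exI[of _ "insert T \<T>"] conjI)
qed

lemma comp_closed_Union: "disp_part c G \<T> \<Longrightarrow> comp_closed (cub G) (disp c G) (\<Union>\<T>)"
proof -
  assume p: "disp_part c G \<T>"
  then have T: "comp_closed (cub G) (disp c G) T" if "T \<in> \<T>" for T using that by (simp add: disp_part_def)
  show ?thesis
    unfolding comp_closed_def
  proof (intro conjI ballI impI)
    show "\<Union>\<T> \<subseteq> disp c G" using T by (auto simp: comp_closed_def)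
    fix Q Q' assume "Q \<in> \<Union>\<T>" "Q' \<in> disp c G" "incident (cub G) Q Q'"
    then show "Q' \<in> \<Union>\<T>" using comp_closedD[OF T] by (meson UnionE UnionI)
  qed
qed

lemma class_struct_disp:
  assumes D: "is_cuboid (cub G)" and p: "disp_part c G \<T>" "\<Union>\<T> = disp c G"
    and L: "\<And>T F A B. T \<in> \<T> \<Longrightarrow> F \<in> L_faces c G \<Longrightarrow> A \<in> T \<Longrightarrow> B \<in> T \<Longrightarrow> A \<in> F \<Longrightarrow> B \<in> F \<Longrightarrow> A = B"
  shows "class_struct c G ((\<lambda>T. (cls c G (at_disp c G T), T)) ` \<T>) ((\<lambda>T. (at_disp c G T, T)) ` \<T>)"
  unfolding class_struct_def
proof (intro conjI disjI1)
  show "(\<lambda>T. (cls c G (at_disp c G T), T)) ` \<T> = (\<lambda>(K, S). (cls c G K, S)) ` (\<lambda>T. (at_disp c G T, T)) ` \<T>"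
    by (simp add: image_image)
  show "\<Union> (fst ` (\<lambda>T. (at_disp c G T, T)) ` \<T>) = mixed c G"
  proof (intro set_eqI, clarify)
    fix P Q show "(P, Q) \<in> \<Union> (fst ` (\<lambda>T. (at_disp c G T, T)) ` \<T>) \<longleftrightarrow> (P, Q) \<in> mixed c G"
      using p(2) mixedD(3)[of P Q c G] by (auto simp: at_disp_def)
  qed
  have dj: "A \<inter> B = {}" if "A \<in> \<T>" "B \<in> \<T>" "A \<noteq> B" for A B
    using p(1) that by (auto simp: disp_part_def)
  show "\<forall>x\<in>(\<lambda>T. (at_disp c G T, T)) ` \<T>. \<forall>y\<in>(\<lambda>T. (at_disp c G T, T)) ` \<T>. x \<noteq> y \<longrightarrow> fst x \<inter> fst y = {}"
  proof (intro ballI impI)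
    fix x y assume xy: "x \<in> (\<lambda>T. (at_disp c G T, T)) ` \<T>" "y \<in> (\<lambda>T. (at_disp c G T, T)) ` \<T>" "x \<noteq> y"
    then obtain A B where "A \<in> \<T>" "B \<in> \<T>" "x = (at_disp c G A, A)" "y = (at_disp c G B, B)" by blast
    with dj[of A B] xy(3) show "fst x \<inter> fst y = {}" by (auto simp: at_disp_def)
  qed
  show "\<forall>(K, S)\<in>(\<lambda>T. (at_disp c G T, T)) ` \<T>. \<forall>F\<in>faces (cub G). F \<notin> L_faces c G \<longrightarrow>
     (\<forall>P A P' A'. (P, A) \<in> K \<longrightarrow> (P', A') \<in> mixed c G \<longrightarrow> {P, A, P', A'} \<subseteq> F \<longrightarrow> (P', A') \<in> K)"
  proof clarsimp
    fix T F P A P' A'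
    assume "T \<in> \<T>" "F \<in> faces (cub G)" "F \<notin> L_faces c G" "(P, A) \<in> at_disp c G T" "(P', A') \<in> mixed c G"
      "P \<in> F" "A \<in> F" "P' \<in> F" "A' \<in> F"
    moreover have "comp_closed (cub G) (disp c G) T" using p(1) \<open>T \<in> \<T>\<close> by (simp add: disp_part_def)
    ultimately show "(P', A') \<in> at_disp c G T"
      using mixed_face_same_disp[OF D, of F c T P A P' A'] by (simp add: at_disp_def)
  qed
  show "\<forall>(K, S)\<in>(\<lambda>T. (at_disp c G T, T)) ` \<T>. (\<forall>P A. (P, A) \<in> mixed c G \<longrightarrow> A \<in> S \<longleftrightarrow> (P, A) \<in> K) \<and>
         (\<forall>F \<in> L_faces c G. \<forall>P A P' A'. (P, A) \<in> K \<longrightarrow> (P', A') \<in> K \<longrightarrow> {P, A, P', A'} \<subseteq> F \<longrightarrow> A = A')"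
    using L by (auto simp: at_disp_def)
qed

text \<open>The disperse nodes that remain after the run form one more class. Two nodes of one class
  on an L-face would be opposite there: a clique forbids this, and for the remaining nodes the face
  would still be an L-face of \<open>G'\<close>.\<close>

lemma class_struct_S12:
  assumes D: "is_cuboid (cub G)" and r: "S_rules c r n G R G'" "r \<noteq> S3" "0 < c" and L: "L_faces c G' = {}"
  shows "\<exists>\<K>. class_struct c G (insert (C_lines c G', disp c G') R) \<K>"
proof -
  obtain \<T> where T: "R = (\<lambda>T. (cls c G (at_disp c G T), T)) ` \<T>" "disp_part c G \<T>" "\<forall>T \<in> \<T>. clique (cub G) T"
    "G' = relabel (\<Union>\<T>) 0 G"
    using S12_rules[OF r(1,2) D r(3)] by blast
  have v: "0 \<le> c" using r(3) by simp
  note cl = comp_closed_Union[OF T(2)]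
  have d: "disp c G' = disp c G - \<Union>\<T>" unfolding T(4) by (rule disp_relabel_cont[OF v])
  have m: "mixed c G' = at_disp c G (disp c G')"
    using mixed_relabel_cont[OF v cl] by (simp only: T(4)[symmetric] d)
  have D': "is_cuboid (cub G')" using D T(4) by simp
  have "C_lines c G' = cls c G (at_disp c G (disp c G'))"
    unfolding C_lines_eq[OF D' L] m[symmetric] unfolding T(4) by (rule cls_relabel_cont[OF v cl]) simp
  then have W: "insert (C_lines c G', disp c G') R = (\<lambda>T. (cls c G (at_disp c G T), T)) ` insert (disp c G') \<T>"
    unfolding T(1) by simp
  have sub: "T \<subseteq> disp c G" if "T \<in> \<T>" for T using T(2) that by (auto simp: disp_part_def comp_closed_def)
  have part: "disp_part c G (insert (disp c G') \<T>)"
  proof -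
    have cc: "comp_closed (cub G) (disp c G) (disp c G')"
      unfolding comp_closed_def
    proof (intro conjI ballI impI)
      show "disp c G' \<subseteq> disp c G" using d by simp
      fix Q Q' assume a: "Q \<in> disp c G'" "Q' \<in> disp c G" "incident (cub G) Q Q'"
      have "Q' \<notin> \<Union>\<T>"
      proof
        assume "Q' \<in> \<Union>\<T>"
        then have "Q \<in> \<Union>\<T>" by (rule comp_closedD[OF cl]) (use a d in \<open>simp_all add: incident_sym\<close>)
        with a(1) d show False by simp
      qed
      with a(2) d show "Q' \<in> disp c G'" by simp
    qed
    have dj: "disp c G' \<inter> T = {}" if "T \<in> \<T>" for T using that d by blast
    show ?thesis by (rule disp_part_insert[OF _ _ cc dj]) (use T(2) in \<open>auto simp: disp_part_def\<close>)
  qed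
  have "class_struct c G ((\<lambda>T. (cls c G (at_disp c G T), T)) ` insert (disp c G') \<T>)
     ((\<lambda>T. (at_disp c G T, T)) ` insert (disp c G') \<T>)"
  proof (rule class_struct_disp[OF D part])
    show "\<Union>(insert (disp c G') \<T>) = disp c G" using sub d by blast
    fix T F A B assume a: "T \<in> insert (disp c G') \<T>" "F \<in> L_faces c G" "A \<in> T" "B \<in> T" "A \<in> F" "B \<in> F"
    have s: "A \<in> disp c G" "B \<in> disp c G" using a sub d by auto
    have F: "F \<in> alternating_faces (cub G) (disp c G)" using a(2) L_faces_eq[OF D] by blast
    show "A = B"
    proof (rule ccontr)
      assume ne: "A \<noteq> B"
      obtain P B' Q where q: "quad (cub G) F A P B' Q" "B' \<in> disp c G" "P \<notin> disp c G" "Q \<notin> disp c G"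
        by (rule alternating_quadE_at[OF D F a(5) s(1)])
      have "B = A \<or> B = P \<or> B = B' \<or> B = Q" using quadD(2)[OF q(1)] a(6) by simp
      then have B: "B' = B" using q(3,4) ne s(2) by auto
      show False
      proof (cases "T = disp c G'")
        case True
        have "F \<in> alternating_faces (cub G) (disp c G')"
          by (rule alternating_quad[OF q(1)]) (use True a B q d in auto)
        then show False using L L_faces_eq[OF D'] T(4) by auto
      next
        case False
        then have "clique (cub G) T" using T(3) a(1) by blast
        then have "incident (cub G) A B" using a ne by (auto simp: clique_def)
        then show False using quadD(17)[OF q(1)] B by simp
      qed
    qed
  qed
  then show ?thesis unfolding W by blast
qed

lemma S_rules_one:
  assumes "S_rules c r 1 G R G'"
  obtains H where "S_subgraph c r G H" "R = {(lines_in c G H, H \<inter> disp c G)}" "G' = S_relabel c r G H"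
proof -
  from assms show ?thesis
  proof (cases rule: S_rules.cases)
    case (2 H n R')
    have "n = 0" using 2 by simp
    with 2(4) have "S_rules c r 0 (S_relabel c r G H) R' G'" by simp
    then have "R' = {}" "G' = S_relabel c r G H" by (auto elim: S_rules.cases)
    with 2 that show ?thesis by blast
  qed simp
qed

text \<open>Dual situation with just two classes: the mixed edges at the isolated continuous node
  \<open>P0\<close>, and all others. The label of \<open>P0\<close> is strictly below
  \<open>c\<close>, so the three iso-points at \<open>P0\<close> are distinct.\<close>

lemma class_struct_S3:
  assumes D: "is_cuboid (cub G)" and r: "S_rules c S3 1 G R G'" "c < 1"
    and L: "L_faces c G' = {}" and card: "5 \<le> card (disp c G)"
  shows "\<exists>\<K>. class_struct c G (insert (C_lines c G', disp c G') R) \<K>"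
proof -
  obtain H where H: "S_subgraph c S3 G H" "R = {(lines_in c G H, H \<inter> disp c G)}" "G' = S_relabel c S3 G H"
    by (rule S_rules_one[OF r(1)])
  from H(1) obtain P0 where P0: "P0 \<in> nodes (cub G)" "lab G P0 < c" "H = insert P0 (nbrs (cub G) P0)"
    "nbrs (cub G) P0 \<subseteq> disp c G" by auto
  have c0: "P0 \<notin> disp c G" using P0(2) by (simp add: disp_def)
  have nd: "Q \<in> disp c G" if "incident (cub G) P0 Q" for Q using that P0(4) by (auto simp: in_nbrs)
  have Hc: "H \<inter> cont c G = {P0}" using P0 c0 cont_disp by (auto simp: cont_iff)
  then have G': "G' = relabel {P0} 1 G" using H(3) by simp
  have d: "disp c G' = insert P0 (disp c G)"
    unfolding G' using disp_relabel_disp[OF r(2), of "{P0}" G] P0(1) by simp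
  have cb: "cub G' = cub G" using G' by simp
  have m': "(P, Q) \<in> mixed c G' \<longleftrightarrow> (P, Q) \<in> mixed c G \<and> P \<noteq> P0" for P Q
    unfolding mixed_iff d cb using nd[of P] c0 incident_sym[of "cub G" P P0] by (cases "Q = P0") auto
  let ?U = "cont c G - {P0}"
  let ?\<K> = "{(at_cont c G {P0}, H \<inter> disp c G), (at_cont c G ?U, disp c G')}"
  have ac: "(P, Q) \<in> at_cont c G {P0} \<longleftrightarrow> (P, Q) \<in> mixed c G \<and> P = P0"
    "(P, Q) \<in> at_cont c G ?U \<longleftrightarrow> (P, Q) \<in> mixed c G \<and> P \<noteq> P0" for P Q
    using mixedD(2)[of P Q c G] by (auto simp: at_cont_def)
  have l1: "lines_in c G H = cls c G (at_cont c G {P0})"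
  proof (intro equalityI subsetI)
    fix l assume "l \<in> lines_in c G H"
    then obtain P Q P' Q' F where m: "l = closed_segment (iso_pt c G (P, Q)) (iso_pt c G (P', Q'))"
        "(P, Q) \<in> mixed c G" "(P', Q') \<in> mixed c G" "(P, Q) \<noteq> (P', Q')" "{P, Q, P', Q'} \<subseteq> H"
      and F: "F \<in> faces (cub G)" "{P, Q, P', Q'} \<subseteq> F"
      by (rule lines_inE)
    have "P \<in> H \<inter> cont c G" "P' \<in> H \<inter> cont c G" using m(5) mixedD(2)[OF m(2)] mixedD(2)[OF m(3)] by auto
    then have e: "P = P0" "P' = P0" using Hc by auto
    have "iso_pt c G (P, Q) \<noteq> iso_pt c G (P', Q')" using iso_eqD[OF D m(2,3)] m(4) e P0(2) by auto
    then show "l \<in> cls c G (at_cont c G {P0})"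
      unfolding m(1) using m F e by (intro clsI[where F = F]) (simp_all add: ac)
  next
    fix l assume "l \<in> cls c G (at_cont c G {P0})"
    then obtain a b F where ab: "l = closed_segment (iso_pt c G a) (iso_pt c G b)"
      "a \<in> at_cont c G {P0}" "b \<in> at_cont c G {P0}"
      "F \<in> faces (cub G)" "ends a \<subseteq> F" "ends b \<subseteq> F" "iso_pt c G a \<noteq> iso_pt c G b"
      by (rule clsE)
    obtain P Q P' Q' where e: "a = (P, Q)" "b = (P', Q')" by (cases a, cases b) simp
    have m: "(P, Q) \<in> mixed c G" "(P', Q') \<in> mixed c G" "P = P0" "P' = P0" using ab e by (auto simp: ac)
    have "Q \<in> H" "Q' \<in> H" using mixedD(1)[OF m(1)] mixedD(1)[OF m(2)] m(3,4) P0(3) by (auto simp: in_nbrs)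
    then show "l \<in> lines_in c G H"
      unfolding ab(1) e using ab(4-7) m P0(3) by (intro lines_inI[where F = F]) (auto simp: e)
  qed
  have D': "is_cuboid (cub G')" using D G' by simp
  have mc: "mixed c G' = at_cont c G ?U" using m' ac by (intro set_eqI) auto
  have l2: "C_lines c G' = cls c G (at_cont c G ?U)"
    unfolding C_lines_eq[OF D' L] mc
  proof (rule cls_cong)
    fix a assume "a \<in> at_cont c G ?U"
    then obtain P Q where "a = (P, Q)" "(P, Q) \<in> mixed c G" "P \<noteq> P0" using ac by (cases a) auto
    then show "iso_pt c G' a = iso_pt c G a"
      unfolding G' using iso_relabel[of P "{P0}" Q] mixedD(3)[of P Q c G] c0 by auto
  qed (simp add: G')
  have cl: "comp_closed (cub G) (cont c G) {P0}"
    unfolding comp_closed_def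
  proof (intro conjI ballI impI)
    show "{P0} \<subseteq> cont c G" using Hc by auto
    fix Q Q' assume "Q \<in> {P0}" "Q' \<in> cont c G" "incident (cub G) Q Q'"
    then show "Q' \<in> {P0}" using nd[of Q'] cont_disp[of Q' c G] by simp
  qed
  have cl': "comp_closed (cub G) (cont c G) ?U"
    unfolding comp_closed_def
  proof (intro conjI ballI impI)
    fix Q Q' assume a: "Q \<in> ?U" "Q' \<in> cont c G" "incident (cub G) Q Q'"
    then have "Q' \<noteq> P0" using nd[of Q] cont_disp by (auto simp: incident_sym)
    with a show "Q' \<in> ?U" by simp
  qed simp
  have "class_struct c G (insert (C_lines c G', disp c G') R) ?\<K>"
    unfolding class_struct_def
  proof (intro conjI disjI2 card)
    show "insert (C_lines c G', disp c G') R = (\<lambda>(K, S). (cls c G K, S)) ` ?\<K>"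
      unfolding H(2) l1 l2 by auto
    show "\<Union> (fst ` ?\<K>) = mixed c G" using ac by auto
    show "\<forall>x\<in>?\<K>. \<forall>y\<in>?\<K>. x \<noteq> y \<longrightarrow> fst x \<inter> fst y = {}" using ac by auto
    show "\<forall>(K, S)\<in>?\<K>. \<forall>F\<in>faces (cub G). F \<notin> L_faces c G \<longrightarrow>
     (\<forall>P A P' A'. (P, A) \<in> K \<longrightarrow> (P', A') \<in> mixed c G \<longrightarrow> {P, A, P', A'} \<subseteq> F \<longrightarrow> (P', A') \<in> K)"
    proof -
      have "(P', A') \<in> at_cont c G U" if U: "comp_closed (cub G) (cont c G) U"
        and "F \<in> faces (cub G)" "F \<notin> L_faces c G" "(P, A) \<in> at_cont c G U" "(P', A') \<in> mixed c G"
        "{P, A, P', A'} \<subseteq> F" for U F P A P' A'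
        using that mixed_face_same_cont[OF D that(2,3) U, of P A P' A'] by (simp add: at_cont_def)
      from this[OF cl] this[OF cl'] show ?thesis by auto
    qed
    show "\<forall>(K, S) \<in> ?\<K>. (\<forall>P A A'. (P, A) \<in> K \<longrightarrow> (P, A') \<in> mixed c G \<longrightarrow> (P, A') \<in> K) \<and>
       (\<forall>F \<in> L_faces c G. \<forall>P A P' A'. (P, A) \<in> K \<longrightarrow> (P', A') \<in> K \<longrightarrow> {P, A, P', A'} \<subseteq> F \<longrightarrow> P = P')"
    proof -
      have "P = P'" if F: "F \<in> L_faces c G" and m: "(P, A) \<in> mixed c G" "(P', A') \<in> mixed c G" "P \<noteq> P0" "P' \<noteq> P0"
        "{P, A, P', A'} \<subseteq> F" for F P A P' A'
      \<comment> \<open>Two continuous nodes of the remaining class on \<open>F\<close> would be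
        opposite, and \<open>F\<close> would stay an L-face after the relabeling of
        \<open>P0\<close>.\<close>
      proof (rule ccontr)
        assume ne: "P \<noteq> P'"
        have F': "F \<in> alternating_faces (cub G) (- disp c G)"
          using F unfolding L_faces_eq[OF D] alternating_compl .
        have PF: "P \<in> F" "P \<in> - disp c G" "P' \<in> F" "P' \<in> - disp c G"
          using m mixedD(2)[OF m(1)] mixedD(2)[OF m(2)] cont_disp by auto
        obtain X B Y where q: "quad (cub G) F P X B Y" "B \<in> - disp c G" "X \<notin> - disp c G" "Y \<notin> - disp c G"
          by (rule alternating_quadE_at[OF D F' PF(1,2)])
        have "P' = P \<or> P' = X \<or> P' = B \<or> P' = Y" using quadD(2)[OF q(1)] PF(3) by simp
        then have B: "P' = B" using q(3,4) PF(4) ne by auto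
        have "F \<in> alternating_faces (cub G') (- disp c G')"
          by (subst G', simp, rule alternating_quad[OF q(1)])
            (use q(2-4) d PF m(3,4) B in auto)
        then have "F \<in> L_faces c G'" unfolding L_faces_eq[OF D'] alternating_compl .
        then show False using L by simp
      qed
      then show ?thesis by (auto simp: ac)
    qed
  qed
  then show ?thesis by blast
qed

section \<open>After the \<open>S\<close>-rules no L-face is left\<close>

lemma alternating_two:
  assumes D: "is_cuboid D" and F: "F \<in> alternating_faces D d"
  obtains A B where "A \<in> d" "B \<in> d" "A \<in> nodes D" "B \<in> nodes D" "A \<noteq> B" "\<not> incident D A B"
proof -
  obtain A P B Q where q: "quad D F A P B Q" "A \<in> d" "B \<in> d" "P \<notin> d" "Q \<notin> d"
    by (rule alternating_quadE[OF D F])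
  show ?thesis by (rule that[OF q(2,3)]) (use quadD[OF q(1)] in simp_all)
qed

lemma L_faces_card_disp:
  assumes D: "is_cuboid (cub G)" and "card (disp c G) \<le> 1"
  shows "L_faces c G = {}"
proof (rule ccontr)
  assume "L_faces c G \<noteq> {}"
  then obtain F where F: "F \<in> alternating_faces (cub G) (disp c G)" unfolding L_faces_eq[OF D] by blast
  obtain A B where AB: "A \<in> disp c G" "B \<in> disp c G" "A \<noteq> B" by (rule alternating_two[OF D F])
  have "card {A, B} \<le> card (disp c G)"
    by (rule card_mono) (use AB finite_subset[OF disp_sub finite_nodes] in auto)
  then show False using AB(3) assms(2) by simp
qed

text \<open>A remaining L-face would avoid the removed isolated node, which forces at least three
  original L-faces and at most four disperse nodes.\<close>

lemma residual_S1:
  assumes D: "is_cuboid (cub G)" and S: "S_rules c S1 1 G R G'" "0 < c"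
    and n: "card (L_faces c G) < 3 \<or> 4 < card (disp c G)"
  shows "L_faces c G' = {}"
proof (rule ccontr)
  assume ne: "L_faces c G' \<noteq> {}"
  obtain H where H: "S_subgraph c S1 G H" "G' = S_relabel c S1 G H" by (rule S_rules_one[OF S(1)])
  obtain T where T: "S_relabel c S1 G H = relabel T 0 G"
    "S1 = S1 \<longrightarrow> (\<exists>A \<in> nodes (cub G). T = {A} \<and> (\<forall>i. flip (cub G) i A \<notin> disp c G))" "H \<inter> disp c G = T"
    by (rule S12_subgraph[OF D H(1)]) simp_all
  then obtain A where A: "A \<in> nodes (cub G)" "T = {A}" "\<And>i. flip (cub G) i A \<notin> disp c G" by auto
  have d: "disp c G' = disp c G - {A}" unfolding H(2) T(1) A(2) using S(2) by (intro disp_relabel_cont) simp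
  have "cub G' = cub G" using H(2) T(1) by simp
  then obtain F where F: "F \<in> alternating_faces (cub G) (disp c G - {A})"
    using ne L_faces_eq[of G' c] D d by auto
  have AD: "A \<in> disp c G" using T(3) A(2) by auto
  have "3 \<le> card (L_faces c G)"
    unfolding L_faces_eq[OF D] by (rule isolated_alternating_three[OF D A(1) AD A(3) F])
  moreover have "card (disp c G) \<le> 4"
    by (rule isolated_alternating_card[OF D A(1) AD A(3) disp_sub F])
  ultimately show False using n by simp
qed

text \<open>All further neighbours of the removed edge are continuous, so only the diagonally
  opposite edge can still be disperse. Its ends are incident, whereas an L-face needs two disperse
  nodes that are not.\<close>

lemma residual_S2:
  assumes D: "is_cuboid (cub G)" and S: "S_rules c S2 1 G R G'" "0 < c"
  shows "L_faces c G' = {}"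
proof (rule ccontr)
  assume ne: "L_faces c G' \<noteq> {}"
  obtain H where H: "S_subgraph c S2 G H" "G' = S_relabel c S2 G H" by (rule S_rules_one[OF S(1)])
  obtain T where T: "S_relabel c S2 G H = relabel T 0 G"
    "S2 = S2 \<longrightarrow> (\<exists>A i. A \<in> nodes (cub G) \<and> T = {A, flip (cub G) i A} \<and>
       (\<forall>j. j \<noteq> i \<longrightarrow> flip (cub G) j A \<notin> disp c G \<and> flip (cub G) j (flip (cub G) i A) \<notin> disp c G))"
    by (rule S12_subgraph[OF D H(1)]) simp_all
  then obtain A i where A: "A \<in> nodes (cub G)" "T = {A, flip (cub G) i A}"
    "\<And>j. j \<noteq> i \<Longrightarrow> flip (cub G) j A \<notin> disp c G" "\<And>j. j \<noteq> i \<Longrightarrow> flip (cub G) j (flip (cub G) i A) \<notin> disp c G"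
    by auto
  have d: "disp c G' = disp c G - T" unfolding H(2) T(1) using S(2) by (intro disp_relabel_cont) simp
  have cb: "cub G' = cub G" using H(2) T(1) by simp
  then obtain F where F: "F \<in> alternating_faces (cub G) (disp c G - T)"
    using ne L_faces_eq[of G' c] D d by auto
  obtain X Y where XY: "X \<in> disp c G - T" "Y \<in> disp c G - T" "X \<in> nodes (cub G)" "Y \<in> nodes (cub G)"
    "X \<noteq> Y" "\<not> incident (cub G) X Y"
    by (rule alternating_two[OF D F])
  obtain j k :: 3 where ax: "j \<noteq> i" "k \<noteq> i" "k \<noteq> j" by (rule other_axes)
  let ?R = "flip (cub G) j (flip (cub G) k A)"
  have *: "Z = ?R \<or> Z = flip (cub G) i ?R" if Z: "Z \<in> disp c G - T" "Z \<in> nodes (cub G)" for Z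
  proof -
    have 1: "face (cub G) i A = {A, flip (cub G) j A, ?R, flip (cub G) k A}"
      by (rule face_eq4[OF D A(1) ax])
    have 2: "face (cub G) i (flip (cub G) i A) = {flip (cub G) i A, flip (cub G) j (flip (cub G) i A),
        flip (cub G) j (flip (cub G) k (flip (cub G) i A)), flip (cub G) k (flip (cub G) i A)}"
      by (rule face_eq4[OF D _ ax]) (simp add: A(1))
    have e: "flip (cub G) j (flip (cub G) k (flip (cub G) i A)) = flip (cub G) i ?R" by (metis flip_commute)
    have "Z \<in> face (cub G) i A \<or> Z \<in> face (cub G) i (flip (cub G) i A)"
      using node_nth_cases[OF D A(1) Z(2), of i] Z(2) by (auto simp: face_def)
    moreover have "Z \<noteq> A" "Z \<noteq> flip (cub G) i A" "Z \<noteq> flip (cub G) j A" "Z \<noteq> flip (cub G) k A"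
      "Z \<noteq> flip (cub G) j (flip (cub G) i A)" "Z \<noteq> flip (cub G) k (flip (cub G) i A)"
      using Z(1) A(2) A(3)[OF ax(1)] A(3)[OF ax(2)] A(4)[OF ax(1)] A(4)[OF ax(2)] by auto
    ultimately show ?thesis unfolding 1 2 e by blast
  qed
  have i1: "incident (cub G) ?R (flip (cub G) i ?R)" using A(1) D by (auto simp: incident_iff)
  then have "incident (cub G) (flip (cub G) i ?R) ?R" by (simp only: incident_sym)
  then show False using i1 *[OF XY(1,3)] *[OF XY(2,4)] XY(5,6) by metis
qed

text \<open>The argument for \<open>S1\<close>, applied to the complement of the disperse nodes.
  With six disperse nodes the remaining L-face has two continuous nodes besides \<open>A\<close>,
  which makes nine nodes in all.\<close>

lemma residual_S3:
  assumes D: "is_cuboid (cub G)" and S: "S_rules c S3 1 G R G'" "c < 1"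
    and n: "card (L_faces c G) < 3 \<or> card (disp c G) = 6"
  shows "L_faces c G' = {}"
proof (rule ccontr)
  assume ne: "L_faces c G' \<noteq> {}"
  obtain H where H: "S_subgraph c S3 G H" "R = {(lines_in c G H, H \<inter> disp c G)}" "G' = S_relabel c S3 G H"
    by (rule S_rules_one[OF S(1)])
  from H(1) obtain A where A: "A \<in> nodes (cub G)" "lab G A < c" "H = insert A (nbrs (cub G) A)"
    "nbrs (cub G) A \<subseteq> disp c G" by auto
  have c0: "A \<in> - disp c G" using A(2) by (simp add: disp_def)
  have nd: "flip (cub G) i A \<notin> - disp c G" for i
    using A(1,4) D by (auto simp: nbrs_eq)
  have "H \<inter> cont c G = {A}" using A c0 cont_disp by (auto simp: cont_iff)
  then have G': "G' = relabel {A} 1 G" using H(3) by simp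
  have d: "disp c G' = insert A (disp c G)"
    unfolding G' using disp_relabel_disp[OF S(2), of "{A}" G] A(1) by simp
  have cb: "cub G' = cub G" using G' by simp
  have "L_faces c G' = alternating_faces (cub G) (- insert A (disp c G))"
    using L_faces_eq[of G' c] D cb d alternating_compl by metis
  also have "- insert A (disp c G) = - disp c G - {A}" by auto
  finally obtain F where F: "F \<in> alternating_faces (cub G) (- disp c G - {A})" using ne by blast
  have "3 \<le> card (L_faces c G)"
    unfolding L_faces_eq[OF D] alternating_compl[of _ "disp c G", symmetric]
    by (rule isolated_alternating_three[OF D A(1) c0 nd F])
  with n have c6: "card (disp c G) = 6" by simp
  obtain X Y where XY: "X \<in> - disp c G - {A}" "Y \<in> - disp c G - {A}" "X \<in> nodes (cub G)" "Y \<in> nodes (cub G)"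
    "X \<noteq> Y" by (rule alternating_two[OF D F])
  have "card ({A, X, Y} \<union> disp c G) \<le> card (nodes (cub G))"
    by (rule card_mono[OF finite_nodes]) (use A XY disp_sub in auto)
  moreover have "card ({A, X, Y} \<union> disp c G) = 3 + 6"
  proof -
    have "card {A, X, Y} = 3" using XY by auto
    then show ?thesis using XY c0 c6 finite_subset[OF disp_sub finite_nodes] by (subst card_Un_disjoint) auto
  qed
  ultimately show False using card_nodes_le[OF D] by simp
qed

lemma residual_card:
  assumes D: "is_cuboid (cub G)" and S: "S_rules c S1 n G R G'" "0 < c" and n: "card (disp c G) \<le> n + 1"
  shows "L_faces c G' = {}"
proof -
  obtain \<T> where "G' = relabel (\<Union>\<T>) 0 G" "card (disp c G') + n = card (disp c G)"
    using S12_rules[OF S(1) _ D S(2)] by auto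
  with L_faces_card_disp[of G' c] D n show ?thesis by simp
qed

lemma class_struct_exists:
  assumes D: "is_cuboid (cub G)" and c: "0 < c" "c < 1"
    and reg: "regular_graph c \<G> G" and W: "inner_iso_paths c \<G> G W"
  shows "\<exists>\<K>. class_struct c G W \<K>"
proof (cases "L_faces c G = {}")
  case False
  with W reg obtain r n R G' where S: "S_table c G r n" "S_rules c r n G R G'" "W = insert (C_lines c G', disp c G') R"
    unfolding inner_iso_paths_def by auto
  \<comment> \<open>The rows of the table, each reduced to the data from which the absence of
    L-faces in the remaining graph follows.\<close>
  consider "card (disp c G) = 2" "r = S1" "n = 1" | "card (L_faces c G) = 1" "r = S1" "n = 1"
    | "card (disp c G) = 3" "r = S1" "n = 2" | "card (L_faces c G) = 2" "r = S1" "n = 1"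
    | "r = S2" "n = 1" | "card (disp c G) = 4" "r = S1" "n = 3"
    | "card (disp c G) = 5" "card (L_faces c G) = 1" "r = S3" "n = 1"
    | "card (disp c G) = 5" "r = S1" "n = 1" | "card (disp c G) = 6" "r = S3" "n = 1"
    using S(1) unfolding S_table_def Let_def by argo
  then consider "r \<noteq> S3" "L_faces c G' = {}" | "r = S3" "n = 1" "5 \<le> card (disp c G)" "L_faces c G' = {}"
  proof cases
    case 1 then show ?thesis using that(1) residual_card[OF D _ c(1)] S(2) by simp
  next
    case 2 then show ?thesis using that(1) residual_S1[OF D _ c(1)] S(2) by simp
  next
    case 3 then show ?thesis using that(1) residual_card[OF D _ c(1)] S(2) by simp
  next
    case 4 then show ?thesis using that(1) residual_S1[OF D _ c(1)] S(2) by simp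
  next
    case 5 then show ?thesis using that(1) residual_S2[OF D _ c(1)] S(2) by simp
  next
    case 6 then show ?thesis using that(1) residual_card[OF D _ c(1)] S(2) by simp
  next
    case 7 then show ?thesis using that(2) residual_S3[OF D _ c(2)] S(2) by simp
  next
    case 8 then show ?thesis using that(1) residual_S1[OF D _ c(1)] S(2) by simp
  next
    case 9 then show ?thesis using that(2) residual_S3[OF D _ c(2)] S(2) by simp
  qed
  then show ?thesis
  proof cases
    case 1 then show ?thesis unfolding S(3) using class_struct_S12[OF D S(2) _ c(1)] by blast
  next
    case 2 then show ?thesis unfolding S(3) using class_struct_S3[OF D _ c(2)] S(2) by blast
  qed
next
  case True
  note L = this
  have "(\<exists>R G'. card (disp c G) = 2 \<and> S_rules c S1 1 G R G' \<and> W = insert (C_lines c G', disp c G') R) \<or>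
    (\<exists>R G'. card (disp c G) = 6 \<and> S_rules c S3 1 G R G' \<and> W = insert (C_lines c G', disp c G') R) \<or>
    W = {(C_lines c G, disp c G)}"
    using W reg L unfolding inner_iso_paths_def by (simp split: if_splits; blast?)
  then show ?thesis
  proof (elim disjE exE conjE)
    fix R G' assume a: "card (disp c G) = 2" "S_rules c S1 1 G R G'" and W: "W = insert (C_lines c G', disp c G') R"
    show ?thesis unfolding W using class_struct_S12[OF D a(2) _ c(1)] residual_card[OF D a(2) c(1)] a(1) by simp
  next
    fix R G' assume a: "card (disp c G) = 6" "S_rules c S3 1 G R G'" and W: "W = insert (C_lines c G', disp c G') R"
    show ?thesis unfolding W using class_struct_S3[OF D a(2) c(2)] residual_S3[OF D a(2) c(2)] a(1) by simp
  next
    assume W: "W = {(C_lines c G, disp c G)}"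
    have "class_struct c G (insert (C_lines c G, disp c G) {}) = class_struct c G W" unfolding W ..
    \<comment> \<open>Applying no rule is a run of length zero, so this case is covered by the lemma
      for \<open>S1\<close> and \<open>S2\<close>.\<close>
    moreover have "S_rules c S1 0 G {} G" by (rule S_rules.intros)
    ultimately show ?thesis using class_struct_S12[OF D \<open>S_rules c S1 0 G {} G\<close> _ c(1) L] by simp
  qed
qed

section \<open>Face-to-face meshes\<close>

lemma mesh_cuboid: "cuboid_mesh M \<Longrightarrow> D \<in> M \<Longrightarrow> is_cuboid D"
  by (simp add: cuboid_mesh_def)

lemma edges_sub: "e \<in> edges D \<Longrightarrow> e \<subseteq> nodes D"
  by (auto simp: edges_def incident_def)

lemma convex_nth_eq: "convex {x :: pt. x $ i = a}"
proof (rule convexI)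
  fix x y :: pt and u v :: real
  assume a: "x \<in> {x. x $ i = a}" "y \<in> {x. x $ i = a}" "u + v = 1"
  then have "u * a + v * a = a" by (simp flip: distrib_right)
  then show "u *\<^sub>R x + v *\<^sub>R y \<in> {x. x $ i = a}" using a by simp
qed

text \<open>In each axis the intervals of two touching cuboids coincide or abut. If the common node,
  edge or face extends in direction \<open>i\<close>, both bounds agree; otherwise the intersection
  has a single \<open>i\<close>-coordinate, which properly overlapping intervals would
  contradict.\<close>

lemma mesh_coord:
  assumes M: "cuboid_mesh M" "C \<in> M" "D \<in> M" and x: "x \<in> body C" "x \<in> body D"
  shows "fst C $ i = fst D $ i \<and> snd C $ i = snd D $ i \<or> snd C $ i = fst D $ i \<or> snd D $ i = fst C $ i"
proof (cases "C = D")
  case False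
  have cC: "is_cuboid C" and cD: "is_cuboid D" using M mesh_cuboid by blast+
  have "body C \<inter> body D \<noteq> {}" using x by blast
  with M False obtain S where S: "S \<in> ((\<lambda>P. {P}) ` nodes C \<union> edges C \<union> faces C) \<inter>
      ((\<lambda>P. {P}) ` nodes D \<union> edges D \<union> faces D)" "body C \<inter> body D = convex hull S"
    unfolding cuboid_mesh_def by blast
  have "S \<subseteq> nodes E" if "S \<in> (\<lambda>P. {P}) ` nodes E \<union> edges E \<union> faces E" for E
    using that edges_sub[of S E] faces_sub[of S E] by blast
  then have SC: "S \<subseteq> nodes C" and SD: "S \<subseteq> nodes D" using S(1) by blast+
  show ?thesis
  proof (cases "\<exists>V \<in> S. \<exists>W \<in> S. V $ i \<noteq> W $ i")
    case True
    then obtain V W where V: "V \<in> S" "W \<in> S" "V $ i \<noteq> W $ i" by blast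
    have "V \<in> nodes C" "W \<in> nodes C" "V \<in> nodes D" "W \<in> nodes D" using V SC SD by auto
    note n = this[THEN nodesD, of i]
    show ?thesis using n V(3) is_cuboidD[OF cC, of i] is_cuboidD[OF cD, of i] by argo
  next
    case False
    obtain V where V: "V \<in> S" using S(2) x by (metis Int_iff convex_hull_empty empty_iff ex_in_conv)
    have "convex hull S \<subseteq> {y. y $ i = V $ i}"
    proof (rule hull_minimal)
      show "S \<subseteq> {y. y $ i = V $ i}" using False V by blast
      show "convex {y :: pt. y $ i = V $ i}" by (rule convex_nth_eq)
    qed
    then have t: "y $ i = V $ i" if "y \<in> body C" "y \<in> body D" for y using S(2) that by blast
    show ?thesis
    proof (rule ccontr)
      assume nt: "\<not> ?thesis"
      have b: "fst C $ l \<le> x $ l" "x $ l \<le> snd C $ l" "fst D $ l \<le> x $ l" "x $ l \<le> snd D $ l" for l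
        using x by (auto simp: body_nth)
      have lt: "fst D $ i < snd C $ i" "fst C $ i < snd D $ i" using b[of i] nt by linarith+
      \<comment> \<open>\<open>lo\<close> and \<open>hi\<close> bound the overlap of the two
        intervals; moving \<open>x\<close> along it in direction \<open>i\<close> stays in both
        cuboids.\<close>
      define lo where "lo = max (fst C $ i) (fst D $ i)"
      define hi where "hi = min (snd C $ i) (snd D $ i)"
      have lh: "lo < hi" using lt is_cuboidD[OF cC, of i] is_cuboidD[OF cD, of i] by (auto simp: lo_def hi_def)
      have y: "(\<chi> l. if l = i then s else x $ l) $ i = V $ i" if "lo \<le> s" "s \<le> hi" for s
        by (rule t) (use that b in \<open>auto simp: body_nth lo_def hi_def\<close>)
      from y[of lo] y[of hi] lh show False by simp
    qed
  qed
qed simp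

text \<open>Where the intervals abut, the coordinate of \<open>x\<close> is their common bound and
  hence extremal in both cuboids; elsewhere they coincide.\<close>

lemma car_mesh:
  assumes M: "cuboid_mesh M" "C \<in> M" "D \<in> M" and x: "x \<in> body C" "x \<in> body D"
  shows "car C x = car D x"
proof -
  have *: "(if x $ i \<in> {fst C $ i, snd C $ i} then V $ i = x $ i else V $ i \<in> {fst C $ i, snd C $ i}) \<longleftrightarrow>
    (if x $ i \<in> {fst D $ i, snd D $ i} then V $ i = x $ i else V $ i \<in> {fst D $ i, snd D $ i})" for V i
  proof -
    have b: "fst C $ i \<le> x $ i" "x $ i \<le> snd C $ i" "fst D $ i \<le> x $ i" "x $ i \<le> snd D $ i"
      using x by (auto simp: body_nth)
    consider "fst C $ i = fst D $ i \<and> snd C $ i = snd D $ i" | "snd C $ i = fst D $ i" | "snd D $ i = fst C $ i"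
      using mesh_coord[OF assms, of i] by blast
    then show ?thesis
    proof cases
      case 2
      then have "x $ i = snd C $ i" "x $ i = fst D $ i" using b by linarith+
      then show ?thesis by simp
    next
      case 3
      then have "x $ i = snd D $ i" "x $ i = fst C $ i" using b by linarith+
      then show ?thesis by simp
    qed simp
  qed
  show ?thesis unfolding car_def * ..
qed

lemma seg_flip:
  assumes D: "is_cuboid D" and U: "U $ i \<in> {fst D $ i, snd D $ i}"
    and z: "\<And>l. l \<noteq> i \<Longrightarrow> z $ l = U $ l" "fst D $ i \<le> z $ i" "z $ i \<le> snd D $ i"
  shows "z \<in> closed_segment U (flip D i U)"
proof -
  define w where "w = flip D i U $ i - U $ i"
  have w: "w \<noteq> 0" "w = fst D $ i + snd D $ i - 2 * U $ i"
    using is_cuboidD[OF D, of i] U by (auto simp: w_def flip_nth)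
  define u where "u = (z $ i - U $ i) / w"
  have lt: "fst D $ i < snd D $ i" by (rule is_cuboidD[OF D])
  have "0 \<le> u \<and> u \<le> 1"
  proof (cases "U $ i = fst D $ i")
    case True
    then have "w = snd D $ i - fst D $ i" using w(2) by simp
    then show ?thesis using z(2,3) lt True by (simp add: u_def divide_simps)
  next
    case False
    then have "U $ i = snd D $ i" using U by simp
    then have e: "u = (snd D $ i - z $ i) / (snd D $ i - fst D $ i)"
      using w(2) lt by (simp add: u_def divide_simps) (simp add: algebra_simps)
    show ?thesis unfolding e using z(2,3) lt by (simp add: divide_simps)
  qed
  moreover have "z = (1 - u) *\<^sub>R U + u *\<^sub>R flip D i U"
  proof -
    have "z $ l = (1 - u) * U $ l + u * flip D i U $ l" for l
    proof (cases "l = i")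
      case True
      have "u * w = z $ i - U $ i" using w(1) by (simp add: u_def)
      then show ?thesis using True by (simp add: w_def algebra_simps)
    next
      case False
      then show ?thesis using z(1) by (simp add: flip_nth algebra_simps)
    qed
    then show ?thesis by (simp add: vec_eq_iff)
  qed
  ultimately show ?thesis unfolding in_segment by blast
qed

text \<open>A point of the face lies between its projections to two opposite edges, and these lie
  between nodes.\<close>

lemma hull_face:
  assumes D: "is_cuboid D" "V \<in> nodes D"
  shows "convex hull (face D i V) = {x \<in> body D. x $ i = V $ i}"
proof (intro equalityI hull_minimal)
  show "face D i V \<subseteq> {x \<in> body D. x $ i = V $ i}"
    using nodes_body[OF D(1)] by (auto simp: face_def)
  have "convex (body D \<inter> {x. x $ i = V $ i})"
    unfolding body_def by (intro convex_Int convex_box convex_nth_eq)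
  moreover have "body D \<inter> {x. x $ i = V $ i} = {x \<in> body D. x $ i = V $ i}" by blast
  ultimately show "convex {x \<in> body D. x $ i = V $ i}" by simp
  show "{x \<in> body D. x $ i = V $ i} \<subseteq> convex hull face D i V"
  proof
    fix x assume x: "x \<in> {x \<in> body D. x $ i = V $ i}"
    then have b: "fst D $ l \<le> x $ l" "x $ l \<le> snd D $ l" for l by (auto simp: body_nth)
    obtain j k :: 3 where ax: "j \<noteq> i" "k \<noteq> i" "k \<noteq> j" "\<forall>P. (\<forall>l. P l) \<longleftrightarrow> P i \<and> P j \<and> P k"
      by (rule other_axes)
    have ng: "W $ l \<in> {fst D $ l, snd D $ l}" if "W \<in> nodes D" for W l using nodesD[OF that] by auto
    define y where "y = (\<chi> l. if l = j then x $ l else V $ l)"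
    have f: "V \<in> face D i V" "flip D j V \<in> face D i V" "flip D k V \<in> face D i V" "flip D j (flip D k V) \<in> face D i V"
      using D ax by simp_all
    have sub: "closed_segment p q \<subseteq> convex hull face D i V" if "p \<in> convex hull face D i V" "q \<in> convex hull face D i V" for p q
      by (rule closed_segment_subset) (use that in auto)
    have y1: "y \<in> closed_segment V (flip D j V)"
      by (rule seg_flip[OF D(1)]) (use ng[OF D(2), of j] b[of j] in \<open>simp_all add: y_def\<close>)
    have y2: "flip D k y \<in> closed_segment (flip D k V) (flip D j (flip D k V))"
      by (rule seg_flip[OF D(1)]) (use ng[OF D(2), of j] b[of j] ax in \<open>auto simp: y_def flip_nth\<close>)
    note yy = subsetD[OF sub[OF hull_inc[OF f(1)] hull_inc[OF f(2)]] y1]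
      subsetD[OF sub[OF hull_inc[OF f(3)] hull_inc[OF f(4)]] y2]
    have "x \<in> closed_segment y (flip D k y)"
    proof (rule seg_flip[OF D(1)])
      show "y $ k \<in> {fst D $ k, snd D $ k}" using ng[OF D(2), of k] ax by (simp add: y_def)
      have "\<forall>l. l \<noteq> k \<longrightarrow> x $ l = y $ l" unfolding ax(4)[rule_format] using x ax by (auto simp: y_def)
      then show "\<And>l. l \<noteq> k \<Longrightarrow> x $ l = y $ l" by blast
    qed (use b in auto)
    then show "x \<in> convex hull face D i V" using sub[OF yy] by blast
  qed
qed

lemma two_ends:
  assumes "is_cuboid C" "is_cuboid D" "U \<in> nodes C" "U \<in> nodes D" "V \<in> nodes C" "V \<in> nodes D" "U $ i \<noteq> V $ i"
  shows "fst C $ i = fst D $ i" "snd C $ i = snd D $ i"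
  using assms(3-6)[THEN nodesD, of i] assms(7) is_cuboidD[OF assms(1), of i] is_cuboidD[OF assms(2), of i]
  by argo+

lemma cuboid_eqI:
  fixes C D :: cuboid
  assumes "\<And>i. fst C $ i = fst D $ i" "\<And>i. snd C $ i = snd D $ i"
  shows "C = D"
  using assms by (simp add: prod_eq_iff vec_eq_iff)

section \<open>Cuboids around a common node, face or edge\<close>

context
  fixes M :: "cuboid set"
  assumes M: "cuboid_mesh M"
begin

lemma same_side:
  assumes "C \<in> M" "D \<in> M" "P \<in> nodes C" "P \<in> nodes D" "P $ i = fst C $ i \<longleftrightarrow> P $ i = fst D $ i"
  shows "fst C $ i = fst D $ i" "snd C $ i = snd D $ i"
proof -
  have c: "is_cuboid C" "is_cuboid D" using M assms mesh_cuboid by blast+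
  have "P \<in> body C" "P \<in> body D" using assms c nodes_body by blast+
  from mesh_coord[OF M assms(1,2) this, of i] show "fst C $ i = fst D $ i" "snd C $ i = snd D $ i"
    using assms(5) nodesD[OF assms(3), of i] nodesD[OF assms(4), of i] is_cuboidD[OF c(1), of i] is_cuboidD[OF c(2), of i]
    by argo+
qed

text \<open>A cuboid of the mesh with node \<open>P\<close> is determined by the octant at
  \<open>P\<close> that it occupies: for each axis, whether \<open>P\<close> is at the lower
  bound.\<close>

lemma same_quadrant:
  assumes "C \<in> M" "D \<in> M" "P \<in> nodes C" "P \<in> nodes D" "\<And>i. P $ i = fst C $ i \<longleftrightarrow> P $ i = fst D $ i"
  shows "C = D"
  by (rule cuboid_eqI) (use same_side[OF assms] in auto)

text \<open>In an axis in which the intervals differ they abut at the coordinate of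
  \<open>P\<close>; so all common points have this coordinate, and \<open>P\<close> is at the lower
  bound of exactly one cuboid.\<close>

lemma pinned:
  assumes "C \<in> M" "D \<in> M" "P \<in> nodes C" "P \<in> nodes D"
    and ne: "\<not> (fst C $ i = fst D $ i \<and> snd C $ i = snd D $ i)"
    and x: "x \<in> body C" "x \<in> body D"
  shows "x $ i = P $ i" "P $ i = fst C $ i \<longleftrightarrow> P $ i \<noteq> fst D $ i"
proof -
  have c: "is_cuboid C" "is_cuboid D" using M assms mesh_cuboid by blast+
  have b: "fst C $ i \<le> x $ i" "x $ i \<le> snd C $ i" "fst D $ i \<le> x $ i" "x $ i \<le> snd D $ i"
    using x by (auto simp: body_nth)
  from mesh_coord[OF M assms(1,2) x, of i] show "x $ i = P $ i"
    using b ne nodesD[OF assms(3), of i] nodesD[OF assms(4), of i] is_cuboidD[OF c(1), of i] is_cuboidD[OF c(2), of i]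
    by argo
  from mesh_coord[OF M assms(1,2) x, of i] show "P $ i = fst C $ i \<longleftrightarrow> P $ i \<noteq> fst D $ i"
    using b ne nodesD[OF assms(3), of i] nodesD[OF assms(4), of i] is_cuboidD[OF c(1), of i] is_cuboidD[OF c(2), of i]
    by argo
qed

text \<open>Nodes of \<open>F\<close> that differ in a direction within \<open>F\<close> fix both
  bounds there, so cuboids on \<open>F\<close> can differ only in the normal direction, where they
  abut. For uniqueness: two cuboids other than \<open>C\<close> both lie on the far side of
  \<open>F\<close> and hence in the same octant.\<close>

lemma common_face:
  assumes CD: "C \<in> M" "D \<in> M" "C \<noteq> D" and F: "F \<in> faces C" "F \<subseteq> nodes D"
  shows "F \<in> faces D" "nodes C \<inter> nodes D = F" "body C \<inter> body D = convex hull F" "face_neighbors C D"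
    and "\<And>D'. D' \<in> M \<Longrightarrow> D' \<noteq> C \<Longrightarrow> F \<subseteq> nodes D' \<Longrightarrow> D' = D"
proof -
  have cC: "is_cuboid C" using M CD mesh_cuboid by blast
  obtain i V where V: "V \<in> nodes C" "F = face C i V" by (rule facesE[OF cC F(1)])
  have same: "fst C $ j = fst E $ j" "snd C $ j = snd E $ j"
    if "E \<in> M" "F \<subseteq> nodes E" "j \<noteq> i" for E j
  proof -
    have "V \<in> F" "flip C j V \<in> F" using that V by simp_all
    then have "V \<in> nodes E" "flip C j V \<in> nodes E" using that by auto
    moreover have "V $ j \<noteq> flip C j V $ j" using flip_nth_neq[OF cC V(1), of j] by simp
    ultimately show "fst C $ j = fst E $ j" "snd C $ j = snd E $ j"
      using two_ends[OF cC mesh_cuboid[OF M that(1)] V(1), of "flip C j V" j] V(1) by auto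
  qed
  have diff: "\<not> (fst C $ i = fst E $ i \<and> snd C $ i = snd E $ i)" if "E \<in> M" "F \<subseteq> nodes E" "E \<noteq> C" for E
    using cuboid_eqI[of C E] same[OF that(1,2)] that(3) by metis
  have VD: "V \<in> nodes D" using F(2) V by auto
  have vb: "V \<in> body C" using nodes_body[OF cC V(1)] .
  note d = diff[OF CD(2) F(2) CD(3)[symmetric]]
  note pin = pinned[OF CD(1,2) V(1) VD d]
  have FD: "F = face D i V"
  proof (intro equalityI subsetI)
    fix U assume "U \<in> face D i V"
    then have U: "U \<in> nodes D" "U $ i = V $ i" by (auto simp: face_def)
    have "U $ l \<in> {fst C $ l, snd C $ l}" for l
      using nodesD[OF U(1), of l] nodesD[OF V(1), of l] same[OF CD(2) F(2), of l] U(2) by (cases "l = i") auto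
    then show "U \<in> F" using U V by (auto simp: face_def nodes_def)
  qed (use F V in \<open>auto simp: face_def\<close>)
  show F': "F \<in> faces D" unfolding FD by (rule face_in_faces[OF VD])
  have cD: "is_cuboid D" using M CD mesh_cuboid by blast
  show "nodes C \<inter> nodes D = F"
    using pin(1) nodes_body[OF cC] nodes_body[OF cD] F(2) unfolding V(2) by (auto simp: face_def)
  have hull: "convex hull F = {x \<in> body C. x $ i = V $ i}" unfolding V(2) by (rule hull_face[OF cC V(1)])
  have "convex hull F = {x \<in> body D. x $ i = V $ i}" unfolding FD by (rule hull_face[OF cD VD])
  with hull pin(1) show *: "body C \<inter> body D = convex hull F" by auto
  then show "face_neighbors C D" using F(1) F' by (auto simp: face_neighbors_def)
  fix D' assume D': "D' \<in> M" "D' \<noteq> C" "F \<subseteq> nodes D'"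
  have VD': "V \<in> nodes D'" using D' V by auto
  have bD: "V \<in> body D" "V \<in> body D'" using nodes_body VD VD' M CD D' mesh_cuboid by blast+
  show "D' = D"
  proof (rule same_quadrant[OF D'(1) CD(2) VD' VD])
    fix l
    show "V $ l = fst D' $ l \<longleftrightarrow> V $ l = fst D $ l"
    proof (cases "l = i")
      case True
      then show ?thesis
        using pin(2)[OF vb bD(1)] pinned(2)[OF CD(1) D'(1) V(1) VD' diff[OF D'(1,3,2)] vb bD(2)] by blast
    next
      case False
      then show ?thesis using same[OF CD(2) F(2)] same[OF D'(1,3)] by simp
    qed
  qed
qed

lemma face_neighborsE:
  assumes CD: "C \<in> M" "D \<in> M" and n: "face_neighbors C D"
  obtains F where "C \<noteq> D" "F \<in> faces C" "F \<in> faces D" "nodes C \<inter> nodes D = F" "body C \<inter> body D = convex hull F"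
proof -
  from n obtain F where F: "F \<in> faces C" "F \<in> faces D" "body C \<inter> body D = convex hull F"
    by (auto simp: face_neighbors_def)
  have cC: "is_cuboid C" using M CD mesh_cuboid by blast
  have "C \<noteq> D"
  proof
    assume e: "C = D"
    obtain i V where V: "V \<in> nodes C" "F = face C i V" by (rule facesE[OF cC F(1)])
    have "flip C i V \<in> body C" using nodes_body[OF cC] V by simp
    then have "flip C i V \<in> convex hull F" using F(3) e by simp
    then show False unfolding V(2) hull_face[OF cC V(1)] using flip_nth_neq[OF cC V(1)] by simp
  qed
  moreover have "nodes C \<inter> nodes D = F" by (rule common_face(2)[OF CD calculation F(1) faces_sub[OF F(2)]])
  ultimately show ?thesis using that F by blast
qed

text \<open>If the intervals differed in two axes, all common nodes would be pinned in both, which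
  leaves at most two of them.\<close>

lemma three_common:
  assumes CD: "C \<in> M" "D \<in> M" "C \<noteq> D"
    and U: "U1 \<in> nodes C \<inter> nodes D" "U2 \<in> nodes C \<inter> nodes D" "U3 \<in> nodes C \<inter> nodes D" "U1 \<noteq> U2" "U1 \<noteq> U3" "U2 \<noteq> U3"
  shows "nodes C \<inter> nodes D \<in> faces C" "nodes C \<inter> nodes D \<in> faces D"
proof -
  have cC: "is_cuboid C" and cD: "is_cuboid D" using M CD mesh_cuboid by blast+
  obtain i where i: "\<not> (fst C $ i = fst D $ i \<and> snd C $ i = snd D $ i)"
    using cuboid_eqI[of C D] CD(3) by blast
  obtain j k :: 3 where ax: "j \<noteq> i" "k \<noteq> i" "k \<noteq> j" "\<forall>P. (\<forall>l. P l) \<longleftrightarrow> P i \<and> P j \<and> P k"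
    by (rule other_axes)
  have pin: "U $ l = U' $ l" if "\<not> (fst C $ l = fst D $ l \<and> snd C $ l = snd D $ l)"
    "U \<in> nodes C \<inter> nodes D" "U' \<in> nodes C \<inter> nodes D" for U U' l
    using two_ends[OF cC cD, of U U' l] that by blast
  have U1: "U1 \<in> nodes C" "U1 \<in> nodes D" using U by auto
  have two: "fst C $ l = fst D $ l \<and> snd C $ l = snd D $ l" if l: "l \<noteq> i" "m \<noteq> i" "m \<noteq> l" "\<forall>P. (\<forall>l. P l) \<longleftrightarrow> P i \<and> P l \<and> P m" for l m
  proof (rule ccontr)
    assume nl: "\<not> ?thesis"
    have eq: "X = Y" if "X \<in> nodes C \<inter> nodes D" "Y \<in> nodes C \<inter> nodes D" "X $ m = Y $ m" for X Y
      unfolding vec_eq_iff l(4)[rule_format] using that pin[OF nl, of X Y] pin[OF i, of X Y] by simp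
    have "U1 $ m \<noteq> U2 $ m" "U1 $ m \<noteq> U3 $ m" "U2 $ m \<noteq> U3 $ m" using eq U by blast+
    moreover have "U1 \<in> nodes C" "U2 \<in> nodes C" "U3 \<in> nodes C" using U by auto
    note nodesD[OF this(1), of m] nodesD[OF this(2), of m] nodesD[OF this(3), of m]
    ultimately show False by argo
  qed
  have j: "fst C $ j = fst D $ j \<and> snd C $ j = snd D $ j" by (rule two[OF ax])
  have k: "fst C $ k = fst D $ k \<and> snd C $ k = snd D $ k"
    by (rule two[of k j]) (use ax in auto)
  have F: "face C i U1 \<in> faces C" by (rule face_in_faces[OF U1(1)])
  have "face C i U1 \<subseteq> nodes D"
  proof
    fix X assume X: "X \<in> face C i U1"
    then have "X \<in> nodes C" "X $ i = U1 $ i" by (auto simp: face_def)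
    then have "\<forall>l. X $ l \<in> {fst D $ l, snd D $ l}"
      unfolding ax(4)[rule_format]
      using nodesD[of X C j] nodesD[of X C k] nodesD[OF U1(2), of i] j k by simp
    then show "X \<in> nodes D" by (simp add: nodes_def)
  qed
  from common_face[OF CD F this] F show "nodes C \<inter> nodes D \<in> faces C" "nodes C \<inter> nodes D \<in> faces D"
    by auto
qed

lemma face_sub_quadrant:
  assumes "C \<in> M" "D \<in> M" "P \<in> nodes C" "P \<in> nodes D"
    and "\<And>l. l \<noteq> j \<Longrightarrow> P $ l = fst C $ l \<longleftrightarrow> P $ l = fst D $ l"
  shows "face C j P \<subseteq> nodes D"
proof
  fix X assume "X \<in> face C j P"
  then have X: "X \<in> nodes C" "X $ j = P $ j" by (auto simp: face_def)
  have "X $ l \<in> {fst D $ l, snd D $ l}" for l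
  proof (cases "l = j")
    case True
    then show ?thesis using X(2) nodesD[OF assms(4), of j] by simp
  next
    case False
    then show ?thesis using same_side[OF assms(1-4) assms(5)[OF False]] nodesD[OF X(1), of l] by simp
  qed
  then show "X \<in> nodes D" by (simp add: nodes_def)
qed

text \<open>The four cuboids at the edge are classified by the sides of \<open>P\<close> in the axes
  \<open>j\<close> and \<open>k\<close>. This is injective, and there are just four pairs of sides,
  so all occur; changing one side at a time yields the cyclic order \<open>C\<close>,
  \<open>C1\<close>, \<open>C2\<close>, \<open>C3\<close> with common faces normal to
  \<open>j\<close>, \<open>k\<close>, \<open>j\<close>, \<open>k\<close>.\<close>

lemma edge_ring:
  assumes C: "C \<in> M" "surrounded M C" and P: "P \<in> nodes C" and ax: "j \<noteq> i" "k \<noteq> i" "k \<noteq> (j :: 3)"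
  obtains C1 C2 C3 where "C1 \<in> M" "C2 \<in> M" "C3 \<in> M"
    "\<forall>D \<in> {C1, C2, C3}. incident D P (flip C i P) \<and> flip D i P = flip C i P"
    "C1 \<noteq> C" "C2 \<noteq> C1" "C3 \<noteq> C2" "C \<noteq> C3" "C2 \<noteq> C"
    "face C j P \<subseteq> nodes C1" "face C1 k P \<subseteq> nodes C2" "face C2 j P \<subseteq> nodes C3" "face C3 k P \<subseteq> nodes C"
proof -
  have cC: "is_cuboid C" using M C mesh_cuboid by blast
  let ?Q = "flip C i P"
  let ?E = "{D \<in> M. {P, ?Q} \<in> edges D}"
  have inc: "incident C P ?Q" using cC P by (auto simp: incident_iff)
  then have "{P, ?Q} \<in> edges C" unfolding edges_def by blast
  then have card: "card ?E = 4" and CE: "C \<in> ?E" using C by (auto simp: surrounded_def)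
  have E: "D \<in> M" "incident D P ?Q" "P \<in> nodes D" "?Q \<in> nodes D" if "D \<in> ?E" for D
  proof -
    show "D \<in> M" using that by simp
    from that obtain X Y where XY: "{P, ?Q} = {X, Y}" "incident D X Y" unfolding edges_def by auto
    then show i: "incident D P ?Q" by (auto simp: doubleton_eq_iff incident_sym)
    then show "P \<in> nodes D" "?Q \<in> nodes D" by (auto dest: incident_nodes)
  qed
  have Qi: "P $ i \<noteq> ?Q $ i" using flip_nth_neq[OF cC P, of i] by simp
  have Ei: "fst C $ i = fst D $ i" "snd C $ i = snd D $ i" if "D \<in> ?E" for D
    using two_ends[OF cC mesh_cuboid[OF M E(1)[OF that]] P E(3)[OF that] _ E(4)[OF that] Qi] P by auto
  define q where "q = (\<lambda>D :: cuboid. (P $ j = fst D $ j, P $ k = fst D $ k))"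
  have ax': "\<forall>l. l = i \<or> l = j \<or> l = k"
  proof -
    obtain k' where k': "k' \<noteq> i" "k' \<noteq> j" "\<forall>P. (\<forall>l. P l) \<longleftrightarrow> P i \<and> P j \<and> P k'"
      by (rule third_axis[OF ax(1)[symmetric]])
    have "\<forall>l. l = i \<or> l = j \<or> l = k'" unfolding k'(3)[rule_format] by simp
    then have "k' = k" using ax by metis
    with \<open>\<forall>l. l = i \<or> l = j \<or> l = k'\<close> show ?thesis by simp
  qed
  have "inj_on q ?E"
  proof (rule inj_onI)
    fix D D' assume d: "D \<in> ?E" "D' \<in> ?E" "q D = q D'"
    show "D = D'"
    proof (rule same_quadrant[OF E(1)[OF d(1)] E(1)[OF d(2)] E(3)[OF d(1)] E(3)[OF d(2)]])
      fix l
      have "l = i \<or> l = j \<or> l = k" using ax' by blast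
      then show "P $ l = fst D $ l \<longleftrightarrow> P $ l = fst D' $ l"
        using d(3) Ei(1)[OF d(1)] Ei(1)[OF d(2)] by (auto simp: q_def)
    qed
  qed
  then have "card (q ` ?E) = 4" using card by (simp add: card_image)
  then have "q ` ?E = UNIV"
    by (intro card_subset_eq) (auto simp: UNIV_Times_UNIV[symmetric] card_cartesian_product simp del: UNIV_Times_UNIV)
  then have ex: "\<exists>D. D \<in> ?E \<and> q D = ab" for ab by (metis (no_types, lifting) UNIV_I imageE)
  let ?a = "P $ j = fst C $ j" and ?b = "P $ k = fst C $ k"
  from ex[of "(\<not> ?a, ?b)"] obtain C1 where 1: "C1 \<in> ?E" "q C1 = (\<not> ?a, ?b)" by blast
  from ex[of "(\<not> ?a, \<not> ?b)"] obtain C2 where 2: "C2 \<in> ?E" "q C2 = (\<not> ?a, \<not> ?b)" by blast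
  from ex[of "(?a, \<not> ?b)"] obtain C3 where 3: "C3 \<in> ?E" "q C3 = (?a, \<not> ?b)" by blast
  have qC: "q C = (?a, ?b)" by (simp add: q_def)
  have sub: "face D l P \<subseteq> nodes D'" if d: "D \<in> ?E" "D' \<in> ?E" and l: "l = j \<and> snd (q D) = snd (q D') \<or> l = k \<and> fst (q D) = fst (q D')" for D D' l
  proof (rule face_sub_quadrant[OF E(1)[OF d(1)] E(1)[OF d(2)] E(3)[OF d(1)] E(3)[OF d(2)]])
    fix l' assume "l' \<noteq> l"
    moreover have "l' = i \<or> l' = j \<or> l' = k" using ax' by blast
    ultimately show "P $ l' = fst D $ l' \<longleftrightarrow> P $ l' = fst D' $ l'"
      using l Ei(1)[OF d(1)] Ei(1)[OF d(2)] by (auto simp: q_def)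
  qed
  have fl: "flip D i P = ?Q" if "D \<in> ?E" for D using Ei[OF that] by (simp add: flip_def fun_eq_iff)
  show ?thesis
  proof (rule that[of C1 C2 C3])
    show "C1 \<in> M" "C2 \<in> M" "C3 \<in> M" using E(1) 1(1) 2(1) 3(1) by blast+
    show "\<forall>D \<in> {C1, C2, C3}. incident D P ?Q \<and> flip D i P = ?Q"
    proof
      fix D assume "D \<in> {C1, C2, C3}"
      then have "D \<in> ?E" using 1(1) 2(1) 3(1) by blast
      then show "incident D P ?Q \<and> flip D i P = ?Q" using E(2) fl by blast
    qed
    show "C1 \<noteq> C" "C2 \<noteq> C1" "C3 \<noteq> C2" "C \<noteq> C3" "C2 \<noteq> C"
      using 1(2) 2(2) 3(2) qC by auto
    show "face C j P \<subseteq> nodes C1" by (rule sub[OF CE 1(1)]) (simp only: qC 1(2) snd_conv simp_thms)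
    show "face C1 k P \<subseteq> nodes C2" by (rule sub[OF 1(1) 2(1)]) (simp only: 1(2) 2(2) fst_conv simp_thms)
    show "face C2 j P \<subseteq> nodes C3" by (rule sub[OF 2(1) 3(1)]) (simp only: 3(2) 2(2) snd_conv simp_thms)
    show "face C3 k P \<subseteq> nodes C" by (rule sub[OF 3(1) CE]) (simp only: 3(2) qC fst_conv simp_thms)
  qed
qed

end

section \<open>The removal step\<close>

context
  fixes c :: real and M :: "cuboid set" and \<phi> :: "pt \<Rightarrow> real"
  assumes c: "0 < c" "c < 1" and M: "cuboid_mesh M"
begin

abbreviation raw :: "cuboid \<Rightarrow> lcgraph" where "raw D \<equiv> \<lparr>cub = D, lab = \<phi>\<rparr>"

text \<open>An \<open>F_2\<close>-configuration seen from a node \<open>P\<close> of its level face,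
  which is normal to the axis \<open>r\<close>. It is phrased with the mesh labels so that it can be
  carried over to the cuboid on the other side.\<close>

definition F2_at :: "cuboid \<Rightarrow> 3 \<Rightarrow> pt \<Rightarrow> bool" where
  "F2_at D r P \<longleftrightarrow> (\<forall>V \<in> nodes D. (V $ r = P $ r \<longrightarrow> \<phi> V = c) \<and> (V $ r \<noteq> P $ r \<longrightarrow> c < \<phi> V)) \<and>
     (\<exists>D' \<in> M. D' \<noteq> D \<and> face D r P \<subseteq> nodes D' \<and> (\<forall>V \<in> nodes D' - nodes D. c < \<phi> V))"

definition promoted :: "cuboid \<Rightarrow> pt \<Rightarrow> bool" where
  "promoted D V \<longleftrightarrow> V \<in> nodes D \<and> \<phi> V = c \<and> lab (removed c M \<phi> D) V = 1"

lemma removed_F: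
  assumes "F1_graph c (raw D) \<or> F2_graph c (raw ` M) (raw D)"
  shows "removed c M \<phi> D = relabel (level c (raw D)) 1 (raw D)"
  using assms by (simp add: removed_def Let_def)

lemma removed_T:
  assumes "\<not> (F1_graph c (raw D) \<or> F2_graph c (raw ` M) (raw D))"
  obtains X1 X2 where "removed c M \<phi> D = relabel X2 1 (relabel X1 1 (raw D))"
    "X1 = level c (raw D) \<inter> \<Union>{H. T1_subgraph c (raw D) H}"
    "X2 = level c (relabel X1 1 (raw D)) \<inter> \<Union>{H. T2_subgraph c (relabel X1 1 (raw D)) H}"
  using assms that by (simp add: removed_def Let_def)

lemma cub_removed [simp]: "cub (removed c M \<phi> D) = D"
  by (simp add: removed_def Let_def)

lemma lab_removed:
  assumes V: "V \<in> nodes D"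
  shows "lab (removed c M \<phi> D) V = \<phi> V \<or> promoted D V"
proof (cases "F1_graph c (raw D) \<or> F2_graph c (raw ` M) (raw D)")
  case True
  show ?thesis unfolding promoted_def removed_F[OF True] using V by (simp add: lab_relabel level_def)
next
  case False
  obtain X1 X2 where X: "removed c M \<phi> D = relabel X2 1 (relabel X1 1 (raw D))"
    "X1 = level c (raw D) \<inter> \<Union>{H. T1_subgraph c (raw D) H}"
    "X2 = level c (relabel X1 1 (raw D)) \<inter> \<Union>{H. T2_subgraph c (relabel X1 1 (raw D)) H}"
    by (rule removed_T[OF False])
  have "\<phi> V = c" if "V \<in> X1" using that X(2) by (simp add: level_def)
  moreover have "\<phi> V = c" if "V \<in> X2" "V \<notin> X1" using that X(3) by (simp add: level_def lab_relabel)
  ultimately show ?thesis unfolding promoted_def X(1) using V by (auto simp: lab_relabel)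
qed

lemma disp_removed_iff:
  "V \<in> nodes D \<Longrightarrow> V \<in> disp c (removed c M \<phi> D) \<longleftrightarrow> c < \<phi> V \<or> promoted D V"
  using lab_removed[of V D] c by (auto simp: disp_def promoted_def)

text \<open>A node of the level set has two neighbours outside the set and so exactly one inside.
  The level nodes are thus paired by edges, and around each such edge the labels are those of a
  \<open>T_2\<close>-subgraph.\<close>

lemma F1_promoted:
  assumes D: "is_cuboid D" and F1: "F1_graph c (raw D)" and V: "V \<in> nodes D" "\<phi> V = c"
  shows "\<exists>i. promoted D (flip D i V) \<and> (\<forall>j. j \<noteq> i \<longrightarrow> c < \<phi> (flip D j V) \<and> c < \<phi> (flip D j (flip D i V)))"
proof -
  from F1 obtain W where W: "W \<subseteq> nodes D" "\<And>P. P \<in> W \<Longrightarrow> card (nbrs D P - W) = 2"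
    "W \<subseteq> level c (raw D)" "nodes D - W \<subseteq> disp c (raw D)"
    unfolding F1_graph_def by auto
  have one: "\<exists>i. flip D i P \<in> W \<and> (\<forall>j. j \<noteq> i \<longrightarrow> flip D j P \<notin> W)" if P: "P \<in> W" for P
  proof -
    have n: "P \<in> nodes D" using P W by auto
    have nb: "nbrs D P = range (\<lambda>i. flip D i P)" by (rule nbrs_eq[OF D n])
    have inj: "inj (\<lambda>i. flip D i P)" using flip_inj[OF D n] by (auto simp: inj_def)
    have c3: "card (nbrs D P) = 3" unfolding nb using card_image[OF inj] by simp
    have "\<exists>i. flip D i P \<in> W"
    proof (rule ccontr)
      assume "\<nexists>i. flip D i P \<in> W"
      then have "nbrs D P \<inter> W = {}" unfolding nb by auto
      then have "nbrs D P - W = nbrs D P" by (rule Diff_triv)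
      then show False using c3 W(2)[OF P] by simp
    qed
    then obtain i where i: "flip D i P \<in> W" by blast
    moreover have "flip D j P \<notin> W" if "j \<noteq> i" for j
    proof
      assume j: "flip D j P \<in> W"
      have "nbrs D P - W \<subseteq> nbrs D P - {flip D i P, flip D j P}" using i j by blast
      moreover have "card (nbrs D P - {flip D i P, flip D j P}) = 3 - 2"
        using c3 nb flip_inj[OF D n] that by (subst card_Diff_subset) auto
      moreover have "finite (nbrs D P)" using c3 by (simp add: card_ge_0_finite)
      ultimately have "card (nbrs D P - W) \<le> 1" by (metis card_mono finite_Diff diff_numeral_special(9) numeral_3_eq_3 numeral_2_eq_2 One_nat_def diff_Suc_Suc diff_zero)
      then show False using W(2)[OF P] by simp
    qed
    ultimately show ?thesis by blast
  qed
  have VW: "V \<in> W" using V W(4) by (auto simp: disp_def)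
  obtain i where i: "flip D i V \<in> W" "\<And>j. j \<noteq> i \<Longrightarrow> flip D j V \<notin> W" using one[OF VW] by blast
  obtain i' where i': "\<And>j. j \<noteq> i' \<Longrightarrow> flip D j (flip D i V) \<notin> W" using one[OF i(1)] by blast
  \<comment> \<open>The only level neighbour of \<open>flip D i V\<close> is \<open>V\<close>
    itself.\<close>
  have "i' = i" using i'[of i] VW by auto
  have "removed c M \<phi> D = relabel (level c (raw D)) 1 (raw D)" using F1 by (intro removed_F) simp
  then have "promoted D (flip D i V)" using i(1) W(1,3) by (auto simp: promoted_def lab_relabel level_def)
  moreover have "c < \<phi> U" if "U \<in> nodes D" "U \<notin> W" for U using W(4) that by (auto simp: disp_def)
  ultimately show ?thesis using i(2) i' \<open>i' = i\<close> V(1) by (intro exI[of _ i]) auto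
qed

lemma F2_promoted:
  assumes D: "D \<in> M" and F2: "F2_graph c (raw ` M) (raw D)" and V: "V \<in> nodes D" "\<phi> V = c"
  shows "\<exists>r. F2_at D r V"
proof -
  have cD: "is_cuboid D" using M D mesh_cuboid by blast
  from F2 obtain D' where D': "D' \<in> M" "face_neighbors D D'"
    "nodes D \<inter> nodes D' \<subseteq> level c (raw D)" "nodes D - nodes D' \<subseteq> disp c (raw D)" "nodes D' - nodes D \<subseteq> disp c (raw D')"
    unfolding F2_graph_def by auto
  obtain F where F: "D \<noteq> D'" "F \<in> faces D" "F \<in> faces D'" "nodes D \<inter> nodes D' = F"
    by (rule face_neighborsE[OF M D D'(1,2)])
  have "V \<in> F" using V D'(4) F(4) by (auto simp: disp_def)
  obtain r where r: "F = face D r V" by (rule facesE_at[OF cD F(2) \<open>V \<in> F\<close>])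
  have "F2_at D r V"
    unfolding F2_at_def
  proof (intro conjI ballI impI bexI[of _ D'])
    fix U assume U: "U \<in> nodes D" 
    { assume "U $ r = V $ r"
      then have "U \<in> F" using U r by (simp add: face_def)
      then show "\<phi> U = c" using D'(3) F(4) by (auto simp: level_def) }
    { assume "U $ r \<noteq> V $ r"
      then have "U \<notin> F" using r by (simp add: face_def)
      then show "c < \<phi> U" using D'(4) F(4) U by (auto simp: disp_def) }
  next
    fix U assume "U \<in> nodes D' - nodes D"
    then show "c < \<phi> U" using D'(5) by (auto simp: disp_def)
  qed (use F r D' in auto)
  then show ?thesis by blast
qed

lemma F2_at_promoted:
  assumes D: "D \<in> M" "P \<in> nodes D" and F2: "F2_at D r P" and V: "V \<in> nodes D" "\<phi> V = c"
  shows "promoted D V"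
proof -
  have cD: "is_cuboid D" using M D mesh_cuboid by blast
  from F2 obtain D' where D': "D' \<in> M" "D' \<noteq> D" "face D r P \<subseteq> nodes D'" "\<forall>V \<in> nodes D' - nodes D. c < \<phi> V"
    by (auto simp: F2_at_def)
  note cf = common_face[OF M D(1) D'(1) D'(2)[symmetric] face_in_faces[OF D(2)] D'(3)]
  have "F2_graph c (raw ` M) (raw D)"
    unfolding F2_graph_def
  proof (intro bexI[of _ "raw D'"] conjI)
    show "nodes (cub (raw D)) \<inter> nodes (cub (raw D')) \<subseteq> level c (raw D) \<inter> level c (raw D')"
      using cf(2) F2 by (auto simp: level_def F2_at_def face_def)
    show "nodes (cub (raw D)) - nodes (cub (raw D')) \<subseteq> disp c (raw D)"
      using cf(2) F2 by (auto simp: disp_def F2_at_def face_def)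
    show "nodes (cub (raw D')) - nodes (cub (raw D)) \<subseteq> disp c (raw D')"
      using D'(4) by (auto simp: disp_def)
  qed (use cf(4) D' in auto)
  then have "removed c M \<phi> D = relabel (level c (raw D)) 1 (raw D)" by (intro removed_F) simp
  then show ?thesis using V by (simp add: promoted_def lab_relabel level_def)
qed

text \<open>The three local shapes of a relabeled node: an isolated node (\<open>T_1\<close>), a
  level edge relabeled as a whole (\<open>T_2\<close> or \<open>F_1\<close>), or a level face
  (\<open>F_2\<close>). The later arguments see the order of the removals only through this
  list.\<close>

lemma promoted_cases:
  assumes D: "D \<in> M" and V: "promoted D V"
  shows "(\<forall>i. c < \<phi> (flip D i V)) \<or>
    (\<exists>i. promoted D (flip D i V) \<and> (\<forall>j. j \<noteq> i \<longrightarrow> c < \<phi> (flip D j V) \<and> c < \<phi> (flip D j (flip D i V)))) \<or>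
    (\<exists>r. F2_at D r V)"
proof -
  have cD: "is_cuboid D" using M D mesh_cuboid by blast
  have n: "V \<in> nodes D" and Vc: "\<phi> V = c" using V by (auto simp: promoted_def)
  consider "F1_graph c (raw D)" | "F2_graph c (raw ` M) (raw D)"
    | "\<not> (F1_graph c (raw D) \<or> F2_graph c (raw ` M) (raw D))" by blast
  then show ?thesis
  proof cases
    case 1 then show ?thesis using F1_promoted[OF cD 1 n Vc] by blast
  next
    case 2 then show ?thesis using F2_promoted[OF D 2 n Vc] by blast
  next
    case 3
    obtain X1 X2 where X: "removed c M \<phi> D = relabel X2 1 (relabel X1 1 (raw D))"
      "X1 = level c (raw D) \<inter> \<Union>{H. T1_subgraph c (raw D) H}"
      "X2 = level c (relabel X1 1 (raw D)) \<inter> \<Union>{H. T2_subgraph c (relabel X1 1 (raw D)) H}"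
      by (rule removed_T[OF 3])
    have T1: "\<forall>i. c < \<phi> (flip D i U)" if "U \<in> X1" for U
    proof -
      from that X(2) obtain H P where H: "U \<in> level c (raw D)" "U \<in> H" "P \<in> level c (raw D)"
        "H = insert P (nbrs D P)" "nbrs D P \<subseteq> disp c (raw D)" unfolding T1_subgraph_def by auto
      have "U \<notin> disp c (raw D)" using H(1) by (auto simp: level_def disp_def)
      then have "U = P" using H by auto
      moreover have "P \<in> nodes D" using H(3) by (simp add: level_def)
      ultimately show ?thesis using H(5) nbrs_eq[OF cD, of P] by (auto simp: disp_def)
    qed
    let ?G = "relabel X1 1 (raw D)"
    have "V \<in> X1 \<or> V \<in> X2" using V Vc c unfolding promoted_def X(1) by (auto simp: lab_relabel split: if_splits)
    then show ?thesis
    proof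
      assume "V \<in> X1"
      then show ?thesis using T1 by blast
    next
      assume VX: "V \<in> X2"
      then obtain H where H1: "T2_subgraph c ?G H" "V \<in> level c ?G" "V \<in> H" unfolding X(3) by blast
      from H1(1) obtain P Q where PQ: "P \<in> level c ?G" "Q \<in> level c ?G"
        "incident D P Q" "nbrs D P \<union> nbrs D Q \<subseteq> H" "H - {P, Q} \<subseteq> disp c ?G"
        unfolding T2_subgraph_def by auto
      note H = H1 PQ
      have "V \<notin> disp c ?G" using H(2) by (auto simp: level_def disp_def)
      then have "V = P \<or> V = Q" using H(3,8) by blast
      then have "\<exists>U. U \<in> level c ?G \<and> incident D V U \<and> nbrs D V \<union> nbrs D U \<subseteq> H \<and> H - {V, U} \<subseteq> disp c ?G"
      proof
        assume "V = P" then show ?thesis using H(4-8) by blast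
      next
        assume VQ: "V = Q"
        have "H - {V, P} \<subseteq> disp c ?G" using H(8) VQ by blast
        then show ?thesis using H(4,6,7) VQ incident_sym[of D P Q] by (intro exI[of _ P]) blast
      qed
      then obtain U where U: "U \<in> level c ?G" "incident D V U" "nbrs D V \<union> nbrs D U \<subseteq> H" "H - {V, U} \<subseteq> disp c ?G"
        by blast
      have lev: "W \<notin> X1 \<and> \<phi> W = c" if "W \<in> level c ?G" for W
        using that c by (auto simp: level_def lab_relabel split: if_splits)
      obtain i where i: "U = flip D i V" using U(2) cD by (auto simp: incident_iff)
      have nU: "U \<in> nodes D" using i n by simp
      have UH: "U \<in> H" using U(2,3) by (auto simp: in_nbrs)
      then have "U \<in> X2" unfolding X(3) using H(1) U(1) by blast
      then have "promoted D U" using nU lev[OF U(1)] unfolding promoted_def X(1) by (simp add: lab_relabel)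
      moreover have d: "c < \<phi> (flip D j W)" if W: "W = V \<or> W = U" and j: "j \<noteq> i" for W j
      proof -
        have nW: "W \<in> nodes D" using W n nU by auto
        have "flip D j W \<in> H" using U(3) W nbrs_eq[OF cD nW] by auto
        moreover have "flip D j W \<noteq> W" by (rule flip_neq[OF cD nW])
        moreover have "flip D j W \<noteq> flip D i W" using flip_inj[OF cD nW] j by simp
        moreover have "W = V \<and> U = flip D i W \<or> W = U \<and> V = flip D i W" using W i by auto
        ultimately have dG: "flip D j W \<in> disp c ?G" using U(4) by blast
        \<comment> \<open>The \<open>T_2\<close>-subgraphs are sought after the
          \<open>T_1\<close>-nodes have been raised. A raised neighbour of \<open>W\<close> would
          have only neighbours with label above \<open>c\<close>, but \<open>W\<close> has label
          \<open>c\<close>.\<close>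
        have "flip D j W \<notin> X1"
        proof
          assume "flip D j W \<in> X1"
          from T1[OF this] have "c < \<phi> (flip D j (flip D j W))" by blast
          then show False using W lev[OF H(2)] lev[OF U(1)] by auto
        qed
        then show ?thesis using dG by (simp add: disp_def lab_relabel)
      qed
      ultimately show ?thesis unfolding i[symmetric] using i by (intro disjI2 disjI1 exI[of _ i]) auto
    qed
  qed
qed

text \<open>In each shape a neighbour has a label above \<open>c\<close> or is relabeled together
  with \<open>V\<close>.\<close>

lemma promoted_nbr:
  assumes D: "D \<in> M" and V: "promoted D V" and U: "incident D V U"
  shows "U \<in> disp c (removed c M \<phi> D)"
proof -
  have cD: "is_cuboid D" using M D mesh_cuboid by blast
  obtain j where j: "U = flip D j V" using U cD by (auto simp: incident_iff)
  have n: "V \<in> nodes D" "U \<in> nodes D" using incident_nodes[OF U] by auto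
  from promoted_cases[OF D V] show ?thesis
  proof (elim disjE exE conjE)
    assume "\<forall>i. c < \<phi> (flip D i V)"
    then show ?thesis using disp_removed_iff[OF n(2)] j by simp
  next
    fix i assume a: "promoted D (flip D i V)" "\<forall>j. j \<noteq> i \<longrightarrow> c < \<phi> (flip D j V) \<and> c < \<phi> (flip D j (flip D i V))"
    then show ?thesis using disp_removed_iff[OF n(2)] j by (cases "j = i") auto
  next
    fix r assume F: "F2_at D r V"
    then have "\<phi> U = c \<or> c < \<phi> U" using n(2) by (auto simp: F2_at_def)
    then show ?thesis using disp_removed_iff[OF n(2)] F2_at_promoted[OF D n(1) F n(2)] by blast
  qed
qed

text \<open>Next to a continuous node, being disperse is decided by \<open>\<phi>\<close> alone and
  so does not depend on the cuboid.\<close>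

lemma disp_removed_nbr:
  assumes "D \<in> M" "incident D V U" "U \<notin> disp c (removed c M \<phi> D)"
  shows "V \<in> disp c (removed c M \<phi> D) \<longleftrightarrow> c < \<phi> V" "\<not> promoted D V"
  using promoted_nbr[OF assms(1) _ assms(2)] disp_removed_iff[of V D] incident_nodes[OF assms(2)] assms(3) by blast+

lemma mixed_removedD:
  assumes "D \<in> M" "(P, Q) \<in> mixed c (removed c M \<phi> D)"
  shows "incident D P Q" "\<phi> P \<le> c" "c < \<phi> Q" "lab (removed c M \<phi> D) P = \<phi> P" "lab (removed c M \<phi> D) Q = \<phi> Q"
    "P \<in> nodes D" "Q \<in> nodes D" "P \<notin> disp c (removed c M \<phi> D)" "Q \<in> disp c (removed c M \<phi> D)"
proof -
  note m = assms(2)[unfolded mixed_iff cub_removed]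
  show i: "incident D P Q" and P: "P \<notin> disp c (removed c M \<phi> D)" and Q: "Q \<in> disp c (removed c M \<phi> D)" using m by auto
  show n: "P \<in> nodes D" "Q \<in> nodes D" using incident_nodes[OF i] by auto
  have "\<not> promoted D P" using disp_removed_iff[OF n(1)] P by blast
  then show lP: "lab (removed c M \<phi> D) P = \<phi> P" using lab_removed[OF n(1)] by blast
  have Q': "\<not> promoted D Q" "c < \<phi> Q"
    using disp_removed_nbr[OF assms(1) _ P, of Q] i Q by (auto simp: incident_sym)
  then show "c < \<phi> Q" "lab (removed c M \<phi> D) Q = \<phi> Q" using lab_removed[OF n(2)] by blast+
  show "\<phi> P \<le> c" using disp_removed_iff[OF n(1)] P by force
qed

text \<open>\<open>iso_pt\<close> reads only labels, so the cuboid \<open>E\<close> is free; one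
  function can thus describe the iso-points of all graphs.\<close>

lemma iso_pt_removed:
  assumes "D \<in> M" "(P, Q) \<in> mixed c (removed c M \<phi> D)"
  shows "iso_pt c (removed c M \<phi> D) (P, Q) = iso_pt c (raw E) (P, Q)"
  using mixed_removedD(4,5)[OF assms] by (simp add: iso_pt_def)

text \<open>Only the \<open>F_2\<close>-shape admits two neighbours with label at most
  \<open>c\<close>, and then the face spanned by them is the level face.\<close>

lemma promoted_two_nbrs:
  assumes D: "D \<in> M" and V: "promoted D V" and q: "quad D F V P A Q" and PQ: "\<phi> P \<le> c" "\<phi> Q \<le> c"
  shows "\<phi> A = c"
proof -
  have cD: "is_cuboid D" using M D mesh_cuboid by blast
  note qd = quadD[OF q]
  obtain j k where jk: "P = flip D j V" "Q = flip D k V" using qd cD by (auto simp: incident_iff)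
  then have "j \<noteq> k" using qd by auto
  from promoted_cases[OF D V] show ?thesis
  proof (elim disjE exE conjE)
    assume "\<forall>i. c < \<phi> (flip D i V)"
    then show ?thesis using PQ jk by (metis not_less)
  next
    fix i assume a: "\<forall>j. j \<noteq> i \<longrightarrow> c < \<phi> (flip D j V) \<and> c < \<phi> (flip D j (flip D i V))"
    have "j = i" "k = i" using a PQ jk by (metis not_less)+
    then show ?thesis using \<open>j \<noteq> k\<close> by simp
  next
    fix r assume "F2_at D r V"
    then have r: "U $ r = V $ r \<longleftrightarrow> \<phi> U \<le> c" "\<phi> U \<le> c \<Longrightarrow> \<phi> U = c" if "U \<in> nodes D" for U
      using that unfolding F2_at_def by fastforce+
    have "P $ r = V $ r" "Q $ r = V $ r" using r PQ qd by auto
    then have "r \<noteq> j" "r \<noteq> k" using jk flip_nth_neq[OF cD qd(21)] by auto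
    obtain i where i: "F = face D i V" using facesE_at[OF cD qd(1), of V] qd(2) by blast
    have "P \<in> face D i V" "Q \<in> face D i V" using qd(2) i by auto
    then have "P $ i = V $ i" "Q $ i = V $ i" by (auto simp: face_def)
    then have "i \<noteq> j" "i \<noteq> k" using jk flip_nth_neq[OF cD qd(21)] by auto
    have "i = r"
    proof -
      obtain l where l: "\<forall>P. (\<forall>l. P l) \<longleftrightarrow> P j \<and> P k \<and> P l" by (rule third_axis[OF \<open>j \<noteq> k\<close>])
      have "\<forall>m. m = j \<or> m = k \<or> m = l" unfolding l[rule_format] by simp
      then show ?thesis using \<open>r \<noteq> j\<close> \<open>r \<noteq> k\<close> \<open>i \<noteq> j\<close> \<open>i \<noteq> k\<close> by metis
    qed
    have "A \<in> face D i V" using qd(2) i by auto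
    then show ?thesis using r[of A] qd \<open>i = r\<close> by (auto simp: face_def)
  qed
qed

text \<open>The level neighbour along \<open>i\<close> excludes the \<open>T_1\<close>-shape. In the
  edge shape the relabeled edge is this one; in the face shape the level face contains the edge, so
  its normal is \<open>j\<close> or \<open>k\<close>.\<close>

lemma promoted_edge:
  assumes D: "D \<in> M" and P: "promoted D P" and Q: "\<phi> (flip D i P) = c" and ax: "j \<noteq> i" "k \<noteq> i" "k \<noteq> (j :: 3)"
  shows "(c < \<phi> (flip D j P) \<and> c < \<phi> (flip D j (flip D i P)) \<and> c < \<phi> (flip D k P) \<and> c < \<phi> (flip D k (flip D i P))) \<or>
    F2_at D j P \<or> F2_at D k P"
proof -
  have cD: "is_cuboid D" using M D mesh_cuboid by blast
  have n: "P \<in> nodes D" using P by (simp add: promoted_def)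
  from promoted_cases[OF D P] show ?thesis
  proof (elim disjE exE conjE)
    assume "\<forall>i. c < \<phi> (flip D i P)"
    then show ?thesis using Q by (metis less_irrefl)
  next
    fix i' assume a: "\<forall>j. j \<noteq> i' \<longrightarrow> c < \<phi> (flip D j P) \<and> c < \<phi> (flip D j (flip D i' P))"
    have "i = i'" using a Q by (metis less_irrefl)
    then show ?thesis using a ax by auto
  next
    fix r assume F: "F2_at D r P"
    have "r \<noteq> i"
    proof
      assume "r = i"
      then have "c < \<phi> (flip D i P)" using F n flip_nth_neq[OF cD n, of i] by (simp add: F2_at_def)
      then show False using Q by simp
    qed
    moreover obtain k' where k': "\<forall>P. (\<forall>l. P l) \<longleftrightarrow> P i \<and> P j \<and> P k'" by (rule third_axis[OF ax(1)[symmetric]])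
    have "\<forall>m. m = i \<or> m = j \<or> m = k'" unfolding k'[rule_format] by simp
    then have "\<forall>m. m = i \<or> m = j \<or> m = k" using ax by metis
    ultimately show ?thesis using F by metis
  qed
qed

end

lemma quad_separation:
  assumes D: "is_cuboid D" and q: "quad D F A P B Q"
  obtains w r where "w \<bullet> A < r" "w \<bullet> P = r" "w \<bullet> Q = r" "r < w \<bullet> B"
proof -
  note qd = quadD[OF q]
  obtain j k where jk: "P = flip D j A" "Q = flip D k A" using qd(9,16) D by (auto simp: incident_iff)
  have ne: "j \<noteq> k" using jk qd(7) by auto
  obtain i where i: "F = face D i A" using facesE_at[OF D qd(1), of A] qd(2) by blast
  have "P \<in> face D i A" "Q \<in> face D i A" using qd(2) i by auto
  then have ij: "j \<noteq> i" "k \<noteq> i" using jk flip_nth_neq[OF D qd(21)] by (auto simp: face_def)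
  have "face D i A = {A, flip D j A, flip D j (flip D k A), flip D k A}"
    by (rule face_eq4[OF D qd(21) ij]) (use ne in simp)
  then have "B \<in> {A, flip D j A, flip D j (flip D k A), flip D k A}" using qd(2) i by auto
  then have B: "B = flip D j (flip D k A)" using qd(4,6,8) jk by auto
  let ?u = "P - A" and ?v = "Q - A"
  have uv: "?u \<bullet> ?v = 0"
    unfolding inner_vec_def by (rule sum.neutral) (use ne in \<open>auto simp: jk flip_nth\<close>)
  have BA: "B = A + ?u + ?v" using ne by (auto simp: B jk vec_eq_iff flip_nth)
  have u0: "?u \<bullet> ?u \<noteq> 0" "?v \<bullet> ?v \<noteq> 0" using qd by auto
  \<comment> \<open>The edge vectors at \<open>A\<close> are orthogonal, and \<open>w\<close> is
    scaled to have inner product 1 with both. So it is constant on the diagonal \<open>P\<close>,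
    \<open>Q\<close>, one unit above its value at \<open>A\<close> and one below its value at
    \<open>B\<close>.\<close>
  define w where "w = (1 / (?u \<bullet> ?u)) *\<^sub>R ?u + (1 / (?v \<bullet> ?v)) *\<^sub>R ?v"
  have wu: "w \<bullet> ?u = 1" "w \<bullet> ?v = 1"
    using u0 uv by (simp_all add: w_def inner_add_left inner_commute[of ?v ?u])
  have "w \<bullet> P = w \<bullet> A + 1" "w \<bullet> Q = w \<bullet> A + 1" using wu by (simp_all add: inner_diff_right)
  moreover have "w \<bullet> B = w \<bullet> A + 2" unfolding BA inner_add_right wu by simp
  ultimately show ?thesis using that[of w "w \<bullet> A + 1"] by simp
qed

lemma segment_inner_less:
  fixes w x y z :: pt
  assumes "x \<in> closed_segment y z" "w \<bullet> y < r" "w \<bullet> z < r"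
  shows "w \<bullet> x < r"
proof -
  have "closed_segment y z \<subseteq> {x. w \<bullet> x < r}"
    by (rule closed_segment_subset) (use assms convex_halfspace_lt in auto)
  then show ?thesis using assms(1) by blast
qed

lemma segment_inner_le:
  fixes w x y z :: pt
  assumes "x \<in> closed_segment y z" "w \<bullet> y \<le> r" "w \<bullet> z \<le> r"
  shows "w \<bullet> x \<le> r" "w \<bullet> x = r \<Longrightarrow> x = y \<and> w \<bullet> y = r \<or> x = z \<and> w \<bullet> z = r \<or> w \<bullet> y = r \<and> w \<bullet> z = r"
proof -
  have "closed_segment y z \<subseteq> {x. w \<bullet> x \<le> r}"
    by (rule closed_segment_subset) (use assms convex_halfspace_le in auto)
  then show "w \<bullet> x \<le> r" using assms(1) by blast
  assume e: "w \<bullet> x = r"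
  obtain u where u: "0 \<le> u" "u \<le> 1" "x = (1 - u) *\<^sub>R y + u *\<^sub>R z" using assms(1) by (auto simp: in_segment)
  have "(1 - u) * (r - w \<bullet> y) + u * (r - w \<bullet> z) = 0" using e by (simp add: u(3) inner_add_right algebra_simps)
  moreover have "0 \<le> (1 - u) * (r - w \<bullet> y)" "0 \<le> u * (r - w \<bullet> z)" using u assms by auto
  ultimately have "(1 - u) * (r - w \<bullet> y) = 0" "u * (r - w \<bullet> z) = 0" by linarith+
  then have "(u = 1 \<or> w \<bullet> y = r) \<and> (u = 0 \<or> w \<bullet> z = r)" by auto
  then show "x = y \<and> w \<bullet> y = r \<or> x = z \<and> w \<bullet> z = r \<or> w \<bullet> y = r \<and> w \<bullet> z = r" using u(3) by auto
qed

section \<open>Iso-points in terms of the labels of the mesh\<close>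

context graph_system
begin

lemma graph_eq: "graph = removed c M \<phi>"
  by (rule ext) (simp add: graph_def)

lemma cub_graph [simp]: "cub (graph D) = D"
  by (simp add: graph_def removed_def Let_def)

lemma system_M: "D \<in> system \<Longrightarrow> D \<in> M"
  by (simp add: system_def system_of_cuboids_def)

lemma C_system: "C \<in> system"
  using mesh(2) by (simp add: system_def system_of_cuboids_def)

lemma cuboid_M: "D \<in> M \<Longrightarrow> is_cuboid D"
  using mesh(1) by (rule mesh_cuboid)

text \<open>One iso-point function for all cuboids; the cuboid in the record only fills the
  field.\<close>

definition ip :: "pt \<times> pt \<Rightarrow> pt" where "ip = iso_pt c \<lparr>cub = C, lab = \<phi>\<rparr>"

abbreviation seg :: "pt \<times> pt \<Rightarrow> pt \<times> pt \<Rightarrow> pt set" where "seg a b \<equiv> closed_segment (ip a) (ip b)"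

abbreviation mx :: "cuboid \<Rightarrow> (pt \<times> pt) set" where "mx D \<equiv> mixed c (graph D)"

abbreviation dsp :: "cuboid \<Rightarrow> pt set" where "dsp D \<equiv> disp c (graph D)"

abbreviation Lf :: "cuboid \<Rightarrow> pt set set" where "Lf D \<equiv> L_faces c (graph D)"

lemma Lf_eq: "D \<in> M \<Longrightarrow> Lf D = alternating_faces D (dsp D)"
  using L_faces_eq[of "graph D" c] cuboid_M by simp

lemma mxD:
  assumes "D \<in> M" "(P, Q) \<in> mx D"
  shows "incident D P Q" "\<phi> P \<le> c" "c < \<phi> Q" "lab (graph D) P = \<phi> P" "lab (graph D) Q = \<phi> Q"
    "P \<in> nodes D" "Q \<in> nodes D" "P \<notin> dsp D" "Q \<in> dsp D" "incident D Q P" "P \<noteq> Q"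
  using mixed_removedD[OF iso_level mesh(1) assms(1), of P Q] assms(2) unfolding graph_eq
  by (auto simp: incident_sym)

lemma iso_pt_graph: "D \<in> M \<Longrightarrow> a \<in> mx D \<Longrightarrow> iso_pt c (graph D) a = ip a"
  using iso_pt_removed[OF iso_level mesh(1), where D = D and P = "fst a" and Q = "snd a" and E = C]
  unfolding graph_eq ip_def by simp

lemma mxI: "incident D P Q \<Longrightarrow> P \<notin> dsp D \<Longrightarrow> Q \<in> dsp D \<Longrightarrow> (P, Q) \<in> mx D"
  by (simp add: mixed_iff)

lemma dsp_nbr:
  assumes "D \<in> M" "incident D V U" "U \<notin> dsp D"
  shows "V \<in> dsp D \<longleftrightarrow> c < \<phi> V"
  using disp_removed_nbr(1)[OF iso_level mesh(1) assms(1,2)] assms(3) unfolding graph_eq .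

lemma ip_level: "\<phi> P = c \<Longrightarrow> ip (P, A) = P"
  by (simp add: ip_def iso_pt_def)

lemma ip_param:
  assumes "\<phi> P \<le> c" "c < \<phi> A"
  obtains t where "0 \<le> t" "t < 1" "ip (P, A) = P + t *\<^sub>R (A - P)" "t = 0 \<longleftrightarrow> \<phi> P = c"
proof -
  define t where "t = (c - \<phi> P) / (\<phi> A - \<phi> P)"
  have "0 \<le> t" "t < 1" "t = 0 \<longleftrightarrow> \<phi> P = c" using assms by (auto simp: t_def)
  then show ?thesis using that by (simp add: ip_def iso_pt_def t_def)
qed

lemma car_ip:
  assumes "D \<in> M" "(P, A) \<in> mx D"
  shows "\<phi> P < c \<Longrightarrow> car D (ip (P, A)) = {P, A}" "\<phi> P = c \<Longrightarrow> car D (ip (P, A)) = {P}"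
proof -
  have cD: "is_cuboid (cub (graph D))" using cuboid_M[OF assms(1)] by simp
  note m = mxD[OF assms]
  show "\<phi> P < c \<Longrightarrow> car D (ip (P, A)) = {P, A}"
    using car_iso_strict[OF cD assms(2)] m(4) iso_pt_graph[OF assms] by simp
  show "\<phi> P = c \<Longrightarrow> car D (ip (P, A)) = {P}"
    using car_iso_level[OF assms(2)] m(4) iso_pt_graph[OF assms] by simp
qed

lemma ip_body: "D \<in> M \<Longrightarrow> a \<in> mx D \<Longrightarrow> ip a \<in> body D"
  using iso_body[of "graph D" "fst a" "snd a" c] cuboid_M iso_pt_graph[of D a] by simp

lemma seg_body: "D \<in> M \<Longrightarrow> a \<in> mx D \<Longrightarrow> b \<in> mx D \<Longrightarrow> seg a b \<subseteq> body D"
  by (intro body_segment ip_body)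

lemma ip_eqD:
  assumes "D \<in> M" "(P, Q) \<in> mx D" "(P', Q') \<in> mx D" "ip (P, Q) = ip (P', Q')"
  shows "P = P' \<and> (Q = Q' \<or> \<phi> P = c)"
proof -
  have "P = P' \<and> (Q = Q' \<or> lab (graph D) P = c)"
  proof (rule iso_eqD[OF _ assms(2,3)])
    show "iso_pt c (graph D) (P, Q) = iso_pt c (graph D) (P', Q')"
      unfolding iso_pt_graph[OF assms(1,2)] iso_pt_graph[OF assms(1,3)] by (rule assms(4))
  qed (simp add: cuboid_M[OF assms(1)])
  then show ?thesis unfolding mxD(4)[OF assms(1,2)] .
qed

text \<open>The cases are iso-node, strict iso-point, interior of a face, and interior of a level
  edge. In the last three the carrier of \<open>x\<close> is known, so two lines through
  \<open>x\<close> can be compared even if they belong to different cuboids.\<close>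

lemma line_cases:
  assumes D: "D \<in> M" and m: "(P, A) \<in> mx D" "(P', A') \<in> mx D"
    and F: "F \<in> faces D" "{P, A, P', A'} \<subseteq> F" and ne: "ip (P, A) \<noteq> ip (P', A')"
    and x: "x \<in> seg (P, A) (P', A')"
  obtains (n) U where "U = P \<or> U = P'" "\<phi> U = c" "x = U"
    | (s) U V where "(U, V) = (P, A) \<or> (U, V) = (P', A')" "\<phi> U < c" "x = ip (U, V)" "car D x = {U, V}"
    | (f) "car D x = F"
    | (e) "\<phi> P = c" "\<phi> P' = c" "incident D P P'" "car D x = {P, P'}"
proof -
  note i = iso_pt_graph[OF D m(1)] iso_pt_graph[OF D m(2)]
  note l = mxD[OF D m(1)] mxD[OF D m(2)]
  have cD: "is_cuboid (cub (graph D))" using cuboid_M[OF D] by simp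
  have F': "F \<in> faces (cub (graph D))" using F by simp
  have "x = ip (P, A) \<or> x = ip (P', A') \<or> car D x = F \<or> (\<phi> P = c \<and> \<phi> P' = c \<and> incident D P P' \<and> car D x = {P, P'})"
    using line_point_cases[OF cD m F' F(2), unfolded i l cub_graph, OF ne x] .
  then show ?thesis
  proof (elim disjE conjE)
    assume x: "x = ip (P, A)"
    show ?thesis
    proof (cases "\<phi> P = c")
      case True
      then show ?thesis using n[of P] ip_level[OF True, of A] x by simp
    next
      case False
      then have "\<phi> P < c" using l(2) by simp
      then show ?thesis using s[of P A] car_ip(1)[OF D m(1)] x by simp
    qed
  next
    assume x: "x = ip (P', A')"
    show ?thesis
    proof (cases "\<phi> P' = c")
      case True
      then show ?thesis using n[of P'] ip_level[OF True, of A'] x by simp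
    next
      case False
      then have "\<phi> P' < c" using l(13) by simp
      then show ?thesis using s[of P' A'] car_ip(1)[OF D m(2)] x by simp
    qed
  next
    assume "car D x = F" then show ?thesis by (rule f)
  next
    assume "\<phi> P = c" "\<phi> P' = c" "incident D P P'" "car D x = {P, P'}"
    then show ?thesis by (rule e)
  qed
qed

section \<open>Inner iso-paths of the system\<close>

text \<open>\<open>W\<close> records only polygons; a partition of the mixed edges that induces them
  is fixed here once for each cuboid.\<close>

definition KK :: "cuboid \<Rightarrow> ((pt \<times> pt) set \<times> pt set) set" where
  "KK D = (SOME \<K>. class_struct c (graph D) (W D) \<K>)"

abbreviation ln :: "cuboid \<Rightarrow> (pt \<times> pt) set \<Rightarrow> pt set set" where "ln D K \<equiv> cls c (graph D) K"

lemma inner_graph: "D \<in> system \<Longrightarrow> inner_iso_paths c (graph ` M) (graph D) (W D)"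
  using inner[of D] by (simp add: graph_eq system_def)

lemma KK_struct:
  assumes "D \<in> system" "regular D"
  shows "class_struct c (graph D) (W D) (KK D)"
proof -
  have "\<exists>\<K>. class_struct c (graph D) (W D) \<K>"
    using class_struct_exists[OF _ iso_level _ inner_graph[OF assms(1)]] assms(2)
      cuboid_M[OF system_M[OF assms(1)]] by (simp add: regular_def)
  then show ?thesis unfolding KK_def by (rule someI_ex)
qed

lemma KK_facts:
  assumes "D \<in> system" "regular D"
  shows "W D = (\<lambda>(K, S). (ln D K, S)) ` KK D" "\<Union> (fst ` KK D) = mx D"
    "\<forall>x\<in>KK D. \<forall>y\<in>KK D. x \<noteq> y \<longrightarrow> fst x \<inter> fst y = {}"
proof -
  note st = KK_struct[OF assms, unfolded class_struct_def]
  show "W D = (\<lambda>(K, S). (ln D K, S)) ` KK D" using st by (elim conjE)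
  show "\<Union> (fst ` KK D) = mx D" using st by (elim conjE)
  show "\<forall>x\<in>KK D. \<forall>y\<in>KK D. x \<noteq> y \<longrightarrow> fst x \<inter> fst y = {}" using st by (elim conjE)
qed

lemma regular_mx:
  assumes "D \<in> system" "a \<in> mx D"
  shows "regular D"
proof -
  obtain P A where a: "a = (P, A)" by (cases a)
  note m = mixedD(2,3)[OF assms(2)[unfolded a]]
  have "singular_free c (graph D)" "isolated_free c (graph ` M) (graph D)"
    using free[of D] assms(1) by (simp_all add: graph_eq system_def)
  then show ?thesis using m unfolding regular_def regular_graph_def by blast
qed

definition is_class :: "cuboid \<Rightarrow> (pt \<times> pt) set \<Rightarrow> pt set \<Rightarrow> bool" where
  "is_class D K S \<longleftrightarrow> D \<in> system \<and> regular D \<and> (K, S) \<in> KK D"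

abbreviation pth :: "cuboid \<Rightarrow> (pt \<times> pt) set \<Rightarrow> pt set \<Rightarrow> iso_path" where
  "pth D K S \<equiv> Inner D (ln D K) S"

lemma is_classD:
  assumes "is_class D K S"
  shows "D \<in> system" "D \<in> M" "regular D" "is_cuboid D" "K \<subseteq> mx D" "pth D K S \<in> iso_paths D"
    "pth D K S \<in> system_iso_paths"
proof -
  show D: "D \<in> system" "regular D" using assms by (auto simp: is_class_def)
  then show "D \<in> M" "is_cuboid D" using system_M cuboid_M by auto
  have k: "(K, S) \<in> KK D" using assms by (simp add: is_class_def)
  have "fst (K, S) \<in> fst ` KK D" using k by (rule imageI)
  then show "K \<subseteq> mx D" unfolding KK_facts(2)[OF D, symmetric] by auto
  have "(ln D K, S) \<in> W D" unfolding KK_facts(1)[OF D] using imageI[OF k, of "\<lambda>(K, S). (ln D K, S)"] by simp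
  then show "pth D K S \<in> iso_paths D" unfolding iso_paths_def by blast
  then show "pth D K S \<in> system_iso_paths" using D unfolding system_iso_paths_def by blast
qed

lemma W_classE:
  assumes "D \<in> system" "(L, S) \<in> W D"
  obtains K where "is_class D K S" "L = ln D K"
proof -
  have reg: "regular D"
    using inner_graph[OF assms(1)] assms(2) unfolding inner_iso_paths_def regular_def by (auto split: if_splits)
  obtain K where "(K, S) \<in> KK D" "L = ln D K" using assms(2) unfolding KK_facts(1)[OF assms(1) reg] by auto
  then show ?thesis using that assms(1) reg by (auto simp: is_class_def)
qed

lemma class_ex:
  assumes "D \<in> system" "a \<in> mx D"
  obtains K S where "is_class D K S" "a \<in> K"
proof -
  note reg = regular_mx[OF assms]
  obtain x where "x \<in> KK D" "a \<in> fst x"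
    using assms(2) unfolding KK_facts(2)[OF assms(1) reg, symmetric] by blast
  then show ?thesis using that[of "fst x" "snd x"] assms(1) reg by (simp add: is_class_def)
qed

lemma class_disjoint:
  assumes "is_class D K S" "is_class D K' S'" "a \<in> K" "a \<in> K'"
  shows "K = K'" "S = S'"
proof -
  have k: "(K, S) \<in> KK D" "(K', S') \<in> KK D" and d: "D \<in> system" "regular D"
    using assms by (auto simp: is_class_def)
  have "(K, S) \<noteq> (K', S') \<longrightarrow> fst (K, S) \<inter> fst (K', S') = {}"
    using KK_facts(3)[OF d] k by blast
  then have "(K, S) = (K', S')" using assms(3,4) by auto
  then show "K = K'" "S = S'" by simp_all
qed

lemma class_face:
  assumes k: "is_class D K S" and "F \<in> faces D" "F \<notin> Lf D" "(P, A) \<in> K" "(P', A') \<in> mx D" "{P, A, P', A'} \<subseteq> F"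
  shows "(P', A') \<in> K"
proof -
  have st: "class_struct c (graph D) (W D) (KK D)" using KK_struct k by (simp add: is_class_def)
  have "\<forall>(K, S) \<in> KK D. \<forall>F \<in> faces (cub (graph D)). F \<notin> Lf D \<longrightarrow>
        (\<forall>P A P' A'. (P, A) \<in> K \<longrightarrow> (P', A') \<in> mx D \<longrightarrow> {P, A, P', A'} \<subseteq> F \<longrightarrow> (P', A') \<in> K)"
    using st unfolding class_struct_def by (elim conjE)
  moreover have "(K, S) \<in> KK D" using k by (simp add: is_class_def)
  ultimately show ?thesis using assms(2-) by fastforce
qed

text \<open>The first alternative in \<open>class_struct\<close>: on L-faces the lines go around the
  disperse nodes. \<open>ptype\<close> is the second one, with lines around the continuous
  nodes.\<close>

definition dtype :: "cuboid \<Rightarrow> bool" where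
  "dtype D \<longleftrightarrow> (\<forall>K S. is_class D K S \<longrightarrow> (\<forall>P A. (P, A) \<in> mx D \<longrightarrow> (A \<in> S \<longleftrightarrow> (P, A) \<in> K)) \<and>
     (\<forall>F \<in> Lf D. \<forall>P A P' A'. (P, A) \<in> K \<longrightarrow> (P', A') \<in> K \<longrightarrow> {P, A, P', A'} \<subseteq> F \<longrightarrow> A = A'))"

definition ptype :: "cuboid \<Rightarrow> bool" where
  "ptype D \<longleftrightarrow> 5 \<le> card (dsp D) \<and> (\<forall>K S. is_class D K S \<longrightarrow>
     (\<forall>P A A'. (P, A) \<in> K \<longrightarrow> (P, A') \<in> mx D \<longrightarrow> (P, A') \<in> K) \<and>
     (\<forall>F \<in> Lf D. \<forall>P A P' A'. (P, A) \<in> K \<longrightarrow> (P', A') \<in> K \<longrightarrow> {P, A, P', A'} \<subseteq> F \<longrightarrow> P = P'))"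

lemma types:
  assumes k: "is_class D K S"
  shows "dtype D \<or> ptype D"
proof -
  have st: "class_struct c (graph D) (W D) (KK D)" using KK_struct k by (simp add: is_class_def)
  then have "(\<forall>(K, S) \<in> KK D. (\<forall>P A. (P, A) \<in> mx D \<longrightarrow> A \<in> S \<longleftrightarrow> (P, A) \<in> K) \<and>
         (\<forall>F \<in> Lf D. \<forall>P A P' A'. (P, A) \<in> K \<longrightarrow> (P', A') \<in> K \<longrightarrow> {P, A, P', A'} \<subseteq> F \<longrightarrow> A = A')) \<or>
      5 \<le> card (dsp D) \<and>
      (\<forall>(K, S) \<in> KK D. (\<forall>P A A'. (P, A) \<in> K \<longrightarrow> (P, A') \<in> mx D \<longrightarrow> (P, A') \<in> K) \<and>
         (\<forall>F \<in> Lf D. \<forall>P A P' A'. (P, A) \<in> K \<longrightarrow> (P', A') \<in> K \<longrightarrow> {P, A, P', A'} \<subseteq> F \<longrightarrow> P = P'))"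
    unfolding class_struct_def by (elim conjE)
  then show ?thesis
  proof
    assume a: "\<forall>(K, S) \<in> KK D. (\<forall>P A. (P, A) \<in> mx D \<longrightarrow> A \<in> S \<longleftrightarrow> (P, A) \<in> K) \<and>
         (\<forall>F \<in> Lf D. \<forall>P A P' A'. (P, A) \<in> K \<longrightarrow> (P', A') \<in> K \<longrightarrow> {P, A, P', A'} \<subseteq> F \<longrightarrow> A = A')"
    have "dtype D" unfolding dtype_def
    proof (intro allI impI)
      fix K S assume "is_class D K S"
      then have "(K, S) \<in> KK D" by (simp add: is_class_def)
      from bspec[OF a this] show "(\<forall>P A. (P, A) \<in> mx D \<longrightarrow> (A \<in> S \<longleftrightarrow> (P, A) \<in> K)) \<and>
         (\<forall>F \<in> Lf D. \<forall>P A P' A'. (P, A) \<in> K \<longrightarrow> (P', A') \<in> K \<longrightarrow> {P, A, P', A'} \<subseteq> F \<longrightarrow> A = A')" by simp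
    qed
    then show ?thesis ..
  next
    assume a: "5 \<le> card (dsp D) \<and> (\<forall>(K, S) \<in> KK D. (\<forall>P A A'. (P, A) \<in> K \<longrightarrow> (P, A') \<in> mx D \<longrightarrow> (P, A') \<in> K) \<and>
         (\<forall>F \<in> Lf D. \<forall>P A P' A'. (P, A) \<in> K \<longrightarrow> (P', A') \<in> K \<longrightarrow> {P, A, P', A'} \<subseteq> F \<longrightarrow> P = P'))"
    have "ptype D" unfolding ptype_def
    proof (intro conjI[OF conjunct1[OF a]] allI impI)
      fix K S assume "is_class D K S"
      then have "(K, S) \<in> KK D" by (simp add: is_class_def)
      from bspec[OF conjunct2[OF a] this] show "(\<forall>P A A'. (P, A) \<in> K \<longrightarrow> (P, A') \<in> mx D \<longrightarrow> (P, A') \<in> K) \<and>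
         (\<forall>F \<in> Lf D. \<forall>P A P' A'. (P, A) \<in> K \<longrightarrow> (P', A') \<in> K \<longrightarrow> {P, A, P', A'} \<subseteq> F \<longrightarrow> P = P')" by simp
    qed
    then show ?thesis ..
  qed
qed

lemma dtypeD:
  assumes "dtype D" "is_class D K S"
  shows "(P, A) \<in> mx D \<Longrightarrow> A \<in> S \<longleftrightarrow> (P, A) \<in> K" "(P, A) \<in> K \<Longrightarrow> (P', A) \<in> mx D \<Longrightarrow> (P', A) \<in> K"
    "F \<in> Lf D \<Longrightarrow> (P, A) \<in> K \<Longrightarrow> (P', A') \<in> K \<Longrightarrow> {P, A, P', A'} \<subseteq> F \<Longrightarrow> A = A'"
proof -
  note a = mp[OF spec[OF spec[OF assms(1)[unfolded dtype_def], of K], of S] assms(2)]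
  show 1: "(P, A) \<in> mx D \<Longrightarrow> A \<in> S \<longleftrightarrow> (P, A) \<in> K" for P
    by (rule conjunct1[OF a, rule_format])
  show "(P', A) \<in> K" if m: "(P, A) \<in> K" "(P', A) \<in> mx D"
    using 1[of P] 1[OF m(2)] m(1) subsetD[OF is_classD(5)[OF assms(2)] m(1)] by simp
  show "F \<in> Lf D \<Longrightarrow> (P, A) \<in> K \<Longrightarrow> (P', A') \<in> K \<Longrightarrow> {P, A, P', A'} \<subseteq> F \<Longrightarrow> A = A'"
    by (rule conjunct2[OF a, rule_format])
qed

lemma ptypeD:
  assumes "ptype D" "is_class D K S"
  shows "5 \<le> card (dsp D)" "(P, A) \<in> K \<Longrightarrow> (P, A') \<in> mx D \<Longrightarrow> (P, A') \<in> K"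
    "F \<in> Lf D \<Longrightarrow> (P, A) \<in> K \<Longrightarrow> (P', A') \<in> K \<Longrightarrow> {P, A, P', A'} \<subseteq> F \<Longrightarrow> P = P'"
proof -
  note a = mp[OF spec[OF spec[OF conjunct2[OF assms(1)[unfolded ptype_def]], of K], of S] assms(2)]
  show "5 \<le> card (dsp D)" by (rule conjunct1[OF assms(1)[unfolded ptype_def]])
  show "(P, A) \<in> K \<Longrightarrow> (P, A') \<in> mx D \<Longrightarrow> (P, A') \<in> K"
    by (rule conjunct1[OF a, rule_format])
  show "F \<in> Lf D \<Longrightarrow> (P, A) \<in> K \<Longrightarrow> (P', A') \<in> K \<Longrightarrow> {P, A, P', A'} \<subseteq> F \<Longrightarrow> P = P'"
    by (rule conjunct2[OF a, rule_format])
qed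

lemma lnI:
  assumes k: "is_class D K S" and a: "(P, A) \<in> K" "(P', A') \<in> K" "F \<in> faces D" "{P, A, P', A'} \<subseteq> F" "ip (P, A) \<noteq> ip (P', A')"
  shows "seg (P, A) (P', A') \<in> ln D K"
proof -
  note c = is_classD[OF k]
  have i: "iso_pt c (graph D) (P, A) = ip (P, A)" "iso_pt c (graph D) (P', A') = ip (P', A')"
    using iso_pt_graph[OF c(2)] c(5) a by auto
  show ?thesis unfolding i[symmetric] by (rule clsI[where F = F]) (use a i in auto)
qed

lemma lnE:
  assumes k: "is_class D K S" and "l \<in> ln D K"
  obtains P A P' A' F where "l = seg (P, A) (P', A')" "(P, A) \<in> K" "(P', A') \<in> K" "F \<in> faces D" "{P, A, P', A'} \<subseteq> F"
    "ip (P, A) \<noteq> ip (P', A')" "(P, A) \<in> mx D" "(P', A') \<in> mx D"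
proof -
  note c = is_classD[OF k]
  obtain a b F where ab: "l = closed_segment (iso_pt c (graph D) a) (iso_pt c (graph D) b)" "a \<in> K" "b \<in> K"
    "F \<in> faces (cub (graph D))" "ends a \<subseteq> F" "ends b \<subseteq> F" "iso_pt c (graph D) a \<noteq> iso_pt c (graph D) b"
    using assms(2) by (rule clsE)
  obtain P A P' A' where e: "a = (P, A)" "b = (P', A')" by (cases a, cases b) simp
  have m: "a \<in> mx D" "b \<in> mx D" using ab c by auto
  note i = iso_pt_graph[OF c(2) m(1)] iso_pt_graph[OF c(2) m(2)]
  show ?thesis by (rule that[of P A P' A' F]) (use ab(1-6) ab(7)[unfolded i] m i in \<open>simp_all add: e\<close>)
qed

lemma ln_body:
  assumes k: "is_class D K S" and l: "l \<in> ln D K"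
  shows "l \<subseteq> body D"
proof -
  obtain P A P' A' where "l = seg (P, A) (P', A')" "(P, A) \<in> mx D" "(P', A') \<in> mx D"
    using k l by (rule lnE)
  then show ?thesis using seg_body[OF is_classD(2)[OF k]] by simp
qed

lemma mx_on_quad:
  assumes D: "D \<in> M" and q: "quad D F A P B Q" and m: "(P, A) \<in> mx D" "(U, V) \<in> mx D" "{U, V} \<subseteq> F"
  shows "(U, V) \<in> {(P, A), (P, B), (Q, A), (Q, B), (B, Q)}"
proof -
  note qd = quadD[OF q] and m1 = mxD[OF D m(1)] and m2 = mxD[OF D m(2)]
  have "U = P \<or> U = B \<or> U = Q" "V = A \<or> V = B \<or> V = Q" using m(3) qd(2) m1(8,9) m2(8,9) by auto
  then show ?thesis using m2(1,11) qd(17-20) by auto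
qed

text \<open>A class has at most two mixed edges on a face, hence draws at most one line there: a
  face that is no L-face has no more mixed edges, and on an L-face the class is confined to one
  disperse or one continuous node.\<close>

lemma class_two:
  assumes k: "is_class D K S" and F: "F \<in> faces D"
    and a: "(P, A) \<in> K" "b \<in> K" "d \<in> K" and on: "{P, A} \<subseteq> F" "ends b \<subseteq> F" "ends d \<subseteq> F" and ne: "b \<noteq> (P, A)" "d \<noteq> (P, A)"
  shows "b = d"
proof -
  note c = is_classD[OF k]
  obtain U V U' V' where e: "b = (U, V)" "d = (U', V')" by (cases b, cases d) simp
  have m: "(P, A) \<in> mx D" "(U, V) \<in> mx D" "(U', V') \<in> mx D" using a c e by auto
  have "incident D A P" using mxD(10)[OF c(2) m(1)] .
  then obtain B Q where q: "quad D F A P B Q" using quad_exists_edge[OF c(4) F, of A P] on(1) by auto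
  have on': "{U, V} \<subseteq> F" "{U', V'} \<subseteq> F" using on e by auto
  note x = mx_on_quad[OF c(2) q m(1,2) on'(1)] mx_on_quad[OF c(2) q m(1,3) on'(2)]
  note md = mxD(8,9)[OF c(2) m(1)] mxD(8,9)[OF c(2) m(2)] mxD(8,9)[OF c(2) m(3)]
  show ?thesis
  proof (cases "F \<in> Lf D")
    case False
    then have "\<not> (B \<in> dsp D \<and> Q \<notin> dsp D)"
      using alternating_quad[OF q, of "dsp D"] md unfolding Lf_eq[OF c(2)] by blast
    then show ?thesis using x md ne e by auto
  next
    case True
    from types[OF k] show ?thesis
    proof
      assume t: "dtype D"
      have "A = V" "A = V'" using dtypeD(3)[OF t k True a(1)] a on e by auto
      then show ?thesis using x ne e quadD(4,5)[OF q] by auto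
    next
      assume t: "ptype D"
      have "P = U" "P = U'" using ptypeD(3)[OF t k True a(1)] a on e by auto
      then show ?thesis using x ne e quadD(6,7)[OF q] by auto
    qed
  qed
qed

section \<open>Contacts of two inner iso-paths\<close>

definition N :: "pt set" where "N = (\<Union>C' \<in> system. iso_nodes c (graph C'))"

lemma NI: "D \<in> system \<Longrightarrow> (P, A) \<in> mx D \<Longrightarrow> \<phi> P = c \<Longrightarrow> P \<in> N"
proof -
  assume a: "D \<in> system" "(P, A) \<in> mx D" "\<phi> P = c"
  have "iso_pt c (graph D) (P, A) = P" using iso_pt_graph[OF system_M[OF a(1)] a(2)] ip_level[OF a(3)] by simp
  then have "P \<in> iso_points c (graph D)" unfolding iso_points_def using a(2) by (metis imageI)
  moreover have "P \<in> nodes D" using mxD(6)[OF system_M[OF a(1)] a(2)] .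
  ultimately show ?thesis using a(1) unfolding N_def iso_nodes_def by (auto intro!: bexI[of _ D])
qed

lemma meetI:
  assumes "l \<in> lines \<omega>1" "l \<in> lines \<omega>2"
    and "\<And>x m1 m2. m1 \<in> lines \<omega>1 \<Longrightarrow> m2 \<in> lines \<omega>2 \<Longrightarrow> x \<in> m1 \<Longrightarrow> x \<in> m2 \<Longrightarrow> x \<notin> l \<Longrightarrow>
      x \<in> N \<or> (\<exists>m \<in> lines \<omega>1 \<inter> lines \<omega>2. x \<in> m \<and> m \<inter> N \<noteq> {})"
  shows "meet \<omega>1 \<omega>2 l"
  unfolding meet_def meet_along_def N_def[symmetric] curve_def using assms by auto

text \<open>Tells carriers apart: a face is never the carrier of a node or of a point of an
  edge.\<close>

lemma face_card_neq:
  assumes "is_cuboid D" "F \<in> faces D"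
  shows "F \<noteq> {X, Y}"
proof
  assume F: "F = {X, Y}"
  then obtain P B Q where "quad D F X P B Q" using quad_ex[OF assms, of X] by auto
  note qd = quadD[OF this]
  have "P \<in> {X, Y}" "B \<in> {X, Y}" "Q \<in> {X, Y}" using qd(2) F by auto
  then show False using qd(3-8) by auto
qed

text \<open>The diagonal \<open>P\<close>, \<open>Q\<close> separates the line around
  \<open>A\<close> from the line around \<open>B\<close>; an iso-point lies on it only if it is a
  node with label \<open>c\<close>.\<close>

lemma opposite_disp:
  assumes D: "D \<in> M" and q: "quad D F A P B Q" and m: "(P, A) \<in> mx D" "(Q, A) \<in> mx D" "(P, B) \<in> mx D" "(Q, B) \<in> mx D"
    and x: "x \<in> seg (P, A) (Q, A)" "x \<in> seg (P, B) (Q, B)"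
  shows "(x = P \<and> \<phi> P = c) \<or> (x = Q \<and> \<phi> Q = c) \<or> (\<phi> P = c \<and> \<phi> Q = c)"
proof -
  obtain w r where w: "w \<bullet> A < r" "w \<bullet> P = r" "w \<bullet> Q = r" "r < w \<bullet> B"
    by (rule quad_separation[OF cuboid_M[OF D] q])
  have A: "w \<bullet> ip (U, A) \<le> r \<and> (w \<bullet> ip (U, A) = r \<longrightarrow> \<phi> U = c)" if U: "w \<bullet> U = r" "(U, A) \<in> mx D" for U
  proof -
    obtain t where t: "0 \<le> t" "t < 1" "ip (U, A) = U + t *\<^sub>R (A - U)" "t = 0 \<longleftrightarrow> \<phi> U = c"
      by (rule ip_param[OF mxD(2,3)[OF D U(2)]])
    have "w \<bullet> ip (U, A) = r + t * (w \<bullet> A - r)" using U(1) by (simp add: t(3) inner_add_right inner_diff_right)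
    moreover have "t * (w \<bullet> A - r) \<le> 0" using t(1) w(1) by (simp add: mult_le_0_iff)
    moreover have "t * (w \<bullet> A - r) = 0 \<longrightarrow> t = 0" using w(1) by simp
    ultimately show ?thesis using t(4) by auto
  qed
  have B: "r \<le> w \<bullet> ip (U, B)" if U: "w \<bullet> U = r" "(U, B) \<in> mx D" for U
  proof -
    obtain t where t: "0 \<le> t" "t < 1" "ip (U, B) = U + t *\<^sub>R (B - U)"
      by (rule ip_param[OF mxD(2,3)[OF D U(2)]])
    have "w \<bullet> ip (U, B) = r + t * (w \<bullet> B - r)" using U(1) by (simp add: t(3) inner_add_right inner_diff_right)
    moreover have "0 \<le> t * (w \<bullet> B - r)" using t(1) w(4) by simp
    ultimately show ?thesis by simp
  qed
  note s = segment_inner_le[OF x(1), of w r, OF conjunct1[OF A[OF w(2) m(1)]] conjunct1[OF A[OF w(3) m(2)]]]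
  have "(- w) \<bullet> x \<le> - r"
    by (rule segment_inner_le(1)[OF x(2)]) (use B[OF w(2) m(3)] B[OF w(3) m(4)] in simp_all)
  then have e: "w \<bullet> x = r" using s(1) by simp
  from s(2)[OF e] show ?thesis
    using A[OF w(2) m(1)] A[OF w(3) m(2)] ip_level[of P A] ip_level[of Q A] by metis
qed

text \<open>Here the separation by the diagonal \<open>A\<close>, \<open>B\<close> is strict,
  because an iso-point never reaches the disperse end of its edge.\<close>

lemma opposite_cont:
  assumes D: "D \<in> M" and q: "quad D F A P B Q" and m: "(P, A) \<in> mx D" "(Q, A) \<in> mx D" "(P, B) \<in> mx D" "(Q, B) \<in> mx D"
    and x: "x \<in> seg (P, A) (P, B)" "x \<in> seg (Q, A) (Q, B)"
  shows False
proof -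
  obtain w r where w: "w \<bullet> P < r" "w \<bullet> B = r" "w \<bullet> A = r" "r < w \<bullet> Q"
    by (rule quad_separation[OF cuboid_M[OF D] quad_rot[OF q]])
  have P: "w \<bullet> ip (P, U) < r" if U: "w \<bullet> U = r" "(P, U) \<in> mx D" for U
  proof -
    obtain t where t: "0 \<le> t" "t < 1" "ip (P, U) = P + t *\<^sub>R (U - P)"
      by (rule ip_param[OF mxD(2,3)[OF D U(2)]])
    have "w \<bullet> ip (P, U) = r + (1 - t) * (w \<bullet> P - r)"
      using U(1) by (simp add: t(3) inner_add_right inner_diff_right algebra_simps)
    moreover have "(1 - t) * (w \<bullet> P - r) < 0" using t(2) w(1) by (simp add: mult_less_0_iff)
    ultimately show ?thesis by simp
  qed
  have Q: "r < w \<bullet> ip (Q, U)" if U: "w \<bullet> U = r" "(Q, U) \<in> mx D" for U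
  proof -
    obtain t where t: "0 \<le> t" "t < 1" "ip (Q, U) = Q + t *\<^sub>R (U - Q)"
      by (rule ip_param[OF mxD(2,3)[OF D U(2)]])
    have "w \<bullet> ip (Q, U) = r + (1 - t) * (w \<bullet> Q - r)"
      using U(1) by (simp add: t(3) inner_add_right inner_diff_right algebra_simps)
    moreover have "0 < (1 - t) * (w \<bullet> Q - r)" using t(2) w(4) by simp
    ultimately show ?thesis by simp
  qed
  have "w \<bullet> x < r" by (rule segment_inner_less[OF x(1) P[OF w(3) m(1)] P[OF w(2) m(3)]])
  moreover have "(- w) \<bullet> x < - r"
    by (rule segment_inner_less[OF x(2)]) (use Q[OF w(3) m(2)] Q[OF w(2) m(4)] in simp_all)
  ultimately show False by simp
qed

text \<open>Provides an inner point whose carrier shows whether the line crosses a face or runs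
  along a level edge.\<close>

lemma midpoint_line:
  assumes D: "D \<in> M" and m: "(P, A) \<in> mx D" "(P', A') \<in> mx D"
    and F: "F \<in> faces D" "{P, A, P', A'} \<subseteq> F" and ne: "ip (P, A) \<noteq> ip (P', A')"
  obtains y where "y \<in> seg (P, A) (P', A')" "car D y = F"
    | y where "y \<in> seg (P, A) (P', A')" "\<phi> P = c" "\<phi> P' = c" "incident D P P'" "car D y = {P, P'}"
proof -
  let ?y = "midpoint (ip (P, A)) (ip (P', A'))"
  have y: "?y \<in> seg (P, A) (P', A')" by simp
  have yn: "?y \<noteq> ip (P, A)" "?y \<noteq> ip (P', A')" using ne by (simp_all add: midpoint_eq_endpoint)
  from D m F ne y show ?thesis
  proof (cases rule: line_cases)
    case (n U)
    then have "?y = ip (P, A) \<or> ?y = ip (P', A')" using ip_level[of P A] ip_level[of P' A'] by auto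
    then show ?thesis using yn by blast
  next
    case (s U V) then show ?thesis using yn by auto
  next
    case f then show ?thesis using that(1) y by blast
  next
    case e then show ?thesis using that(2) y by blast
  qed
qed

lemma ip_node:
  assumes "D \<in> M" "(U, V) \<in> mx D" "ip (U, V) = P" "P \<in> nodes D"
  shows "\<phi> U = c" "U = P"
proof -
  note m = mxD[OF assms(1,2)]
  have "\<not> \<phi> U < c"
  proof
    assume "\<phi> U < c"
    then have "car D (ip (U, V)) = {U, V}" by (rule car_ip(1)[OF assms(1,2)])
    then have "{P} = {U, V}" using assms(3) car_node[OF assms(4)] by simp
    then have "U \<in> {P}" "V \<in> {P}" by blast+
    then show False using m(11) by simp
  qed
  then show "\<phi> U = c" using m(2) by simp
  then show "U = P" using ip_level[of U V] assms(3) by simp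
qed

lemma level_line:
  assumes k: "is_class D K S" and l: "closed_segment P Q \<in> ln D K" and n: "P \<in> nodes D" "Q \<in> nodes D"
  obtains X Y F where "(P, X) \<in> K" "(Q, Y) \<in> K" "\<phi> P = c" "\<phi> Q = c" "P \<noteq> Q" "F \<in> faces D" "{P, X, Q, Y} \<subseteq> F"
proof -
  obtain U V U' V' F where L: "closed_segment P Q = seg (U, V) (U', V')" "(U, V) \<in> K" "(U', V') \<in> K"
    "F \<in> faces D" "{U, V, U', V'} \<subseteq> F" "ip (U, V) \<noteq> ip (U', V')" "(U, V) \<in> mx D" "(U', V') \<in> mx D"
    by (rule lnE[OF k l])
  note D = is_classD(2)[OF k]
  have "{P, Q} = {ip (U, V), ip (U', V')}" using L(1) by simp
  then consider "ip (U, V) = P" "ip (U', V') = Q" | "ip (U, V) = Q" "ip (U', V') = P"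
    unfolding doubleton_eq_iff by metis
  then show ?thesis
  proof cases
    case 1
    note a = ip_node[OF D L(7) 1(1) n(1)] ip_node[OF D L(8) 1(2) n(2)]
    show ?thesis by (rule that[of V V' F]) (use L a 1 in auto)
  next
    case 2
    note a = ip_node[OF D L(7) 2(1) n(2)] ip_node[OF D L(8) 2(2) n(1)]
    show ?thesis by (rule that[of V' V F]) (use L a 2 in auto)
  qed
qed

lemma not_Lf_adjacent:
  assumes "D \<in> M" "F \<in> faces D" "P \<in> F" "Q \<in> F" "incident D P Q" "P \<notin> dsp D" "Q \<notin> dsp D"
  shows "F \<notin> Lf D"
  using assms unfolding Lf_eq[OF assms(1)] alternating_faces_def by blast

text \<open>If \<open>l\<close> crosses a face, this face is all that the cuboids share, and by
  \<open>class_two\<close> the iso-point is an end of \<open>l\<close>. If \<open>l\<close> is a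
  level edge, its ends and \<open>P\<close> are three common nodes, so the cuboids share the face
  with this edge and the edge from \<open>P\<close> to \<open>A\<close>. There both classes draw the
  line from the iso-point to the end \<open>R\<close> of \<open>l\<close> next to \<open>A\<close>,
  and \<open>R\<close> is an iso-node.\<close>

lemma meet_strict:
  assumes k: "is_class D1 K1 Sa" "is_class D2 K2 Sb" and ne: "D1 \<noteq> D2"
    and l: "l \<in> ln D1 K1" "l \<in> ln D2 K2"
    and a: "(P, A) \<in> K1" "(P, A) \<in> K2" "\<phi> P < c" and x: "ip (P, A) \<notin> l"
  shows "\<exists>m \<in> ln D1 K1 \<inter> ln D2 K2. ip (P, A) \<in> m \<and> m \<inter> N \<noteq> {}"
proof -
  note c1 = is_classD[OF k(1)] and c2 = is_classD[OF k(2)]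
  have m1: "(P, A) \<in> mx D1" and m2: "(P, A) \<in> mx D2" using a c1(5) c2(5) by auto
  note d1 = mxD[OF c1(2) m1] and d2 = mxD[OF c2(2) m2]
  obtain U V U' V' F where L: "l = seg (U, V) (U', V')" "(U, V) \<in> K1" "(U', V') \<in> K1"
    "F \<in> faces D1" "{U, V, U', V'} \<subseteq> F" "ip (U, V) \<noteq> ip (U', V')" "(U, V) \<in> mx D1" "(U', V') \<in> mx D1"
    by (rule lnE[OF k(1) l(1)])
  have body: "y \<in> body D1" "y \<in> body D2" if "y \<in> l" for y
    using that ln_body[OF k(1) l(1)] ln_body[OF k(2) l(2)] by auto
  have car: "car D1 y = car D2 y" if "y \<in> l" for y
    by (rule car_mesh[OF mesh(1) c1(2) c2(2) body[OF that]])
  from c1(2) L(7,8,4,5,6) show ?thesis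
  proof (cases rule: midpoint_line)
    case (1 y)
    have y: "y \<in> l" using 1 L(1) by simp
    have "F \<subseteq> nodes D2" using car_sub[of D2 y] car[OF y] 1(2) by simp
    then have "nodes D1 \<inter> nodes D2 = F" by (rule common_face(2)[OF mesh(1) c1(2) c2(2) ne L(4)])
    then have on: "{P, A} \<subseteq> F" using d1(6,7) d2(6,7) by auto
    have "(P, A) = (U, V) \<or> (P, A) = (U', V')"
    proof (rule ccontr)
      assume "\<not> ?thesis"
      then have "(U, V) = (U', V')"
        by (intro class_two[OF k(1) L(4) a(1) L(2,3) on]) (use L(5) in auto)
      then show False using L(6) by simp
    qed
    then have "ip (P, A) \<in> l" unfolding L(1) by auto
    with x show ?thesis by simp
  next
    case (2 y)
    have y: "y \<in> l" using 2 L(1) by simp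
    have sub: "{U, U'} \<subseteq> nodes D2" using car_sub[of D2 y] car[OF y] 2(5) by simp
    have nU: "U \<in> nodes D1" "U' \<in> nodes D1" using mxD(6)[OF c1(2) L(7)] mxD(6)[OF c1(2) L(8)] by auto
    have le: "l = closed_segment U U'" unfolding L(1) using ip_level[OF 2(2)] ip_level[OF 2(3)] by simp
    obtain X Y F2 where XY: "(U, X) \<in> K2" "(U', Y) \<in> K2" "U \<noteq> U'"
      by (rule level_line[OF k(2), of U U']) (use l(2) le sub in auto)
    have cU: "U \<notin> dsp D1" "U' \<notin> dsp D1" "U \<notin> dsp D2" "U' \<notin> dsp D2"
      using mxD(8)[OF c1(2) L(7)] mxD(8)[OF c1(2) L(8)] mxD(8)[OF c2(2)] XY c2(5) by blast+
    have PU: "P \<noteq> U" "P \<noteq> U'" using a(3) 2 by auto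
    let ?F = "nodes D1 \<inter> nodes D2"
    have F: "?F \<in> faces D1" "?F \<in> faces D2"
      by (rule three_common[OF mesh(1) c1(2) c2(2) ne, of U U' P]; use nU sub d1 d2 XY PU in auto)+
    have in1: "incident D1 U U'" and in2: "incident D2 U U'" using 2(4) sub unfolding incident_def by auto
    have UF: "U \<in> ?F" "U' \<in> ?F" "P \<in> ?F" "A \<in> ?F" using nU sub d1 d2 by auto
    obtain Z Z' where q: "quad D1 ?F U U' Z Z'" by (rule quad_exists_edge[OF c1(4) F(1) UF(1,2) in1])
    note qd = quadD[OF q]
    have AU: "A \<noteq> U" "A \<noteq> U'" "A \<noteq> P" using cU d1(9,11) by auto
    have nL: "?F \<notin> Lf D1" "?F \<notin> Lf D2"
      using not_Lf_adjacent[OF c1(2) F(1) UF(1,2) in1 cU(1,2)] not_Lf_adjacent[OF c2(2) F(2) UF(1,2) in2 cU(3,4)] by auto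
    have "P \<in> {U, U', Z, Z'}" "A \<in> {U, U', Z, Z'}" using qd(2) UF(3,4) by auto
    then have "(P = Z \<and> A = Z') \<or> (P = Z' \<and> A = Z)" using PU AU by auto
    then have "\<exists>R \<in> {U, U'}. incident D1 R A"
    proof
      assume "P = Z \<and> A = Z'" then show ?thesis using qd(16) by blast
    next
      assume "P = Z' \<and> A = Z" then show ?thesis using qd(10) by blast
    qed
    then obtain R where R: "R = U \<or> R = U'" "incident D1 R A" by blast
    have iR: "incident D2 R A" using R sub d2(7) unfolding incident_def by auto
    have mR: "(R, A) \<in> mx D1" "(R, A) \<in> mx D2" using R iR cU d1(9) d2(9) by (auto intro!: mxI)
    have sub': "{P, A, R, A} \<subseteq> ?F" using UF R by auto
    have K: "(R, A) \<in> K1" "(R, A) \<in> K2"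
      using class_face[OF k(1) F(1) nL(1) a(1) mR(1) sub'] class_face[OF k(2) F(2) nL(2) a(2) mR(2) sub'] by auto
    have RP: "R \<noteq> P" "\<phi> R = c" using R PU 2 by auto
    then have nip: "ip (P, A) \<noteq> ip (R, A)" using ip_eqD[OF c1(2) m1 mR(1)] by auto
    have "seg (P, A) (R, A) \<in> ln D1 K1 \<inter> ln D2 K2"
      using lnI[OF k(1) a(1) K(1) F(1) sub' nip] lnI[OF k(2) a(2) K(2) F(2) sub' nip] by simp
    moreover have "R \<in> seg (P, A) (R, A)" using ip_level[OF RP(2), of A] by (metis ends_in_segment(2))
    moreover have "R \<in> N" by (rule NI[OF c1(1) mR(1) RP(2)])
    ultimately show ?thesis using ends_in_segment(1) by blast
  qed
qed

text \<open>If \<open>l\<close> lies across \<open>F\<close>, both lines through \<open>x\<close>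
  equal \<open>l\<close>, since a class draws one line on a face. Otherwise \<open>l\<close> is a
  level edge of \<open>F\<close>, and exactly one of the other two nodes of \<open>F\<close> is
  disperse, since with two the line on \<open>F\<close> would be \<open>l\<close> itself; then both
  graphs draw the same line on \<open>F\<close>, and it ends in an iso-node of
  \<open>l\<close>.\<close>

lemma meet_face:
  assumes k: "is_class D1 K1 Sa" "is_class D2 K2 Sb" and ne: "D1 \<noteq> D2"
    and l: "l \<in> ln D1 K1" "l \<in> ln D2 K2" and F: "F \<in> faces D1" "F \<in> faces D2"
    and a: "(P, A) \<in> K1" "(P', A') \<in> K1" "{P, A, P', A'} \<subseteq> F" "ip (P, A) \<noteq> ip (P', A')"
    and b: "(R, B) \<in> K2" "(R', B') \<in> K2" "{R, B, R', B'} \<subseteq> F" "ip (R, B) \<noteq> ip (R', B')"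
    and x: "x \<in> seg (P, A) (P', A')" "x \<in> seg (R, B) (R', B')" "x \<notin> l"
  shows "\<exists>m \<in> ln D1 K1 \<inter> ln D2 K2. x \<in> m \<and> m \<inter> N \<noteq> {}"
proof -
  note c1 = is_classD[OF k(1)] and c2 = is_classD[OF k(2)]
  have m: "(P, A) \<in> mx D1" "(P', A') \<in> mx D1" "(R, B) \<in> mx D2" "(R', B') \<in> mx D2" using a b c1(5) c2(5) by auto
  obtain U V U' V' F1 where L: "l = seg (U, V) (U', V')" "(U, V) \<in> K1" "(U', V') \<in> K1"
    "F1 \<in> faces D1" "{U, V, U', V'} \<subseteq> F1" "ip (U, V) \<noteq> ip (U', V')" "(U, V) \<in> mx D1" "(U', V') \<in> mx D1"
    by (rule lnE[OF k(1) l(1)])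
  have body: "y \<in> body D1" "y \<in> body D2" if "y \<in> l" for y
    using that ln_body[OF k(1) l(1)] ln_body[OF k(2) l(2)] by auto
  have car: "car D1 y = car D2 y" if "y \<in> l" for y
    by (rule car_mesh[OF mesh(1) c1(2) c2(2) body[OF that]])
  have comm: "nodes D1 \<inter> nodes D2 = F"
    by (rule common_face(2)[OF mesh(1) c1(2) c2(2) ne F(1) faces_sub[OF F(2)]])
  from c1(2) L(7,8,4,5,6) show ?thesis
  proof (cases rule: midpoint_line)
    case (1 y)
    have y: "y \<in> l" using 1 L(1) by simp
    have "F1 \<subseteq> nodes D2" using car_sub[of D2 y] car[OF y] 1(2) by simp
    then have "F1 = F" using common_face(2)[OF mesh(1) c1(2) c2(2) ne L(4)] comm by simp
    have *: "b = (U, V) \<or> b = (U', V')" if b: "b \<in> K1" "ends b \<subseteq> F" for b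
    proof (rule ccontr)
      assume n: "\<not> ?thesis"
      obtain Y Z where e: "b = (Y, Z)" by (cases b)
      have "(U, V) = (U', V')"
        by (rule class_two[OF k(1) F(1) b(1)[unfolded e] L(2,3)]) (use b n e L(5) \<open>F1 = F\<close> in auto)
      then show False using L(6) by simp
    qed
    have "(P, A) = (U, V) \<or> (P, A) = (U', V')" "(P', A') = (U, V) \<or> (P', A') = (U', V')"
      using *[OF a(1)] *[OF a(2)] a(3) by auto
    then have "seg (P, A) (P', A') = l" using a(4) unfolding L(1) by (auto simp: closed_segment_commute)
    with x show ?thesis by simp
  next
    case (2 y)
    have y: "y \<in> l" using 2 L(1) by simp
    have sub: "{U, U'} \<subseteq> nodes D2" using car_sub[of D2 y] car[OF y] 2(5) by simp
    have nU: "U \<in> nodes D1" "U' \<in> nodes D1" using mxD(6)[OF c1(2) L(7)] mxD(6)[OF c1(2) L(8)] by auto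
    have le: "l = closed_segment U U'" unfolding L(1) using ip_level[OF 2(2)] ip_level[OF 2(3)] by simp
    obtain X Y F2 where XY: "(U, X) \<in> K2" "(U', Y) \<in> K2" "U \<noteq> U'"
      by (rule level_line[OF k(2), of U U']) (use l(2) le sub in auto)
    have cU: "U \<notin> dsp D1" "U' \<notin> dsp D1" "U \<notin> dsp D2" "U' \<notin> dsp D2"
      using mxD(8)[OF c1(2) L(7)] mxD(8)[OF c1(2) L(8)] mxD(8)[OF c2(2)] XY c2(5) by blast+
    have UF: "U \<in> F" "U' \<in> F" using nU sub comm by auto
    \<comment> \<open>Up to reflection, \<open>Z\<close> next to \<open>U0'\<close> is the only
      disperse node of \<open>F\<close>. In both graphs the mixed edges of \<open>F\<close> are then
      those from \<open>U0'\<close> and \<open>Z'\<close> to \<open>Z\<close>.\<close>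
    have *: "?thesis" if UU: "(U0 = U \<and> U0' = U') \<or> (U0 = U' \<and> U0' = U)" and q: "quad D1 F U0 U0' Z Z'" and Z: "Z \<in> dsp D1" "Z' \<notin> dsp D1" for U0 U0' Z Z'
    proof -
      have q2: "quad D2 F U0 U0' Z Z'" by (rule quad_mono[OF q F(2)])
      note qd = quadD[OF q] and qd2 = quadD[OF q2]
      have u: "U0 \<notin> dsp D1" "U0' \<notin> dsp D1" "U0 \<notin> dsp D2" "U0' \<notin> dsp D2" using UU cU by auto
      have Z2: "Z \<in> dsp D2" "Z' \<notin> dsp D2"
        using dsp_nbr[OF c1(2) qd(14) u(2)] dsp_nbr[OF c2(2) qd2(14) u(4)]
          dsp_nbr[OF c1(2) qd(12) u(1)] dsp_nbr[OF c2(2) qd2(12) u(3)] Z by auto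
      have *: "b = (U0', Z) \<or> b = (Z', Z)" if "b \<in> mx D" "ends b \<subseteq> F" "D = D1 \<or> D = D2" for b D
      proof -
        obtain Y1 Y2 where e: "b = (Y1, Y2)" by (cases b)
        have D: "D \<in> M" using that(3) c1(2) c2(2) by auto
        note mm = mxD[OF D, of Y1 Y2] that(1)[unfolded e]
        have "Y1 \<in> {U0, U0', Z, Z'}" "Y2 \<in> {U0, U0', Z, Z'}" using that(2) e qd(2) by auto
        moreover have "Y2 \<in> dsp D" "Y1 \<notin> dsp D" using mm by auto
        ultimately have "Y2 = Z" "Y1 = U0 \<or> Y1 = U0' \<or> Y1 = Z'" using that(3) u Z Z2 by auto
        moreover have "Y1 \<noteq> U0" using mm(1) mm(12) \<open>Y2 = Z\<close> that(3) qd(17) qd2(17) by auto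
        ultimately show ?thesis using e by auto
      qed
      have "(P, A) = (U0', Z) \<or> (P, A) = (Z', Z)" "(P', A') = (U0', Z) \<or> (P', A') = (Z', Z)"
        "(R, B) = (U0', Z) \<or> (R, B) = (Z', Z)" "(R', B') = (U0', Z) \<or> (R', B') = (Z', Z)"
        by (rule *[of _ D1] *[of _ D2]; use m a(3) b(3) in simp)+
      then have s: "{ip (P, A), ip (P', A')} = {ip (U0', Z), ip (Z', Z)}" "{ip (R, B), ip (R', B')} = {ip (U0', Z), ip (Z', Z)}"
        using a(4) b(4) by auto
      then have e: "seg (P, A) (P', A') = seg (R, B) (R', B')" by (simp only: closed_segment_eq)
      have "seg (P, A) (P', A') \<in> ln D1 K1" by (rule lnI[OF k(1) a(1,2) F(1) a(3,4)])
      moreover have "seg (P, A) (P', A') \<in> ln D2 K2" unfolding e by (rule lnI[OF k(2) b(1,2) F(2) b(3,4)])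
      moreover have "U0' \<in> seg (P, A) (P', A')"
      proof -
        have "\<phi> U0' = c" using UU 2 by auto
        then have "ip (U0', Z) = U0'" by (rule ip_level)
        then have "U0' \<in> {ip (P, A), ip (P', A')}" using s(1) by simp
        then show ?thesis by auto
      qed
      moreover have "U0' \<in> N"
      proof -
        have "U \<in> N" "U' \<in> N" using NI[OF c1(1) L(7) 2(2)] NI[OF c1(1) L(8) 2(3)] by auto
        then show ?thesis using UU by auto
      qed
      ultimately show ?thesis using x(1) by blast
    qed
    obtain Z Z' where q: "quad D1 F U U' Z Z'" by (rule quad_exists_edge[OF c1(4) F(1) UF 2(4)])
    note qd = quadD[OF q]
    have on: "A \<in> {U, U', Z, Z'}" "P \<in> {U, U', Z, Z'}" "P' \<in> {U, U', Z, Z'}" "A' \<in> {U, U', Z, Z'}" using a(3) qd(2) by auto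
    note mA = mxD[OF c1(2) m(1)] mxD[OF c1(2) m(2)]
    have "Z \<in> dsp D1 \<or> Z' \<in> dsp D1" using on(1) mA(9) cU by auto
    moreover have "\<not> (Z \<in> dsp D1 \<and> Z' \<in> dsp D1)"
    proof
      assume z: "Z \<in> dsp D1 \<and> Z' \<in> dsp D1"
      have "P = U \<or> P = U'" "P' = U \<or> P' = U'" using on z mA by auto
      moreover have "ip (U, V1) = U" "ip (U', V1) = U'" for V1 using 2 by (simp_all add: ip_level)
      ultimately have "{ip (P, A), ip (P', A')} = {U, U'}" using a(4) by auto
      then have "seg (P, A) (P', A') = closed_segment U U'" by (simp only: closed_segment_eq)
      then have "x \<in> l" using x(1) le by metis
      then show False using x by simp
    qed
    ultimately show ?thesis
      using *[of U U' Z Z', OF _ q] *[of U' U Z' Z] quad_rot[OF quad_refl[OF quad_rot[OF quad_rot[OF q]]]] quad_refl[OF quad_rot[OF q]] by blast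
  qed
qed

text \<open>Two classes of one graph share a face only if it is an L-face. Lines around its two
  disperse nodes have an inner point in common only if both are the diagonal joining two iso-nodes;
  lines around its two continuous nodes are disjoint.\<close>

lemma meet_face_same:
  assumes k: "is_class D K1 Sa" "is_class D K2 Sb" and dj: "K1 \<inter> K2 = {}" and F: "F \<in> faces D"
    and a: "(P, A) \<in> K1" "(P', A') \<in> K1" "{P, A, P', A'} \<subseteq> F" "ip (P, A) \<noteq> ip (P', A')"
    and b: "(R, B) \<in> K2" "(R', B') \<in> K2" "{R, B, R', B'} \<subseteq> F" "ip (R, B) \<noteq> ip (R', B')"
    and x: "x \<in> seg (P, A) (P', A')" "x \<in> seg (R, B) (R', B')" and car: "car D x = F"
  shows "seg (P, A) (P', A') = seg (R, B) (R', B') \<and> \<phi> P = c"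
proof -
  note c = is_classD[OF k(1)]
  have m: "(P, A) \<in> mx D" "(P', A') \<in> mx D" "(R, B) \<in> mx D" "(R', B') \<in> mx D"
    using a b c(5) is_classD(5)[OF k(2)] by auto
  note md = mxD[OF c(2) m(1)] mxD[OF c(2) m(2)] mxD[OF c(2) m(3)] mxD[OF c(2) m(4)]
  have nv: "x \<noteq> Y" if "Y \<in> nodes D" for Y
  proof
    assume "x = Y"
    then have "F = {Y}" using car car_node[OF that] by simp
    then have "F = {Y, Y}" by (rule trans) simp
    then show False using face_card_neq[OF c(4) F] by metis
  qed
  have L: "F \<in> Lf D"
  proof (rule ccontr)
    assume "F \<notin> Lf D"
    then have "(R, B) \<in> K1" by (rule class_face[OF k(1) F _ a(1) m(3)]) (use a(3) b(3) in auto)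
    then show False using b(1) dj by blast
  qed
  then have alt: "F \<in> alternating_faces D (dsp D)" using Lf_eq[OF c(2)] by simp
  have AF: "A \<in> F" "A \<in> dsp D" using a(3) md by auto
  obtain X B0 Y where q: "quad D F A X B0 Y" "B0 \<in> dsp D" "X \<notin> dsp D" "Y \<notin> dsp D"
    by (rule alternating_quadE_at[OF c(4) alt AF])
  note qd = quadD[OF q(1)]
  have m4: "(X, A) \<in> mx D" "(Y, A) \<in> mx D" "(X, B0) \<in> mx D" "(Y, B0) \<in> mx D"
    using qd q AF(2) by (auto intro!: mxI)
  have cP: "Z = X \<or> Z = Y" if "Z \<in> F" "Z \<notin> dsp D" for Z using that qd(2) AF(2) q(2) by auto
  have dP: "Z = A \<or> Z = B0" if "Z \<in> F" "Z \<in> dsp D" for Z using that qd(2) q(3,4) by auto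
  have co: "P = X \<or> P = Y" "P' = X \<or> P' = Y" "R = X \<or> R = Y" "R' = X \<or> R' = Y"
    by (rule cP; use a(3) b(3) md in simp)+
  have di: "A' = A \<or> A' = B0" "B = A \<or> B = B0" "B' = A \<or> B' = B0"
    by (rule dP; use a(3) b(3) md in simp)+
  from types[OF k(1)] show ?thesis
  proof
    assume t: "dtype D"
    have e: "A' = A" "B' = B" using dtypeD(3)[OF t k(1) L a(1,2) a(3)] dtypeD(3)[OF t k(2) L b(1,2) b(3)] by auto
    have "B \<noteq> A" using dtypeD(2)[OF t k(1) a(1), of R] b(1) m(3) dj by auto
    then have B: "B = B0" using di by simp
    have PP: "P \<noteq> P'" "R \<noteq> R'" using a(4) b(4) e by auto
    then have s: "seg (P, A) (P', A') = seg (X, A) (Y, A)" "seg (R, B) (R', B') = seg (X, B0) (Y, B0)"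
      using co e B by (auto simp: closed_segment_commute)
    have "x = X \<or> x = Y \<or> \<phi> X = c \<and> \<phi> Y = c"
      using opposite_disp[OF c(2) q(1) m4 x(1)[unfolded s(1)] x(2)[unfolded s(2)]] by blast
    then have lv: "\<phi> X = c" "\<phi> Y = c" using nv qd by auto
    then show ?thesis unfolding s using ip_level[OF lv(1)] ip_level[OF lv(2)] co(1) by auto
  next
    assume t: "ptype D"
    have e: "P' = P" "R' = R" using ptypeD(3)[OF t k(1) L a(1,2) a(3)] ptypeD(3)[OF t k(2) L b(1,2) b(3)] by auto
    have RP: "R \<noteq> P" using ptypeD(2)[OF t k(1) a(1), of B] b(1) m(3) dj by auto
    have AA: "A' = B0" "(B = A \<and> B' = B0) \<or> (B = B0 \<and> B' = A)" using a(4) b(4) e di by auto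
    have s: "seg (P, A) (P', A') = seg (P, A) (P, B0)" "seg (R, B) (R', B') = seg (R, A) (R, B0)"
      using e AA by (auto simp: closed_segment_commute)
    note x' = x(1)[unfolded s(1)] x(2)[unfolded s(2)]
    have False
    proof (cases "P = X")
      case True
      then have RY: "R = Y" using co RP by auto
      show False by (rule opposite_cont[OF c(2) q(1) m4 x'[unfolded True RY]])
    next
      case False
      then have PY: "P = Y" "R = X" using co RP by auto
      show False by (rule opposite_cont[OF c(2) q(1) m4 x'(2,1)[unfolded PY]])
    qed
    then show ?thesis ..
  qed
qed

text \<open>A contact \<open>x\<close> outside \<open>l\<close> has the same carrier in both
  cuboids, so the two lines through it fall under the same case of \<open>line_cases\<close> unless
  \<open>x\<close> is an iso-node. Each case yields a common line through \<open>x\<close> that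
  contains an iso-node, or a contradiction.\<close>

lemma meet_inner:
  assumes k: "is_class D1 K1 Sa" "is_class D2 K2 Sb" and ne: "D1 \<noteq> D2 \<or> K1 \<noteq> K2"
    and l: "l \<in> ln D1 K1" "l \<in> ln D2 K2"
  shows "meet (pth D1 K1 Sa) (pth D2 K2 Sb) l"
proof (rule meetI)
  show "l \<in> lines (pth D1 K1 Sa)" "l \<in> lines (pth D2 K2 Sb)" using l by auto
  note c1 = is_classD[OF k(1)] and c2 = is_classD[OF k(2)]
  have dj: "K1 \<inter> K2 = {}" if "D1 = D2"
    using class_disjoint[of D1 K1 Sa K2 Sb] k ne that by auto
  fix x l1 l2
  assume l1: "l1 \<in> lines (pth D1 K1 Sa)" and l2: "l2 \<in> lines (pth D2 K2 Sb)" and x: "x \<in> l1" "x \<in> l2" "x \<notin> l"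
  have l1': "l1 \<in> ln D1 K1" and l2': "l2 \<in> ln D2 K2" using l1 l2 by auto
  let ?goal = "x \<in> N \<or> (\<exists>m\<in>lines (pth D1 K1 Sa) \<inter> lines (pth D2 K2 Sb). x \<in> m \<and> m \<inter> N \<noteq> {})"
  obtain P A P' A' F where a: "l1 = seg (P, A) (P', A')" "(P, A) \<in> K1" "(P', A') \<in> K1" "F \<in> faces D1" "{P, A, P', A'} \<subseteq> F"
    "ip (P, A) \<noteq> ip (P', A')" "(P, A) \<in> mx D1" "(P', A') \<in> mx D1"
    by (rule lnE[OF k(1) l1'])
  obtain R B R' B' F' where b: "l2 = seg (R, B) (R', B')" "(R, B) \<in> K2" "(R', B') \<in> K2" "F' \<in> faces D2" "{R, B, R', B'} \<subseteq> F'"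
    "ip (R, B) \<noteq> ip (R', B')" "(R, B) \<in> mx D2" "(R', B') \<in> mx D2"
    by (rule lnE[OF k(2) l2'])
  have bd: "x \<in> body D1" "x \<in> body D2" using x ln_body[OF k(1) l1'] ln_body[OF k(2) l2'] by auto
  have car: "car D1 x = car D2 x" by (rule car_mesh[OF mesh(1) c1(2) c2(2) bd])
  note fc = face_card_neq[OF c1(4)] face_card_neq[OF c2(4)]
  note da = mxD[OF c1(2) a(7)] mxD[OF c1(2) a(8)] and db = mxD[OF c2(2) b(7)] mxD[OF c2(2) b(8)]
  from c1(2) a(7,8,4-6) x(1)[unfolded a(1)] show ?goal
  proof (cases rule: line_cases)
    case (n U)
    then have "x \<in> N" using NI[OF c1(1) a(7)] NI[OF c1(1) a(8)] by auto
    then show ?thesis ..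
  next
    case s1: (s U V)
    have UV: "(U, V) \<in> K1" "c < \<phi> V" using s1(1) a da by auto
    from c2(2) b(7,8,4-6) x(2)[unfolded b(1)] show ?thesis
    proof (cases rule: line_cases)
      case (n U)
      then have "x \<in> N" using NI[OF c2(1) b(7)] NI[OF c2(1) b(8)] by auto
      then show ?thesis ..
    next
      case (s U' V')
      have "c < \<phi> V'" "(U', V') \<in> K2" using s(1) b db by auto
      moreover have "{U, V} = {U', V'}" using s(4) s1(4) car by simp
      ultimately have "U' = U" "V' = V" using s(2) s1(2) UV(2) by (auto simp: doubleton_eq_iff)
      then have K2: "(U, V) \<in> K2" using \<open>(U', V') \<in> K2\<close> by simp
      then have "D1 \<noteq> D2" using dj UV(1) by blast
      from meet_strict[OF k this l UV(1) K2 s1(2)] x(3) s1(3) show ?thesis by simp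
    next
      case f
      then show ?thesis using fc(2)[OF b(4)] s1(4) car by metis
    next
      case e
      then have "{U, V} = {R, R'}" using s1(4) car by simp
      then have "V = R \<or> V = R'" by blast
      then show ?thesis using UV(2) e by auto
    qed
  next
    case f1: f
    from c2(2) b(7,8,4-6) x(2)[unfolded b(1)] show ?thesis
    proof (cases rule: line_cases)
      case (n U)
      then have "x \<in> N" using NI[OF c2(1) b(7)] NI[OF c2(1) b(8)] by auto
      then show ?thesis ..
    next
      case (s U' V')
      then show ?thesis using fc(1)[OF a(4)] f1 car by metis
    next
      case f
      have FF: "F' = F" using f f1 car by simp
      show ?thesis
      proof (cases "D1 = D2")
        case True
        have "seg (P, A) (P', A') = seg (R, B) (R', B') \<and> \<phi> P = c"
          by (rule meet_face_same[OF k(1) _ dj[OF True] a(4,2,3,5,6)])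
            (use k(2) True b a(1) x FF f1 in auto)
        then have "l1 = l2" "\<phi> P = c" using a(1) b(1) by auto
        moreover have "P \<in> N" by (rule NI[OF c1(1) a(7) \<open>\<phi> P = c\<close>])
        moreover have "P \<in> l1" using ip_level[OF \<open>\<phi> P = c\<close>, of A] a(1) by (metis ends_in_segment(1))
        ultimately show ?thesis using l1 l2 x by blast
      next
        case False
        have "F \<in> faces D2" using b(4) FF by simp
        from meet_face[OF k False l a(4) this a(2,3,5,6) b(2,3) _ b(6)] x a(1) b(1,5) FF
        show ?thesis by simp
      qed
    next
      case e
      then show ?thesis using fc(1)[OF a(4)] f1 car by metis
    qed
  next
    case e1: e
    from c2(2) b(7,8,4-6) x(2)[unfolded b(1)] show ?thesis
    proof (cases rule: line_cases)
      case (n U)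
      then have "x \<in> N" using NI[OF c2(1) b(7)] NI[OF c2(1) b(8)] by auto
      then show ?thesis ..
    next
      case (s U' V')
      then have "{U', V'} = {P, P'}" "c < \<phi> V'" using e1(4) car db by auto
      then have "V' = P \<or> V' = P'" by blast
      then show ?thesis using \<open>c < \<phi> V'\<close> e1 by auto
    next
      case f
      then show ?thesis using fc(2)[OF b(4)] e1(4) car by metis
    next
      case e
      have "{P, P'} = {R, R'}" using e(4) e1(4) car by simp
      then have "l1 = l2" unfolding a(1) b(1)
        using ip_level[OF e1(1)] ip_level[OF e1(2)] ip_level[OF e(1)] ip_level[OF e(2)] by (simp only: closed_segment_eq)
      moreover have "P \<in> N" by (rule NI[OF c1(1) a(7) e1(1)])
      moreover have "P \<in> l1" using ip_level[OF e1(1), of A] a(1) by (metis ends_in_segment(1))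
      ultimately show ?thesis using l1 l2 x by blast
    qed
  qed
qed

section \<open>Non-trivial L-faces and outer iso-paths\<close>

lemma dsp_raw: "D \<in> M \<Longrightarrow> V \<in> nodes D \<Longrightarrow> c < \<phi> V \<Longrightarrow> V \<in> dsp D"
  using disp_removed_iff[OF iso_level mesh(1), of V D] unfolding graph_eq by simp

lemma dsp_cases: "D \<in> M \<Longrightarrow> V \<in> dsp D \<Longrightarrow> c < \<phi> V \<or> \<phi> V = c"
proof -
  assume V: "V \<in> dsp D"
  then have "V \<in> nodes D" using disp_sub[of c "graph D"] by auto
  from disp_removed_iff[OF iso_level mesh(1) this, of \<phi>] V show ?thesis
    unfolding graph_eq promoted_def[OF iso_level mesh(1)] by auto
qed

lemma incident_mono: "incident D P Q \<Longrightarrow> P \<in> nodes D' \<Longrightarrow> Q \<in> nodes D' \<Longrightarrow> incident D' P Q"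
  by (simp add: incident_def)

text \<open>The face \<open>F = {A, P, B, Q}\<close> between \<open>C1\<close> and \<open>C2\<close> is a non-trivial L-face with respect to the labels
  \<open>\<phi>\<close>; in \<open>C1\<close> or \<open>C2\<close> the node \<open>P\<close> may have been relabeled.\<close>
definition Lraw :: "cuboid \<Rightarrow> cuboid \<Rightarrow> pt set \<Rightarrow> pt \<Rightarrow> pt \<Rightarrow> pt \<Rightarrow> pt \<Rightarrow> bool" where
  "Lraw C1 C2 F A P B Q \<longleftrightarrow> C1 \<in> system \<and> C2 \<in> system \<and> C1 \<noteq> C2 \<and> F \<in> faces C2 \<and> quad C1 F A P B Q \<and>
     c < \<phi> A \<and> c < \<phi> B \<and> \<phi> P \<le> c \<and> \<phi> Q < c"

definition Dl :: "pt \<Rightarrow> pt \<Rightarrow> pt \<Rightarrow> pt \<Rightarrow> pt set set" where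
  "Dl A P B Q = {seg (Q, A) (P, A), seg (Q, B) (P, B)}"

text \<open>The line around \<open>P\<close> is left out if \<open>P\<close> has label
  \<open>c\<close>, because it then shrinks to the point \<open>P\<close>.\<close>

definition Pl :: "pt \<Rightarrow> pt \<Rightarrow> pt \<Rightarrow> pt \<Rightarrow> pt set set" where
  "Pl A P B Q = insert (seg (Q, A) (Q, B)) (if \<phi> P < c then {seg (P, A) (P, B)} else {})"

definition lnF :: "cuboid \<Rightarrow> pt set \<Rightarrow> pt set set" where
  "lnF D F = {seg (U, V) (U', V') | U V U' V' K S. is_class D K S \<and> (U, V) \<in> K \<and> (U', V') \<in> K \<and>
     {U, V, U', V'} \<subseteq> F \<and> ip (U, V) \<noteq> ip (U', V')}"

lemma LrawD:
  assumes "Lraw C1 C2 F A P B Q"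
  shows "C1 \<in> system" "C2 \<in> system" "C1 \<in> M" "C2 \<in> M" "C1 \<noteq> C2" "F \<in> faces C1" "F \<in> faces C2"
    "quad C1 F A P B Q" "quad C2 F A P B Q" "c < \<phi> A" "c < \<phi> B" "\<phi> P \<le> c" "\<phi> Q < c"
    "nodes C1 \<inter> nodes C2 = F" "body C1 \<inter> body C2 = convex hull F" "face_neighbors C1 C2"
    "D \<in> M \<Longrightarrow> F \<subseteq> nodes D \<Longrightarrow> D = C1 \<or> D = C2"
proof -
  show a: "C1 \<in> system" "C2 \<in> system" "C1 \<noteq> C2" "F \<in> faces C2" "quad C1 F A P B Q" "c < \<phi> A" "c < \<phi> B" "\<phi> P \<le> c" "\<phi> Q < c"
    using assms by (auto simp: Lraw_def)
  then show b: "C1 \<in> M" "C2 \<in> M" using system_M by auto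
  show f: "F \<in> faces C1" using a(5) by (rule quadD)
  show "quad C2 F A P B Q" by (rule quad_mono[OF a(5,4)])
  note cf = common_face[OF mesh(1) b a(3) f faces_sub[OF a(4)]]
  show "nodes C1 \<inter> nodes C2 = F" "body C1 \<inter> body C2 = convex hull F" "face_neighbors C1 C2" by (rule cf)+
  show "D \<in> M \<Longrightarrow> F \<subseteq> nodes D \<Longrightarrow> D = C1 \<or> D = C2" using cf(5) by blast
qed

lemma Lraw_sym: "Lraw C1 C2 F A P B Q \<Longrightarrow> Lraw C2 C1 F A P B Q"
  using LrawD[of C1 C2 F A P B Q] unfolding Lraw_def by auto

lemma Lraw_swap: "Lraw C1 C2 F A P B Q \<Longrightarrow> Lraw C1 C2 F B P A Q"
  unfolding Lraw_def using quad_refl[OF quad_rot[OF quad_rot]] by auto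

lemma Lraw_mx:
  assumes L: "Lraw C1 C2 F A P B Q"
  shows "A \<in> dsp C1" "B \<in> dsp C1" "Q \<notin> dsp C1" "(Q, A) \<in> mx C1" "(Q, B) \<in> mx C1"
    "P \<notin> dsp C1 \<Longrightarrow> (P, A) \<in> mx C1" "P \<notin> dsp C1 \<Longrightarrow> (P, B) \<in> mx C1" "P \<in> dsp C1 \<Longrightarrow> \<phi> P = c"
    "P \<notin> dsp C1 \<Longrightarrow> F \<in> Lf C1" "P \<in> dsp C1 \<Longrightarrow> F \<notin> Lf C1"
proof -
  note d = LrawD[OF L] and qd = quadD[OF LrawD(8)[OF L]]
  show a: "A \<in> dsp C1" "B \<in> dsp C1" using dsp_raw[OF d(3)] qd d by auto
  show q: "Q \<notin> dsp C1" using dsp_cases[OF d(3), of Q] d(13) by auto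
  show "(Q, A) \<in> mx C1" "(Q, B) \<in> mx C1" "P \<notin> dsp C1 \<Longrightarrow> (P, A) \<in> mx C1" "P \<notin> dsp C1 \<Longrightarrow> (P, B) \<in> mx C1"
    using a q qd by (auto intro!: mxI)
  show "P \<in> dsp C1 \<Longrightarrow> \<phi> P = c" using dsp_cases[OF d(3), of P] d(12) by auto
  show "P \<notin> dsp C1 \<Longrightarrow> F \<in> Lf C1" unfolding Lf_eq[OF d(3)] by (rule alternating_quad[OF d(8) a _ q])
  show "P \<in> dsp C1 \<Longrightarrow> F \<notin> Lf C1" unfolding Lf_eq[OF d(3)] alternating_faces_def using qd a by auto
qed

text \<open>The graph on \<open>C1\<close> draws on \<open>F\<close> either the lines around
  \<open>A\<close> and \<open>B\<close> or those around \<open>P\<close> and \<open>Q\<close>; the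
  comparison with the neighbour uses only this alternative.\<close>

lemma Lraw_types:
  assumes L: "Lraw C1 C2 F A P B Q"
  obtains (D) KA SA KB SB where "is_class C1 KA SA" "(Q, A) \<in> KA" "(P, A) \<in> KA" "A \<in> SA"
      "is_class C1 KB SB" "(Q, B) \<in> KB" "(P, B) \<in> KB" "B \<in> SB" "P \<notin> dsp C1" "F \<in> Lf C1"
      "KA \<inter> KB = {}" "lnF C1 F = Dl A P B Q"
    | (P) K S where "is_class C1 K S" "(Q, A) \<in> K" "(Q, B) \<in> K" "\<And>K' S'. is_class C1 K' S' \<Longrightarrow> \<phi> P < c \<Longrightarrow> (P, A) \<in> K' \<longleftrightarrow> (P, B) \<in> K'"
      "\<And>K' S' U V. is_class C1 K' S' \<Longrightarrow> (P, U) \<in> K' \<Longrightarrow> (Q, V) \<in> K' \<Longrightarrow> U \<in> F \<Longrightarrow> V \<in> F \<Longrightarrow> False"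
      "lnF C1 F = Pl A P B Q"
proof -
  note d = LrawD[OF L] and qd = quadD[OF LrawD(8)[OF L]] and x = Lraw_mx[OF L]
  have on: "A \<in> F" "P \<in> F" "B \<in> F" "Q \<in> F" using qd(2) by auto
  have onm: "(U, V) \<in> {(P, A), (P, B), (Q, A), (Q, B)} \<and> (U = P \<longrightarrow> P \<notin> dsp C1)" if "(U, V) \<in> mx C1" "U \<in> F" "V \<in> F" for U V
  proof -
    note m = mxD[OF d(3) that(1)]
    have "U = P \<or> U = Q" using that(2) qd(2) m(2) d(10,11) by auto
    moreover have "V = A \<or> V = B" using that(3) qd(2) m(3) d(12,13) by auto
    ultimately show ?thesis using m(8) by auto
  qed
  obtain K S where K: "is_class C1 K S" "(Q, A) \<in> K" by (rule class_ex[OF d(1) x(4)])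
  obtain K2 S2 where K2: "is_class C1 K2 S2" "(Q, B) \<in> K2" by (rule class_ex[OF d(1) x(5)])
  have ipQ: "ip (Q, A) \<noteq> ip (Q, B)" using ip_eqD[OF d(3) x(4,5)] qd d(13) by auto
  have lnFE: "\<exists>U V U' V' K S. l = seg (U, V) (U', V') \<and> is_class C1 K S \<and> (U, V) \<in> K \<and> (U', V') \<in> K \<and>
     (U, V) \<in> {(P, A), (P, B), (Q, A), (Q, B)} \<and> (U', V') \<in> {(P, A), (P, B), (Q, A), (Q, B)} \<and>
     {U, V, U', V'} \<subseteq> F \<and> ip (U, V) \<noteq> ip (U', V')" if "l \<in> lnF C1 F" for l
  proof -
    from that obtain U V U' V' K S where a: "l = seg (U, V) (U', V')" "is_class C1 K S" "(U, V) \<in> K" "(U', V') \<in> K"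
     "{U, V, U', V'} \<subseteq> F" "ip (U, V) \<noteq> ip (U', V')"
      unfolding lnF_def mem_Collect_eq by (elim exE conjE) (rule that)
    have "(U, V) \<in> mx C1" "(U', V') \<in> mx C1" using a(3,4) is_classD(5)[OF a(2)] by auto
    then have "(U, V) \<in> {(P, A), (P, B), (Q, A), (Q, B)}" "(U', V') \<in> {(P, A), (P, B), (Q, A), (Q, B)}"
      using onm[of U V] onm[of U' V'] a(5) by auto
    with a show ?thesis by (intro exI conjI)
  qed
  have lnFI: "seg (U, V) (U', V') \<in> lnF C1 F" if "is_class C1 K S" "(U, V) \<in> K" "(U', V') \<in> K"
     "{U, V, U', V'} \<subseteq> F" "ip (U, V) \<noteq> ip (U', V')" for U V U' V' K S
    unfolding lnF_def mem_Collect_eq using that by (intro exI conjI) (rule refl)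
  have Pcase: thesis if QB: "(Q, B) \<in> K"
      and PB: "\<And>K' S'. is_class C1 K' S' \<Longrightarrow> \<phi> P < c \<Longrightarrow> (P, A) \<in> K' \<longleftrightarrow> (P, B) \<in> K'"
      and nPQ: "\<And>K' S' U V. is_class C1 K' S' \<Longrightarrow> (P, U) \<in> K' \<Longrightarrow> (Q, V) \<in> K' \<Longrightarrow> U \<in> F \<Longrightarrow> V \<in> F \<Longrightarrow> False"
  proof (rule P[OF K QB PB nPQ])
    show "lnF C1 F = Pl A P B Q"
    proof (intro equalityI subsetI)
      fix l assume "l \<in> lnF C1 F"
      from lnFE[OF this] obtain U V U' V' K' S' where l: "l = seg (U, V) (U', V')" "is_class C1 K' S'" "(U, V) \<in> K'" "(U', V') \<in> K'"
        "(U, V) \<in> {(P, A), (P, B), (Q, A), (Q, B)}" "(U', V') \<in> {(P, A), (P, B), (Q, A), (Q, B)}" "{U, V, U', V'} \<subseteq> F"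
        "ip (U, V) \<noteq> ip (U', V')"
        by (elim exE conjE) (rule that)
      have same: "U = U'"
        using nPQ[OF l(2), of V V'] nPQ[OF l(2), of V' V] l(3-7) by auto
      show "l \<in> Pl A P B Q"
      proof (cases "U = Q")
        case True
        then have "{V, V'} = {A, B}" using same l(5,6,8) qd(7) by auto
        then show ?thesis using True same unfolding l(1) Pl_def doubleton_eq_iff by (auto simp: closed_segment_commute)
      next
        case False
        then have "U = P" "{V, V'} = {A, B}" using same l(5,6,8) by auto
        moreover have "\<phi> P < c" using l(8) same \<open>U = P\<close> ip_level[of P V] ip_level[of P V'] d(12) by fastforce
        ultimately show ?thesis using same unfolding l(1) Pl_def doubleton_eq_iff by (auto simp: closed_segment_commute)
      qed
    next
      fix l assume "l \<in> Pl A P B Q"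
      then consider "l = seg (Q, A) (Q, B)" | "\<phi> P < c" "l = seg (P, A) (P, B)" unfolding Pl_def by (auto split: if_splits)
      then show "l \<in> lnF C1 F"
      proof cases
        case 1 then show ?thesis using lnFI[OF K QB] on ipQ by simp
      next
        case 2
        have "P \<notin> dsp C1" using x(8) 2 by auto
        obtain K' S' where K': "is_class C1 K' S'" "(P, A) \<in> K'" by (rule class_ex[OF d(1) x(6)[OF \<open>P \<notin> dsp C1\<close>]])
        have "ip (P, A) \<noteq> ip (P, B)" using ip_eqD[OF d(3) x(6,7)] \<open>P \<notin> dsp C1\<close> qd 2 by auto
        then show ?thesis using lnFI[OF K', of P B] PB[OF K'(1) 2(1)] K'(2) on 2(2) by simp
      qed
    qed
  qed
  show thesis
  \<comment> \<open>If \<open>P\<close> has been relabeled, \<open>F\<close> is no L-face of this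
    graph and carries a single line, around \<open>Q\<close>. As \<open>P\<close> then has label
    \<open>c\<close>, this is exactly \<open>Pl\<close>.\<close>
  proof (cases "P \<in> dsp C1")
    case True
    have nL: "F \<notin> Lf C1" by (rule x(10)[OF True])
    have "(Q, B) \<in> K" by (rule class_face[OF K(1) d(6) nL K(2) x(5)]) (use on in simp)
    then show thesis
    proof (rule Pcase)
      fix K' S' U V assume a: "is_class C1 K' S'" "(P, U) \<in> K'" 
      then have "(P, U) \<in> mx C1" using is_classD(5) by blast
      then show False using mxD(8)[OF d(3)] True by blast
    qed (use x(8) True in auto)
  next
    case False
    note y = x(6,7,9)[OF False]
    from types[OF K(1)] show thesis
    proof
      assume t: "dtype C1"
      have a: "(P, A) \<in> K" "(P, B) \<in> K2" "A \<in> S" "B \<in> S2"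
        using dtypeD(2)[OF t K y(1)] dtypeD(2)[OF t K2 y(2)] dtypeD(1)[OF t K(1) x(4)] dtypeD(1)[OF t K2(1) x(5)] K(2) K2(2) by auto
      have dj: "K \<inter> K2 = {}"
      proof (rule ccontr)
        assume "K \<inter> K2 \<noteq> {}"
        then have "K = K2" using class_disjoint(1)[OF K(1) K2(1)] by blast
        then show False using dtypeD(3)[OF t K(1) y(3) K(2), of Q B] K2(2) on qd by auto
      qed
      show thesis
      proof (rule D[OF K a(1) a(3) K2 a(2) a(4) False y(3) dj], intro equalityI subsetI)
        fix l assume "l \<in> lnF C1 F"
        from lnFE[OF this] obtain U V U' V' K' S' where l: "l = seg (U, V) (U', V')" "is_class C1 K' S'" "(U, V) \<in> K'" "(U', V') \<in> K'"
          "(U, V) \<in> {(P, A), (P, B), (Q, A), (Q, B)}" "(U', V') \<in> {(P, A), (P, B), (Q, A), (Q, B)}" "{U, V, U', V'} \<subseteq> F"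
          "ip (U, V) \<noteq> ip (U', V')"
          by (elim exE conjE) (rule that)
        have "V = V'" by (rule dtypeD(3)[OF t l(2) y(3) l(3,4,7)])
        moreover from this have "{U, U'} = {P, Q}" using l(5,6,8) by auto
        ultimately show "l \<in> Dl A P B Q" using l(5) unfolding l(1) Dl_def doubleton_eq_iff
          by (auto simp: closed_segment_commute)
      next
        fix l assume "l \<in> Dl A P B Q"
        then consider "l = seg (Q, A) (P, A)" | "l = seg (Q, B) (P, B)" unfolding Dl_def by auto
        then show "l \<in> lnF C1 F"
        proof cases
          case 1
          have "ip (Q, A) \<noteq> ip (P, A)" using ip_eqD[OF d(3) x(4) y(1)] qd by auto
          then show ?thesis using lnFI[OF K a(1)] on 1 by simp
        next
          case 2
          have "ip (Q, B) \<noteq> ip (P, B)" using ip_eqD[OF d(3) x(5) y(2)] qd by auto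
          then show ?thesis using lnFI[OF K2 a(2)] on 2 by simp
        qed
      qed
    next
      assume t: "ptype C1"
      show thesis
      proof (rule Pcase)
        show "(Q, B) \<in> K" by (rule ptypeD(2)[OF t K x(5)])
        show "(P, A) \<in> K' \<longleftrightarrow> (P, B) \<in> K'" if "is_class C1 K' S'" for K' S'
          using ptypeD(2)[OF t that _ y(1)] ptypeD(2)[OF t that _ y(2)] by blast
        fix K' S' U V assume "is_class C1 K' S'" "(P, U) \<in> K'" "(Q, V) \<in> K'" "U \<in> F" "V \<in> F"
        then have "P = Q" using ptypeD(3)[OF t _ y(3)] on by blast
        then show False using qd(7) by simp
      qed
    qed
  qed
qed

definition pts :: "pt \<Rightarrow> pt \<Rightarrow> pt \<Rightarrow> pt \<Rightarrow> pt set" where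
  "pts A P B Q = {ip (P, A), ip (P, B), ip (Q, A), ip (Q, B)}"

text \<open>Needed besides \<open>car_ip\<close> because the edges at a relabeled node are not mixed
  in the graph, although their iso-points are among \<open>pts\<close>.\<close>

lemma car_raw:
  assumes "D \<in> M" "incident D P A" "\<phi> P \<le> c" "c < \<phi> A"
  shows "\<phi> P < c \<Longrightarrow> car D (ip (P, A)) = {P, A}" "\<phi> P = c \<Longrightarrow> car D (ip (P, A)) = {P}"
    "ip (P, A) \<in> closed_segment P A"
proof -
  obtain t where t: "0 \<le> t" "t < 1" "ip (P, A) = P + t *\<^sub>R (A - P)" "t = 0 \<longleftrightarrow> \<phi> P = c"
    by (rule ip_param[OF assms(3,4)])
  show "\<phi> P < c \<Longrightarrow> car D (ip (P, A)) = {P, A}"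
    by (rule car_edge[OF cuboid_M[OF assms(1)] assms(2) _ t(2,3)]) (use t in auto)
  show "\<phi> P = c \<Longrightarrow> car D (ip (P, A)) = {P}"
    using ip_level[of P A] car_node[of P D] incident_nodes[OF assms(2)] by simp
  have "ip (P, A) = (1 - t) *\<^sub>R P + t *\<^sub>R A" using t(3) by (simp add: algebra_simps)
  then show "ip (P, A) \<in> closed_segment P A" using t(1,2) by (auto simp: in_segment)
qed

lemma Lraw_car:
  assumes L: "Lraw C1 C2 F A P B Q"
  shows "car C1 (ip (Q, A)) = {Q, A}" "car C1 (ip (Q, B)) = {Q, B}"
    "\<phi> P < c \<Longrightarrow> car C1 (ip (P, A)) = {P, A}" "\<phi> P < c \<Longrightarrow> car C1 (ip (P, B)) = {P, B}"
    "\<phi> P = c \<Longrightarrow> ip (P, A) = P" "\<phi> P = c \<Longrightarrow> ip (P, B) = P" "\<phi> P = c \<Longrightarrow> car C1 P = {P}"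
    "pts A P B Q \<subseteq> convex hull F" "pts A P B Q \<subseteq> body C1"
proof -
  note d = LrawD[OF L] and qd = quadD[OF LrawD(8)[OF L]]
  note r = car_raw[OF d(3) qd(15) _ d(11)] car_raw[OF d(3) qd(12) _ d(10)]
    car_raw[OF d(3) qd(10) _ d(11)] car_raw[OF d(3) qd(13) _ d(10)]
  show "car C1 (ip (Q, A)) = {Q, A}" "car C1 (ip (Q, B)) = {Q, B}"
    "\<phi> P < c \<Longrightarrow> car C1 (ip (P, A)) = {P, A}" "\<phi> P < c \<Longrightarrow> car C1 (ip (P, B)) = {P, B}"
    "\<phi> P = c \<Longrightarrow> ip (P, A) = P" "\<phi> P = c \<Longrightarrow> ip (P, B) = P"
    using r d(12,13) ip_level by auto
  show "\<phi> P = c \<Longrightarrow> car C1 P = {P}" by (rule car_node[OF qd(22)])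
  have h: "closed_segment X Y \<subseteq> convex hull F" if "X \<in> F" "Y \<in> F" for X Y
    using that hull_inc closed_segment_subset[OF _ _ convex_convex_hull] by metis
  have "A \<in> F" "P \<in> F" "B \<in> F" "Q \<in> F" using qd(2) by auto
  then have "ip (P, A) \<in> convex hull F" "ip (P, B) \<in> convex hull F" "ip (Q, A) \<in> convex hull F" "ip (Q, B) \<in> convex hull F"
    using r(3,6,9,12) d(12,13) h by (meson less_imp_le subsetD)+
  then show "pts A P B Q \<subseteq> convex hull F" by (simp add: pts_def)
  then show "pts A P B Q \<subseteq> body C1" using d(15) by blast
qed

text \<open>The carriers of the points are pairwise incomparable, whereas the carrier of a point
  strictly between two others would contain both of theirs.\<close>

lemma pts_not_collinear:
  assumes L: "Lraw C1 C2 F A P B Q" and x: "x \<in> pts A P B Q" "y \<in> pts A P B Q" "z \<in> pts A P B Q" "x \<noteq> y" "y \<noteq> z" "x \<noteq> z"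
  shows "\<not> collinear {x, y, z}"
proof
  note d = LrawD[OF L] and qd = quadD[OF LrawD(8)[OF L]] and lc = Lraw_car[OF L]
  have inj: "u = v" if "u \<in> pts A P B Q" "v \<in> pts A P B Q" "car C1 u \<subseteq> car C1 v" for u v
  proof (cases "\<phi> P = c")
    case True
    then show ?thesis using that lc(1,2,5,6,7) qd(3-8) unfolding pts_def by auto
  next
    case False
    then have "\<phi> P < c" using d(12) by simp
    note lc' = lc(1,2) lc(3,4)[OF this]
    show ?thesis using that lc' qd(3-8) unfolding pts_def by (auto simp: doubleton_eq_iff)
  qed
  have no: False if "u \<in> pts A P B Q" "v \<in> pts A P B Q" "w \<in> pts A P B Q" "between (v, w) u" "u \<noteq> v" "u \<noteq> w" for u v w
  proof -
    have o: "u \<in> open_segment v w" using that by (simp add: between_mem_segment open_segment_def)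
    have "car C1 v \<subseteq> car C1 u" by (rule car_mono(1)[OF o]) (use that lc(9) in auto)
    then show False using inj[OF that(2,1)] that(5) by simp
  qed
  assume "collinear {x, y, z}"
  then show False using no[of x y z] no[of y z x] no[of z x y] x unfolding collinear_between_cases by auto
qed

lemma two_points_collinear:
  fixes s t v w x y :: pt
  assumes "x \<in> closed_segment s t" "y \<in> closed_segment s t" "x \<in> closed_segment v w" "y \<in> closed_segment v w" "x \<noteq> y"
  shows "collinear {s, t, v, w}"
proof -
  have 1: "affine hull {x, y} = affine hull {p, q}" if "x \<in> closed_segment p q" "y \<in> closed_segment p q" for p q :: pt
  proof -
    have xy: "x \<in> affine hull {p, q}" "y \<in> affine hull {p, q}"
      using that closed_segment_subset[OF _ _ affine_imp_convex[OF affine_affine_hull], of p "{p, q}" q] hull_inc[of p "{p, q}"] hull_inc[of q "{p, q}"] by auto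
    have "p \<noteq> q" using that assms(5) by auto
    have "{x, y, p} \<subseteq> affine hull {p, q}" "{x, y, q} \<subseteq> affine hull {p, q}"
      using xy hull_inc[of p "{p, q}"] hull_inc[of q "{p, q}"] by auto
    then have "collinear {x, y, p}" "collinear {x, y, q}" unfolding collinear_affine_hull by blast+
    then have "p \<in> affine hull {x, y}" "q \<in> affine hull {x, y}"
      unfolding collinear_3_affine_hull[OF assms(5)] by blast+
    then show ?thesis using xy by (intro equalityI hull_minimal) auto
  qed
  have "{s, t, v, w} \<subseteq> affine hull {x, y}"
    using 1[OF assms(1,2)] 1[OF assms(3,4)] hull_inc[of s "{s, t}"] hull_inc[of t "{s, t}"] hull_inc[of v "{v, w}"] hull_inc[of w "{v, w}"] by auto
  then show ?thesis unfolding collinear_affine_hull by blast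
qed

text \<open>The infinite segment is covered by finitely many lines and points, so some line of the
  family shares two points with it and is collinear with it. As no three of the iso-points are
  collinear, both have the same ends.\<close>

lemma pts_line:
  assumes L: "Lraw C1 C2 F A P B Q" and v: "v \<in> pts A P B Q" "w \<in> pts A P B Q" "v \<noteq> w"
    and \<L>: "\<L> \<subseteq> Dl A P B Q \<union> Pl A P B Q" and sub: "closed_segment v w \<subseteq> \<Union>\<L> \<union> pts A P B Q"
  shows "closed_segment v w \<in> \<L>"
proof -
  have fin: "finite \<L>" by (rule finite_subset[OF \<L>]) (simp add: Dl_def Pl_def)
  have "infinite (closed_segment v w)" using v(3) by (simp add: finite_closed_segment)
  moreover have "closed_segment v w \<subseteq> (\<Union>m\<in>\<L>. m \<inter> closed_segment v w) \<union> pts A P B Q" using sub by blast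
  ultimately have "\<not> finite ((\<Union>m\<in>\<L>. m \<inter> closed_segment v w) \<union> pts A P B Q)" using finite_subset by blast
  then have inf: "\<not> finite (\<Union>m\<in>\<L>. m \<inter> closed_segment v w)" by (auto simp: pts_def)
  have "\<exists>m \<in> \<L>. infinite (m \<inter> closed_segment v w)"
  proof (rule ccontr)
    assume "\<not> ?thesis"
    then have "finite (\<Union>m\<in>\<L>. m \<inter> closed_segment v w)" by (intro finite_UN_I fin) blast
    then show False using inf by simp
  qed
  then obtain m where m: "m \<in> \<L>" "infinite (m \<inter> closed_segment v w)" by blast
  have "m \<inter> closed_segment v w \<noteq> {}" using m(2) by (metis finite.emptyI)
  then obtain x where x: "x \<in> m \<inter> closed_segment v w" by blast
  have "m \<inter> closed_segment v w \<noteq> {x}" using m(2) by auto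
  then obtain y where y: "y \<in> m \<inter> closed_segment v w" "x \<noteq> y" using x by blast
  obtain s t where st: "m = closed_segment s t" "s \<in> pts A P B Q" "t \<in> pts A P B Q"
    using m(1) \<L> unfolding Dl_def Pl_def pts_def by (auto split: if_splits)
  have col: "collinear {s, t, v, w}" by (rule two_points_collinear[of x _ _ y]) (use x y st in auto)
  have "s \<noteq> t" using x y st by auto
  have *: "u = s \<or> u = t" if "u \<in> {v, w}" for u
  proof (rule ccontr)
    assume n: "\<not> ?thesis"
    have "collinear {s, t, u}" by (rule collinear_subset[OF col]) (use that in auto)
    moreover have "\<not> collinear {s, t, u}" by (rule pts_not_collinear[OF L]) (use st v that n \<open>s \<noteq> t\<close> in auto)
    ultimately show False by simp
  qed
  have "{v, w} = {s, t}" using *[of v] *[of w] v(3) by auto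
  then have "closed_segment v w = m" unfolding st(1) by (simp only: closed_segment_eq)
  then show ?thesis using m(1) by simp
qed

lemma hull_face_car:
  assumes D: "D \<in> M" "F \<in> faces D" and x: "x \<in> convex hull F"
  shows "car D x \<subseteq> F" "x \<in> body D"
proof -
  note cD = cuboid_M[OF D(1)]
  obtain i V where V: "V \<in> nodes D" "F = face D i V" by (rule facesE[OF cD D(2)])
  have "x \<in> body D" "x $ i = V $ i" using x unfolding V(2) hull_face[OF cD V(1)] by auto
  then show "car D x \<subseteq> F" "x \<in> body D" unfolding V(2) using car_face[OF V(1)] by auto
qed

lemma faces_sub_eq:
  assumes D: "D \<in> M" "F \<in> faces D" "F' \<in> faces D" "F \<subseteq> F'"
  shows "F = F'"
proof -
  note cD = cuboid_M[OF D(1)]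
  have 4: "card G = 4 \<and> finite G" if G: "G \<in> faces D" for G
  proof -
    obtain V where "V \<in> G" using faces_nonempty[OF cD G] by blast
    then obtain P B Q where q: "quad D G V P B Q" using quad_ex[OF cD G] by blast
    show ?thesis using quadD(3-8)[OF q] unfolding quadD(2)[OF q] by simp
  qed
  then show ?thesis using D(2,3,4) card_subset_eq by metis
qed

lemma lnF_in:
  assumes "l \<in> lnF D F" "F \<in> faces D"
  obtains K S where "is_class D K S" "l \<in> ln D K"
proof -
  from assms obtain U V U' V' K S where a: "l = seg (U, V) (U', V')" "is_class D K S" "(U, V) \<in> K" "(U', V') \<in> K"
     "{U, V, U', V'} \<subseteq> F" "ip (U, V) \<noteq> ip (U', V')"
    unfolding lnF_def mem_Collect_eq by (elim exE conjE) (rule that)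
  show ?thesis by (rule that[OF a(2)]) (use lnI[OF a(2-4) assms(2) a(5,6)] a(1) in simp)
qed

text \<open>Where an inner iso-path meets \<open>F\<close>, it either runs on \<open>F\<close> or
  touches it in an iso-point of \<open>F\<close>, coming from another face.\<close>

lemma Lraw_points:
  assumes L: "Lraw C1 C2 F A P B Q" and k: "is_class C1 K S" and l: "l \<in> ln C1 K" and x: "x \<in> l" "x \<in> convex hull F"
  shows "l \<in> lnF C1 F \<or> x \<in> pts A P B Q \<and> (x \<in> N \<or> (\<exists>U V. (U, V) \<in> K \<and> {U, V} \<subseteq> F \<and> x = ip (U, V)))"
proof -
  note d = LrawD[OF L] and qd = quadD[OF LrawD(8)[OF L]]
  have cF: "car C1 x \<subseteq> F" by (rule hull_face_car[OF d(3,6) x(2)])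
  obtain U V U' V' F' where a: "l = seg (U, V) (U', V')" "(U, V) \<in> K" "(U', V') \<in> K" "F' \<in> faces C1" "{U, V, U', V'} \<subseteq> F'"
    "ip (U, V) \<noteq> ip (U', V')" "(U, V) \<in> mx C1" "(U', V') \<in> mx C1"
    by (rule lnE[OF k l])
  note da = mxD[OF d(3) a(7)] mxD[OF d(3) a(8)]
  have lev: "Z = P" if "Z \<in> F" "\<phi> Z = c" for Z using that qd(2) d(10,11,13) by auto
  from d(3) a(7,8,4-6) x(1)[unfolded a(1)] show ?thesis
  proof (cases rule: line_cases)
    case (n Z)
    then have Z: "Z \<in> nodes C1" "Z \<in> N" using da NI[OF d(1) a(7)] NI[OF d(1) a(8)] by auto
    then have "Z \<in> F" using cF n car_node by auto
    then have "Z = P" "\<phi> P = c" using lev n(2) by auto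
    then have "x = ip (P, A)" using n(3) ip_level by simp
    then show ?thesis using Z n(3) by (auto simp: pts_def)
  next
    case (s Y Z)
    have "(Y, Z) \<in> K" "c < \<phi> Z" "\<phi> Y < c" using s a da by auto
    moreover have on: "{Y, Z} \<subseteq> F" using cF s by simp
    ultimately have "(Y = P \<or> Y = Q) \<and> (Z = A \<or> Z = B)" using qd(2) d(10-13) by auto
    then have "x \<in> pts A P B Q" using s(3) by (auto simp: pts_def)
    then show ?thesis using on \<open>(Y, Z) \<in> K\<close> s(3) by blast
  next
    case f
    then have "F' = F" using faces_sub_eq[OF d(3) a(4) d(6)] cF by simp
    then have "l \<in> lnF C1 F" unfolding lnF_def mem_Collect_eq using a k by (intro exI conjI) auto
    then show ?thesis ..
  next
    case e
    then have "U \<in> F" "U' \<in> F" using cF by auto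
    then have "U = P" "U' = P" using lev e by auto
    then show ?thesis using e(3) by simp
  qed
qed

lemma Lraw_line_hull:
  assumes L: "Lraw C1 C2 F A P B Q" and l: "l \<in> Dl A P B Q \<union> Pl A P B Q"
  shows "l \<subseteq> convex hull F"
proof -
  obtain s t where st: "l = closed_segment s t" "s \<in> pts A P B Q" "t \<in> pts A P B Q"
    using l unfolding Dl_def Pl_def pts_def by (auto split: if_splits)
  show ?thesis unfolding st(1)
    by (rule closed_segment_subset) (use st Lraw_car(8)[OF L] in auto)
qed

text \<open>An inner point with carrier \<open>F\<close> pins the line to \<open>F\<close>: the
  cuboids containing this point are just those with face \<open>F\<close>.\<close>

lemma Lraw_line_mid:
  assumes L: "Lraw C1 C2 F A P B Q" and l: "l \<in> lnF C1 F"
  shows "\<exists>y. y \<in> l \<and> car C1 y = F \<and> y \<in> body C1"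
proof -
  note d = LrawD[OF L] and qd = quadD[OF LrawD(8)[OF L]]
  from l obtain U V U' V' K S where a: "l = seg (U, V) (U', V')" "is_class C1 K S" "(U, V) \<in> K" "(U', V') \<in> K"
     "{U, V, U', V'} \<subseteq> F" "ip (U, V) \<noteq> ip (U', V')"
    unfolding lnF_def mem_Collect_eq by (elim exE conjE) (rule that)
  have m: "(U, V) \<in> mx C1" "(U', V') \<in> mx C1" using a(3,4) is_classD(5)[OF a(2)] by auto
  have b: "y \<in> body C1" if "y \<in> l" for y using that seg_body[OF d(3) m] a(1) by auto
  from d(3) m d(6) a(5,6) show ?thesis
  proof (cases rule: midpoint_line)
    case (1 y) then show ?thesis using b a(1) by blast
  next
    case (2 y)
    have lev: "Z = P" if "Z \<in> F" "\<phi> Z = c" for Z using that qd(2) d(10,11,13) by auto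
    have "U = P" "U' = P" using lev[of U] lev[of U'] 2 a(5) by auto
    then show ?thesis using 2(4) by simp
  qed
qed

lemma Lraw_line_mid2:
  assumes L: "Lraw C1 C2 F A P B Q" and l: "l \<in> lnF C1 F \<union> lnF C2 F"
  shows "\<exists>y. y \<in> l \<and> car C1 y = F \<and> y \<in> body C1 \<and> y \<in> body C2"
proof -
  note d = LrawD[OF L]
  have h: "F \<subseteq> nodes C1" "F \<subseteq> nodes C2" using faces_sub d by blast+
  from l obtain E where E: "E = C1 \<or> E = C2" "l \<in> lnF E F" by blast
  have "\<exists>y. y \<in> l \<and> car E y = F \<and> y \<in> body E"
    using E Lraw_line_mid[OF L] Lraw_line_mid[OF Lraw_sym[OF L]] by auto
  then obtain y where y: "y \<in> l" "car E y = F" "y \<in> body E" by blast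
  have "l \<in> Dl A P B Q \<union> Pl A P B Q"
  proof -
    have "lnF C1 F = Dl A P B Q \<or> lnF C1 F = Pl A P B Q" by (rule Lraw_types[OF L]) simp_all
    moreover have "lnF C2 F = Dl A P B Q \<or> lnF C2 F = Pl A P B Q"
      by (rule Lraw_types[OF Lraw_sym[OF L]]) simp_all
    ultimately show ?thesis using l by auto
  qed
  then have "y \<in> convex hull F" using Lraw_line_hull[OF L] y(1) by blast
  then have b: "y \<in> body C1" "y \<in> body C2" using d(15) by auto
  have "car C1 y = car C2 y" by (rule car_mesh[OF mesh(1) d(3,4) b])
  then have "car C1 y = F" using y(2) E(1) by auto
  then show ?thesis using y(1) b by blast
qed

end

section \<open>Triangles and quadrilaterals as simple closed polygons\<close>

lemma polygon_vertex:
  assumes "closed_polygon Qs" "v \<in> set Qs"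
  obtains w u where "w \<in> set Qs" "u \<in> set Qs" "w \<noteq> u" "w \<noteq> v" "u \<noteq> v"
    "closed_segment v w \<in> polygon_lines Qs" "closed_segment v u \<in> polygon_lines Qs"
proof -
  let ?n = "length Qs"
  have n: "3 \<le> ?n" "distinct Qs" using assms(1) by (auto simp: closed_polygon_def)
  obtain i where i: "i < ?n" "v = Qs ! i" using assms(2) by (auto simp: in_set_conv_nth)
  define j where "j = Suc i mod ?n"
  define p where "p = (if i = 0 then ?n - 1 else i - 1)"
  have jp: "j < ?n" "p < ?n" "j \<noteq> p" "j \<noteq> i" "p \<noteq> i" "Suc p mod ?n = i"
    using i n unfolding j_def p_def by (auto simp: mod_Suc)
  have "side Qs i = closed_segment v (Qs ! j)" "side Qs p = closed_segment v (Qs ! p)"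
    using i jp by (auto simp: side_def j_def closed_segment_commute)
  moreover have "side Qs i \<in> polygon_lines Qs" "side Qs p \<in> polygon_lines Qs"
    using i jp by (auto simp: polygon_lines_def)
  ultimately show ?thesis
    using that[of "Qs ! j" "Qs ! p"] jp i n(2) by (simp add: nth_eq_iff_index_eq)
qed

lemma side_ends:
  assumes "i < length Qs"
  shows "Qs ! i \<in> set Qs" "Qs ! (Suc i mod length Qs) \<in> set Qs"
proof -
  have "Suc i mod length Qs < length Qs" using assms by (intro mod_less_divisor) linarith
  then show "Qs ! i \<in> set Qs" "Qs ! (Suc i mod length Qs) \<in> set Qs" using assms by auto
qed

lemma triangle_simple:
  fixes a b d :: pt
  assumes "\<not> collinear {a, b, d}"
  shows "simple_closed_polygon [a, b, d]" "polygon_lines [a, b, d] = {closed_segment a b, closed_segment b d, closed_segment d a}"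
proof -
  have ne: "a \<noteq> b" "b \<noteq> d" "a \<noteq> d" using assms by (auto simp: insert_commute)
  have i: "closed_segment a b \<inter> closed_segment b d = {b}" "closed_segment b d \<inter> closed_segment d a = {d}"
    "closed_segment d a \<inter> closed_segment a b = {a}"
    by (rule Int_closed_segment; use assms in \<open>simp add: insert_commute\<close>)+
  have s: "side [a, b, d] 0 = closed_segment a b" "side [a, b, d] (Suc 0) = closed_segment b d"
    "side [a, b, d] (Suc (Suc 0)) = closed_segment d a"
    by (simp_all add: side_def)
  have all: "(\<forall>i < length [a, b, d]. R i) \<longleftrightarrow> R 0 \<and> R (Suc 0) \<and> R (Suc (Suc 0))" for R
    by (auto simp: less_Suc_eq)
  show "simple_closed_polygon [a, b, d]"
    unfolding simple_closed_polygon_def closed_polygon_def all s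
    using ne i by (auto simp: Int_commute)
  have "{..<length [a, b, d]} = {0, Suc 0, Suc (Suc 0)}" by auto
  then show "polygon_lines [a, b, d] = {closed_segment a b, closed_segment b d, closed_segment d a}"
    unfolding polygon_lines_def by (simp only: image_insert image_empty s)
qed

lemma quadrilateral_simple:
  fixes a b d e :: pt
  assumes "\<not> collinear {a, b, d}" "\<not> collinear {b, d, e}" "\<not> collinear {d, e, a}" "\<not> collinear {e, a, b}"
    and "closed_segment a b \<inter> closed_segment d e = {}" "closed_segment b d \<inter> closed_segment e a = {}"
  shows "simple_closed_polygon [a, b, d, e]"
    "polygon_lines [a, b, d, e] = {closed_segment a b, closed_segment b d, closed_segment d e, closed_segment e a}"
proof -
  have ne: "a \<noteq> b" "b \<noteq> d" "a \<noteq> d" "e \<noteq> a" "e \<noteq> b" "e \<noteq> d" using assms(1-4) by (auto simp: insert_commute)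
  have i: "closed_segment a b \<inter> closed_segment b d = {b}" "closed_segment b d \<inter> closed_segment d e = {d}"
    "closed_segment d e \<inter> closed_segment e a = {e}" "closed_segment e a \<inter> closed_segment a b = {a}"
    by (rule Int_closed_segment; use assms(1-4) in simp)+
  have s: "side [a, b, d, e] 0 = closed_segment a b" "side [a, b, d, e] (Suc 0) = closed_segment b d"
    "side [a, b, d, e] (Suc (Suc 0)) = closed_segment d e" "side [a, b, d, e] (Suc (Suc (Suc 0))) = closed_segment e a"
    by (simp_all add: side_def)
  have all: "(\<forall>i < length [a, b, d, e]. R i) \<longleftrightarrow> R 0 \<and> R (Suc 0) \<and> R (Suc (Suc 0)) \<and> R (Suc (Suc (Suc 0)))" for R
    by (auto simp: less_Suc_eq)
  show "simple_closed_polygon [a, b, d, e]"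
    unfolding simple_closed_polygon_def closed_polygon_def all s
    using ne i assms(5,6) by (simp add: Int_commute)
  have "{..<length [a, b, d, e]} = {0, Suc 0, Suc (Suc 0), Suc (Suc (Suc 0))}" by auto
  then show "polygon_lines [a, b, d, e] = {closed_segment a b, closed_segment b d, closed_segment d e, closed_segment e a}"
    unfolding polygon_lines_def by (simp only: image_insert image_empty s)
qed

section \<open>The outer iso-path on a non-trivial L-face\<close>

context graph_system
begin

lemma Lraw_lnF:
  assumes L: "Lraw C1 C2 F A P B Q"
  shows "lnF C1 F = Dl A P B Q \<or> lnF C1 F = Pl A P B Q" "lnF C2 F = Dl A P B Q \<or> lnF C2 F = Pl A P B Q"
proof -
  have *: "lnF E F = Dl A P B Q \<or> lnF E F = Pl A P B Q" if L: "Lraw E E' F A P B Q" for E E'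
    using L
  proof (cases rule: Lraw_types)
    case D then show ?thesis by blast
  next
    case P then show ?thesis by blast
  qed
  show "lnF C1 F = Dl A P B Q \<or> lnF C1 F = Pl A P B Q" by (rule *[OF L])
  show "lnF C2 F = Dl A P B Q \<or> lnF C2 F = Pl A P B Q" by (rule *[OF Lraw_sym[OF L]])
qed

lemma pts_distinct:
  assumes L: "Lraw C1 C2 F A P B Q"
  shows "ip (Q, A) \<noteq> ip (Q, B)" "ip (Q, A) \<noteq> ip (P, A)" "ip (Q, A) \<noteq> ip (P, B)" "ip (Q, B) \<noteq> ip (P, A)"
    "ip (Q, B) \<noteq> ip (P, B)" "ip (P, A) = ip (P, B) \<longleftrightarrow> \<phi> P = c"
proof -
  note d = LrawD[OF L] and qd = quadD[OF LrawD(8)[OF L]] and lc = Lraw_car[OF L]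
  have PA: "car C1 (ip (P, A)) \<subseteq> {P, A}" and PB: "car C1 (ip (P, B)) \<subseteq> {P, B}"
    using d(12) lc(3-7) by (cases "\<phi> P = c"; simp)+
  have q: "Q \<in> car C1 (ip (Q, A))" "Q \<in> car C1 (ip (Q, B))" unfolding lc(1,2) by simp_all
  have p: "Q \<notin> car C1 (ip (P, A))" "Q \<notin> car C1 (ip (P, B))" using PA PB qd(5,7,8) by blast+
  show "ip (Q, A) \<noteq> ip (P, A)" "ip (Q, A) \<noteq> ip (P, B)" "ip (Q, B) \<noteq> ip (P, A)" "ip (Q, B) \<noteq> ip (P, B)"
    using q p by metis+
  have "A \<in> car C1 (ip (Q, A))" "A \<notin> car C1 (ip (Q, B))" unfolding lc(1,2) using qd(4,5) by simp_all
  then show "ip (Q, A) \<noteq> ip (Q, B)" by metis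
  show "ip (P, A) = ip (P, B) \<longleftrightarrow> \<phi> P = c"
  proof
    assume e: "ip (P, A) = ip (P, B)"
    show "\<phi> P = c"
    proof (rule ccontr)
      assume "\<phi> P \<noteq> c"
      then have "\<phi> P < c" using d(12) by simp
      then have "{P, A} = {P, B}" using lc(3,4) e by metis
      then have "A \<in> {P, B}" by blast
      then show False using qd(3,4) by simp
    qed
  qed (simp add: lc(5,6))
qed

lemma Dl_Pl_disjoint:
  assumes L: "Lraw C1 C2 F A P B Q"
  shows "Dl A P B Q \<inter> Pl A P B Q = {}"
  using pts_distinct[OF L] unfolding Dl_def Pl_def by (auto simp: closed_segment_eq doubleton_eq_iff split: if_splits)

lemma Dl_neq_Pl: "Lraw C1 C2 F A P B Q \<Longrightarrow> Dl A P B Q \<noteq> Pl A P B Q"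
  using Dl_Pl_disjoint[of C1 C2 F A P B Q] unfolding Dl_def by auto

lemma Lraw_vertex:
  assumes L: "Lraw C1 C2 F A P B Q" and v: "v \<in> iso_points c (graph C1)" "v \<in> convex hull F"
  shows "v \<in> pts A P B Q"
proof -
  note d = LrawD[OF L] and qd = quadD[OF LrawD(8)[OF L]]
  from v(1) obtain U V where m: "(U, V) \<in> mx C1" "v = iso_pt c (graph C1) (U, V)"
    unfolding iso_points_def by auto
  have vi: "v = ip (U, V)" using m iso_pt_graph[OF d(3)] by simp
  have cF: "car C1 v \<subseteq> F" by (rule hull_face_car[OF d(3,6) v(2)])
  note md = mxD[OF d(3) m(1)]
  show ?thesis
  proof (cases "\<phi> U = c")
    case True
    then have "U \<in> F" using cF car_ip(2)[OF d(3) m(1)] vi by simp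
    then have "U = P" using True qd(2) d(10,11,13) by auto
    then show ?thesis using vi True ip_level by (auto simp: pts_def)
  next
    case False
    then have s: "\<phi> U < c" using md by auto
    then have "{U, V} \<subseteq> F" using cF car_ip(1)[OF d(3) m(1)] vi by simp
    then have "(U = P \<or> U = Q) \<and> (V = A \<or> V = B)" using s md(3) qd(2) d(10-13) by auto
    then show ?thesis using vi by (auto simp: pts_def)
  qed
qed

abbreviation surf :: "cuboid \<Rightarrow> cuboid \<Rightarrow> pt set" where
  "surf C1 C2 \<equiv> \<Union>(L, S) \<in> W C1 \<union> W C2. \<Union>L"

text \<open>The inner iso-paths meet \<open>F\<close> in the lines on \<open>F\<close> and possibly
  in iso-points of \<open>F\<close> touched from other faces, so the two inclusions differ by at
  most the four points.\<close>

lemma Lraw_surf: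
  assumes L: "Lraw C1 C2 F A P B Q"
  shows "surf C1 C2 \<inter> convex hull F \<subseteq> \<Union>(lnF C1 F \<union> lnF C2 F) \<union> pts A P B Q"
    "\<Union>(lnF C1 F \<union> lnF C2 F) \<subseteq> surf C1 C2 \<inter> convex hull F"
proof -
  note d = LrawD[OF L]
  have 1: "x \<in> \<Union>(lnF C1 F) \<union> pts A P B Q" if L: "Lraw C1 C2 F A P B Q" and W: "(Ls, S) \<in> W C1" and x: "l \<in> Ls" "x \<in> l" "x \<in> convex hull F"
    for C1 C2 Ls S l x
  proof -
    obtain K where K: "is_class C1 K S" "Ls = ln C1 K" by (rule W_classE[OF LrawD(1)[OF L] W])
    from Lraw_points[OF L K(1) _ x(2,3)] x(1,2) K(2) show ?thesis by auto
  qed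
  show "surf C1 C2 \<inter> convex hull F \<subseteq> \<Union>(lnF C1 F \<union> lnF C2 F) \<union> pts A P B Q"
  proof
    fix x assume "x \<in> surf C1 C2 \<inter> convex hull F"
    then obtain Ls S l where x: "(Ls, S) \<in> W C1 \<or> (Ls, S) \<in> W C2" "l \<in> Ls" "x \<in> l" "x \<in> convex hull F" by auto
    then show "x \<in> \<Union>(lnF C1 F \<union> lnF C2 F) \<union> pts A P B Q"
      using 1[OF L _ x(2-4), of S] 1[OF Lraw_sym[OF L] _ x(2-4), of S] by auto
  qed
  have 2: "l \<subseteq> surf C1 C2" if l: "l \<in> lnF E F" "E = C1 \<or> E = C2" for l E
  proof -
    have "F \<in> faces E" using l(2) d(6,7) by auto
    obtain K S where K: "is_class E K S" "l \<in> ln E K" by (rule lnF_in[OF l(1) \<open>F \<in> faces E\<close>])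
    have "pth E K S \<in> iso_paths E" by (rule is_classD(6)[OF K(1)])
    then have "(ln E K, S) \<in> W E" unfolding iso_paths_def by auto
    then show ?thesis using K(2) l(2) by blast
  qed
  have 3: "l \<subseteq> convex hull F" if "l \<in> lnF C1 F \<union> lnF C2 F" for l
    by (rule Lraw_line_hull[OF L]) (use that Lraw_lnF[OF L] in auto)
  show "\<Union>(lnF C1 F \<union> lnF C2 F) \<subseteq> surf C1 C2 \<inter> convex hull F"
    using 2 3 by blast
qed

text \<open>By \<open>pts_line\<close> each side is one of the available lines, and every vertex
  lies on two sides. An iso-point at \<open>Q\<close> can be joined only to the other one at
  \<open>Q\<close> and to the one at \<open>P\<close> with the same disperse node, so both joins
  occur; continuing around uses up all lines of \<open>Dl\<close> and \<open>Pl\<close>. Since these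
  families are disjoint, the two graphs must draw different ones.\<close>

lemma outer_polygon_eq:
  assumes L: "Lraw C1 C2 F A P B Q" and Qs: "simple_closed_polygon Qs" "E = polygon_lines Qs"
    "set Qs \<subseteq> iso_points c (graph C1) \<union> iso_points c (graph C2)"
    and E: "\<Union>E = surf C1 C2 \<inter> convex hull F"
  shows "E = Dl A P B Q \<union> Pl A P B Q" "lnF C1 F = Dl A P B Q \<and> lnF C2 F = Pl A P B Q \<or> lnF C1 F = Pl A P B Q \<and> lnF C2 F = Dl A P B Q"
proof -
  note pd = pts_distinct[OF L]
  let ?p1 = "ip (P, A)" and ?p2 = "ip (P, B)" and ?q1 = "ip (Q, A)" and ?q2 = "ip (Q, B)"
  have cp: "closed_polygon Qs" using Qs(1) by (simp add: simple_closed_polygon_def)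
  let ?L = "lnF C1 F \<union> lnF C2 F"
  have LDP: "?L \<subseteq> Dl A P B Q \<union> Pl A P B Q" using Lraw_lnF[OF L] by auto
  have vh: "v \<in> convex hull F" if v: "v \<in> set Qs" for v
  proof -
    obtain w u where "closed_segment v w \<in> polygon_lines Qs" by (rule polygon_vertex[OF cp v])
    then have "v \<in> \<Union>E" using Qs(2) ends_in_segment(1) by blast
    then show ?thesis using E by simp
  qed
  have vp: "v \<in> pts A P B Q" if v: "v \<in> set Qs" for v
    using Lraw_vertex[OF L _ vh[OF v]] Lraw_vertex[OF Lraw_sym[OF L] _ vh[OF v]] Qs(3) v by auto
  have side_in: "closed_segment v w \<in> ?L" if "v \<in> set Qs" "w \<in> set Qs" "v \<noteq> w" "closed_segment v w \<in> E" for v w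
  proof (rule pts_line[OF L vp[OF that(1)] vp[OF that(2)] that(3) LDP])
    have "closed_segment v w \<subseteq> \<Union>E" using that(4) by blast
    also have "\<Union>E \<subseteq> \<Union>?L \<union> pts A P B Q" unfolding E by (rule Lraw_surf(1)[OF L])
    finally show "closed_segment v w \<subseteq> \<Union>?L \<union> pts A P B Q" .
  qed
  have EL: "E \<subseteq> ?L"
  proof
    fix e assume "e \<in> E"
    then obtain i where i: "i < length Qs" "e = side Qs i" unfolding Qs(2) polygon_lines_def by auto
    have l: "3 \<le> length Qs" "distinct Qs" using cp by (auto simp: closed_polygon_def)
    have "Suc i mod length Qs \<noteq> i" using i(1) l(1) by (auto simp: mod_Suc)
    moreover have "Suc i mod length Qs < length Qs" using l(1) by (intro mod_less_divisor) linarith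
    ultimately have "Qs ! i \<noteq> Qs ! (Suc i mod length Qs)" using i(1) l(2) by (simp add: nth_eq_iff_index_eq)
    then show "e \<in> ?L" using side_in[OF side_ends[OF i(1)]] \<open>e \<in> E\<close> i(2) by (simp add: side_def)
  qed
  have nb: "\<exists>w u. w \<in> set Qs \<and> u \<in> set Qs \<and> w \<noteq> u \<and> w \<noteq> v \<and> u \<noteq> v \<and> closed_segment v w \<in> E \<and> closed_segment v u \<in> E"
    if "v \<in> set Qs" for v
    using polygon_vertex[OF cp that] unfolding Qs(2) by metis
  have n1: "w = ?p1 \<or> w = ?q2" if "closed_segment ?q1 w \<in> E" "w \<noteq> ?q1" for w
  proof -
    have "closed_segment ?q1 w \<in> Dl A P B Q \<union> Pl A P B Q" using that(1) EL LDP by blast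
    then show ?thesis using pd that(2) unfolding Dl_def Pl_def
      by (auto simp: doubleton_eq_iff split: if_splits)
  qed
  have n2: "w = ?p2 \<or> w = ?q1" if "closed_segment ?q2 w \<in> E" "w \<noteq> ?q2" for w
  proof -
    have "closed_segment ?q2 w \<in> Dl A P B Q \<union> Pl A P B Q" using that(1) EL LDP by blast
    then show ?thesis using pd that(2) unfolding Dl_def Pl_def
      by (auto simp: doubleton_eq_iff split: if_splits)
  qed
  have n3: "w = ?q1 \<or> w = ?p2" if "closed_segment ?p1 w \<in> E" "w \<noteq> ?p1" "\<phi> P < c" for w
  proof -
    have "closed_segment ?p1 w \<in> Dl A P B Q \<union> Pl A P B Q" using that(1) EL LDP by blast
    then show ?thesis using pd that(2,3) unfolding Dl_def Pl_def
      by (auto simp: doubleton_eq_iff split: if_splits)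
  qed
  have e1: "?q2 \<in> set Qs \<and> ?p1 \<in> set Qs \<and> closed_segment ?q1 ?p1 \<in> E \<and> closed_segment ?q1 ?q2 \<in> E" if "?q1 \<in> set Qs"
    using nb[OF that] n1 by metis
  have e2: "?q1 \<in> set Qs \<and> ?p2 \<in> set Qs \<and> closed_segment ?q2 ?p2 \<in> E" if "?q2 \<in> set Qs"
    using nb[OF that] n2 by metis
  \<comment> \<open>A polygon has at least three vertices, so they cannot all be iso-points at
    \<open>P\<close>.\<close>
  have "?q1 \<in> set Qs \<or> ?q2 \<in> set Qs"
  proof (rule ccontr)
    assume "\<not> ?thesis"
    then have "set Qs \<subseteq> {?p1, ?p2}" using vp unfolding pts_def by blast
    then have "card (set Qs) \<le> card {?p1, ?p2}" by (intro card_mono) auto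
    also have "\<dots> \<le> 2" by (simp add: card_insert_if)
    finally show False using cp by (simp add: closed_polygon_def distinct_card)
  qed
  then have q: "?q1 \<in> set Qs" "?q2 \<in> set Qs" using e1 e2 by blast+
  note in1 = e1[OF q(1)] and in2 = e2[OF q(2)]
  have "?p1 \<in> set Qs" using in1 by blast
  have e3: "closed_segment ?p1 ?p2 \<in> E" if "\<phi> P < c"
    using nb[OF \<open>?p1 \<in> set Qs\<close>] n3[OF _ _ that] by metis
  have DPE: "Dl A P B Q \<union> Pl A P B Q \<subseteq> E"
    unfolding Dl_def Pl_def using in1 in2 e3 by (auto split: if_splits)
  then show "E = Dl A P B Q \<union> Pl A P B Q" using EL LDP by blast
  have "lnF C1 F \<noteq> lnF C2 F"
  proof
    assume e: "lnF C1 F = lnF C2 F"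
    have "Dl A P B Q \<union> Pl A P B Q \<subseteq> lnF C1 F" using DPE EL e by blast
    moreover have "Dl A P B Q \<noteq> {}" "Pl A P B Q \<noteq> {}" by (auto simp: Dl_def Pl_def)
    ultimately show False using Lraw_lnF(1)[OF L] Dl_Pl_disjoint[OF L] by blast
  qed
  then show "lnF C1 F = Dl A P B Q \<and> lnF C2 F = Pl A P B Q \<or> lnF C1 F = Pl A P B Q \<and> lnF C2 F = Dl A P B Q"
    using Lraw_lnF[OF L] by auto
qed

text \<open>The polygon is a triangle if the iso-points at \<open>P\<close> coincide and a
  quadrilateral otherwise; opposite sides are disjoint by the separating diagonals. The face is
  non-trivial because \<open>Q\<close> has a label below \<open>c\<close>.\<close>

lemma outer_exists:
  assumes L: "Lraw C1 C2 F A P B Q" and D: "lnF C1 F = Dl A P B Q" and Pt: "lnF C2 F = Pl A P B Q"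
  shows "outer_iso_path C1 (Dl A P B Q \<union> Pl A P B Q)"
proof -
  note d = LrawD[OF L] and qd = quadD[OF LrawD(8)[OF L]] and x = Lraw_mx[OF L] and pd = pts_distinct[OF L]
  have "P \<notin> dsp C1 \<and> F \<in> Lf C1"
    using L
  proof (cases rule: Lraw_types)
    case D then show ?thesis by blast
  next
    case P then show ?thesis using assms(2) Dl_neq_Pl[OF L] by simp
  qed
  then have F: "P \<notin> dsp C1" "F \<in> Lf C1" by auto
  note y = x(6,7)[OF F(1)]
  let ?p1 = "ip (P, A)" and ?p2 = "ip (P, B)" and ?q1 = "ip (Q, A)" and ?q2 = "ip (Q, B)"
  have nt: "\<not> trivial_L_face c (graph C1) F"
  proof
    assume t: "trivial_L_face c (graph C1) F"
    have "Q \<in> F \<inter> cont c (graph C1)" using qd(2,24) x(3) by (auto simp: cont_iff)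
    then have "Q \<in> iso_nodes c (graph C1)" using t by (auto simp: trivial_L_face_def)
    then obtain U V where "(U, V) \<in> mx C1" "Q = iso_pt c (graph C1) (U, V)"
      unfolding iso_nodes_def iso_points_def by auto
    then have "(U, V) \<in> mx C1" "ip (U, V) = Q" using iso_pt_graph[OF d(3)] by auto
    from ip_node[OF d(3) this qd(24)] show False using d(13) by simp
  qed
  have pin: "pts A P B Q \<subseteq> iso_points c (graph C1)"
    using imageI[OF x(4), of "iso_pt c (graph C1)"] imageI[OF x(5), of "iso_pt c (graph C1)"]
      imageI[OF y(1), of "iso_pt c (graph C1)"] imageI[OF y(2), of "iso_pt c (graph C1)"]
      iso_pt_graph[OF d(3) x(4)] iso_pt_graph[OF d(3) x(5)] iso_pt_graph[OF d(3) y(1)] iso_pt_graph[OF d(3) y(2)]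
    unfolding pts_def iso_points_def by simp
  have pU: "pts A P B Q \<subseteq> \<Union>(Dl A P B Q \<union> Pl A P B Q)" unfolding pts_def Dl_def by auto
  have U: "\<Union>(Dl A P B Q \<union> Pl A P B Q) = surf C1 C2 \<inter> convex hull F"
    using Lraw_surf[OF L] pU unfolding D Pt by blast
  have nc: "\<not> collinear {u, v, w}" if "u \<in> pts A P B Q" "v \<in> pts A P B Q" "w \<in> pts A P B Q" "u \<noteq> v" "v \<noteq> w" "u \<noteq> w" for u v w
    by (rule pts_not_collinear[OF L that])
  have pm: "?p1 \<in> pts A P B Q" "?p2 \<in> pts A P B Q" "?q1 \<in> pts A P B Q" "?q2 \<in> pts A P B Q" by (auto simp: pts_def)
  have "\<exists>Qs. simple_closed_polygon Qs \<and> Dl A P B Q \<union> Pl A P B Q = polygon_lines Qs \<and> set Qs \<subseteq> pts A P B Q"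
  proof (cases "\<phi> P = c")
    case True
    then have e: "?p2 = ?p1" using pd(6) by simp
    have "\<not> collinear {?q1, ?q2, ?p1}" by (rule nc) (use pm pd in auto)
    note t = triangle_simple[OF this]
    have "Dl A P B Q \<union> Pl A P B Q = polygon_lines [?q1, ?q2, ?p1]"
      unfolding t(2) Dl_def Pl_def using True e by (auto simp: closed_segment_commute)
    then show ?thesis using t(1) pm by (intro exI[of _ "[?q1, ?q2, ?p1]"]) simp
  next
    case False
    then have lt: "\<phi> P < c" and ne: "?p1 \<noteq> ?p2" using d(12) pd(6) by auto
    have o1: "closed_segment ?q1 ?q2 \<inter> closed_segment ?p2 ?p1 = {}"
      using opposite_cont[OF d(3,8) y(1) x(4) y(2) x(5)] by (auto simp: closed_segment_commute)
    have o2: "closed_segment ?q2 ?p2 \<inter> closed_segment ?p1 ?q1 = {}"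
    proof (rule ccontr)
      assume "\<not> ?thesis"
      then obtain z where "z \<in> seg (P, A) (Q, A)" "z \<in> seg (P, B) (Q, B)" by (auto simp: closed_segment_commute)
      from opposite_disp[OF d(3,8) y(1) x(4) y(2) x(5) this] show False using lt d(13) by auto
    qed
    have "\<not> collinear {?q1, ?q2, ?p2}" "\<not> collinear {?q2, ?p2, ?p1}" "\<not> collinear {?p2, ?p1, ?q1}" "\<not> collinear {?p1, ?q1, ?q2}"
      by (rule nc; use pm pd ne in auto)+
    note t = quadrilateral_simple[OF this o1 o2]
    have "Dl A P B Q \<union> Pl A P B Q = polygon_lines [?q1, ?q2, ?p2, ?p1]"
      unfolding t(2) Dl_def Pl_def using lt by (auto simp: closed_segment_commute)
    then show ?thesis using t(1) pm by (intro exI[of _ "[?q1, ?q2, ?p2, ?p1]"]) simp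
  qed
  then obtain Qs where Qs: "simple_closed_polygon Qs" "Dl A P B Q \<union> Pl A P B Q = polygon_lines Qs" "set Qs \<subseteq> pts A P B Q"
    by blast
  show ?thesis
    unfolding outer_iso_path_def
    by (intro conjI regular_mx[OF d(1) x(4)] bexI[OF _ d(2)] bexI[of _ F] exI[of _ Qs])
      (use d(6,7,16) F(2) nt Qs pin U in auto)
qed

section \<open>Criteria for disperse connectedness, and non-trivial L-faces\<close>

lemma system_edge:
  assumes "D \<in> M" "incident C P Q" "incident D P Q"
  shows "D \<in> system"
proof -
  have "{P, Q} \<in> edges C \<inter> edges D" using assms(2,3) unfolding edges_def by blast
  then show ?thesis using assms(1) unfolding system_def system_of_cuboids_def by blast
qed

lemma face_neighbor:
  assumes F: "F \<in> faces C"
  obtains D where "D \<in> system" "D \<noteq> C" "F \<in> faces D"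
proof -
  have cC: "is_cuboid C" using cuboid_M mesh(2) by blast
  obtain j P where P: "P \<in> nodes C" "F = face C j P" by (rule facesE[OF cC F])
  obtain i k :: 3 where ik: "i \<noteq> j" "k \<noteq> j" "k \<noteq> i" by (rule other_axes)
  have ax: "j \<noteq> i" "k \<noteq> i" "k \<noteq> j" using ik by auto
  obtain C1 C2 C3 where r: "C1 \<in> M" "\<forall>D \<in> {C1, C2, C3}. incident D P (flip C i P) \<and> flip D i P = flip C i P"
    "C1 \<noteq> C" "face C j P \<subseteq> nodes C1"
    by (rule edge_ring[OF mesh(1,2,3) P(1) ax])
  have "incident C P (flip C i P)" using cC P(1) by (auto simp: incident_iff)
  then have "C1 \<in> system" using system_edge[OF r(1)] r(2) by simp
  moreover have "F \<in> faces C1"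
    using common_face(1)[OF mesh(1,2) r(1) r(3)[symmetric] F] r(4) P(2) by simp
  ultimately show ?thesis using that r(3) by blast
qed

definition good :: "iso_path \<Rightarrow> pt set \<Rightarrow> bool" where
  "good \<omega> l \<longleftrightarrow> (\<exists>\<omega>'. \<omega>' \<in> system_iso_paths \<and> meet \<omega> \<omega>' l \<and> disperse_connected \<omega> \<omega>' l)"

text \<open>Leads to the first clause of disperse connectedness: iso-paths that meet along
  \<open>l\<close> contain \<open>l\<close>, so it suffices to list the iso-paths through
  \<open>l\<close>.\<close>

lemma good_only:
  assumes "\<omega> \<in> iso_paths C" "\<omega>' \<in> system_iso_paths" "\<omega>' \<noteq> \<omega>" "meet \<omega> \<omega>' l"
    and "\<And>\<alpha>. \<alpha> \<in> system_iso_paths \<Longrightarrow> l \<in> lines \<alpha> \<Longrightarrow> \<alpha> = \<omega> \<or> \<alpha> = \<omega>'"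
  shows "good \<omega> l"
proof -
  have "{\<alpha>, \<beta>} = {\<omega>, \<omega>'}" if "\<alpha> \<in> system_iso_paths" "\<beta> \<in> system_iso_paths" "\<alpha> \<noteq> \<beta>" "meet \<alpha> \<beta> l" for \<alpha> \<beta>
  proof -
    have "l \<in> lines \<alpha>" "l \<in> lines \<beta>" using that(4) by (auto simp: meet_def meet_along_def)
    then show ?thesis using assms(5)[OF that(1)] assms(5)[OF that(2)] that(3) by auto
  qed
  then have "disperse_connected \<omega> \<omega>' l"
    unfolding disperse_connected_def by (intro conjI assms(1-4) disjI1 ballI impI) (elim conjE)
  then show ?thesis unfolding good_def by (intro exI[of _ \<omega>'] conjI assms(2,4))
qed

lemma good_common:
  assumes k: "is_class C K S" "is_class D K' S'" and ne: "pth D K' S' \<noteq> pth C K S" "C \<noteq> D \<or> K \<noteq> K'"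
    and l: "l \<in> ln C K" "l \<in> ln D K'" and Q: "corresponds Q l (pth C K S)" "corresponds Q l (pth D K' S')"
  shows "good (pth C K S) l"
proof -
  have m: "meet (pth C K S) (pth D K' S') l" by (rule meet_inner[OF k ne(2) l])
  have "disperse_connected (pth C K S) (pth D K' S') l"
    unfolding disperse_connected_def
    by (intro conjI is_classD(6)[OF k(1)] is_classD(7)[OF k(2)] ne(1) m disjI2 disjI1 exI[of _ Q] Q) simp_all
  then show ?thesis unfolding good_def
    by (intro exI[of _ "pth D K' S'"] conjI is_classD(7)[OF k(2)] m)
qed

text \<open>A disperse path of two edges suffices; it will pass through a node \<open>R\<close> that
  is relabeled in the cuboids on the way.\<close>

lemma good_path:
  assumes k: "is_class C K S" "is_class D K' S'" and ne: "C \<noteq> D"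
    and l: "l \<in> ln C K" "l \<in> ln D K'" and Q: "corresponds P1 l (pth C K S)" "corresponds P2 l (pth D K' S')"
    and p: "distinct [P1, R, P2]" "disperse_edge P1 R" "disperse_edge R P2"
  shows "good (pth C K S) l"
proof -
  have m: "meet (pth C K S) (pth D K' S') l" by (rule meet_inner[OF k _ l]) (use ne in simp)
  have "disperse_path [P1, R, P2]" using p by (simp add: disperse_path_def)
  then have e: "\<exists>Ps. disperse_path Ps \<and> hd Ps = P1 \<and> last Ps = P2" by (intro exI[of _ "[P1, R, P2]"]) simp
  have n: "P1 \<noteq> P2" using p(1) by auto
  have "disperse_connected (pth C K S) (pth D K' S') l"
    unfolding disperse_connected_def
    by (intro conjI is_classD(6)[OF k(1)] is_classD(7)[OF k(2)] m disjI2 exI[of _ P1] exI[of _ P2] n Q e)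
      (use ne in simp_all)
  then show ?thesis unfolding good_def
    by (intro exI[of _ "pth D K' S'"] conjI is_classD(7)[OF k(2)] m)
qed

lemma meet_sym: "meet \<alpha> \<beta> l \<longleftrightarrow> meet \<beta> \<alpha> l"
  unfolding meet_def meet_along_def by (simp add: Int_commute)

lemma ln_on_face:
  assumes k: "is_class D K S" and l: "l \<in> ln D K" and y: "y \<in> l" "car D y = F" "F \<in> faces D"
  obtains P A P' A' where "l = seg (P, A) (P', A')" "(P, A) \<in> K" "(P', A') \<in> K" "{P, A, P', A'} \<subseteq> F"
    "ip (P, A) \<noteq> ip (P', A')" "(P, A) \<in> mx D" "(P', A') \<in> mx D"
proof -
  note c = is_classD[OF k]
  obtain P A P' A' F' where a: "l = seg (P, A) (P', A')" "(P, A) \<in> K" "(P', A') \<in> K" "F' \<in> faces D" "{P, A, P', A'} \<subseteq> F'"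
    "ip (P, A) \<noteq> ip (P', A')" "(P, A) \<in> mx D" "(P', A') \<in> mx D"
    by (rule lnE[OF k l])
  note fc = face_card_neq[OF c(4) y(3)]
  have "F' = F"
    using c(2) a(7,8,4-6) y(1)[unfolded a(1)]
  proof (cases rule: line_cases)
    case (n U)
    then have "U \<in> nodes D" using mxD(6)[OF c(2)] a(7,8) by auto
    then have "F = {U}" using n(3) y(2) car_node by auto
    then have "F = {U, U}" by (rule trans) simp
    then show ?thesis using fc by metis
  next
    case (s U V) then show ?thesis using fc y(2) by metis
  next
    case f then show ?thesis using y(2) by simp
  next
    case e then show ?thesis using fc y(2) by metis
  qed
  then show ?thesis using that[of P A P' A'] a by simp
qed

lemma class_line_unique:
  assumes k: "is_class D K S" and F: "F \<in> faces D"
    and a: "(P, A) \<in> K" "(P', A') \<in> K" "{P, A, P', A'} \<subseteq> F" "ip (P, A) \<noteq> ip (P', A')"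
    and b: "(R, B) \<in> K" "{R, B} \<subseteq> F"
  shows "(R, B) = (P, A) \<or> (R, B) = (P', A')"
proof (rule ccontr)
  assume n: "\<not> ?thesis"
  have "(P, A) = (P', A')" by (rule class_two[OF k F b(1) a(1,2) b(2)]) (use a n in auto)
  then show False using a(4) by simp
qed

text \<open>A strict iso-point determines its mixed edge through its carrier, and the edge
  determines the class.\<close>

lemma strict_in_class:
  assumes k: "is_class D K S" and l: "closed_segment (ip (U, V)) t \<in> ln D K"
    and c: "car D (ip (U, V)) = {U, V}" "U \<noteq> V" "\<phi> U < c" "c < \<phi> V"
  shows "(U, V) \<in> K"
proof -
  note D = is_classD(2)[OF k]
  obtain P A P' A' F where a: "closed_segment (ip (U, V)) t = seg (P, A) (P', A')" "(P, A) \<in> K" "(P', A') \<in> K"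
    "(P, A) \<in> mx D" "(P', A') \<in> mx D"
    by (rule lnE[OF k l])
  have *: "(X, Y) = (U, V)" if "(X, Y) \<in> mx D" "ip (X, Y) = ip (U, V)" for X Y
  proof -
    note m = mxD[OF D that(1)]
    have "\<phi> X \<noteq> c"
    proof
      assume "\<phi> X = c"
      then have "{X} = {U, V}" using car_ip(2)[OF D that(1)] c(1) that(2) by simp
      then have "U \<in> {X}" "V \<in> {X}" by blast+
      then show False using c(2) by simp
    qed
    then have "{X, Y} = {U, V}" using car_ip(1)[OF D that(1)] c(1) that(2) m(2) by simp
    then show ?thesis using m(2,3) c(3,4) by (auto simp: doubleton_eq_iff)
  qed
  have "{ip (U, V), t} = {ip (P, A), ip (P', A')}" using a(1) by simp
  then have "ip (P, A) = ip (U, V) \<or> ip (P', A') = ip (U, V)" by (auto simp: doubleton_eq_iff)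
  then show ?thesis using *[OF a(4)] *[OF a(5)] a(2,3) by auto
qed

lemma Lraw_strict:
  assumes L: "Lraw C1 C2 F A P B Q" and l: "l \<in> Dl A P B Q \<union> Pl A P B Q"
  obtains U V t where "l = closed_segment (ip (U, V)) t" "car C1 (ip (U, V)) = {U, V}" "U \<noteq> V" "\<phi> U < c" "c < \<phi> V"
proof -
  note d = LrawD[OF L] and qd = quadD[OF LrawD(8)[OF L]] and lc = Lraw_car[OF L]
  consider "l = seg (Q, A) (P, A)" | "l = seg (Q, B) (P, B)" | "l = seg (Q, A) (Q, B)" | "l = seg (P, A) (P, B)" "\<phi> P < c"
    using l unfolding Dl_def Pl_def by (auto split: if_splits)
  then show ?thesis
  proof cases
    case 1 then show ?thesis by (rule that[OF _ lc(1)]) (use qd d in auto)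
  next
    case 2 then show ?thesis by (rule that[OF _ lc(2)]) (use qd d in auto)
  next
    case 3 then show ?thesis by (rule that[OF _ lc(1)]) (use qd d in auto)
  next
    case 4 then show ?thesis by (intro that[OF _ lc(3)]) (use qd d in auto)
  qed
qed

text \<open>Every line of \<open>Dl\<close> and \<open>Pl\<close> has a strict end, so only one
  class of a graph can draw it. This fails on trivial L-faces.\<close>

lemma class_through:
  assumes L: "Lraw C1 C2 F A P B Q" and l: "l \<in> Dl A P B Q \<union> Pl A P B Q"
    and k: "is_class C1 K S" "is_class C1 K' S'" "l \<in> ln C1 K" "l \<in> ln C1 K'"
  shows "K = K'" "S = S'"
proof -
  obtain U V t where u: "l = closed_segment (ip (U, V)) t" "car C1 (ip (U, V)) = {U, V}" "U \<noteq> V" "\<phi> U < c" "c < \<phi> V"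
    by (rule Lraw_strict[OF L l])
  have "(U, V) \<in> K" "(U, V) \<in> K'"
    using strict_in_class[OF k(1) k(3)[unfolded u(1)] u(2-5)] strict_in_class[OF k(2) k(4)[unfolded u(1)] u(2-5)] by auto
  then show "K = K'" "S = S'" using class_disjoint[OF k(1,2)] by auto
qed

text \<open>A contact with the outer iso-path lies on \<open>F\<close>. There the class draws no
  line but \<open>l\<close>, and its other points on \<open>F\<close> are ends of \<open>l\<close>
  or iso-nodes.\<close>

lemma meet_outer:
  assumes L: "Lraw C1 C2 F A P B Q" and k: "is_class C1 K S" and l: "l \<in> ln C1 K" "l \<in> lnF C1 F"
  shows "meet (pth C1 K S) (Outer (Dl A P B Q \<union> Pl A P B Q)) l"
proof (rule meetI)
  note d = LrawD[OF L]
  show "l \<in> lines (pth C1 K S)" using l by simp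
  show "l \<in> lines (Outer (Dl A P B Q \<union> Pl A P B Q))" using l(2) Lraw_lnF(1)[OF L] by auto
  obtain y where y: "y \<in> l" "car C1 y = F" using Lraw_line_mid[OF L l(2)] by blast
  obtain U V U' V' where u: "l = seg (U, V) (U', V')" "(U, V) \<in> K" "(U', V') \<in> K" "{U, V, U', V'} \<subseteq> F"
    "ip (U, V) \<noteq> ip (U', V')"
    by (rule ln_on_face[OF k l(1) y d(6)])
  note un = class_line_unique[OF k d(6) u(2-5)]
  fix x m1 m2
  assume m: "m1 \<in> lines (pth C1 K S)" "m2 \<in> lines (Outer (Dl A P B Q \<union> Pl A P B Q))" and x: "x \<in> m1" "x \<in> m2" "x \<notin> l"
  have m1: "m1 \<in> ln C1 K" using m by simp
  have xh: "x \<in> convex hull F" using Lraw_line_hull[OF L, of m2] m(2) x(2) by auto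
  from Lraw_points[OF L k m1 x(1) xh]
  show "x \<in> N \<or> (\<exists>m\<in>lines (pth C1 K S) \<inter> lines (Outer (Dl A P B Q \<union> Pl A P B Q)). x \<in> m \<and> m \<inter> N \<noteq> {})"
  proof (elim disjE conjE exE)
    assume m1F: "m1 \<in> lnF C1 F"
    obtain z where z: "z \<in> m1" "car C1 z = F" using Lraw_line_mid[OF L m1F] by blast
    obtain R X R' X' where r: "m1 = seg (R, X) (R', X')" "(R, X) \<in> K" "(R', X') \<in> K" "{R, X, R', X'} \<subseteq> F"
      "ip (R, X) \<noteq> ip (R', X')"
      by (rule ln_on_face[OF k m1 z d(6)])
    have "(R, X) = (U, V) \<or> (R, X) = (U', V')" "(R', X') = (U, V) \<or> (R', X') = (U', V')"
      using un[OF r(2)] un[OF r(3)] r(4) by auto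
    then have "{ip (R, X), ip (R', X')} = {ip (U, V), ip (U', V')}" using r(5) by auto
    then have "m1 = l" unfolding r(1) u(1) by (simp only: closed_segment_eq)
    then show ?thesis using x by simp
  next
    fix R X assume "(R, X) \<in> K" "{R, X} \<subseteq> F" "x = ip (R, X)"
    then have "x = ip (U, V) \<or> x = ip (U', V')" using un[of R X] by auto
    then have "x \<in> l" unfolding u(1) by auto
    then show ?thesis using x by simp
  qed simp
qed

text \<open>The inner point of \<open>l\<close> with carrier \<open>F\<close> lies in no cuboid of
  the system other than \<open>C1\<close> and \<open>C2\<close>; an outer iso-path through it
  belongs to \<open>F\<close> as well and is determined by \<open>outer_polygon_eq\<close>.\<close>

lemma lines_through:
  assumes L: "Lraw C1 C2 F A P B Q" and l: "l \<in> lnF C1 F \<union> lnF C2 F" and \<alpha>: "\<alpha> \<in> system_iso_paths" "l \<in> lines \<alpha>"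
  obtains (inner) D K S where "D = C1 \<or> D = C2" "is_class D K S" "l \<in> ln D K" "l \<in> lnF D F" "\<alpha> = pth D K S"
    | (outer) "\<alpha> = Outer (Dl A P B Q \<union> Pl A P B Q)"
      "lnF C1 F = Dl A P B Q \<and> lnF C2 F = Pl A P B Q \<or> lnF C1 F = Pl A P B Q \<and> lnF C2 F = Dl A P B Q"
proof -
  note d = LrawD[OF L]
  obtain y where y: "y \<in> l" "car C1 y = F" "y \<in> body C1" "y \<in> body C2" using Lraw_line_mid2[OF L l] by blast
  have near: "(D = C1 \<or> D = C2) \<and> car D y = F \<and> F \<in> faces D" if D: "D \<in> system" "y \<in> body D" for D
  proof -
    have c: "car D y = F" using car_mesh[OF mesh(1) system_M[OF D(1)] d(3) D(2) y(3)] y(2) by simp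
    then have "F \<subseteq> nodes D" using car_sub by blast
    then show ?thesis using d(17)[OF system_M[OF D(1)]] d(6,7) c by auto
  qed
  from \<alpha>(1) obtain D where D: "D \<in> system" "\<alpha> \<in> iso_paths D" unfolding system_iso_paths_def by blast
  from D(2) consider Ls S where "\<alpha> = Inner D Ls S" "(Ls, S) \<in> W D" | E where "\<alpha> = Outer E" "outer_iso_path D E"
    unfolding iso_paths_def by blast
  then show ?thesis
  proof cases
    case (1 Ls S)
    obtain K where K: "is_class D K S" "Ls = ln D K" by (rule W_classE[OF D(1) 1(2)])
    have lK: "l \<in> ln D K" using \<alpha>(2) 1 K by simp
    have "y \<in> body D" using ln_body[OF K(1) lK] y(1) by blast
    note n = near[OF D(1) this]
    then have n': "car D y = F" "F \<in> faces D" by auto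
    obtain U V U' V' where u: "l = seg (U, V) (U', V')" "(U, V) \<in> K" "(U', V') \<in> K" "{U, V, U', V'} \<subseteq> F"
      "ip (U, V) \<noteq> ip (U', V')"
      by (rule ln_on_face[OF K(1) lK y(1) n'])
    have "l \<in> lnF D F" unfolding lnF_def mem_Collect_eq using u K(1) by (intro exI conjI)
    then show ?thesis using inner[of D K S] n K lK 1(1) by blast
  next
    case (2 E)
    from 2(2) obtain D2 F' Qs where o: "D2 \<in> system" "F' \<in> faces D" "F' \<in> faces D2" "face_neighbors D D2"
      "simple_closed_polygon Qs" "E = polygon_lines Qs"
      "set Qs \<subseteq> iso_points c (graph D) \<union> iso_points c (graph D2)" "\<Union>E = surf D D2 \<inter> convex hull F'"
      unfolding outer_iso_path_def by blast
    have "l \<in> E" using \<alpha>(2) 2(1) by simp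
    then have "y \<in> convex hull F'" using y(1) o(8) by blast
    note h1 = hull_face_car[OF system_M[OF D(1)] o(2) this] and h2 = hull_face_car[OF system_M[OF o(1)] o(3) this]
    note n1 = near[OF D(1) h1(2)] and n2 = near[OF o(1) h2(2)]
    have "D \<noteq> D2" using face_neighborsE[OF mesh(1) system_M[OF D(1)] system_M[OF o(1)] o(4)] by metis
    then have DD: "D = C1 \<and> D2 = C2 \<or> D = C2 \<and> D2 = C1" using n1 n2 by auto
    have "F = F'"
      by (rule faces_sub_eq[OF system_M[OF D(1)] _ o(2)]) (use n1 h1(1) in auto)
    have L': "Lraw D D2 F A P B Q" using DD L Lraw_sym[OF L] by auto
    note r = outer_polygon_eq[OF L' o(5-7) o(8)[folded \<open>F = F'\<close>]]
    show ?thesis using outer r 2(1) DD by auto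
  qed
qed

declare corresponds.simps [simp del]

lemma corresponds_line: "corresponds Q l \<omega> \<Longrightarrow> l \<in> lines \<omega>"
  by (cases \<omega>) (simp_all add: corresponds.simps)

lemma corresponds_L:
  assumes k: "is_class D K S" and a: "(P, A) \<in> K" "(P', A) \<in> K" "P \<noteq> P'" "{P, P', A} \<subseteq> F" "F \<in> Lf D" "A \<in> S"
  shows "corresponds A (seg (P, A) (P', A)) (pth D K S)"
proof -
  note c = is_classD[OF k]
  have m: "(P, A) \<in> mx D" "(P', A) \<in> mx D" using a c(5) by auto
  have F: "F \<in> faces D" using a(5) unfolding Lf_eq[OF c(2)] alternating_faces_def by simp
  have ne: "ip (P, A) \<noteq> ip (P', A)" using ip_eqD[OF c(2) m] a(3) by auto
  have "seg (P, A) (P', A) \<in> ln D K" by (rule lnI[OF k a(1,2) F _ ne]) (use a(4) in simp)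
  moreover have "A \<in> dsp D" by (rule mxD(9)[OF c(2) m(1)])
  moreover have e: "seg (P, A) (P', A) = closed_segment (iso_pt c (graph D) (P, A)) (iso_pt c (graph D) (P', A))"
    using iso_pt_graph[OF c(2) m(1)] iso_pt_graph[OF c(2) m(2)] by simp
  have "\<exists>X Y. X \<noteq> Y \<and> {X, Y} \<subseteq> F \<and> {(X, A), (Y, A)} \<subseteq> mx D \<and>
      seg (P, A) (P', A) = closed_segment (iso_pt c (graph D) (X, A)) (iso_pt c (graph D) (Y, A))"
  proof (intro exI conjI)
    show "P \<noteq> P'" by (rule a(3))
    show "{P, P'} \<subseteq> F" "{(P, A), (P', A)} \<subseteq> mx D" using a(4) m by auto
  qed (rule e)
  moreover have "A \<in> F" using a(4) by simp
  ultimately show ?thesis unfolding corresponds.simps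
    using a(5,6) by blast
qed

lemma good_Lraw_DD:
  assumes L: "Lraw C C2 F A P B Q" and t: "lnF C F = Dl A P B Q" "lnF C2 F = Dl A P B Q"
    and k: "is_class C K S" "l \<in> ln C K" and l: "l = seg (Q, A) (P, A)"
  shows "good (pth C K S) l"
proof -
  note d = LrawD[OF L] and qd = quadD[OF LrawD(8)[OF L]]
  have on: "{Q, P, A} \<subseteq> F" using qd(2) by auto
  have *: "\<exists>KA SA. is_class E KA SA \<and> l \<in> ln E KA \<and> corresponds A l (pth E KA SA)"
    if L: "Lraw E E' F A P B Q" and tE: "lnF E F = Dl A P B Q" for E E'
    using L
  proof (cases rule: Lraw_types)
    case (D KA SA KB SB)
    have "corresponds A l (pth E KA SA)" unfolding l by (rule corresponds_L[OF D(1-3) _ on D(10) D(4)]) (use qd in simp)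
    then show ?thesis using D(1) corresponds_line by fastforce
  next
    case (P K S) then show ?thesis using tE Dl_neq_Pl[OF L] by simp
  qed
  obtain KA SA where A: "is_class C KA SA" "l \<in> ln C KA" "corresponds A l (pth C KA SA)" using *[OF L t(1)] by blast
  obtain KB SB where B: "is_class C2 KB SB" "l \<in> ln C2 KB" "corresponds A l (pth C2 KB SB)" using *[OF Lraw_sym[OF L] t(2)] by blast
  have lD: "l \<in> Dl A P B Q \<union> Pl A P B Q" unfolding l Dl_def by simp
  note e = class_through[OF L lD A(1) k(1) A(2) k(2)]
  show ?thesis
    by (rule good_common[OF k(1) B(1) _ _ k(2) B(2) _ B(3)]) (use A(3) e d(5) in auto)
qed

text \<open>Lines around the disperse nodes in both graphs share the disperse node. In the other
  cases a corresponding disperse node may be missing, so all iso-paths through \<open>l\<close> are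
  listed: two inner ones if both graphs draw around the continuous nodes, one inner and one outer if
  they differ.\<close>

lemma good_Lraw:
  assumes L: "Lraw C C2 F A P B Q" and k: "is_class C K S" "l \<in> ln C K" and l: "l \<in> lnF C F"
  shows "good (pth C K S) l"
proof -
  note d = LrawD[OF L] and DP = Dl_Pl_disjoint[OF L] and types = Lraw_lnF[OF L]
  have lDP: "l \<in> Dl A P B Q \<union> Pl A P B Q" using l types by auto
  have through: "\<alpha> = pth C K S \<or> (\<exists>K' S'. is_class C2 K' S' \<and> l \<in> ln C2 K' \<and> l \<in> lnF C2 F \<and> \<alpha> = pth C2 K' S') \<or>
      \<alpha> = Outer (Dl A P B Q \<union> Pl A P B Q) \<and> lnF C F \<noteq> lnF C2 F"
    if "\<alpha> \<in> system_iso_paths" "l \<in> lines \<alpha>" for \<alpha>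
  proof -
    have "l \<in> lnF C F \<union> lnF C2 F" using l by simp
    from L this that show ?thesis
    proof (cases rule: lines_through)
      case (inner D K' S')
      then show ?thesis using class_through[OF L lDP k(1) _ k(2), of K' S'] by auto
    next
      case outer
      then show ?thesis using Dl_neq_Pl[OF L] by auto
    qed
  qed
  show ?thesis
  proof (cases "lnF C F = lnF C2 F")
    case eq: True
    show ?thesis
    proof (cases "lnF C F = Dl A P B Q")
      case True
      then have "l = seg (Q, A) (P, A) \<or> l = seg (Q, B) (P, B)" using l by (simp add: Dl_def)
      then show ?thesis
      proof
        assume "l = seg (Q, A) (P, A)"
        then show ?thesis using good_Lraw_DD[OF L True _ k] eq True by simp
      next
        assume lB: "l = seg (Q, B) (P, B)"
        have "Dl B P A Q = Dl A P B Q" by (simp add: Dl_def insert_commute)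
        then show ?thesis using good_Lraw_DD[OF Lraw_swap[OF L] _ _ k lB] eq True by simp
      qed
    next
      case False
      have l2: "l \<in> lnF C2 F" using eq l by simp
      obtain K2 Sb where K2: "is_class C2 K2 Sb" "l \<in> ln C2 K2" by (rule lnF_in[OF l2 d(7)])
      show ?thesis
      proof (rule good_only[OF is_classD(6)[OF k(1)] is_classD(7)[OF K2(1)]])
        show "pth C2 K2 Sb \<noteq> pth C K S" using d(5) by simp
        show "meet (pth C K S) (pth C2 K2 Sb) l" by (rule meet_inner[OF k(1) K2(1) _ k(2) K2(2)]) (use d(5) in simp)
        fix \<alpha> assume "\<alpha> \<in> system_iso_paths" "l \<in> lines \<alpha>"
        from through[OF this] eq
        show "\<alpha> = pth C K S \<or> \<alpha> = pth C2 K2 Sb"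
          using class_through[OF Lraw_sym[OF L] lDP K2(1) _ K2(2)] by blast
      qed
    qed
  next
    case ne: False
    then have o: "outer_iso_path C (Dl A P B Q \<union> Pl A P B Q) \<or> outer_iso_path C2 (Dl A P B Q \<union> Pl A P B Q)"
      using types outer_exists[OF L] outer_exists[OF Lraw_sym[OF L]] by auto
    have s: "Outer (Dl A P B Q \<union> Pl A P B Q) \<in> system_iso_paths"
      using o d(1,2) unfolding system_iso_paths_def iso_paths_def by blast
    show ?thesis
    proof (rule good_only[OF is_classD(6)[OF k(1)] s _ meet_outer[OF L k l]])
      fix \<alpha> assume "\<alpha> \<in> system_iso_paths" "l \<in> lines \<alpha>"
      moreover have "l \<notin> lnF C2 F" using ne types l DP by auto
      ultimately show "\<alpha> = pth C K S \<or> \<alpha> = Outer (Dl A P B Q \<union> Pl A P B Q)" using through by blast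
    qed simp
  qed
qed

text \<open>For an outer iso-path only the first clause of disperse connectedness is available. Each
  of its lines is drawn by exactly one of the two graphs, and there by one class.\<close>

lemma good_outer:
  assumes o: "outer_iso_path C E" and l: "l \<in> E"
  shows "good (Outer E) l"
proof -
  have cC: "C \<in> M" "is_cuboid C" using mesh(2) cuboid_M by auto
  from o obtain D2 F Qs where o': "D2 \<in> system" "F \<in> faces C" "F \<in> faces D2" "face_neighbors C D2"
      "F \<in> Lf C" "\<not> trivial_L_face c (graph C) F"
      "simple_closed_polygon Qs" "E = polygon_lines Qs"
      "set Qs \<subseteq> iso_points c (graph C) \<union> iso_points c (graph D2)" "\<Union>E = surf C D2 \<inter> convex hull F"
    unfolding outer_iso_path_def by blast
  have ne: "C \<noteq> D2" using face_neighborsE[OF mesh(1) cC(1) system_M[OF o'(1)] o'(4)] by metis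
  obtain A P B Q where q: "quad C F A P B Q" "A \<in> dsp C" "B \<in> dsp C" "P \<notin> dsp C" "Q \<notin> dsp C"
    by (rule alternating_quadE[OF cC(2) o'(5)[unfolded Lf_eq[OF cC(1)]]])
  note qd = quadD[OF q(1)]
  \<comment> \<open>The continuous neighbours \<open>P\<close> and \<open>Q\<close> show that
    \<open>A\<close> and \<open>B\<close> are disperse by their own labels, which leads from the
    graph back to \<open>\<phi>\<close>.\<close>
  have AB: "c < \<phi> A" "c < \<phi> B" using dsp_nbr[OF cC(1) qd(9) q(4)] dsp_nbr[OF cC(1) qd(11) q(5)] q(2,3) by auto
  have PQ: "\<phi> P \<le> c" "\<phi> Q \<le> c" using dsp_raw[OF cC(1) qd(22)] dsp_raw[OF cC(1) qd(24)] q(4,5) by fastforce+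
  have lev: "Z \<in> iso_nodes c (graph C)" if "(Z, A) \<in> mx C" "\<phi> Z = c" for Z
  proof -
    have "iso_pt c (graph C) (Z, A) = Z" using iso_pt_graph[OF cC(1) that(1)] ip_level[OF that(2)] by simp
    then show ?thesis using that(1) mxD(6)[OF cC(1) that(1)] unfolding iso_nodes_def iso_points_def by (metis IntI cub_graph imageI)
  qed
  have "\<phi> P < c \<or> \<phi> Q < c"
  proof (rule ccontr)
    assume "\<not> ?thesis"
    then have "\<phi> P = c" "\<phi> Q = c" using PQ by auto
    moreover have "(P, A) \<in> mx C" "(Q, A) \<in> mx C" using q qd by (auto intro!: mxI)
    ultimately have "P \<in> iso_nodes c (graph C)" "Q \<in> iso_nodes c (graph C)" using lev by auto
    moreover have "F \<inter> cont c (graph C) \<subseteq> {P, Q}" using qd(2) q(2,3) cont_disp by blast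
    ultimately have "trivial_L_face c (graph C) F" using o'(5) unfolding trivial_L_face_def by blast
    then show False using o'(6) by simp
  qed
  then have "\<exists>P Q. Lraw C D2 F A P B Q"
    using C_system o'(1,3) ne q(1) quad_refl[OF q(1)] AB PQ unfolding Lraw_def by blast
  then obtain P Q where L: "Lraw C D2 F A P B Q" by blast
  note r = outer_polygon_eq[OF L o'(7-10)] and d = LrawD[OF L]
  have lF: "l \<in> lnF C F \<union> lnF D2 F" using l r by auto
  have DP: "lnF C F \<inter> lnF D2 F = {}" using r(2) Dl_Pl_disjoint[OF L] by auto
  have Eo: "Outer E \<in> iso_paths C" using o unfolding iso_paths_def by blast
  have *: "good (Outer E) l" if D: "D = C \<and> D' = D2 \<or> D = D2 \<and> D' = C" and lD: "l \<in> lnF D F" for D D'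
  proof -
    have L': "Lraw D D' F A P B Q" using D L Lraw_sym[OF L] by auto
    note d' = LrawD[OF L']
    obtain K S where K: "is_class D K S" "l \<in> ln D K" by (rule lnF_in[OF lD d'(6)])
    show ?thesis
    proof (rule good_only[OF Eo is_classD(7)[OF K(1)]])
      show "meet (Outer E) (pth D K S) l"
        unfolding r(1) meet_sym[of _ "pth D K S"] by (rule meet_outer[OF L' K lD])
      fix \<alpha> assume a: "\<alpha> \<in> system_iso_paths" "l \<in> lines \<alpha>"
      from L lF a show "\<alpha> = Outer E \<or> \<alpha> = pth D K S"
      proof (cases rule: lines_through)
        case (inner D1 K1 Sa)
        then have "D1 = D" using D lD DP by auto
        then show ?thesis using class_through[OF L' _ K(1) _ K(2), of K1 Sa] inner l r(1) by auto
      next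
        case outer
        then show ?thesis using r(1) by simp
      qed
    qed simp
  qed
  show ?thesis using lF *[of C D2] *[of D2 C] by auto
qed

section \<open>Trivial L-faces and faces that are no L-faces\<close>

lemma corresponds_regular:
  assumes k: "is_class D K S" and m: "(P, A) \<in> mx D" "(P', A') \<in> mx D" and F: "F \<in> faces D" "F \<notin> Lf D" "{P, A, P', A'} \<subseteq> F"
    and ne: "ip (P, A) \<noteq> ip (P', A')" and X: "X \<in> F" "X \<in> dsp D" and l: "l = seg (P, A) (P', A')" "l \<in> ln D K"
  shows "corresponds X l (pth D K S)"
proof -
  note c = is_classD[OF k]
  note i = iso_pt_graph[OF c(2) m(1)] iso_pt_graph[OF c(2) m(2)]
  have D: "is_cuboid (cub (graph D))" and F': "F \<in> faces (cub (graph D))" using c(4) F(1) by simp_all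
  have ne': "iso_pt c (graph D) (P, A) \<noteq> iso_pt c (graph D) (P', A')" using ne i by simp
  have "F \<notin> singular_faces c (graph D)" by (rule line_not_singular[OF D F' m F(3) ne'])
  moreover have "P \<notin> dsp D" "A \<notin> cont c (graph D)" using mxD(8,9)[OF c(2) m(1)] cont_disp by blast+
  ultimately have r: "F \<in> regular_faces c (graph D)" using F by (auto simp: regular_faces_def)
  have "closed_segment (iso_pt c (graph D) (P, A)) (iso_pt c (graph D) (P', A')) \<in> lines_in c (graph D) F"
    by (rule lines_inI[OF m _ F(3) F' F(3)]) (use ne in auto)
  then have "l \<in> lines_in c (graph D) F" unfolding i l(1) .
  then show ?thesis unfolding corresponds.simps using r X l(2) by blast
qed

text \<open>All iso-points on \<open>F\<close> are at \<open>P\<close> or \<open>Q\<close>, so a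
  line must join these two and both are continuous. Lines around a continuous node would degenerate,
  whence the disperse type.\<close>

lemma trivial_L_lines:
  assumes E: "E \<in> M" and q: "quad E F A P B Q" and \<phi>: "c < \<phi> A" "c < \<phi> B" "\<phi> P = c" "\<phi> Q = c"
    and k: "is_class E K S" and u: "(U, V) \<in> K" "(U', V') \<in> K" "{U, V, U', V'} \<subseteq> F" "ip (U, V) \<noteq> ip (U', V')"
  shows "P \<notin> dsp E \<and> Q \<notin> dsp E \<and> F \<in> Lf E \<and> dtype E \<and> seg (U, V) (U', V') = closed_segment P Q \<and>
    ((P, A) \<in> K \<and> (Q, A) \<in> K \<or> (P, B) \<in> K \<and> (Q, B) \<in> K)"
proof -
  note qd = quadD[OF q]
  have m: "(U, V) \<in> mx E" "(U', V') \<in> mx E" using u is_classD(5)[OF k] by auto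
  note mm = mxD[OF E m(1)] and mm' = mxD[OF E m(2)]
  have U: "U = P \<or> U = Q" "U' = P \<or> U' = Q" using u(3) qd(2) mm(2) mm'(2) \<phi> by auto
  have V: "V = A \<or> V = B" "V' = A \<or> V' = B" using u(3) qd(2) mm(3) mm'(3) \<phi> by auto
  have "\<phi> U = c" "\<phi> U' = c" using U \<phi>(3,4) by blast+
  then have ipU: "ip (U, V) = U" "ip (U', V') = U'" by (simp_all add: ip_level)
  then have UU: "U \<noteq> U'" using u(4) by simp
  have PQ: "P \<notin> dsp E" "Q \<notin> dsp E" using U UU mm(8) mm'(8) by auto
  have AB: "A \<in> dsp E" "B \<in> dsp E" using dsp_raw[OF E] qd \<phi> by auto
  have F: "F \<in> Lf E" unfolding Lf_eq[OF E] by (rule alternating_quad[OF q AB PQ])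
  have t: "dtype E"
    using types[OF k] ptypeD(3)[OF _ k F u(1,2,3)] UU by blast
  have "V = V'" by (rule dtypeD(3)[OF t k F u(1,2,3)])
  moreover have "closed_segment U U' = closed_segment P Q" using U UU by (auto simp: closed_segment_commute)
  ultimately show ?thesis using PQ F t ipU U V UU u(1,2) by auto
qed

lemma good_trivial:
  assumes C2: "C2 \<in> system" "C2 \<noteq> C" "F \<in> faces C2" and q: "quad C F A P B Q"
    and \<phi>: "c < \<phi> A" "c < \<phi> B" "\<phi> P = c" "\<phi> Q = c"
    and k: "is_class C K S" "l \<in> ln C K" and y: "y \<in> l" "car C y = F"
    and KA: "(P, A) \<in> K" "(Q, A) \<in> K" and l: "l = closed_segment P Q"
    and C: "P \<notin> dsp C" "Q \<notin> dsp C" "F \<in> Lf C" "dtype C"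
  shows "good (pth C K S) l"
proof -
  note c = is_classD[OF k(1)] and qd = quadD[OF q]
  have on: "{P, Q, A} \<subseteq> F" "{P, Q, B} \<subseteq> F" using qd(2) by auto
  have ipl: "ip (P, X) = P" "ip (Q, X) = Q" for X using \<phi> ip_level by auto
  have lA: "l = seg (P, A) (Q, A)" "l = seg (P, B) (Q, B)" unfolding l ipl by simp_all
  have m: "(P, A) \<in> mx C" "(Q, A) \<in> mx C" "(P, B) \<in> mx C" "(Q, B) \<in> mx C"
    using C(1,2) qd dsp_raw[OF c(2) qd(21) \<phi>(1)] dsp_raw[OF c(2) qd(23) \<phi>(2)] by (auto intro!: mxI)
  have AS: "A \<in> S" using dtypeD(1)[OF C(4) k(1) m(1)] KA(1) by simp
  have M2: "C2 \<in> M" by (rule system_M[OF C2(1)])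
  have q2: "quad C2 F A P B Q" by (rule quad_mono[OF q C2(3)])
  have corr: "corresponds A l (pth C K S)"
    unfolding lA(1) by (rule corresponds_L[OF k(1) KA qd(7) on(1) C(3) AS])
  have near: "D = C \<or> D = C2" "car D y = F" "F \<in> faces D" if D: "D \<in> system" "y \<in> body D" for D
  proof -
    have yC: "y \<in> body C" using ln_body[OF k] y(1) by blast
    show cr: "car D y = F" using car_mesh[OF mesh(1) system_M[OF D(1)] c(2) D(2) yC] y(2) by simp
    then have sub: "F \<subseteq> nodes D" using car_sub by blast
    show "D = C \<or> D = C2"
      using common_face(5)[OF mesh(1) c(2) M2 C2(2)[symmetric] qd(1) faces_sub[OF C2(3)] system_M[OF D(1)] _ sub] by blast
    then show "F \<in> faces D" using C2(3) qd(1) by auto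
  qed
  show ?thesis
  proof (cases "\<exists>K2 Sb. is_class C2 K2 Sb \<and> l \<in> ln C2 K2")
    case True
    then obtain K2 Sb where k2: "is_class C2 K2 Sb" "l \<in> ln C2 K2" by blast
    have "y \<in> body C2" using ln_body[OF k2] y(1) by blast
    note n = near[OF C2(1) this]
    obtain U V U' V' where u: "(U, V) \<in> K2" "(U', V') \<in> K2" "{U, V, U', V'} \<subseteq> F" "ip (U, V) \<noteq> ip (U', V')"
      by (rule ln_on_face[OF k2 y(1) n(2,3)])
    note t = trivial_L_lines[OF M2 q2 \<phi> k2(1) u]
    have AB: "A \<in> dsp C2" using dsp_raw[OF M2 quadD(21)[OF q2] \<phi>(1)] .
    have m2: "(P, A) \<in> mx C2" "(Q, A) \<in> mx C2" using t AB quadD(9,13,12,16)[OF q2] by (auto intro!: mxI)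
    \<comment> \<open>The class \<open>K2\<close> may be the one around \<open>B\<close>; the class
      around \<open>A\<close> draws the same diagonal and shares \<open>A\<close> with the given
      iso-path.\<close>
    obtain K3 Sc where k3: "is_class C2 K3 Sc" "(P, A) \<in> K3" by (rule class_ex[OF C2(1) m2(1)])
    have t2: "dtype C2" using t by blast
    have Q3: "(Q, A) \<in> K3" by (rule dtypeD(2)[OF t2 k3 m2(2)])
    have AS3: "A \<in> Sc" using dtypeD(1)[OF t2 k3(1) m2(1)] k3(2) by simp
    have F2: "F \<in> Lf C2" using t by blast
    have c3: "corresponds A l (pth C2 K3 Sc)"
      unfolding lA(1) by (rule corresponds_L[OF k3 Q3 qd(7) on(1) F2 AS3])
    then have l3: "l \<in> ln C2 K3" using corresponds_line by fastforce
    show ?thesis by (rule good_common[OF k(1) k3(1) _ _ k(2) l3 corr c3]) (use C2(2) in auto)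
  next
    case False
    obtain KB SB where kB: "is_class C KB SB" "(P, B) \<in> KB" by (rule class_ex[OF c(1) m(3)])
    have QB: "(Q, B) \<in> KB" by (rule dtypeD(2)[OF C(4) kB m(4)])
    have PQne: "ip (P, B) \<noteq> ip (Q, B)" unfolding ipl by (rule qd(7))
    have lB: "l \<in> ln C KB" unfolding lA(2) by (rule lnI[OF kB(1,2) QB qd(1) _ PQne]) (use on in simp)
    \<comment> \<open>On an L-face a class of this type has only one disperse node, which for
      \<open>KB\<close> is \<open>B\<close>.\<close>
    have "A \<notin> SB"
    proof
      assume "A \<in> SB"
      then have "(P, A) \<in> KB" using dtypeD(1)[OF C(4) kB(1) m(1)] by simp
      then show False using dtypeD(3)[OF C(4) kB(1) C(3) _ kB(2), of P A] on qd(4) by auto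
    qed
    then have ne: "pth C KB SB \<noteq> pth C K S" "KB \<noteq> K" using AS dtypeD(1)[OF C(4) kB(1) m(1)] KA(1) by auto
    show ?thesis
    proof (rule good_only[OF c(6) is_classD(7)[OF kB(1)] ne(1)])
      show "meet (pth C K S) (pth C KB SB) l" by (rule meet_inner[OF k(1) kB(1) _ k(2) lB]) (use ne(2) in simp)
      fix \<alpha> assume a: "\<alpha> \<in> system_iso_paths" "l \<in> lines \<alpha>"
      from a(1) obtain D where D: "D \<in> system" "\<alpha> \<in> iso_paths D" unfolding system_iso_paths_def by blast
      from D(2) consider Ls S' where "\<alpha> = Inner D Ls S'" "(Ls, S') \<in> W D" | E where "\<alpha> = Outer E" "outer_iso_path D E"
        unfolding iso_paths_def by blast
      then show "\<alpha> = pth C K S \<or> \<alpha> = pth C KB SB"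
      proof cases
        case (1 Ls S')
        obtain K' where K': "is_class D K' S'" "Ls = ln D K'" by (rule W_classE[OF D(1) 1(2)])
        have lK: "l \<in> ln D K'" using a(2) 1 K' by simp
        have "y \<in> body D" using ln_body[OF K'(1) lK] y(1) by blast
        note n = near[OF D(1) this]
        have DC: "D = C" using n(1) False K'(1) lK by blast
        obtain U V U' V' where u: "(U, V) \<in> K'" "(U', V') \<in> K'" "{U, V, U', V'} \<subseteq> F" "ip (U, V) \<noteq> ip (U', V')"
          by (rule ln_on_face[OF K'(1) lK y(1) n(2,3)])
        have "(P, A) \<in> K' \<or> (P, B) \<in> K'"
          using trivial_L_lines[OF c(2) q \<phi> K'(1)[unfolded DC] u] by blast
        then have "K' = K \<and> S' = S \<or> K' = KB \<and> S' = SB"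
          using class_disjoint[OF K'(1)[unfolded DC] k(1) _ KA(1)] class_disjoint[OF K'(1)[unfolded DC] kB(1) _ kB(2)] by blast
        then show ?thesis using 1(1) K'(2) DC by auto
      next
        case (2 E)
        from 2(2) obtain D2 F' where o: "D2 \<in> system" "F' \<in> faces D" "F' \<in> faces D2" "F' \<in> Lf D"
          "\<not> trivial_L_face c (graph D) F'" "\<Union>E = surf D D2 \<inter> convex hull F'"
          unfolding outer_iso_path_def by blast
        have "l \<in> E" using a(2) 2(1) by simp
        then have "y \<in> convex hull F'" using y(1) o(6) by blast
        note h = hull_face_car[OF system_M[OF D(1)] o(2) this]
        note n = near[OF D(1) h(2)]
        have FF: "F = F'" by (rule faces_sub_eq[OF system_M[OF D(1)] n(3) o(2)]) (use n h in simp)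
        have qD: "quad D F A P B Q" by (rule quad_mono[OF q n(3)])
        note qdD = quadD[OF qD]
        have MD: "D \<in> M" by (rule system_M[OF D(1)])
        have AD: "A \<in> dsp D" by (rule dsp_raw[OF MD qdD(21) \<phi>(1)])
        \<comment> \<open>The outer iso-path would make \<open>F\<close> a non-trivial L-face of
          \<open>D\<close>, but \<open>P\<close> and \<open>Q\<close> turn out to be iso-nodes of
          \<open>D\<close>.\<close>
        have "F \<in> alternating_faces D (dsp D)" using o(4) FF Lf_eq[OF MD] by simp
        then have "(X \<in> dsp D) \<noteq> (Y \<in> dsp D)" if "X \<in> F" "Y \<in> F" "incident D X Y" for X Y
          using that unfolding alternating_faces_def by blast
        then have "P \<notin> dsp D" "Q \<notin> dsp D" using AD qdD(9,16) on by auto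
        then have mD: "(P, A) \<in> mx D" "(Q, A) \<in> mx D" using AD qdD by (auto intro!: mxI)
        have lev: "Z \<in> iso_nodes c (graph D)" if "(Z, A) \<in> mx D" "\<phi> Z = c" for Z
        proof -
          have "iso_pt c (graph D) (Z, A) = Z" using iso_pt_graph[OF MD that(1)] ip_level[OF that(2)] by simp
          then show ?thesis using that(1) mxD(6)[OF MD that(1)] unfolding iso_nodes_def iso_points_def by (metis IntI cub_graph imageI)
        qed
        have "F \<inter> cont c (graph D) \<subseteq> {P, Q}"
          using qdD(2) AD dsp_raw[OF MD qdD(23) \<phi>(2)] cont_disp by blast
        then have "trivial_L_face c (graph D) F"
          using o(4) FF lev[OF mD(1) \<phi>(3)] lev[OF mD(2) \<phi>(4)] unfolding trivial_L_face_def by blast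
        then show ?thesis using o(5) FF by simp
      qed
    qed
  qed
qed

lemma car_level_edge:
  assumes "D \<in> M" "incident D P Q" "y \<in> closed_segment P Q" "car D y = F" "F \<in> faces D"
  shows False
proof -
  note fc = face_card_neq[OF cuboid_M[OF assms(1)] assms(5)]
  obtain t where t: "0 \<le> t" "t \<le> 1" "y = (1 - t) *\<^sub>R P + t *\<^sub>R Q" using assms(3) by (auto simp: in_segment)
  have n: "P \<in> nodes D" "Q \<in> nodes D" using incident_nodes[OF assms(2)] by auto
  have "y = P \<or> y = Q \<or> car D y = {P, Q}"
  proof (cases "t = 0 \<or> t = 1")
    case True then show ?thesis using t(3) by auto
  next
    case False
    have "car D y = {P, Q}"
      by (rule car_edge[OF cuboid_M[OF assms(1)] assms(2), of t]) (use False t in \<open>auto simp: algebra_simps\<close>)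
    then show ?thesis by blast
  qed
  then have "F = {P} \<or> F = {Q} \<or> F = {P, Q}" using assms(4) car_node[OF n(1)] car_node[OF n(2)] by auto
  moreover have "{X} = {X, X}" for X :: pt by simp
  ultimately show False using fc by metis
qed

lemma dsp_promoted: "D \<in> M \<Longrightarrow> V \<in> dsp D \<Longrightarrow> \<phi> V \<le> c \<Longrightarrow> promoted c M \<phi> D V"
proof -
  assume a: "D \<in> M" "V \<in> dsp D" "\<phi> V \<le> c"
  have "V \<in> nodes D" using a(2) disp_sub[of c "graph D"] by auto
  from disp_removed_iff[OF iso_level mesh(1) this, of \<phi>] a show ?thesis unfolding graph_eq by auto
qed

lemma promoted_dsp: "promoted c M \<phi> D V \<Longrightarrow> V \<in> dsp D \<and> \<phi> V = c"
proof -
  assume a: "promoted c M \<phi> D V"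
  then have "V \<in> nodes D" "\<phi> V = c" unfolding promoted_def[OF iso_level mesh(1)] by auto
  then show ?thesis using disp_removed_iff[OF iso_level mesh(1), of V D \<phi>] a unfolding graph_eq by auto
qed

lemma dsp_level_nbr: "D \<in> M \<Longrightarrow> V \<in> dsp D \<Longrightarrow> \<phi> V \<le> c \<Longrightarrow> incident D V U \<Longrightarrow> U \<in> dsp D"
  using promoted_nbr[OF iso_level mesh(1) _ dsp_promoted] unfolding graph_eq by blast

text \<open>By \<open>nL\<close> the labels \<open>\<phi>\<close> do not alternate on
  \<open>F\<close>. It is shown that neither graph has relabeled a node of \<open>F\<close>; so both
  have the same mixed edges there, draw the same line, and \<open>A\<close> corresponds to it in
  both.\<close>

lemma good_regular:
  assumes C2: "C2 \<in> system" "C2 \<noteq> C" "F \<in> faces C2" and q: "quad C F A P B Q"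
    and k: "is_class C K S" "l \<in> ln C K" and y: "y \<in> l" "car C y = F"
    and a: "l = seg (P, A) (P', A')" "(P, A) \<in> K" "(P', A') \<in> K" "{P, A, P', A'} \<subseteq> F" "ip (P, A) \<noteq> ip (P', A')"
    and nL: "\<not> (c < \<phi> B \<and> \<phi> Q \<le> c)"
  shows "good (pth C K S) l"
proof -
  note c = is_classD[OF k(1)] and qd = quadD[OF q]
  have m: "(P, A) \<in> mx C" "(P', A') \<in> mx C" using a(2,3) c(5) by auto
  note mm = mxD[OF c(2) m(1)] and mm' = mxD[OF c(2) m(2)]
  have M2: "C2 \<in> M" by (rule system_M[OF C2(1)])
  have q2: "quad C2 F A P B Q" by (rule quad_mono[OF q C2(3)])
  have onq: "(P', A') \<in> {(P, A), (P, B), (Q, A), (Q, B), (B, Q)}"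
    by (rule mx_on_quad[OF c(2) q m]) (use a(4) in simp)
  have raw: "V \<in> dsp E \<longleftrightarrow> c < \<phi> V" if E: "E = C \<or> E = C2" and V: "V \<in> F" for E V
  proof
    assume "c < \<phi> V"
    moreover have "V \<in> nodes E" using V E faces_sub[OF C2(3)] faces_sub[OF qd(1)] by auto
    ultimately show "V \<in> dsp E" using E c(2) M2 dsp_raw by blast
  next
    assume VE: "V \<in> dsp E"
    have EM: "E \<in> M" using E c(2) M2 by auto
    have qE: "quad E F A P B Q" using E q q2 by auto
    note qe = quadD[OF qE] and nb = dsp_level_nbr[OF EM]
    show "c < \<phi> V"
    proof (rule ccontr)
      assume nV: "\<not> ?thesis"
      then have Vc: "\<phi> V = c" using dsp_cases[OF EM VE] by auto
      have VA: "V \<noteq> A" using nV mm(3) by auto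
      \<comment> \<open>The nodes of \<open>F\<close> with label at most \<open>c\<close> are
        \<open>P\<close>, or \<open>P\<close> and \<open>B\<close>, or \<open>P\<close>,
        \<open>B\<close> and \<open>Q\<close>. A relabeled node among them makes the line degenerate
        in the first case, and puts it along an edge, against the carrier of \<open>y\<close>, in
        the second. In the third \<open>B\<close> is relabeled too, and its two neighbours of label
        at most \<open>c\<close> would give \<open>A\<close> the label \<open>c\<close>.\<close>
      consider "c < \<phi> B" "c < \<phi> Q" | "\<phi> B \<le> c" "c < \<phi> Q" | "\<phi> B \<le> c" "\<phi> Q \<le> c" using nL by linarith
      then show False
      proof cases
        case 1
        then have "V = P" using V VA nV qd(2) by auto
        have "P' = P" using onq mm'(2) 1 by auto
        then show False using a(5) ip_level \<open>V = P\<close> Vc by metis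
      next
        case 2
        have "V = P \<or> V = B" using V VA nV qd(2) 2 by auto
        then have "P \<in> dsp E \<and> B \<in> dsp E" using nb[of P B] nb[of B P] VE qe(10,14) mm(2) 2(1) by blast
        then have lev: "\<phi> P = c" "\<phi> B = c" using dsp_cases[OF EM, of P] dsp_cases[OF EM, of B] mm(2) 2(1) by auto
        have "P' = P \<or> P' = B" using onq mm'(2) 2 by auto
        moreover have "P' \<noteq> P" using a(5) lev(1) ip_level by metis
        ultimately have "ip (P', A') = B" using lev(2) ip_level by auto
        then have "y \<in> closed_segment P B" using y(1) a(1) ip_level[OF lev(1)] by simp
        then show False by (rule car_level_edge[OF c(2) qd(10) _ y(2) qd(1)])
      next
        case 3
        have "V = P \<or> V = B \<or> V = Q" using V VA qd(2) by auto
        then have "B \<in> dsp E" using VE nb[of P B] nb[of Q B] qe(10,15) mm(2) 3(2) by blast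
        then have "promoted c M \<phi> E B" using dsp_promoted[OF EM _ 3(1)] by blast
        then have "\<phi> A = c"
          by (rule promoted_two_nbrs[OF iso_level mesh(1) EM _ quad_rot[OF quad_rot[OF qE]]]) (use 3 mm(2) in auto)
        then show False using mm(3) by simp
      qed
    qed
  qed
  have nLf: "F \<notin> Lf E" if E: "E = C \<or> E = C2" for E
  proof
    assume "F \<in> Lf E"
    moreover have EM: "E \<in> M" using E c(2) M2 by auto
    ultimately have "F \<in> alternating_faces E (dsp E)" using Lf_eq by simp
    then have alt: "(X \<in> dsp E) \<noteq> (Y \<in> dsp E)" if "X \<in> F" "Y \<in> F" "incident E X Y" for X Y
      using that unfolding alternating_faces_def by blast
    have qE: "quad E F A P B Q" using E q q2 by auto
    note qe = quadD[OF qE]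
    have on: "P \<in> F" "B \<in> F" "Q \<in> F" using qe(2) by auto
    have "B \<in> dsp E" using alt[OF on(1,2) qe(10)] raw[OF E on(1)] mm(2) by auto
    moreover have "Q \<notin> dsp E" using alt[OF on(2,3) qe(11)] calculation by auto
    ultimately show False using nL raw[OF E on(2)] raw[OF E on(3)] by auto
  qed
  have on: "P \<in> F" "A \<in> F" "P' \<in> F" "A' \<in> F" using a(4) by auto
  have n2: "P \<in> nodes C2" "A \<in> nodes C2" "P' \<in> nodes C2" "A' \<in> nodes C2" using on faces_sub[OF C2(3)] by auto
  have m2: "(P, A) \<in> mx C2" "(P', A') \<in> mx C2"
    using raw[of C2] on mm mm' incident_mono[OF mm(1) n2(1,2)] incident_mono[OF mm'(1) n2(3,4)]
    by (auto intro!: mxI)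
  obtain K2 Sb where k2: "is_class C2 K2 Sb" "(P, A) \<in> K2" by (rule class_ex[OF C2(1) m2(1)])
  have PA2: "(P', A') \<in> K2" by (rule class_face[OF k2(1) C2(3) nLf k2(2) m2(2) a(4)]) simp
  have l2: "l \<in> ln C2 K2" unfolding a(1) by (rule lnI[OF k2 PA2 C2(3) a(4,5)])
  have c1: "corresponds A l (pth C K S)"
    by (rule corresponds_regular[OF k(1) m qd(1) nLf a(4,5) on(2) mm(9) a(1) k(2)]) simp
  have c2: "corresponds A l (pth C2 K2 Sb)"
    by (rule corresponds_regular[OF k2(1) m2 C2(3) nLf a(4,5) on(2) _ a(1) l2])
      (use mxD(9)[OF M2 m2(1)] in auto)
  show ?thesis by (rule good_common[OF k(1) k2(1) _ _ k(2) l2 c1 c2]) (use C2(2) in auto)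
qed

section \<open>Iso-lines along edges of the cuboid\<close>

text \<open>A face at a level edge whose other labels exceed \<open>c\<close> carries the iso-line
  along the edge as soon as one end is not relabeled: then the other end is not relabeled
  either.\<close>

lemma active_class:
  assumes E: "E \<in> system" and q: "quad E F P Q Y X" and \<phi>: "\<phi> P = c" "\<phi> Q = c" "c < \<phi> X" "c < \<phi> Y"
    and P: "P \<notin> dsp E"
  obtains K S where "is_class E K S" "(P, X) \<in> K" "(Q, Y) \<in> K" "closed_segment P Q \<in> ln E K"
    "corresponds X (closed_segment P Q) (pth E K S)" "corresponds Y (closed_segment P Q) (pth E K S)"
    "F \<notin> Lf E" "Q \<notin> dsp E"
proof -
  note EM = system_M[OF E] and qd = quadD[OF q]
  have Q: "Q \<notin> dsp E" using dsp_level_nbr[OF EM, of Q P] qd(13) \<phi>(2) P by auto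
  have XY: "X \<in> dsp E" "Y \<in> dsp E" using dsp_raw[OF EM] qd \<phi> by auto
  have m: "(P, X) \<in> mx E" "(Q, Y) \<in> mx E" using P Q XY qd by (auto intro!: mxI)
  have nL: "F \<notin> Lf E" by (rule not_Lf_adjacent[OF EM qd(1) _ _ qd(9) P Q]) (use qd(2) in auto)
  obtain K S where k: "is_class E K S" "(P, X) \<in> K" by (rule class_ex[OF E m(1)])
  have on: "{P, X, Q, Y} \<subseteq> F" using qd(2) by auto
  have K2: "(Q, Y) \<in> K" by (rule class_face[OF k(1) qd(1) nL k(2) m(2) on])
  have ip: "ip (P, X) = P" "ip (Q, Y) = Q" using \<phi>(1,2) by (simp_all add: ip_level)
  have ne: "ip (P, X) \<noteq> ip (Q, Y)" unfolding ip by (rule qd(3))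
  have seg: "closed_segment P Q = seg (P, X) (Q, Y)" unfolding ip ..
  have l: "closed_segment P Q \<in> ln E K" unfolding seg by (rule lnI[OF k K2 qd(1) on ne])
  have "corresponds Z (closed_segment P Q) (pth E K S)" if "Z \<in> {X, Y}" for Z
    by (rule corresponds_regular[OF k(1) m qd(1) nL on ne _ _ seg l]) (use that on XY in auto)
  then show ?thesis using that[OF k K2 l _ _ nL Q] by blast
qed

abbreviation F2 :: "cuboid \<Rightarrow> 3 \<Rightarrow> pt \<Rightarrow> bool" where "F2 \<equiv> F2_at c M \<phi>"

text \<open>A face belongs to at most two cuboids, so \<open>D2\<close> is the partner in the
  \<open>F_2\<close>-configuration of \<open>D\<close>, and each of the two is the partner of the
  other.\<close>

lemma F2_transfer:
  assumes D: "D \<in> M" "D2 \<in> M" "D2 \<noteq> D" and P: "P \<in> nodes D" "face D r P \<subseteq> nodes D2" and F: "F2 D r P"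
  shows "F2 D2 r P" "\<And>V. V \<in> nodes D2 \<Longrightarrow> V $ r \<noteq> P $ r \<Longrightarrow> c < \<phi> V"
proof -
  note d = F2_at_def[OF iso_level mesh(1)]
  note cf = common_face[OF mesh(1) D(1,2) D(3)[symmetric] face_in_faces[OF P(1)] P(2)]
  from F obtain D' where D': "D' \<in> M" "D' \<noteq> D" "face D r P \<subseteq> nodes D'" "\<forall>V \<in> nodes D' - nodes D. c < \<phi> V"
    unfolding d by blast
  have "D' = D2" by (rule cf(5)[OF D'(1,2,3)])
  have raw: "(V $ r = P $ r \<longrightarrow> \<phi> V = c) \<and> (V $ r \<noteq> P $ r \<longrightarrow> c < \<phi> V)" if "V \<in> nodes D" for V
    using F that unfolding d by blast
  have c2: "nodes D \<inter> nodes D2 = face D r P" by (rule cf(2))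
  show o: "c < \<phi> V" if "V \<in> nodes D2" "V $ r \<noteq> P $ r" for V
  proof -
    have "V \<notin> nodes D" using that c2 by (auto simp: face_def)
    then show ?thesis using D'(4) \<open>D' = D2\<close> that(1) by blast
  qed
  have P2: "P \<in> nodes D2" using P by auto
  have cD: "is_cuboid D2" "is_cuboid D" using cuboid_M D by auto
  have f2: "face D2 r P = face D r P"
  proof -
    have "P \<in> face D r P" using P(1) by simp
    then obtain i where i: "face D r P = face D2 i P" by (rule facesE_at[OF cD(1) cf(1)])
    have "i = r"
    proof (rule ccontr)
      assume "i \<noteq> r"
      then have "flip D2 r P \<in> face D2 i P" using P2 by simp
      then have "flip D2 r P \<in> face D r P" using i by simp
      then show False using flip_nth_neq[OF cD(1) P2, of r] by (simp add: face_def)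
    qed
    then show ?thesis using i by simp
  qed
  have 1: "\<phi> V = c" if V: "V \<in> nodes D2" "V $ r = P $ r" for V
  proof -
    have "V \<in> face D2 r P" using V by (simp add: face_def)
    then have "V \<in> nodes D" using f2 by (auto simp: face_def)
    then show ?thesis using raw V by blast
  qed
  have 2: "c < \<phi> V" if V: "V \<in> nodes D - nodes D2" for V
  proof -
    have "V \<notin> face D r P" using V c2 by blast
    then have "V $ r \<noteq> P $ r" using V by (simp add: face_def)
    then show ?thesis using raw V by blast
  qed
  show "F2 D2 r P"
    unfolding d
  proof (intro conjI ballI impI bexI[OF _ D(1)])
    show "face D2 r P \<subseteq> nodes D" unfolding f2 by (rule face_sub)
  qed (use 1 2 o D(3) in auto)
qed

lemma F2_dsp: "D \<in> M \<Longrightarrow> P \<in> nodes D \<Longrightarrow> F2 D r P \<Longrightarrow> P \<in> dsp D"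
proof -
  assume a: "D \<in> M" "P \<in> nodes D" "F2 D r P"
  have "\<phi> P = c" using a(2,3) unfolding F2_at_def[OF iso_level mesh(1)] by blast
  then have "promoted c M \<phi> D P"
    using F2_at_promoted[OF iso_level mesh(1) a(1,2,3) a(2)] by blast
  then show ?thesis using promoted_dsp by blast
qed

lemma level_edge_dsp:
  assumes D: "D \<in> M" and P: "P \<in> dsp D" "\<phi> P = c" and Q: "\<phi> (flip D i P) = c" and ax: "j \<noteq> i" "k \<noteq> i" "k \<noteq> (j :: 3)"
  shows "(c < \<phi> (flip D j P) \<and> c < \<phi> (flip D j (flip D i P)) \<and> c < \<phi> (flip D k P) \<and> c < \<phi> (flip D k (flip D i P))) \<or>
    F2 D j P \<or> F2 D k P"
proof -
  have "promoted c M \<phi> D P" using dsp_promoted[OF D P(1)] P(2) by simp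
  from promoted_edge[OF iso_level mesh(1) D this Q ax] show ?thesis .
qed

lemma graph_lab: "D \<in> M \<Longrightarrow> V \<in> nodes D \<Longrightarrow> V \<notin> dsp D \<Longrightarrow> lab (graph D) V = \<phi> V"
  using lab_removed[OF iso_level mesh(1), of V D \<phi>] promoted_dsp[of D V] unfolding graph_eq by blast

text \<open>Both faces at the level edge \<open>{P, Q}\<close> carry the iso-line. As there is no \<open>T\<^sub>2\<close>-subgraph, exactly
  four nodes are disperse, and the two iso-paths given by the \<open>S\<^sub>2\<close>-rule meet along the edge.\<close>
lemma two_classes_at_edge:
  assumes sysC: "C \<in> system" and cC: "is_cuboid C" and n: "P \<in> nodes C" and ax: "j \<noteq> i" "k \<noteq> i" "k \<noteq> (j :: 3)"
    and \<phi>: "\<phi> P = c" "\<phi> (flip C i P) = c" "c < \<phi> (flip C k P)" "c < \<phi> (flip C k (flip C i P))"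
      "c < \<phi> (flip C j P)" "c < \<phi> (flip C j (flip C i P))"
    and P: "P \<notin> dsp C" "flip C i P \<notin> dsp C" and k: "is_class C K S" "(P, flip C k P) \<in> K"
  shows "dtype C \<and> face C i P \<in> Lf C"
proof -
  have CM: "C \<in> M" by (rule system_M[OF sysC])
  let ?Q = "flip C i P" and ?X = "flip C k P" and ?Y = "flip C k (flip C i P)"
    and ?X' = "flip C j P" and ?Y' = "flip C j (flip C i P)"
  let ?R = "flip C j (flip C k P)" and ?R' = "flip C j (flip C k (flip C i P))"
  have nd: "?Q \<in> nodes C" "?X \<in> nodes C" "?Y \<in> nodes C" "?X' \<in> nodes C" "?Y' \<in> nodes C" "?R \<in> nodes C" "?R' \<in> nodes C"
    using n by simp_all
  have ds: "?X \<in> dsp C" "?Y \<in> dsp C" "?X' \<in> dsp C" "?Y' \<in> dsp C" using dsp_raw[OF CM] nd \<phi> by auto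
  have lev: "P \<in> level c (graph C)" "?Q \<in> level c (graph C)"
    using graph_lab[OF CM n P(1)] graph_lab[OF CM nd(1) P(2)] n nd \<phi> by (auto simp: level_def)
  obtain a where U: "UNIV = {i, j, a}" "a \<noteq> i" "a \<noteq> j" by (rule third_axis[OF ax(1)[symmetric]])
  have "k \<in> {i, j, a}" using U(1) by blast
  then have Uk: "UNIV = {i, j, k}" using U ax by auto
  have nb: "nbrs C P = {?Q, ?X', ?X}" "nbrs C ?Q = {P, ?Y', ?Y}"
    unfolding nbrs_eq[OF cC n] nbrs_eq[OF cC nd(1)] Uk by auto
  have inc: "incident C P ?Q" using cC n by (auto simp: incident_iff)
  \<comment> \<open>Position relative to \<open>P\<close> in each axis; its values show that the
    seven nodes of the supposed \<open>T_2\<close>-subgraph are distinct.\<close>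
  define sg where "sg = (\<lambda>V :: pt. (V $ i = P $ i, V $ j = P $ j, V $ k = P $ k))"
  have fl: "flip C l V $ l \<noteq> V $ l" if "V \<in> nodes C" for V l using flip_nth_neq[OF cC that] .
  have fP: "fst C $ l + snd C $ l - P $ l \<noteq> P $ l" for l using fl[OF n, of l] by (simp add: flip_nth)
  have nT: "\<not> T2_subgraph c (graph C) H" for H
    using free[of C] sysC unfolding singular_free_def graph_eq system_def by blast
  have no: "Z \<notin> dsp C" if Z: "Z = ?R \<or> Z = ?R'" for Z
  proof
    assume dZ: "Z \<in> dsp C"
    let ?xs = "[P, ?Q, ?X, ?Y, ?X', ?Y', Z]"
    have "distinct (map sg ?xs)"
      using Z ax ax[symmetric] fP by (auto simp: sg_def flip_nth)
    then have d: "distinct ?xs" by (simp only: distinct_map)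
    then have card: "card (set ?xs) = 7" by (simp add: distinct_card)
    have "set ?xs \<subseteq> nodes C" using n nd Z by auto
    moreover have "nbrs C P \<union> nbrs C ?Q \<subseteq> set ?xs" unfolding nb by auto
    moreover have "set ?xs - {P, ?Q} \<subseteq> dsp C" using ds dZ by auto
    ultimately have "T2_subgraph c (graph C) (set ?xs)"
      unfolding T2_subgraph_def cub_graph using card lev inc by blast
    then show False using nT by blast
  qed
  have "dsp C \<subseteq> {?X, ?Y, ?X', ?Y'}"
  proof
    fix Z assume Z: "Z \<in> dsp C"
    then have "Z \<in> nodes C" using disp_sub[of c "graph C"] by auto
    then have "Z \<in> face C i P \<or> Z \<in> face C i ?Q"
      using node_nth_cases[OF cC n, of Z i] by (auto simp: face_def)
    then have "Z \<in> {P, ?X', ?R, ?X} \<or> Z \<in> {?Q, ?Y', ?R', ?Y}"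
      unfolding face_eq4[OF cC n ax] face_eq4[OF cC nd(1) ax] .
    then show "Z \<in> {?X, ?Y, ?X', ?Y'}" using Z no[of ?R] no[of ?R'] P by auto
  qed
  then have "card (dsp C) \<le> card {?X, ?Y, ?X', ?Y'}" by (intro card_mono) auto
  also have "\<dots> \<le> 4" by (simp add: card_insert_if)
  \<comment> \<open>Here the bound of five disperse nodes in \<open>class_struct\<close> is
    used.\<close>
  finally have "\<not> ptype C" using ptypeD(1)[OF _ k(1)] by force
  then have "dtype C" using types[OF k(1)] by blast
  moreover have "face C i P \<in> Lf C"
    unfolding Lf_eq[OF CM]
    by (rule alternating_quad[OF quad_rot[OF quad_face[OF cC n ax]]]) (use ds P no[of ?R] in auto)
  ultimately show ?thesis ..
qed

text \<open>Call a face at the edge active if its other two labels exceed \<open>c\<close>. A cuboid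
  in which the edge is not relabeled draws the line on its active faces. The search starts across
  \<open>F\<close> and passes the cuboids that have relabeled \<open>P\<close>; in these
  \<open>P\<close> is disperse, so a disperse path can run through it.\<close>

lemma good_edge:
  assumes k: "is_class C K S" and F: "F \<in> faces C" and a: "(P, X) \<in> K" "(Q, Y) \<in> K" "{P, X, Q, Y} \<subseteq> F"
    and lev: "\<phi> P = c" "\<phi> Q = c" and inc: "incident C P Q" and l: "l = closed_segment P Q" "l \<in> ln C K"
  shows "good (pth C K S) l"
proof -
  note c = is_classD[OF k]
  have m: "(P, X) \<in> mx C" "(Q, Y) \<in> mx C" using a c(5) by auto
  note mX = mxD[OF c(2) m(1)] and mY = mxD[OF c(2) m(2)]
  obtain i where i: "Q = flip C i P" using inc c(4) by (auto simp: incident_iff)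
  have n: "P \<in> nodes C" "Q \<in> nodes C" using incident_nodes[OF inc] by auto
  have "P \<in> F" using a(3) by simp
  then obtain j where j: "F = face C j P" by (rule facesE_at[OF c(4) F])
  have Fj: "Z $ j = P $ j" if "Z \<in> F" for Z using that j by (simp add: face_def)
  have ji: "j \<noteq> i" using Fj[of Q] a(3) i flip_nth_neq[OF c(4) n(1), of i] by auto
  \<comment> \<open>The axes: \<open>i\<close> along the edge, \<open>j\<close> normal to
    \<open>F\<close>, and \<open>k\<close> within \<open>F\<close>, pointing to \<open>X\<close> and
    \<open>Y\<close>.\<close>
  obtain k where k3: "k \<noteq> i" "k \<noteq> j" "UNIV = {i, j, k}" by (rule third_axis[OF ji[symmetric]])
  note ax = ji k3(1,2)
  have kk: "m = i \<or> m = j \<or> m = k" for m using k3(3) by blast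
  have X: "X = flip C k P"
  proof -
    obtain m where m: "X = flip C m P" using mX(1) c(4) by (auto simp: incident_iff)
    have "m \<noteq> i" using m i mX(3) lev by auto
    moreover have "m \<noteq> j" using m Fj[of X] a(3) flip_nth_neq[OF c(4) n(1), of j] by auto
    ultimately show ?thesis using kk m by blast
  qed
  have Y: "Y = flip C k Q"
  proof -
    obtain m where m: "Y = flip C m Q" using mY(1) c(4) by (auto simp: incident_iff)
    have "m \<noteq> i" using m i mY(3) lev by auto
    moreover have "m \<noteq> j" using m Fj[of Y] Fj[of Q] a(3) flip_nth_neq[OF c(4) n(2), of j] by auto
    ultimately show ?thesis using kk m by blast
  qed
  have qF: "quad C F P Q Y X"
    using quad_face[OF c(4) n(1) ji[symmetric] ax(3) ax(2)] unfolding j X Y i by (simp add: flip_commute)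
  have on: "{P, X, Q, Y} \<subseteq> F" by (rule a(3))
  have nL: "F \<notin> Lf C" by (rule not_Lf_adjacent[OF c(2) F _ _ inc mX(8) mY(8)]) (use on in auto)
  have ip: "ip (P, X) = P" "ip (Q, Y) = Q" using lev by (simp_all add: ip_level)
  have ne: "ip (P, X) \<noteq> ip (Q, Y)" unfolding ip using incident_neq[OF inc] .
  have seg: "l = seg (P, X) (Q, Y)" unfolding l(1) ip ..
  have corr: "corresponds X l (pth C K S)"
    by (rule corresponds_regular[OF k m F nL on ne _ mX(9) seg l(2)]) (use on in simp)
  show ?thesis
  \<comment> \<open>If the other face of \<open>C\<close> at the edge is active too,
    \<open>C\<close> itself supplies the second iso-path.\<close>
  proof (cases "c < \<phi> (flip C j P) \<and> c < \<phi> (flip C j Q)")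
    case True
    have q': "quad C (face C k P) P Q (flip C j Q) (flip C j P)"
      using quad_face[OF c(4) n(1), of i k j] ax unfolding i by (simp add: flip_commute)
    obtain K' S' where k': "is_class C K' S'" "(P, flip C j P) \<in> K'" "closed_segment P Q \<in> ln C K'"
      by (rule active_class[OF c(1) q' lev conjunct1[OF True] conjunct2[OF True] mX(8)])
    have t: "dtype C \<and> face C i P \<in> Lf C"
      by (rule two_classes_at_edge[OF c(1,4) n(1) ax _ _ _ _ _ _ mX(8) _ k])
        (use lev mX(3) mY(3,8) True a(1) in \<open>simp_all add: X Y i\<close>)
    \<comment> \<open>The face orthogonal to the edge is an L-face with disperse nodes
      \<open>X\<close> and \<open>flip C j P\<close>, and a class has only one disperse node
      there.\<close>
    have "X \<noteq> flip C j P" using X flip_inj[OF c(4) n(1)] ax(3) by simp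
    moreover have "{P, X, P, flip C j P} \<subseteq> face C i P" using n(1) ax X by simp
    ultimately have KK: "(P, flip C j P) \<notin> K"
      using dtypeD(3)[OF conjunct1[OF t] k conjunct2[OF t] a(1), of P "flip C j P"] by blast
    have XK': "(P, X) \<notin> K'"
    proof
      assume "(P, X) \<in> K'"
      then have "K = K'" using class_disjoint(1)[OF k k'(1) a(1)] by blast
      then show False using k'(2) KK by simp
    qed
    have "S \<noteq> S'"
      using dtypeD(1)[OF conjunct1[OF t] k m(1)] dtypeD(1)[OF conjunct1[OF t] k'(1) m(1)] a(1) XK' by blast
    moreover have "K \<noteq> K'" using XK' a(1) by blast
    \<comment> \<open>On a regular face an iso-line corresponds to all disperse nodes of the face,
      so \<open>X\<close> serves for both classes although \<open>X\<close> is not in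
      \<open>S'\<close>.\<close>
    moreover have "corresponds X l (pth C K' S')"
    proof -
      have "l \<in> ln C K'" using k'(3) l(1) by simp
      then show ?thesis by (intro corresponds_regular[OF k'(1) m F nL on ne _ mX(9) seg]) (use on in simp_all)
    qed
    ultimately show ?thesis
      using good_common[OF k k'(1) _ _ l(2) _ corr] k'(3) l(1) by simp
  next
    case inactive: False
    obtain C1 C2 C3 where r: "C1 \<in> M" "C2 \<in> M" "C3 \<in> M"
      "\<forall>D \<in> {C1, C2, C3}. incident D P (flip C i P) \<and> flip D i P = flip C i P"
      "C1 \<noteq> C" "C2 \<noteq> C1" "C3 \<noteq> C2" "C \<noteq> C3" "C2 \<noteq> C"
      "face C j P \<subseteq> nodes C1" "face C1 k P \<subseteq> nodes C2" "face C2 j P \<subseteq> nodes C3" "face C3 k P \<subseteq> nodes C"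
      by (rule edge_ring[OF mesh(1,2,3) n(1) ax])
    have iD: "incident D P Q" "flip D i P = Q" if "D \<in> {C1, C2, C3}" for D using r(4) that i by auto
    have nD: "P \<in> nodes D" "Q \<in> nodes D" if "D \<in> {C1, C2, C3}" for D using incident_nodes[OF iD(1)[OF that]] by auto
    have sys: "C1 \<in> system" "C2 \<in> system" "C3 \<in> system"
      using system_edge[OF r(1) inc] system_edge[OF r(2) inc] system_edge[OF r(3) inc] iD(1) by auto
    have cu: "is_cuboid C1" "is_cuboid C2" "is_cuboid C3" using cuboid_M r by auto
    note f01 = common_face[OF mesh(1) c(2) r(1) r(5)[symmetric] face_in_faces[OF n(1)] r(10)]
    have nP: "P \<in> nodes C1" "P \<in> nodes C2" "P \<in> nodes C3" and nQ: "Q \<in> nodes C2" "Q \<in> nodes C3"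
      using nD by auto
    note f12 = common_face[OF mesh(1) r(1,2) r(6)[symmetric] face_in_faces[OF nP(1)] r(11)]
    note f23 = common_face[OF mesh(1) r(2,3) r(7)[symmetric] face_in_faces[OF nP(2)] r(12)]
    have X1: "X \<in> nodes C1" "X $ j = P $ j" using f01(2) on j by (auto simp: face_def)
    have qk: "quad D (face D k P) P Q (flip D j Q) (flip D j P)" if "D \<in> {C1, C2, C3}" for D
    proof -
      have cD: "is_cuboid D" using that cu by auto
      have "flip D i (flip D j P) = flip D j Q" using flip_commute[of D i j P] iD(2)[OF that] by simp
      then show ?thesis using quad_face[OF cD nD(1)[OF that], of i k j] ax iD(2)[OF that] by simp
    qed
    have qj: "quad D (face D j P) P Q (flip D k Q) (flip D k P)" if "D \<in> {C1, C2, C3}" for D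
    proof -
      have cD: "is_cuboid D" using that cu by auto
      have "flip D i (flip D k P) = flip D k Q" using flip_commute[of D i k P] iD(2)[OF that] by simp
      then show ?thesis using quad_face[OF cD nD(1)[OF that], of i j k] ax iD(2)[OF that] by simp
    qed
    have de: "disperse_edge U V" if "D \<in> system" "incident D U V" "U \<in> dsp D" "V \<in> dsp D" for D U V
      using that unfolding disperse_edge_def by blast
    \<comment> \<open>What a relabeled \<open>P\<close> implies in \<open>D\<close>: all labels next
      to the edge exceed \<open>c\<close>, or the edge lies on the level face of an
      \<open>F_2\<close>-pair.\<close>
    have step: "(c < \<phi> (flip D j P) \<and> c < \<phi> (flip D j Q) \<and> c < \<phi> (flip D k P) \<and> c < \<phi> (flip D k Q)) \<or> F2 D j P \<or> F2 D k P"
      if D: "D \<in> {C1, C2, C3}" "P \<in> dsp D" for D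
    proof -
      have "D \<in> M" using D(1) r by auto
      from level_edge_dsp[OF this D(2) lev(1) _ ax] show ?thesis using iD(2)[OF D(1)] lev(2) by simp
    qed
    have F2lev: "\<phi> V = c" if "F2 D r P" "V \<in> nodes D" "V $ r = P $ r" for D r V
      using that unfolding F2_at_def[OF iso_level mesh(1)] by blast
    show ?thesis
    proof (cases "P \<in> dsp C1")
      case False
      have q1: "quad C1 F P Q Y X" by (rule quad_mono[OF qF]) (use f01(1) j in simp)
      obtain K1 S1' where k1: "is_class C1 K1 S1'" "closed_segment P Q \<in> ln C1 K1" "corresponds X (closed_segment P Q) (pth C1 K1 S1')"
        by (rule active_class[OF sys(1) q1 lev mX(3) mY(3) False])
      show ?thesis
        by (rule good_common[OF k k1(1) _ _ l(2) _ corr]) (use k1 l(1) r(5) in auto)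
    next
      case P1: True
      have X1d: "X \<in> dsp C1" by (rule dsp_raw[OF r(1) X1(1) mX(3)])
      have XP1: "disperse_edge X P"
        by (rule de[OF sys(1) _ X1d P1]) (rule incident_mono[OF mX(10) X1(1) nP(1)])
      have n12: "flip C1 j P \<in> nodes C2" "flip C1 j Q \<in> nodes C2" "flip C1 j P \<in> nodes C1" "(flip C1 j P) $ k = P $ k"
        using quadD(2)[OF qk[of C1]] r(11) nP(1) ax by (auto simp: flip_nth)
      \<comment> \<open>The search ends at \<open>C3\<close> at the latest: if \<open>P\<close> is
        relabeled in \<open>C2\<close> and the face between \<open>C2\<close> and \<open>C3\<close>
        is active, \<open>C3\<close> draws the line.\<close>
      have last: ?thesis if act: "c < \<phi> (flip C2 k P)" "c < \<phi> (flip C2 k Q)" and P2: "P \<in> dsp C2"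
      proof -
        have q23: "quad C3 (face C2 j P) P Q (flip C2 k Q) (flip C2 k P)"
          by (rule quad_mono[OF qj f23(1)]) simp_all
        have n3: "flip C2 k P \<in> nodes C3" "(flip C2 k P) $ j = P $ j"
          using quadD(24)[OF q23] ax by (auto simp: flip_nth)
        have n30: "flip C3 j P = flip C j P" "flip C3 j Q = flip C j Q"
        proof -
          have "flip C3 j P \<in> nodes C" "flip C3 j Q \<in> nodes C" using quadD(2)[OF qk[of C3]] r(13) by auto
          then have "flip C3 j P $ j = P $ j \<or> flip C3 j P $ j = flip C j P $ j"
            "flip C3 j Q $ j = Q $ j \<or> flip C3 j Q $ j = flip C j Q $ j"
            using node_nth_cases[OF c(4) n(1)] node_nth_cases[OF c(4) n(2)] by blast+
          moreover have "flip C3 j P $ j \<noteq> P $ j" "flip C3 j Q $ j \<noteq> Q $ j"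
            using flip_nth_neq[OF cu(3) nP(3)] flip_nth_neq[OF cu(3) nQ(2)] by auto
          ultimately show "flip C3 j P = flip C j P" "flip C3 j Q = flip C j Q"
            by (simp_all add: vec_eq_iff flip_nth)
        qed
        \<comment> \<open>A relabeled \<open>P\<close> in \<open>C3\<close> would need an active
          face between \<open>C3\<close> and \<open>C\<close>, excluded by \<open>inactive\<close>,
          or an \<open>F_2\<close>-pair of \<open>C3\<close> with \<open>C2\<close>, excluded by
          \<open>act\<close>, or with \<open>C\<close>, in which \<open>P\<close> is
          continuous.\<close>
        have P3: "P \<notin> dsp C3"
        proof
          assume "P \<in> dsp C3"
          from step[OF _ this] have "c < \<phi> (flip C3 j P) \<and> c < \<phi> (flip C3 j Q) \<or> F2 C3 j P \<or> F2 C3 k P" by auto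
          then show False
          proof (elim disjE)
            assume "c < \<phi> (flip C3 j P) \<and> c < \<phi> (flip C3 j Q)"
            then show False using n30 inactive by simp
          next
            assume "F2 C3 j P"
            then have "\<phi> (flip C2 k P) = c" using F2lev n3 by blast
            then show False using act by simp
          next
            assume "F2 C3 k P"
            then have "F2 C k P" by (rule F2_transfer(1)[OF r(3) c(2) r(8) nP(3) r(13)])
            then have "P \<in> dsp C" by (rule F2_dsp[OF c(2) n(1)])
            then show False using mX(8) by simp
          qed
        qed
        obtain K3 S3' where k3: "is_class C3 K3 S3'" "closed_segment P Q \<in> ln C3 K3"
          "corresponds (flip C2 k P) (closed_segment P Q) (pth C3 K3 S3')"
          by (rule active_class[OF sys(3) q23 lev act P3])
        have i2: "incident C2 P (flip C2 k P)" using cu(2) nP(2) by (auto simp: incident_iff)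
        have e2: "disperse_edge P (flip C2 k P)"
          by (rule de[OF sys(2) i2 P2 dsp_raw[OF r(2) _ act(1)]]) (use nP(2) in simp)
        have "flip C2 k P \<notin> nodes C1"
        proof
          assume "flip C2 k P \<in> nodes C1"
          then have "flip C2 k P \<in> nodes C1 \<inter> nodes C2" using nP(2) by simp
          then have "flip C2 k P \<in> face C1 k P" unfolding f12(2) .
          then show False using flip_nth_neq[OF cu(2) nP(2), of k] by (simp add: face_def)
        qed
        then have d: "distinct [X, P, flip C2 k P]"
          using X1(1) mX(11) nP(1) by auto
        show ?thesis
          by (rule good_path[OF k k3(1) r(8) l(2) _ corr _ d XP1 e2]) (use k3 l(1) in simp_all)
      qed
      from step[OF _ P1] have "c < \<phi> (flip C1 j P) \<and> c < \<phi> (flip C1 j Q) \<or> F2 C1 j P \<or> F2 C1 k P" by auto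
      then show ?thesis
      proof (elim disjE)
        \<comment> \<open>The level face would be \<open>F\<close>, which contains
          \<open>X\<close>.\<close>
        assume "F2 C1 j P"
        then have "\<phi> X = c" using F2lev X1 by blast
        then show ?thesis using mX(3) by simp
      next
        \<comment> \<open>\<open>C1\<close> and \<open>C2\<close> share the level face, so
          \<open>C2\<close> has relabeled \<open>P\<close> as well, and its labels away from that
          face exceed \<open>c\<close>: the next face in the ring is active.\<close>
        assume F: "F2 C1 k P"
        note t = F2_transfer[OF r(1,2,6) nP(1) r(11) F]
        have "c < \<phi> (flip C2 k P)" by (rule t(2)) (use nP(2) flip_nth_neq[OF cu(2) nP(2), of k] in simp_all)
        moreover have "c < \<phi> (flip C2 k Q)"
        proof (rule t(2))
          have "Q $ k = P $ k" using i ax by (simp add: flip_nth)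
          then show "flip C2 k Q $ k \<noteq> P $ k" using flip_nth_neq[OF cu(2) nQ(1), of k] by simp
        qed (use nQ(1) in simp)
        moreover have "P \<in> dsp C2" by (rule F2_dsp[OF r(2) nP(2) t(1)])
        ultimately show ?thesis by (intro last)
      next
        assume act: "c < \<phi> (flip C1 j P) \<and> c < \<phi> (flip C1 j Q)"
        show ?thesis
        proof (cases "P \<in> dsp C2")
          case False
          have q12: "quad C2 (face C1 k P) P Q (flip C1 j Q) (flip C1 j P)"
            by (rule quad_mono[OF qk f12(1)]) simp_all
          obtain K2 S2' where k2: "is_class C2 K2 S2'" "closed_segment P Q \<in> ln C2 K2"
            "corresponds (flip C1 j P) (closed_segment P Q) (pth C2 K2 S2')"
            by (rule active_class[OF sys(2) q12 lev conjunct1[OF act] conjunct2[OF act] False])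
          have i1: "incident C1 P (flip C1 j P)" using cu(1) nP(1) by (auto simp: incident_iff)
          have e1: "disperse_edge P (flip C1 j P)"
            by (rule de[OF sys(1) i1 P1 dsp_raw[OF r(1) n12(3) conjunct1[OF act]]])
          have "flip C1 j P $ j \<noteq> P $ j" by (rule flip_nth_neq[OF cu(1) nP(1)])
          then have d: "distinct [X, P, flip C1 j P]" using X1(2) mX(11) by auto
          show ?thesis
            by (rule good_path[OF k k2(1) r(9)[symmetric] l(2) _ corr _ d XP1 e1]) (use k2 l(1) in simp_all)
        next
          case P2: True
          from step[OF _ P2] have "c < \<phi> (flip C2 k P) \<and> c < \<phi> (flip C2 k Q) \<or> F2 C2 j P \<or> F2 C2 k P" by auto
          then show ?thesis
          proof (elim disjE)
            assume "c < \<phi> (flip C2 k P) \<and> c < \<phi> (flip C2 k Q)"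
            then show ?thesis using last P2 by blast
          next
            assume "F2 C2 k P"
            then have "\<phi> (flip C1 j P) = c" using F2lev n12(1,4) by blast
            then show ?thesis using act by simp
          next
            \<comment> \<open>The partner \<open>C3\<close> would have labels above \<open>c\<close>
              on the nodes it shares with \<open>C\<close> next to the edge, against
              \<open>inactive\<close>.\<close>
            assume F: "F2 C2 j P"
            have t: "c < \<phi> V" if "V \<in> nodes C3" "V $ j \<noteq> P $ j" for V
              by (rule F2_transfer(2)[OF r(2,3,7) nP(2) r(12) F that])
            have n30: "flip C3 j P \<in> nodes C" "flip C3 j Q \<in> nodes C" using quadD(2)[OF qk[of C3]] r(13) by auto
            have Qj: "Q $ j = P $ j" using i ax by (simp add: flip_nth)
            have nj: "flip C3 j P $ j \<noteq> P $ j" "flip C3 j Q $ j \<noteq> Q $ j"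
              using flip_nth_neq[OF cu(3) nP(3)] flip_nth_neq[OF cu(3) nQ(2)] by auto
            have e: "flip C3 j P = flip C j P" "flip C3 j Q = flip C j Q"
              using node_nth_cases[OF c(4) n(1) n30(1), of j] node_nth_cases[OF c(4) n(2) n30(2), of j] nj
              by (simp_all add: vec_eq_iff flip_nth)
            have "c < \<phi> (flip C3 j P)" "c < \<phi> (flip C3 j Q)"
              by (rule t; use nP(3) nQ(2) nj Qj in simp)+
            then show ?thesis using e inactive by simp
          qed
        qed
      qed
    qed
  qed
qed

text \<open>A line across a face is treated according to the labels \<open>\<phi>\<close> on that
  face: not alternating, alternating with a continuous label below \<open>c\<close>, or alternating
  with both continuous labels equal to \<open>c\<close>.\<close>

lemma good_inner:
  assumes k: "is_class C K S" and l: "l \<in> ln C K"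
  shows "good (pth C K S) l"
proof -
  note c = is_classD[OF k]
  obtain P A P' A' F where a: "l = seg (P, A) (P', A')" "(P, A) \<in> K" "(P', A') \<in> K" "F \<in> faces C" "{P, A, P', A'} \<subseteq> F"
    "ip (P, A) \<noteq> ip (P', A')" "(P, A) \<in> mx C" "(P', A') \<in> mx C"
    by (rule lnE[OF k l])
  note mm = mxD[OF c(2) a(7)]
  from c(2) a(7,8,4-6) show ?thesis
  proof (cases rule: midpoint_line)
    case (2 y)
    have "l = closed_segment P P'" unfolding a(1) using ip_level[OF 2(2)] ip_level[OF 2(3)] by simp
    then show ?thesis by (intro good_edge[OF k a(4,2,3,5) 2(2,3,4) _ l])
  next
    case (1 y)
    have y: "y \<in> l" "car C y = F" using 1 a(1) by auto
    obtain C2 where C2: "C2 \<in> system" "C2 \<noteq> C" "F \<in> faces C2" by (rule face_neighbor[OF a(4)])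
    obtain B Q where q: "quad C F A P B Q" by (rule quad_exists_edge[OF c(4) a(4) _ _ mm(10)]) (use a(5) in auto)
    show ?thesis
    proof (cases "c < \<phi> B \<and> \<phi> Q \<le> c")
      case False
      show ?thesis by (rule good_regular[OF C2 q k l y a(1-3,5,6) False])
    next
      case True
      then have B: "c < \<phi> B" and Q: "\<phi> Q \<le> c" by auto
      show ?thesis
      proof (cases "\<phi> P = c \<and> \<phi> Q = c")
        case False
        have lF: "l \<in> lnF C F" unfolding lnF_def mem_Collect_eq using a k by (intro exI conjI)
        \<comment> \<open>\<open>Lraw\<close> expects the label below \<open>c\<close> at its last
          node, so \<open>P\<close> and \<open>Q\<close> are exchanged if necessary.\<close>
        have "\<exists>P Q. Lraw C C2 F A P B Q"
        proof (cases "\<phi> Q < c")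
          case True
          then have "Lraw C C2 F A P B Q" unfolding Lraw_def using c(1) C2 q mm(2,3) B by auto
          then show ?thesis by blast
        next
          case Qc: False
          then have "\<phi> P < c" using False Q mm(2) by auto
          then have "Lraw C C2 F A Q B P" unfolding Lraw_def using c(1) C2 quad_refl[OF q] mm(3) B Q by auto
          then show ?thesis by blast
        qed
        then obtain P0 Q0 where "Lraw C C2 F A P0 B Q0" by blast
        then show ?thesis by (rule good_Lraw[OF _ k l lF])
      next
        case lev: True
        then have lv: "\<phi> P = c" "\<phi> Q = c" by auto
        note t = trivial_L_lines[OF c(2) q mm(3) B lv k a(2,3,5,6)]
        then have lPQ: "l = closed_segment P Q" and C: "P \<notin> dsp C" "Q \<notin> dsp C" "F \<in> Lf C" "dtype C" using a(1) by auto
        from t have "(P, A) \<in> K \<and> (Q, A) \<in> K \<or> (P, B) \<in> K \<and> (Q, B) \<in> K" by blast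
        then show ?thesis
        proof
          assume "(P, A) \<in> K \<and> (Q, A) \<in> K"
          then show ?thesis by (intro good_trivial[OF C2 q mm(3) B lv k l y _ _ lPQ C]) auto
        next
          assume K: "(P, B) \<in> K \<and> (Q, B) \<in> K"
          have q': "quad C F B P A Q" by (rule quad_refl[OF quad_rot[OF quad_rot[OF q]]])
          show ?thesis by (rule good_trivial[OF C2 q' B mm(3) lv k l y _ _ lPQ C]) (use K in auto)
        qed
      qed
    qed
  qed
qed

lemma good_iso_path:
  assumes "\<omega> \<in> iso_paths C" "l \<in> lines \<omega>"
  shows "good \<omega> l"
proof -
  from assms(1) consider L S where "\<omega> = Inner C L S" "(L, S) \<in> W C" | E where "\<omega> = Outer E" "outer_iso_path C E"
    unfolding iso_paths_def by blast
  then show ?thesis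
  proof cases
    case (1 L S)
    obtain K where "is_class C K S" "L = ln C K" by (rule W_classE[OF C_system 1(2)])
    then show ?thesis using good_inner[of K S l] assms(2) 1(1) by simp
  next
    case (2 E)
    then show ?thesis using good_outer[of E l] assms(2) by simp
  qed
qed

end

theorem theorem7p5:
  fixes c :: real and M :: "cuboid set" and \<phi> :: "pt \<Rightarrow> real" and C :: cuboid
    and W :: "cuboid \<Rightarrow> (pt set set \<times> pt set) set"
    and \<omega> :: iso_path and Qs :: "pt list"
  assumes "graph_system c M \<phi> C W"
    and "graph_system.regular c M \<phi> C"
    and "\<omega> \<in> graph_system.iso_paths c M \<phi> C W C"
    and "closed_polygon Qs" and "lines \<omega> = polygon_lines Qs"
  shows "\<exists>\<omega>s :: nat \<Rightarrow> iso_path. \<forall>i < length Qs.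
    \<omega>s i \<in> graph_system.system_iso_paths c M \<phi> C W \<and>
    graph_system.meet c M \<phi> C \<omega> (\<omega>s i) (side Qs i) \<and>
    graph_system.disperse_connected c M \<phi> C W \<omega> (\<omega>s i) (side Qs i)"
proof -
  interpret graph_system c M \<phi> C W by (rule assms(1))
  have "good \<omega> (side Qs i)" if "i < length Qs" for i
    by (rule good_iso_path[OF assms(3)]) (use that assms(5) in \<open>auto simp: polygon_lines_def\<close>)
  then have "\<forall>i. \<exists>\<omega>'. i < length Qs \<longrightarrow> \<omega>' \<in> system_iso_paths \<and> meet \<omega> \<omega>' (side Qs i) \<and>
      disperse_connected \<omega> \<omega>' (side Qs i)"
    unfolding good_def by blast
  then show ?thesis by metis
qed

end
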